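(* Under the simple uniform hashing assumption, let $n=2^d$ for $d\in\mathbb{N}$ and $\varepsilon\in[1/n,1]$. There is a minimal perfect hash function data structure (Monolithic CONSENSUS-RecSplit: a balanced binary tree of $n-1$ two-way splitting hash functions, each splitting the keys arriving at its node perfectly in half) with space requirement $\mathrm{OPT}_{\mathrm{MPHF}}+O(\varepsilon n+\log^2 n)$ bits, expected construction time $O(\max(n^{3/2},n/\varepsilon))$ and query time $O(\log n)$.
   Context: A minimal perfect hash function (MPHF) for a set $X$ of $n$ keys is a data structure representing a function mapping $X$ bijectively to $\{1,\dots,n\}$. $\mathrm{OPT}_{\mathrm{MPHF}}=n\log_2 e-O(\log n)$ is the space lower bound in bits for MPHFs. The simple uniform hashing assumption means access to an infinite sequence of fully random, mutually independent hash functions, each identified by an index (seed).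
   Formalization: A worst-case space bound cannot hold with certainty (with positive probability no seed fits), so construction may restart on fresh hash functions; the restart count, readable in O(1), counts as space, and the total meets the bound in expectation and with probability at least 1-1/n. *)

theory Defs
  imports "HOL-Probability.Probability" "HOL-Library.Landau_Symbols" "HOL-Library.Nat_Bijection"
begin

section \<open>Simple uniform hashing\<close>

text \<open>An infinite sequence of two-way hash functions, \<^term>\<open>h s\<close> being the one with seed \<^term>\<open>s\<close>;
  all values are independent fair bits.\<close>

definition simple_uniform_hashing :: "'w measure \<Rightarrow> (nat \<Rightarrow> 'k \<Rightarrow> 'w \<Rightarrow> bool) \<Rightarrow> bool" where
  "simple_uniform_hashing M h \<longleftrightarrow>
     prob_space M \<and>
     prob_space.indep_vars M (\<lambda>_. count_space UNIV) (\<lambda>(s, x). h s x) UNIV \<and>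
     (\<forall>s x. distr M (count_space UNIV) (h s x) = measure_pmf (pmf_of_set UNIV))"


section \<open>A word RAM with access to the hash functions\<close>

text \<open>Every memory cell holds a word of \<open>w\<close> bits, and every operation has unit cost. Keys are opaque:
  the only access to the input keys is the instruction \<open>Hash a s i\<close>, which stores at address \<open>a\<close>
  the hash value of the \<open>i\<close>-th input key under seed \<open>s\<close>.

  Only finitely many seeds fit into a word, so with positive probability none of them is good.
  The sequence of hash functions is therefore divided into infinitely many batches (by
  \<^const>\<open>prod_encode\<close>). The instruction \<open>Rehash\<close> moves on to the next batch, and the number
  of the batch in use, the second component of the state, belongs to the constructed data structure
  and is charged for in its space below.\<close>

datatype binop = Add | Sub | Mul | Div | Mod | Less | Equal | BAnd | BOr | BXor | Shl | Shr

datatype aexp = Const nat | Load aexp | Op binop aexp aexp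

datatype com =
    Skip
  | Store aexp aexp
  | Hash aexp aexp aexp
  | Rehash
  | Seq com com
  | Cond aexp com com
  | While aexp com

type_synonym memory = "nat \<Rightarrow> nat"
type_synonym state = "memory \<times> nat"

fun binop_val :: "binop \<Rightarrow> nat \<Rightarrow> nat \<Rightarrow> nat" where
  "binop_val Add a b = a + b"
| "binop_val Sub a b = a - b"
| "binop_val Mul a b = a * b"
| "binop_val Div a b = a div b"
| "binop_val Mod a b = a mod b"
| "binop_val Less a b = of_bool (a < b)"
| "binop_val Equal a b = of_bool (a = b)"
| "binop_val BAnd a b = Bit_Operations.and a b"
| "binop_val BOr a b = Bit_Operations.or a b"
| "binop_val BXor a b = Bit_Operations.xor a b"
| "binop_val Shl a b = push_bit b a"
| "binop_val Shr a b = drop_bit b a"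

fun aval :: "nat \<Rightarrow> memory \<Rightarrow> aexp \<Rightarrow> nat" where
  "aval w m (Const k) = take_bit w k"
| "aval w m (Load a) = m (aval w m a)"
| "aval w m (Op f a b) = take_bit w (binop_val f (aval w m a) (aval w m b))"

fun acost :: "aexp \<Rightarrow> nat" where
  "acost (Const k) = 1"
| "acost (Load a) = 1 + acost a"
| "acost (Op f a b) = 1 + acost a + acost b"

definition hash_val :: "(nat \<Rightarrow> 'k \<Rightarrow> bool) \<Rightarrow> 'k list \<Rightarrow> nat \<Rightarrow> nat \<Rightarrow> nat \<Rightarrow> nat" where
  "hash_val H ks g s i = (if i < length ks then of_bool (H (prod_encode (g, s)) (ks ! i)) else 0)"

text \<open>\<open>exec w H ks c s t s'\<close>: with word length \<open>w\<close>, hash functions \<open>H\<close> and input keys \<open>ks\<close>,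
  the command \<open>c\<close> started in state \<open>s\<close> terminates after \<open>t\<close> time units in state \<open>s'\<close>.\<close>

inductive exec ::
  "nat \<Rightarrow> (nat \<Rightarrow> 'k \<Rightarrow> bool) \<Rightarrow> 'k list \<Rightarrow> com \<Rightarrow> state \<Rightarrow> nat \<Rightarrow> state \<Rightarrow> bool"
  for w :: nat and H :: "nat \<Rightarrow> 'k \<Rightarrow> bool" and ks :: "'k list" where
  Skip: "exec w H ks Skip s 1 s"
| Store: "exec w H ks (Store a b) (m, g) (1 + acost a + acost b)
            (m(aval w m a := aval w m b), g)"
| Hash: "exec w H ks (Hash a b i) (m, g) (1 + acost a + acost b + acost i)
            (m(aval w m a := take_bit w (hash_val H ks g (aval w m b) (aval w m i))), g)"
| Rehash: "exec w H ks Rehash (m, g) 1 (m, Suc g)"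
| Seq: "exec w H ks c1 s1 t1 s2 \<Longrightarrow> exec w H ks c2 s2 t2 s3 \<Longrightarrow>
          exec w H ks (Seq c1 c2) s1 (t1 + t2) s3"
| CondTrue: "aval w (fst s) b \<noteq> 0 \<Longrightarrow> exec w H ks c1 s t s' \<Longrightarrow>
          exec w H ks (Cond b c1 c2) s (1 + acost b + t) s'"
| CondFalse: "aval w (fst s) b = 0 \<Longrightarrow> exec w H ks c2 s t s' \<Longrightarrow>
          exec w H ks (Cond b c1 c2) s (1 + acost b + t) s'"
| WhileFalse: "aval w (fst s) b = 0 \<Longrightarrow> exec w H ks (While b c) s (1 + acost b) s"
| WhileTrue: "aval w (fst s1) b \<noteq> 0 \<Longrightarrow> exec w H ks c s1 t1 s2 \<Longrightarrow>
          exec w H ks (While b c) s2 t2 s3 \<Longrightarrow>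
          exec w H ks (While b c) s1 (1 + acost b + t1 + t2) s3"

inductive_cases SkipE: "exec w H ks Skip s t s'"
inductive_cases StoreE: "exec w H ks (Store a b) s t s'"
inductive_cases HashE: "exec w H ks (Hash a b i) s t s'"
inductive_cases RehashE: "exec w H ks Rehash s t s'"
inductive_cases SeqE: "exec w H ks (Seq c1 c2) s t s'"
inductive_cases CondE: "exec w H ks (Cond b c1 c2) s t s'"
inductive_cases WhileE: "exec w H ks (While b c) s t s'"

lemma exec_deterministic:
  assumes "exec w H ks c s t s'" and "exec w H ks c s u s''"
  shows "u = t \<and> s'' = s'"
  using assms
proof (induction arbitrary: u s'' rule: exec.induct)
  case (Skip s)
  from Skip.prems show ?case by (rule SkipE) simp
next
  case (Store a b m g)
  from Store.prems show ?case by (rule StoreE) simp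
next
  case (Hash a b i m g)
  from Hash.prems show ?case by (rule HashE) simp
next
  case (Rehash m g)
  from Rehash.prems show ?case by (rule RehashE) simp
next
  case (Seq c1 s1 t1 s2 c2 t2 s3)
  from Seq.prems obtain t1' s2' t2' where
    *: "u = t1' + t2'" "exec w H ks c1 s1 t1' s2'" "exec w H ks c2 s2' t2' s''"
    by (rule SeqE)
  have "t1' = t1 \<and> s2' = s2" using Seq.IH(1)[OF *(2)] .
  with *(3) Seq.IH(2) have "t2' = t2 \<and> s'' = s3" by metis
  with \<open>t1' = t1 \<and> s2' = s2\<close> *(1) show ?case by simp
next
  case (CondTrue s b c1 t s' c2)
  from CondTrue.prems show ?case
  proof (rule CondE)
    fix t' assume "u = Suc (acost b + t')" "exec w H ks c1 s t' s''"
    with CondTrue.IH show ?thesis by simp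
  qed (use CondTrue.hyps in simp)
next
  case (CondFalse s b c2 t s' c1)
  from CondFalse.prems show ?case
  proof (rule CondE)
    fix t' assume "u = Suc (acost b + t')" "exec w H ks c2 s t' s''"
    with CondFalse.IH show ?thesis by simp
  qed (use CondFalse.hyps in simp)
next
  case (WhileFalse s b c)
  from WhileFalse.prems show ?case
    by (rule WhileE) (use WhileFalse.hyps in simp_all)
next
  case (WhileTrue s1 b c t1 s2 t2 s3)
  from WhileTrue.prems show ?case
  proof (rule WhileE)
    fix t1' s2' t2'
    assume *: "u = Suc (acost b + t1' + t2')" "exec w H ks c s1 t1' s2'"
      "exec w H ks (While b c) s2' t2' s''"
    have "t1' = t1 \<and> s2' = s2" using WhileTrue.IH(1)[OF *(2)] .
    with *(3) WhileTrue.IH(2) have "t2' = t2 \<and> s'' = s3" by metis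
    with \<open>t1' = t1 \<and> s2' = s2\<close> *(1) show ?thesis by simp
  qed (use WhileTrue.hyps in simp)
qed


section \<open>Construction and representation\<close>

text \<open>The construction finds the number of keys and \<open>\<lceil>1/\<epsilon>\<rceil>\<close> in its first two cells. It
  leaves a bit string in memory, its length in cell 0 and its bits packed into the cells from 1 on.
  The result is the running time, the bit string and the number of the batch of hash functions in
  use; it is \<^const>\<open>None\<close> if the construction does not terminate.\<close>

definition build_input :: "nat \<Rightarrow> real \<Rightarrow> memory" where
  "build_input n \<epsilon> = (\<lambda>_. 0)(0 := n, 1 := nat \<lceil>1 / \<epsilon>\<rceil>)"

definition output_bits :: "nat \<Rightarrow> memory \<Rightarrow> bool list" where
  "output_bits w m = map (\<lambda>i. bit (m (1 + i div w)) (i mod w)) [0..<m 0]"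

definition run_build ::
  "nat \<Rightarrow> (nat \<Rightarrow> 'k \<Rightarrow> bool) \<Rightarrow> 'k list \<Rightarrow> real \<Rightarrow> com \<Rightarrow> (nat \<times> bool list \<times> nat) option" where
  "run_build w H ks \<epsilon> c =
     (let R = (\<lambda>(t, s). exec w H ks c (build_input (length ks) \<epsilon>, 0) t s)
      in if \<exists>r. R r then (case THE r. R r of (t, m, g) \<Rightarrow> Some (t, output_bits w m, g)) else None)"

definition build_time :: "(nat \<times> bool list \<times> nat) option \<Rightarrow> ennreal" where
  "build_time r = (case r of None \<Rightarrow> \<infinity> | Some (t, bits, g) \<Rightarrow> of_nat t)"

text \<open>The batch number \<open>g\<close> is stored in unary, with \<open>g + 1\<close> bits, in front of the bit string.\<close>

definition space_bits :: "(nat \<times> bool list \<times> nat) option \<Rightarrow> ennreal" where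
  "space_bits r = (case r of None \<Rightarrow> \<infinity> | Some (t, bits, g) \<Rightarrow> of_nat (length bits + (g + 1)))"

text \<open>A query starts with nothing but the bit string in memory, packed into words, and
  leaves its answer in cell 0.\<close>

definition pack :: "nat \<Rightarrow> bool list \<Rightarrow> memory" where
  "pack w bits a = horner_sum of_bool 2 (take w (drop (a * w) bits))"


section \<open>The splitting tree\<close>

text \<open>The nodes of the balanced binary tree of depth \<open>d\<close> are numbered as in a heap: the root is 1, the
  children of \<open>v\<close> are \<open>2v\<close> and \<open>2v + 1\<close>, the inner nodes are \<open>1, \<dots>, 2\<^sup>d - 1\<close> and the leaves are
  \<open>2\<^sup>d, \<dots>, 2\<^sup>d\<^sup>+\<^sup>1 - 1\<close>. The function \<open>f v\<close> is the splitting hash function at \<open>v\<close>.\<close>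

primrec node_at :: "(nat \<Rightarrow> 'k \<Rightarrow> bool) \<Rightarrow> nat \<Rightarrow> 'k \<Rightarrow> nat" where
  "node_at f 0 x = 1"
| "node_at f (Suc j) x = 2 * node_at f j x + of_bool (f (node_at f j x) x)"

definition splits_perfectly :: "nat \<Rightarrow> (nat \<Rightarrow> 'k \<Rightarrow> bool) \<Rightarrow> 'k set \<Rightarrow> bool" where
  "splits_perfectly d f X \<longleftrightarrow>
     (\<forall>j<d. \<forall>v\<in>{2 ^ j..<2 ^ Suc j}.
        card {x \<in> X. node_at f j x = v \<and> f v x} = card {x \<in> X. node_at f j x = v \<and> \<not> f v x})"

definition leaf_rank :: "nat \<Rightarrow> (nat \<Rightarrow> 'k \<Rightarrow> bool) \<Rightarrow> 'k \<Rightarrow> nat" where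
  "leaf_rank d f x = node_at f d x + 1 - 2 ^ d"

end

theory Submission
 imports Defs "HOL-Library.Discrete_Functions"
begin

text \<open>Every node of the splitting tree stores its seed in a window of a common bit string.  The
 windows of consecutive nodes of one level overlap, so a node only has \<open>b\<close> fresh bits, where \<open>b\<close> is
 about \<open>log (1 / p) + 2 ^ (- x)\<close> for the success probability \<open>p\<close> of a split and a slack \<open>2 ^ (- x)\<close>
 depending on the level; seeds are found by depth-first search over the fresh bits (CONSENSUS).  The
 expected number of tests at a node is then \<open>O (2 ^ x / p)\<close>.  Levels are cut into segments so that
 the windows fit into machine words and different candidate paths use different seeds except with
 tiny probability; if a search fails or exceeds its budget the next batch of hash functions is used,
 which happens with probability at most one half.\<close>

section \<open>Depth-first search for seeds\<close>

text \<open>On the level whose nodes hold \<open>2^k\<close> keys, \<open>1 / p\<close> is of order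
  \<open>2^(k/2)\<close>, a test costs \<open>2^k\<close>, and there are \<open>2^(d-k)\<close>
  nodes. A slack of \<open>2^(-x)\<close> per node thus adds \<open>2^(d-k-x)\<close> bits and costs
  time of order \<open>2^(d+k/2+x)\<close>. With \<open>2^y\<close> about
  \<open>1 / \<epsilon>\<close>, the choice \<open>x = y - 3k/4\<close>, cut off at 0, gives both
  sums the ratio \<open>2^(-1/4)\<close>; any factor strictly between 1/2 and 1 in place of 3/4
  would do, and the cut-off contributes the \<open>n^(3/2)\<close>. The obstacle is dependence. The
  search is analysed as a branching process, in which all candidates for one node must carry
  different hash functions; equal windows break this. Repetitions are split off as an event
  \<open>bad\<close>, bounded by a second-moment count of agreeing pairs, and the budget on tests
  caps the cost of a run in which they occur. All nodes of a segment lie on one level of the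
  splitting tree, so their key sets are settled before the segment is searched, and backtracking
  inside it never changes them.\<close>

definition kids :: "nat => nat => nat => nat list" where
 "kids W b c = map (%f. c div 2 ^ b + f * 2 ^ (W - b)) [0..<2 ^ b]"

text \<open>A window is a \<open>W\<close>-bit number whose low bits come first in the bit string:
  passing to the next node discards \<open>b\<close> low bits and puts \<open>b\<close> fresh bits
  on top. The first component of a layer tells which windows pass the test at its node; the second
  is the number of fresh bits of the node after it.\<close>

type_synonym layer = "(nat => bool) \<times> nat"

definition nxt :: "nat => layer => nat list => nat list" where
 "nxt W l L = concat (map (kids W (snd l)) (filter (fst l) L))"

text \<open>Failure in breadth-first form: the whole frontier is expanded layer by layer. The
  depth-first \<open>srch\<close> has the same outcome, but here failure of a list is failure of its
  expansion, which yields a recursion for probabilities.\<close>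

fun fails :: "nat => layer list => nat list => bool" where
 "fails W [] L = (L = [])"
| "fails W (l # ls) L = fails W ls (nxt W l L)"

text \<open>Repetitions are sought in the full frontier of every layer, also among candidates that
  the depth-first search never reaches, so the event does not depend on the course of the search.
  The list left after the last layer is no longer tested, hence the value for
  \<open>[]\<close>.\<close>

fun bad :: "nat => layer list => nat list => bool" where
 "bad W [] L = False"
| "bad W (l # ls) L = (~ distinct L \<or> bad W ls (nxt W l L))"

fun srch :: "nat => layer list => nat list => nat list option \<times> nat" where
 "srch W [] L = ((if L = [] then None else Some []), 0)"
| "srch W (l # ls) [] = (None, 0)"
| "srch W (l # ls) (c # cs) =
  (if fst l c then
    (case srch W ls (kids W (snd l) c) of
     (Some p, t) => (Some (c # p), Suc t)
    | (None, t) => (fst (srch W (l # ls) cs), Suc (t + snd (srch W (l # ls) cs))))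
   else (fst (srch W (l # ls) cs), Suc (snd (srch W (l # ls) cs))))"

text \<open>A candidate is tested exactly if all candidates before it fail. For a nonempty
  \<open>ls\<close> this is therefore the number of tests that the search of \<open>L\<close> makes
  in the first layer.\<close>

definition cnt :: "nat => layer list => nat list => nat" where
 "cnt W ls L = card {k. k < length L & fails W ls (take k L)}"

lemma length_kids [simp]: "length (kids W b c) = 2 ^ b"
 by (simp add: kids_def)

lemma kids_ne [simp]: "kids W b c ~= []"
 by (simp add: kids_def)

lemma nxt_Nil [simp]: "nxt W l [] = []"
 by (simp add: nxt_def)

lemma nxt_Cons: "nxt W l (c # cs) = (if fst l c then kids W (snd l) c else []) @ nxt W l cs"
 by (simp add: nxt_def)

lemma nxt_append: "nxt W l (A @ B) = nxt W l A @ nxt W l B"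
 by (simp add: nxt_def)

lemma length_nxt: "length (nxt W l L) = 2 ^ snd l * length (filter (fst l) L)"
 by (induction L) (simp_all add: nxt_Cons)

lemma kids_less:
 assumes "b \<le> W" "c < 2 ^ W" "u \<in> set (kids W b c)"
 shows "u < 2 ^ W"
proof -
 obtain f where f: "f < 2 ^ b" "u = c div 2 ^ b + f * 2 ^ (W - b)"
  using assms(3) by (auto simp: kids_def)
 have e: "(2::nat) ^ W = 2 ^ (W - b) * 2 ^ b" using assms(1) by (simp flip: power_add)
 have "c div 2 ^ b < 2 ^ (W - b)"
  using assms(2) unfolding e by (simp add: less_mult_imp_div_less)
 hence "u < (1 + f) * 2 ^ (W - b)" using f by simp
 also have "... \<le> 2 ^ b * 2 ^ (W - b)" using f by (intro mult_right_mono) auto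
 also have "... = 2 ^ W" using e by (simp add: mult.commute)
 finally show ?thesis .
qed

lemma nxt_less:
 assumes "snd l \<le> W" "\<forall>c\<in>set L. c < 2 ^ W"
 shows "\<forall>u\<in>set (nxt W l L). u < 2 ^ W"
 using assms kids_less by (fastforce simp: nxt_def)

lemma fails_append: "fails W ls (A @ B) \<longleftrightarrow> fails W ls A & fails W ls B"
 by (induction ls arbitrary: A B) (auto simp: nxt_append)

lemma fails_Nil [simp]: "fails W ls []"
 by (induction ls) auto

lemma bad_append: "bad W ls A ==> bad W ls (A @ B)"
 by (induction ls arbitrary: A B) (auto simp: nxt_append)

lemma bad_take: "bad W ls (take k L) ==> bad W ls L"
 by (metis append_take_drop_id bad_append)

lemma fails_Cons_iff: "fails W (l # ls) (c # cs) \<longleftrightarrow>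
 (fst l c --> fails W ls (kids W (snd l) c)) & fails W (l # ls) cs"
 by (simp add: nxt_Cons fails_append)

lemma srch_None_iff: "fst (srch W ls L) = None \<longleftrightarrow> fails W ls L"
proof (induction W ls L rule: srch.induct)
 case (3 W l ls c cs)
 then show ?case
  by (auto simp: fails_Cons_iff simp del: fails.simps(2) split: prod.splits option.splits)
qed auto

lemma srch_append:
 "snd (srch W ls (A @ B)) = snd (srch W ls A) + (if fails W ls A then snd (srch W ls B) else 0)"
proof (cases ls)
 case (Cons l ls')
 show ?thesis unfolding Cons
 proof (induction A)
  case (Cons c A)
  have "fst (srch W ls' (kids W (snd l) c)) = None \<longleftrightarrow> fails W ls' (kids W (snd l) c)"
   by (rule srch_None_iff)
  with Cons show ?case
   by (auto simp: fails_Cons_iff simp del: fails.simps(2) split: prod.splits option.splits)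
 qed auto
qed auto

lemma cnt_Cons: "cnt W ls (c # cs) = Suc (if fails W ls [c] then cnt W ls cs else 0)"
proof -
 have "{k. k < length (c # cs) & fails W ls (take k (c # cs))} =
   insert 0 (Suc ` {k. k < length cs & fails W ls (c # take k cs)})"
  by (auto simp: image_iff less_Suc_eq_0_disj)
 moreover have "{k. k < length cs & fails W ls (c # take k cs)} =
   {k. k < length cs & fails W ls [c] & fails W ls (take k cs)}"
  by (simp only: fails_append[of W ls "[c]", unfolded append_Cons append_Nil, of "take _ cs"])
 ultimately have "cnt W ls (c # cs) =
   card (insert 0 (Suc ` {k. k < length cs & fails W ls [c] & fails W ls (take k cs)}))"
  unfolding cnt_def by (simp only:)
 also have "... = Suc (card {k. k < length cs & fails W ls [c] & fails W ls (take k cs)})"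
  by (subst card_insert_disjoint) (auto simp: card_image)
 finally show ?thesis by (cases "fails W ls [c]") (simp_all add: cnt_def)
qed

lemma cnt_Nil [simp]: "cnt W ls [] = 0"
 by (simp add: cnt_def)

text \<open>Searching below the survivors of \<open>L\<close> one after the other makes the same
  tests as a single search of their concatenated children, since both stop at the first success.
  Iterated, this lets the tests of every layer be counted by \<open>cnt\<close> separately.\<close>

lemma srch_count: "snd (srch W (l # ls) L) = cnt W (l # ls) L + snd (srch W ls (nxt W l L))"
proof (induction L)
 case Nil
 show ?case by (cases ls) auto
next
 case (Cons c cs)
 have 0: "snd (srch W ls []) = 0" by (cases ls) auto
 have "fst (srch W ls (kids W (snd l) c)) = None \<longleftrightarrow> fails W ls (kids W (snd l) c)"
  by (rule srch_None_iff)
 moreover have "fails W (l # ls) [c] \<longleftrightarrow> (fst l c --> fails W ls (kids W (snd l) c))"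
  by (simp add: nxt_Cons)
 ultimately show ?case using Cons 0
  by (auto simp: cnt_Cons nxt_Cons srch_append simp del: fails.simps(2)
    split: prod.splits option.splits)
qed

section \<open>The search as a branching process\<close>

fun rl :: "nat => real => nat list => layer list pmf" where
 "rl W p [] = return_pmf []"
| "rl W p (b # bs) = bind_pmf (Pi_pmf {..<2 ^ W} False (%_. bernoulli_pmf p))
  (%ok. map_pmf (%ls. (ok, b) # ls) (rl W p bs))"

text \<open>Survival probability of a branching process: a candidate passes its test with
  probability \<open>p\<close> and then has \<open>2 ^ b\<close> children that survive
  independently.\<close>

fun th :: "real => nat list => real" where
 "th p [] = 1"
| "th p (b # bs) = p * (1 - (1 - th p bs) ^ (2 ^ b))"

fun tsum :: "real => nat list => real" where
 "tsum p [] = 0"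
| "tsum p (b # bs) = 1 / th p (b # bs) + tsum p bs"

lemma th_pos_le:
 assumes "0 < p" "p \<le> 1"
 shows "0 < th p bs & th p bs \<le> 1"
proof (induction bs)
 case (Cons b bs)
 have "(1 - th p bs) ^ (2 ^ b) < 1" "0 \<le> (1 - th p bs) ^ (2 ^ b)"
  using Cons by (auto simp: power_less_one_iff)
 thus ?case using assms by (auto intro: mult_le_one)
qed auto

text \<open>The generating function of a binomial count. Distinct entries of \<open>L\<close> query
  independent coordinates of the product measure, and each contributes a factor of mean
  \<open>1 - p + p * q\<close>.\<close>

lemma nn_integral_power_filter:
 fixes q p :: real and L :: "nat list"
 assumes "0 \<le> q" "0 \<le> p" "p \<le> 1" "distinct L" "\<forall>c\<in>set L. c < 2 ^ W"
 shows "(\<integral>\<^sup>+ok. ennreal (q ^ length (filter ok L)) \<partial>Pi_pmf {..<2 ^ W} False (%_. bernoulli_pmf p))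
  = ennreal ((1 - p + p * q) ^ length L)"
proof -
 have L: "set L \<subseteq> {..<2 ^ W}" using assms by auto
 have 1: "ennreal (q ^ length (filter ok L)) =
   (\<Prod>c\<in>{..<2 ^ W}. if c \<in> set L then (if ok c then ennreal q else 1) else 1)" for ok
 proof -
  have "(\<Prod>c\<in>{..<2 ^ W}. if c \<in> set L then (if ok c then ennreal q else 1) else 1)
    = (\<Prod>c\<in>set L. if ok c then ennreal q else 1)"
   by (rule prod.mono_neutral_cong_right) (use L in auto)
  also have "... = (\<Prod>c\<in>set (filter ok L). ennreal q)"
   by (rule prod.mono_neutral_cong_right) auto
  also have "... = ennreal (q ^ length (filter ok L))"
   using assms distinct_card[of "filter ok L"] by (simp add: ennreal_power)
  finally show ?thesis by simp
 qed
 have "(\<integral>\<^sup>+ok. ennreal (q ^ length (filter ok L)) \<partial>Pi_pmf {..<2 ^ W} False (%_. bernoulli_pmf p))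
  = (\<Prod>c\<in>{..<2 ^ W}. \<integral>\<^sup>+v. (if c \<in> set L then (if v then ennreal q else 1) else 1) \<partial>bernoulli_pmf p)"
  unfolding 1 by (rule nn_integral_prod_Pi_pmf) simp
 also have "... = (\<Prod>c\<in>set L. \<integral>\<^sup>+v. (if v then ennreal q else 1) \<partial>bernoulli_pmf p)"
  by (rule prod.mono_neutral_cong_right) (use L in \<open>auto simp: measure_pmf.emeasure_space_1[simplified]\<close>)
 also have "(\<integral>\<^sup>+v. (if v then ennreal q else 1) \<partial>bernoulli_pmf p) = ennreal (1 - p + p * q)"
  using assms by (simp add: ennreal_plus ennreal_mult mult.commute add.commute)
 also have "(\<Prod>c\<in>set L. ennreal (1 - p + p * q)) = ennreal ((1 - p + p * q) ^ length L)"
  using assms by (simp add: distinct_card ennreal_power del: ennreal_plus)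
 finally show ?thesis .
qed

text \<open>Induction over the layers: if \<open>m\<close> candidates survive the first layer,
  failure below has probability at most \<open>(1 - th p bs) ^ (2 ^ b * m)\<close>; averaging over
  \<open>m\<close> with the generating function reproduces the recursion of \<open>th\<close>.
  Excluding \<open>bad\<close> makes the list distinct, as the averaging requires.\<close>

lemma prob_fails:
 assumes p: "0 < p" "p \<le> 1" and "\<forall>b\<in>set bs. b \<le> W" "\<forall>c\<in>set L. c < 2 ^ W"
 shows "(\<integral>\<^sup>+ls. of_bool (fails W ls L & ~ bad W ls L) \<partial>rl W p bs) \<le> ennreal ((1 - th p bs) ^ length L)"
 using assms(3,4)
proof (induction bs arbitrary: L)
 case Nil
 show ?case by (cases L) auto
next
 case (Cons b bs)
 let ?P = "Pi_pmf {..<2 ^ W :: nat} False (%_. bernoulli_pmf p)"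
 have t: "0 < th p bs" "th p bs \<le> 1" using th_pos_le[OF p] by auto
 show ?case
 proof (cases "distinct L")
  case True
  have "(\<integral>\<^sup>+ls. of_bool (fails W ls L & ~ bad W ls L) \<partial>rl W p (b # bs))
   = (\<integral>\<^sup>+ok. \<integral>\<^sup>+ls. of_bool (fails W ls (nxt W (ok, b) L) & ~ bad W ls (nxt W (ok, b) L)) \<partial>rl W p bs \<partial>?P)"
   by (simp only: rl.simps nn_integral_bind_pmf nn_integral_map_pmf fails.simps bad.simps True simp_thms)
  also have "... \<le> (\<integral>\<^sup>+ok. ennreal ((1 - th p bs) ^ length (nxt W (ok, b) L)) \<partial>?P)"
  proof (rule nn_integral_mono)
   fix ok :: "nat => bool"
   have "\<forall>u\<in>set (nxt W (ok, b) L). u < 2 ^ W" by (rule nxt_less) (use Cons.prems in simp_all)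
   thus "(\<integral>\<^sup>+ls. of_bool (fails W ls (nxt W (ok, b) L) & ~ bad W ls (nxt W (ok, b) L)) \<partial>rl W p bs) \<le>
    ennreal ((1 - th p bs) ^ length (nxt W (ok, b) L))"
    using Cons.prems by (intro Cons.IH) simp_all
  qed
  also have "... = (\<integral>\<^sup>+ok. ennreal (((1 - th p bs) ^ 2 ^ b) ^ length (filter ok L)) \<partial>?P)"
   by (simp add: length_nxt power_mult)
  also have "... = ennreal ((1 - p + p * (1 - th p bs) ^ 2 ^ b) ^ length L)"
   by (rule nn_integral_power_filter) (use p t True Cons.prems in auto)
  also have "1 - p + p * (1 - th p bs) ^ 2 ^ b = 1 - th p (b # bs)"
   by (simp add: algebra_simps)
  finally show ?thesis .
 qed (simp)
qed

text \<open>The tail sum formula: the candidate at position \<open>k\<close> is tested only if the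
  \<open>k\<close> candidates before it fail, so a geometric series bounds the expectation. By
  \<open>bad_take\<close> a prefix inherits the absence of repetitions, so \<open>prob_fails\<close>
  applies to each prefix.\<close>

lemma expect_cnt:
 assumes p: "0 < p" "p \<le> 1" and "\<forall>b\<in>set bs. b \<le> W" "\<forall>c\<in>set L. c < 2 ^ W"
 shows "(\<integral>\<^sup>+ls. of_nat (cnt W ls L) * of_bool (~ bad W ls L) \<partial>rl W p bs) \<le> ennreal (1 / th p bs)"
proof -
 have t: "0 < th p bs" "th p bs \<le> 1" using th_pos_le[OF p] by auto
 have "of_nat (cnt W ls L) * of_bool (~ bad W ls L) \<le>
   (\<Sum>k<length L. of_bool (fails W ls (take k L) & ~ bad W ls (take k L)) :: ennreal)" for ls
 proof (cases "bad W ls L")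
  case False
  have "of_nat (cnt W ls L) = (\<Sum>k<length L. of_bool (fails W ls (take k L)) :: ennreal)"
  proof -
   have "{k. k < length L & fails W ls (take k L)} = {..<length L} \<inter> {k. fails W ls (take k L)}" by blast
   thus ?thesis unfolding cnt_def by (simp only: sum_of_bool_eq finite_lessThan)
  qed
  also have "... = (\<Sum>k<length L. of_bool (fails W ls (take k L) & ~ bad W ls (take k L)) :: ennreal)"
  proof -
   have "~ bad W ls (take k L)" for k using False bad_take by blast
   thus ?thesis by (simp only: simp_thms)
  qed
  finally show ?thesis using False by simp
 qed simp
 hence "(\<integral>\<^sup>+ls. of_nat (cnt W ls L) * of_bool (~ bad W ls L) \<partial>rl W p bs) \<le>
  (\<integral>\<^sup>+ls. (\<Sum>k<length L. of_bool (fails W ls (take k L) & ~ bad W ls (take k L)) :: ennreal) \<partial>rl W p bs)"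
  by (rule nn_integral_mono)
 also have "... = (\<Sum>k<length L. \<integral>\<^sup>+ls. of_bool (fails W ls (take k L) & ~ bad W ls (take k L)) \<partial>rl W p bs)"
  by (rule nn_integral_sum) simp
 also have "... \<le> (\<Sum>k<length L. ennreal ((1 - th p bs) ^ k))"
 proof (intro sum_mono)
  fix k assume "k \<in> {..<length L}"
  thus "(\<integral>\<^sup>+ls. of_bool (fails W ls (take k L) & ~ bad W ls (take k L)) \<partial>rl W p bs) \<le> ennreal ((1 - th p bs) ^ k)"
   using prob_fails[OF p assms(3), of "take k L"] assms(4) by (auto dest: in_set_takeD)
 qed
 also have "... = ennreal (\<Sum>k<length L. (1 - th p bs) ^ k)"
  using t by (intro sum_ennreal) auto
 also have "(\<Sum>k<length L. (1 - th p bs) ^ k) = (1 - (1 - th p bs) ^ length L) / th p bs"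
  using t by (simp add: sum_gp_strict)
 also have "... \<le> 1 / th p bs" using t by (intro divide_right_mono) auto
 finally show ?thesis using t by (simp add: ennreal_leI order_trans)
qed

lemma expect_srch:
 assumes p: "0 < p" "p \<le> 1" and "\<forall>b\<in>set bs. b \<le> W" "\<forall>c\<in>set L. c < 2 ^ W"
 shows "(\<integral>\<^sup>+ls. of_nat (snd (srch W ls L)) * of_bool (~ bad W ls L) \<partial>rl W p bs) \<le> ennreal (tsum p bs)"
 using assms(3,4)
proof (induction bs arbitrary: L)
 case Nil
 show ?case by simp
next
 case (Cons b bs)
 let ?P = "Pi_pmf {..<2 ^ W :: nat} False (%_. bernoulli_pmf p)"
 have t: "0 < th p (b # bs)" using th_pos_le[OF p, of "b # bs"] by blast
 have ts: "0 \<le> tsum p bs"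
 proof (induction bs)
  case (Cons a bs)
  thus ?case using th_pos_le[OF p, of "a # bs"] by (auto simp del: th.simps)
 qed simp
 have "(\<integral>\<^sup>+ls. of_nat (snd (srch W ls L)) * of_bool (~ bad W ls L) \<partial>rl W p (b # bs)) \<le>
  (\<integral>\<^sup>+ls. of_nat (cnt W ls L) * of_bool (~ bad W ls L) +
   of_nat (snd (srch W (tl ls) (nxt W (hd ls) L))) * of_bool (~ bad W (tl ls) (nxt W (hd ls) L)) \<partial>rl W p (b # bs))"
  unfolding rl.simps nn_integral_bind_pmf nn_integral_map_pmf list.sel
  by (intro nn_integral_mono) (simp add: srch_count algebra_simps del: fails.simps)
 also have "... = (\<integral>\<^sup>+ls. of_nat (cnt W ls L) * of_bool (~ bad W ls L) \<partial>rl W p (b # bs)) +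
  (\<integral>\<^sup>+ok. \<integral>\<^sup>+ls. of_nat (snd (srch W ls (nxt W (ok, b) L))) * of_bool (~ bad W ls (nxt W (ok, b) L)) \<partial>rl W p bs \<partial>?P)"
  unfolding rl.simps nn_integral_bind_pmf nn_integral_map_pmf list.sel
  by (subst nn_integral_add[symmetric], simp, simp, subst nn_integral_add[symmetric]) simp_all
 also have "... \<le> ennreal (1 / th p (b # bs)) + (\<integral>\<^sup>+ok. ennreal (tsum p bs) \<partial>?P)"
 proof (rule add_mono)
  show "(\<integral>\<^sup>+ls. of_nat (cnt W ls L) * of_bool (~ bad W ls L) \<partial>rl W p (b # bs)) \<le> ennreal (1 / th p (b # bs))"
   by (rule expect_cnt[OF p Cons.prems])
  show "(\<integral>\<^sup>+ok. \<integral>\<^sup>+ls. of_nat (snd (srch W ls (nxt W (ok, b) L))) * of_bool (~ bad W ls (nxt W (ok, b) L)) \<partial>rl W p bs \<partial>?P)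
   \<le> (\<integral>\<^sup>+ok. ennreal (tsum p bs) \<partial>?P)"
  proof (rule nn_integral_mono)
   fix ok :: "nat => bool"
   have "\<forall>u\<in>set (nxt W (ok, b) L). u < 2 ^ W" by (rule nxt_less) (use Cons.prems in simp_all)
   thus "(\<integral>\<^sup>+ls. of_nat (snd (srch W ls (nxt W (ok, b) L))) * of_bool (~ bad W ls (nxt W (ok, b) L)) \<partial>rl W p bs) \<le>
    ennreal (tsum p bs)"
    using Cons.prems by (intro Cons.IH) simp_all
  qed
 qed
 also have "... = ennreal (tsum p (b # bs))"
  using t ts by (simp add: measure_pmf.emeasure_space_1[simplified] ennreal_plus[symmetric] del: ennreal_plus)
 finally show ?case .
qed

section \<open>Repeated seeds are rare\<close>

text \<open>Agreement in the \<open>a\<close> leading bits, that is, in the bits appended last.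
  Agreement of two children in \<open>a\<close> leading bits leads back to agreement of their
  parents in \<open>a - b\<close> leading bits. Hence all lengths \<open>a\<close> are followed,
  although only equality, the case \<open>a = W\<close>, is wanted in the end.\<close>

definition ag :: "nat => nat => nat => nat => bool" where
 "ag W a x y \<longleftrightarrow> x div 2 ^ (W - a) = y div 2 ^ (W - a)"

definition NA :: "nat => nat => nat => nat list => nat" where
 "NA W a x L = length (filter (ag W a x) L)"

fun V :: "nat => nat => nat list => nat" where
 "V W a [] = 0"
| "V W a (x # L) = NA W a x L + V W a L"

lemma ag_sym: "ag W a x y = ag W a y x"
 by (auto simp: ag_def)

lemma NA_simps [simp]: "NA W a x [] = 0" "NA W a x (A @ B) = NA W a x A + NA W a x B"
 "NA W a x (y # L) = of_bool (ag W a x y) + NA W a x L"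
 by (auto simp: NA_def)

lemma V_append: "V W a (A @ B) = V W a A + V W a B + (\<Sum>u\<leftarrow>A. NA W a u B)"
 by (induction A) auto

lemma sum_NA: "(\<Sum>u\<leftarrow>L. NA W a u L) = 2 * V W a L + length L"
proof (induction L)
 case (Cons x L)
 have "(\<Sum>u\<leftarrow>L. of_bool (ag W a u x)) = NA W a x L"
  unfolding NA_def by (induction L) (auto simp: ag_sym)
 moreover have "ag W a x x" by (simp add: ag_def)
 ultimately show ?case using Cons by (simp add: sum_list_addf)
qed simp

definition KK :: "nat => nat => nat => nat => nat => nat" where
 "KK W a b x y = (\<Sum>u\<leftarrow>kids W b x. NA W a u (kids W b y))"

lemma NA_kids: "NA W a u (kids W b y) = card {f. f < 2 ^ b & ag W a u (y div 2 ^ b + f * 2 ^ (W - b))}"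
 unfolding NA_def kids_def length_filter_conv_card
 by (rule arg_cong[where f = card]) auto

lemma div_less_pow:
 assumes "b \<le> W" "(x::nat) < 2 ^ W"
 shows "x div 2 ^ b < 2 ^ (W - b)"
proof -
 have "(2::nat) ^ W = 2 ^ (W - b) * 2 ^ b" using assms(1) by (simp flip: power_add)
 thus ?thesis using assms(2) by (simp add: less_mult_imp_div_less)
qed

text \<open>For \<open>a \<le> b\<close> only fresh bits are compared, and a fraction
  \<open>2^(-a)\<close> of the \<open>4^b\<close> pairs of children agrees. For \<open>a > b\<close>
  the fresh bits must coincide and the parents must agree in the other \<open>a - b\<close> bits.
  Truncated subtraction covers both cases, agreement in 0 bits being void; the scaling by
  \<open>2 ^ a\<close> makes counts for different lengths comparable.\<close>

lemma KK_eq: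
 assumes "a \<le> W" "b \<le> W" "x < 2 ^ W" "y < 2 ^ W"
 shows "2 ^ a * KK W a b x y = 2 ^ b * 2 ^ b * 2 ^ (a - b) * of_bool (ag W (a - b) x y)"
proof -
 let ?x = "x div 2 ^ b" and ?y = "y div 2 ^ b" and ?t = "2 ^ (W - b) :: nat"
 have xy: "?x < ?t" "?y < ?t" using div_less_pow assms by auto
 have KS: "KK W a b x y = (\<Sum>f<2 ^ b. NA W a (?x + f * ?t) (kids W b y))"
  unfolding KK_def kids_def by (simp add: sum_list_distinct_conv_sum_set atLeast0LessThan comp_def)
 show ?thesis
 proof (cases "a \<le> b")
  case True
  have e: "W - a = (W - b) + (b - a)" using True assms by simp
  have d: "(z + f * ?t) div 2 ^ (W - a) = f div 2 ^ (b - a)" if "z < ?t" for z f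
   unfolding e power_add div_mult2_eq using that by simp
  have "NA W a (?x + f * ?t) (kids W b y) = 2 ^ (b - a)" if f: "f < 2 ^ b" for f
  proof -
   let ?s = "2 ^ (b - a) :: nat"
   have "{f'. f' < 2 ^ b & ag W a (?x + f * ?t) (?y + f' * ?t)} = {f'. f' < 2 ^ b & f' div ?s = f div ?s}"
    unfolding ag_def using d[OF xy(1)] d[OF xy(2)] by auto
   also have "... = {f div ?s * ?s..<f div ?s * ?s + ?s}"
   proof -
    have b: "(2::nat) ^ b = 2 ^ a * ?s" using True by (simp flip: power_add)
    have "f div ?s < 2 ^ a" using f unfolding b by (simp add: less_mult_imp_div_less)
    hence u: "f div ?s * ?s + ?s \<le> 2 ^ b" unfolding b
     by (metis Suc_leI add.commute mult_Suc mult_le_mono1)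
    have eq: "f' div ?s = f div ?s \<longleftrightarrow> f div ?s * ?s \<le> f' & f' < f div ?s * ?s + ?s" for f'
    proof -
     have "f' div ?s = f div ?s \<longleftrightarrow> f div ?s \<le> f' div ?s & f' div ?s < f div ?s + 1" by linarith
     also have "... \<longleftrightarrow> f div ?s * ?s \<le> f' & f' < (f div ?s + 1) * ?s"
      by (subst less_eq_div_iff_mult_less_eq, simp, subst div_less_iff_less_mult) simp_all
     finally show ?thesis by (simp add: algebra_simps)
    qed
    show ?thesis by (rule set_eqI, unfold mem_Collect_eq atLeastLessThan_iff eq) (use u in linarith)
   qed
   finally show ?thesis unfolding NA_kids by simp
  qed
  hence "KK W a b x y = 2 ^ b * 2 ^ (b - a)" unfolding KS by simp
  moreover have "ag W 0 x y" using assms by (simp add: ag_def)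
  moreover have "(2::nat) ^ a * 2 ^ (b - a) = 2 ^ b" using True by (simp flip: power_add)
  ultimately show ?thesis using True by (simp add: mult.left_commute mult.commute)
 next
  case False
  have e: "W - b = (W - a) + (a - b)" using False assms by simp
  have d: "(z + f * ?t) div 2 ^ (W - a) = z div 2 ^ (W - a) + f * 2 ^ (a - b)" for z f
  proof -
   have "f * ?t = (f * 2 ^ (a - b)) * 2 ^ (W - a)" unfolding e power_add by (simp only: ac_simps)
   thus ?thesis using div_mult_self1[of "2 ^ (W - a)" z "f * 2 ^ (a - b)"] by (simp only:) simp
  qed
  have l: "z div 2 ^ (W - a) < 2 ^ (a - b)" if "z < ?t" for z
   using that unfolding e power_add by (simp add: less_mult_imp_div_less mult.commute)
  have agd: "ag W a (?x + f * ?t) (?y + f' * ?t) \<longleftrightarrow> f = f' & ag W (a - b) x y" for f f'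
  proof -
   have "ag W a (?x + f * ?t) (?y + f' * ?t) \<longleftrightarrow>
    ?x div 2 ^ (W - a) + f * 2 ^ (a - b) = ?y div 2 ^ (W - a) + f' * 2 ^ (a - b)"
    unfolding ag_def d ..
   also have "... \<longleftrightarrow> f = f' & ?x div 2 ^ (W - a) = ?y div 2 ^ (W - a)"
   proof
    assume *: "?x div 2 ^ (W - a) + f * 2 ^ (a - b) = ?y div 2 ^ (W - a) + f' * 2 ^ (a - b)"
    from arg_cong[OF *, of "%u. u div 2 ^ (a - b)"] have "f = f'" using l xy by simp
    thus "f = f' & ?x div 2 ^ (W - a) = ?y div 2 ^ (W - a)" using * by simp
   qed auto
   moreover have "?x div 2 ^ (W - a) = x div 2 ^ (W - (a - b))" "?y div 2 ^ (W - a) = y div 2 ^ (W - (a - b))"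
    using False assms by (simp_all add: add.commute flip: div_mult2_eq power_add)
   ultimately show ?thesis by (simp add: ag_def)
  qed
  have "NA W a (?x + f * ?t) (kids W b y) = of_bool (ag W (a - b) x y)" if "f < 2 ^ b" for f
  proof -
   have "{f'. f' < 2 ^ b & ag W a (?x + f * ?t) (?y + f' * ?t)} = (if ag W (a - b) x y then {f} else {})"
    using that agd by auto
   thus ?thesis unfolding NA_kids by simp
  qed
  hence "KK W a b x y = 2 ^ b * of_bool (ag W (a - b) x y)" unfolding KS by simp
  moreover have "(2::nat) ^ a = 2 ^ b * 2 ^ (a - b)" using False by (simp flip: power_add)
  ultimately show ?thesis by simp
 qed
qed

text \<open>Comparing the children of \<open>x\<close> with themselves counts ordered pairs together
  with the diagonal, that is \<open>2 * V + 2 ^ b\<close>, and \<open>KK_eq\<close> gives the value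
  of this count.\<close>

lemma V_kids:
 assumes "a \<le> W" "b \<le> W" "x < 2 ^ W"
 shows "2 ^ a * V W a (kids W b x) \<le> 4 ^ b"
proof -
 have "2 ^ a * (2 * V W a (kids W b x) + 2 ^ b) = 2 ^ a * KK W a b x x"
  unfolding KK_def sum_NA by simp
 also have "... = 2 ^ b * 2 ^ b * 2 ^ (a - b)" using KK_eq[OF assms(1-3,3)] by (simp add: ag_def)
 finally have *: "2 ^ a * (2 * V W a (kids W b x) + 2 ^ b) = 2 ^ b * 2 ^ b * 2 ^ (a - b)" .
 have 4: "(4::nat) ^ b = 2 ^ b * 2 ^ b" by (simp flip: power_mult_distrib)
 show ?thesis
 proof (cases "a \<le> b")
  case True
  thus ?thesis using * 4 by (simp add: algebra_simps)
 next
  case False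
  hence "(2::nat) ^ a = 2 ^ b * 2 ^ (a - b)" by (simp flip: power_add)
  with * have "2 ^ a * (2 * V W a (kids W b x)) = 0" by (simp add: algebra_simps)
  thus ?thesis by simp
 qed
qed

lemma sum_NA_nxt: "(\<Sum>u\<leftarrow>kids W b x. NA W a u (nxt W (ok, b) L)) = (\<Sum>y\<leftarrow>L. of_bool (ok y) * KK W a b x y)"
proof (induction L)
 case (Cons y L)
 thus ?case by (cases "ok y") (simp_all add: nxt_Cons sum_list_addf KK_def)
qed simp

lemma V_nxt_Cons: "V W a (nxt W (ok, b) (x # L)) =
 of_bool (ok x) * V W a (kids W b x) + V W a (nxt W (ok, b) L) +
 (\<Sum>y\<leftarrow>L. of_bool (ok x & ok y) * KK W a b x y)"
 by (cases "ok x") (simp_all add: nxt_Cons V_append sum_NA_nxt)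

lemma prob_all_ok:
 fixes S :: "nat set"
 assumes "0 \<le> p" "p \<le> 1" "S \<subseteq> {..<2 ^ W}"
 shows "(\<integral>\<^sup>+ok. of_bool (\<forall>c\<in>S. ok c) \<partial>Pi_pmf {..<2 ^ W} False (%_. bernoulli_pmf p)) = ennreal (p ^ card S)"
proof -
 have fS: "finite S" using assms finite_subset by blast
 have 1: "of_bool (\<forall>c\<in>S. ok c) = (\<Prod>c\<in>{..<2 ^ W}. if c \<in> S then of_bool (ok c) else 1 :: ennreal)" for ok
 proof -
  have "(\<Prod>c\<in>{..<2 ^ W}. if c \<in> S then of_bool (ok c) else 1 :: ennreal) = (\<Prod>c\<in>S. of_bool (ok c))"
   by (rule prod.mono_neutral_cong_right) (use assms in auto)
  also have "... = of_bool (\<forall>c\<in>S. ok c)" using fS by (induction S) auto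
  finally show ?thesis by simp
 qed
 have "(\<integral>\<^sup>+ok. of_bool (\<forall>c\<in>S. ok c) \<partial>Pi_pmf {..<2 ^ W} False (%_. bernoulli_pmf p)) =
  (\<Prod>c\<in>{..<2 ^ W}. \<integral>\<^sup>+v. (if c \<in> S then of_bool v else 1) \<partial>bernoulli_pmf p)"
  unfolding 1 by (rule nn_integral_prod_Pi_pmf) simp
 also have "... = (\<Prod>c\<in>S. \<integral>\<^sup>+v. of_bool v \<partial>bernoulli_pmf p)"
  by (rule prod.mono_neutral_cong_right) (use assms in \<open>auto simp: measure_pmf.emeasure_space_1[simplified]\<close>)
 also have "(\<integral>\<^sup>+v. of_bool v \<partial>bernoulli_pmf p) = ennreal p" using assms by simp
 finally show ?thesis using assms by (simp add: ennreal_power)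
qed

lemma expect_length_filter:
 fixes L :: "nat list"
 assumes "0 \<le> p" "p \<le> 1" "\<forall>c\<in>set L. c < 2 ^ W"
 shows "(\<integral>\<^sup>+ok. of_nat (length (filter ok L)) \<partial>Pi_pmf {..<2 ^ W} False (%_. bernoulli_pmf p)) = ennreal (p * length L)"
 using assms(3)
proof (induction L)
 case (Cons x L)
 let ?P = "Pi_pmf {..<2 ^ W :: nat} False (%_. bernoulli_pmf p)"
 have "(\<integral>\<^sup>+ok. of_nat (length (filter ok (x # L))) \<partial>?P) = (\<integral>\<^sup>+ok. of_bool (\<forall>c\<in>{x}. ok c) + of_nat (length (filter ok L)) \<partial>?P)"
  by (intro nn_integral_cong) simp
 also have "... = ennreal (p ^ card {x}) + ennreal (p * length L)"
  by (subst nn_integral_add) (use Cons prob_all_ok[OF assms(1,2), of "{x}" W] in simp_all)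
 also have "... = ennreal (p * length (x # L))"
  using assms by (simp add: ennreal_plus[symmetric] algebra_simps del: ennreal_plus)
 finally show ?case .
qed simp

text \<open>Agreeing pairs of children are of two kinds. Children of two different parents need both
  tests to succeed, with probability \<open>p * p\<close> because the parents are distinct windows,
  and \<open>KK_eq\<close> reduces them to agreement of the parents. Siblings need only one
  successful test, and \<open>V_kids\<close> bounds their number.\<close>

lemma expect_V_nxt:
 assumes p: "0 \<le> p" "p \<le> 1" and ab: "a \<le> W" "b \<le> W"
  and "distinct L" "\<forall>c\<in>set L. c < 2 ^ W"
 shows "(\<integral>\<^sup>+ok. ennreal (2 ^ a * V W a (nxt W (ok, b) L)) \<partial>Pi_pmf {..<2 ^ W} False (%_. bernoulli_pmf p))
  \<le> ennreal ((p * 2 ^ b)\<^sup>2 * (2 ^ (a - b) * V W (a - b) L) + p * 4 ^ b * length L)"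
 using assms(5,6)
proof (induction L)
 case (Cons x L)
 let ?P = "Pi_pmf {..<2 ^ W :: nat} False (%_. bernoulli_pmf p)"
 have x: "x < 2 ^ W" "x \<notin> set L" and L: "\<forall>c\<in>set L. c < 2 ^ W" using Cons.prems by auto
 have 4: "(4::real) ^ b = 2 ^ b * 2 ^ b" by (simp flip: power_mult_distrib)
 have s: "(\<integral>\<^sup>+ok. ennreal (\<Sum>y\<leftarrow>L. of_bool (ok x & ok y) * real (2 ^ a * KK W a b x y)) \<partial>?P) =
  ennreal ((p * 2 ^ b)\<^sup>2 * (2 ^ (a - b) * NA W (a - b) x L))"
  using x(2) L
 proof (induction L)
  case (Cons y L)
  have xy: "x ~= y" "y < 2 ^ W" using Cons.prems by auto
  let ?c = "real (2 ^ a * KK W a b x y)"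
  have nn: "0 \<le> (\<Sum>y\<leftarrow>L. of_bool (ok x & ok y) * real (2 ^ a * KK W a b x y))" for ok :: "nat => bool"
   by (intro sum_list_nonneg) auto
  have "(\<integral>\<^sup>+ok. ennreal (\<Sum>y\<leftarrow>y # L. of_bool (ok x & ok y) * real (2 ^ a * KK W a b x y)) \<partial>?P) =
   (\<integral>\<^sup>+ok. ennreal ?c * of_bool (\<forall>c\<in>{x, y}. ok c) + ennreal (\<Sum>y\<leftarrow>L. of_bool (ok x & ok y) * real (2 ^ a * KK W a b x y)) \<partial>?P)"
  proof (intro nn_integral_cong)
   fix ok :: "nat => bool"
   have "ennreal (\<Sum>y\<leftarrow>y # L. of_bool (ok x & ok y) * real (2 ^ a * KK W a b x y)) =
    ennreal (of_bool (ok x & ok y) * ?c) + ennreal (\<Sum>y\<leftarrow>L. of_bool (ok x & ok y) * real (2 ^ a * KK W a b x y))"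
    unfolding list.map sum_list.Cons by (rule ennreal_plus[OF _ nn]) simp
   also have "ennreal (of_bool (ok x & ok y) * ?c) = ennreal ?c * of_bool (\<forall>c\<in>{x, y}. ok c)"
    by (cases "ok x & ok y") auto
   finally show "ennreal (\<Sum>y\<leftarrow>y # L. of_bool (ok x & ok y) * real (2 ^ a * KK W a b x y)) =
    ennreal ?c * of_bool (\<forall>c\<in>{x, y}. ok c) + ennreal (\<Sum>y\<leftarrow>L. of_bool (ok x & ok y) * real (2 ^ a * KK W a b x y))" .
  qed
  also have "... = ennreal ?c * ennreal (p ^ card {x, y}) + ennreal ((p * 2 ^ b)\<^sup>2 * (2 ^ (a - b) * NA W (a - b) x L))"
   using Cons prob_all_ok[OF p, of "{x, y}" W] x xy
   by (subst nn_integral_add) (simp_all add: nn_integral_cmult)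
  also have "ennreal ?c * ennreal (p ^ card {x, y}) = ennreal (?c * p\<^sup>2)"
  proof -
   have "card {x, y} = 2" using xy by simp
   thus ?thesis by (simp only: ennreal_mult[symmetric, OF of_nat_0_le_iff zero_le_power[OF p(1)]])
  qed
  also have "?c = 2 ^ b * 2 ^ b * 2 ^ (a - b) * of_bool (ag W (a - b) x y)"
   unfolding KK_eq[OF ab x(1) xy(2)] by simp
  also have "ennreal (2 ^ b * 2 ^ b * 2 ^ (a - b) * of_bool (ag W (a - b) x y) * p\<^sup>2) +
   ennreal ((p * 2 ^ b)\<^sup>2 * (2 ^ (a - b) * NA W (a - b) x L)) =
   ennreal ((p * 2 ^ b)\<^sup>2 * (2 ^ (a - b) * NA W (a - b) x (y # L)))"
   using p by (subst ennreal_plus[symmetric]) (auto simp: algebra_simps power2_eq_square)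
  finally show ?case .
 qed simp
 have nn: "0 \<le> (\<Sum>y\<leftarrow>L. of_bool (ok x & ok y) * real (2 ^ a * KK W a b x y))" for ok :: "nat => bool"
  by (intro sum_list_nonneg) auto
 have "(\<integral>\<^sup>+ok. ennreal (2 ^ a * V W a (nxt W (ok, b) (x # L))) \<partial>?P) =
  (\<integral>\<^sup>+ok. ennreal (2 ^ a * V W a (kids W b x)) * of_bool (\<forall>c\<in>{x}. ok c) +
    (ennreal (2 ^ a * V W a (nxt W (ok, b) L)) +
    ennreal (\<Sum>y\<leftarrow>L. of_bool (ok x & ok y) * real (2 ^ a * KK W a b x y))) \<partial>?P)"
 proof (intro nn_integral_cong)
  fix ok :: "nat => bool"
  have "2 ^ a * real (\<Sum>y\<leftarrow>L. of_bool (ok x & ok y) * KK W a b x y) =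
   (\<Sum>y\<leftarrow>L. of_bool (ok x & ok y) * real (2 ^ a * KK W a b x y))"
   by (induction L) (auto simp: algebra_simps)
  hence "2 ^ a * real (V W a (nxt W (ok, b) (x # L))) =
   of_bool (ok x) * (2 ^ a * V W a (kids W b x)) + (2 ^ a * V W a (nxt W (ok, b) L) +
   (\<Sum>y\<leftarrow>L. of_bool (ok x & ok y) * real (2 ^ a * KK W a b x y)))"
   unfolding V_nxt_Cons by (simp add: algebra_simps)
  thus "ennreal (2 ^ a * V W a (nxt W (ok, b) (x # L))) =
   ennreal (2 ^ a * V W a (kids W b x)) * of_bool (\<forall>c\<in>{x}. ok c) +
    (ennreal (2 ^ a * V W a (nxt W (ok, b) L)) +
    ennreal (\<Sum>y\<leftarrow>L. of_bool (ok x & ok y) * real (2 ^ a * KK W a b x y)))"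
   using nn[of ok] by (simp add: ennreal_plus)
 qed
 also have "... = ennreal (2 ^ a * V W a (kids W b x)) * ennreal (p ^ card {x}) +
  ((\<integral>\<^sup>+ok. ennreal (2 ^ a * V W a (nxt W (ok, b) L)) \<partial>?P) + ennreal ((p * 2 ^ b)\<^sup>2 * (2 ^ (a - b) * NA W (a - b) x L)))"
 proof -
  have pr: "(\<integral>\<^sup>+ok. of_bool (\<forall>c\<in>{x}. ok c) \<partial>?P) = ennreal (p ^ card {x})"
   by (rule prob_all_ok[OF p]) (use x in simp)
  show ?thesis
   by (subst nn_integral_add, simp, simp, subst nn_integral_add, simp, simp, subst nn_integral_cmult, simp)
    (simp only: s pr)
 qed
 also have "... \<le> ennreal (4 ^ b) * ennreal p +
  (ennreal ((p * 2 ^ b)\<^sup>2 * (2 ^ (a - b) * V W (a - b) L) + p * 4 ^ b * length L) + ennreal ((p * 2 ^ b)\<^sup>2 * (2 ^ (a - b) * NA W (a - b) x L)))"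
 proof (intro add_mono order_refl mult_mono)
  have "real (2 ^ a * V W a (kids W b x)) \<le> real (4 ^ b)"
   using V_kids[OF ab x(1)] by (simp only: of_nat_le_iff)
  thus "ennreal (2 ^ a * V W a (kids W b x)) \<le> ennreal (4 ^ b)" by (intro ennreal_leI) simp
  show "(\<integral>\<^sup>+ok. ennreal (2 ^ a * V W a (nxt W (ok, b) L)) \<partial>?P) \<le>
   ennreal ((p * 2 ^ b)\<^sup>2 * (2 ^ (a - b) * V W (a - b) L) + p * 4 ^ b * length L)"
   using Cons by simp
 qed auto
 also have "... = ennreal ((p * 2 ^ b)\<^sup>2 * (2 ^ (a - b) * V W (a - b) (x # L)) + p * 4 ^ b * length (x # L))"
  using p by (simp add: ennreal_mult[symmetric] ennreal_plus[symmetric] algebra_simps del: ennreal_plus)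
 finally show ?case .
qed simp

text \<open>The count for the frontier after \<open>i\<close> layers, set to zero once an earlier
  frontier has a repetition: from there on independence is lost, and the first repetition is all
  that has to be detected.\<close>

fun vv :: "nat => nat => nat => layer list => nat list => nat" where
 "vv W 0 a ls L = V W a L"
| "vv W (Suc i) a [] L = 0"
| "vv W (Suc i) a (l # ls) L = (if distinct L then vv W i a ls (nxt W l L) else 0)"

text \<open>The coefficients in \<open>expect_vv\<close>: \<open>Gm\<close> is the expected growth
  of the frontier over \<open>i\<close> layers, \<open>Sb\<close> the number of bits appended
  meanwhile, and \<open>Ps\<close> the contribution, per initial candidate, of the sibling pairs
  born on the way.\<close>

fun Gm :: "real => nat => nat list => real" where
 "Gm p 0 bs = 1"
| "Gm p (Suc i) [] = 0"
| "Gm p (Suc i) (b # bs) = p * 2 ^ b * Gm p i bs"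

fun Sb :: "nat => nat list => nat" where
 "Sb 0 bs = 0"
| "Sb (Suc i) [] = 0"
| "Sb (Suc i) (b # bs) = b + Sb i bs"

fun Ps :: "real => nat => nat list => real" where
 "Ps p 0 bs = 0"
| "Ps p (Suc i) [] = 0"
| "Ps p (Suc i) (b # bs) = (Gm p i bs)\<^sup>2 * (p * 4 ^ b) + Ps p i bs * (p * 2 ^ b)"

lemma Gm_nonneg: "0 \<le> p ==> 0 \<le> Gm p i bs"
 by (induction p i bs rule: Gm.induct) auto

lemma Ps_nonneg: "0 \<le> p ==> 0 \<le> Ps p i bs"
 by (induction p i bs rule: Ps.induct) (auto intro!: add_nonneg_nonneg mult_nonneg_nonneg)

lemma expect_vv:
 assumes p: "0 \<le> p" "p \<le> 1" and "a \<le> W" "\<forall>b\<in>set bs. b \<le> W" "\<forall>c\<in>set L. c < 2 ^ W"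
 shows "(\<integral>\<^sup>+ls. ennreal (2 ^ a * vv W i a ls L) \<partial>rl W p bs) \<le>
  ennreal ((Gm p i bs)\<^sup>2 * (2 ^ (a - Sb i bs) * V W (a - Sb i bs) L) + Ps p i bs * length L)"
 using assms(4,5)
proof (induction i arbitrary: bs L)
 case 0
 show ?case by (simp add: measure_pmf.emeasure_space_1[simplified])
next
 case (Suc i bs0 L)
 show ?case
 proof (cases bs0)
  case (Cons b bs)
  let ?P = "Pi_pmf {..<2 ^ W :: nat} False (%_. bernoulli_pmf p)"
  have b: "b \<le> W" "\<forall>b\<in>set bs. b \<le> W" using Suc.prems Cons by auto
  let ?G = "Gm p i bs" and ?S = "a - Sb i bs"
  have nn: "0 \<le> Gm p i bs" "0 \<le> Ps p i bs" using Gm_nonneg Ps_nonneg p by auto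
  show ?thesis
  proof (cases "distinct L")
   case True
   have "(\<integral>\<^sup>+ls. ennreal (2 ^ a * vv W (Suc i) a ls L) \<partial>rl W p bs0) =
    (\<integral>\<^sup>+ok. \<integral>\<^sup>+ls. ennreal (2 ^ a * vv W i a ls (nxt W (ok, b) L)) \<partial>rl W p bs \<partial>?P)"
    by (simp only: Cons rl.simps nn_integral_bind_pmf nn_integral_map_pmf vv.simps True if_True)
   also have "... \<le> (\<integral>\<^sup>+ok. ennreal (?G\<^sup>2 * (2 ^ ?S * V W ?S (nxt W (ok, b) L)) + Ps p i bs * length (nxt W (ok, b) L)) \<partial>?P)"
   proof (rule nn_integral_mono)
    fix ok :: "nat => bool"
    have "\<forall>u\<in>set (nxt W (ok, b) L). u < 2 ^ W" by (rule nxt_less) (use b Suc.prems in simp_all)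
    thus "(\<integral>\<^sup>+ls. ennreal (2 ^ a * vv W i a ls (nxt W (ok, b) L)) \<partial>rl W p bs) \<le>
     ennreal (?G\<^sup>2 * (2 ^ ?S * V W ?S (nxt W (ok, b) L)) + Ps p i bs * length (nxt W (ok, b) L))"
     by (rule Suc.IH[OF b(2)])
   qed
   also have "... = (\<integral>\<^sup>+ok. ennreal (?G\<^sup>2) * ennreal (2 ^ ?S * V W ?S (nxt W (ok, b) L)) +
     ennreal (Ps p i bs * 2 ^ b) * of_nat (length (filter ok L)) \<partial>?P)"
   proof -
    have key: "ennreal (?G\<^sup>2 * (2 ^ ?S * V W ?S (nxt W (ok, b) L)) + Ps p i bs * length (nxt W (ok, b) L)) =
     ennreal (?G\<^sup>2) * ennreal (2 ^ ?S * V W ?S (nxt W (ok, b) L)) + ennreal (Ps p i bs * 2 ^ b) * of_nat (length (filter ok L))"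
     for ok :: "nat => bool"
    proof -
    let ?v = "real (2 ^ ?S * V W ?S (nxt W (ok, b) L))" and ?l = "real (length (filter ok L))"
    have "ennreal (?G\<^sup>2 * ?v + Ps p i bs * real (length (nxt W (ok, b) L))) = ennreal (?G\<^sup>2 * ?v + (Ps p i bs * 2 ^ b) * ?l)"
    proof -
     have "real (length (nxt W (ok, b) L)) = 2 ^ b * ?l" by (simp add: length_nxt)
     thus ?thesis by (simp only: mult.assoc)
    qed
    also have "... = ennreal (?G\<^sup>2 * ?v) + ennreal ((Ps p i bs * 2 ^ b) * ?l)"
     using nn by (intro ennreal_plus) auto
    also have "... = ennreal (?G\<^sup>2) * ennreal ?v + ennreal (Ps p i bs * 2 ^ b) * of_nat (length (filter ok L))"
     using nn by (subst (1 2) ennreal_mult) (auto simp: ennreal_of_nat_eq_real_of_nat)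
    finally show ?thesis .
    qed
    show ?thesis by (rule nn_integral_cong) (rule key)
   qed
   also have "... = ennreal (?G\<^sup>2) * (\<integral>\<^sup>+ok. ennreal (2 ^ ?S * V W ?S (nxt W (ok, b) L)) \<partial>?P) +
     ennreal (Ps p i bs * 2 ^ b) * ennreal (p * length L)"
    by (subst nn_integral_add, simp, simp, subst nn_integral_cmult, simp, subst nn_integral_cmult, simp,
      subst expect_length_filter[OF p Suc.prems(2)], rule refl)
   also have "... \<le> ennreal (?G\<^sup>2) * ennreal ((p * 2 ^ b)\<^sup>2 * (2 ^ (?S - b) * V W (?S - b) L) + p * 4 ^ b * length L) +
     ennreal (Ps p i bs * 2 ^ b) * ennreal (p * length L)"
    by (intro add_mono mult_left_mono order_refl expect_V_nxt) (use p b assms True Suc.prems in auto)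
   also have "... = ennreal (?G\<^sup>2 * ((p * 2 ^ b)\<^sup>2 * (2 ^ (?S - b) * V W (?S - b) L) + p * 4 ^ b * length L) +
     Ps p i bs * 2 ^ b * (p * length L))"
    using nn p by (simp add: ennreal_mult ennreal_plus)
   also have "?S - b = a - Sb (Suc i) bs0" by (simp add: Cons)
   also have "?G\<^sup>2 * ((p * 2 ^ b)\<^sup>2 * (2 ^ (a - Sb (Suc i) bs0) * V W (a - Sb (Suc i) bs0) L) + p * 4 ^ b * length L) +
     Ps p i bs * 2 ^ b * (p * length L) = (Gm p (Suc i) bs0)\<^sup>2 * (2 ^ (a - Sb (Suc i) bs0) * V W (a - Sb (Suc i) bs0) L) + Ps p (Suc i) bs0 * length L"
    by (simp add: Cons algebra_simps power_mult_distrib del: Sb.simps)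
   finally show ?thesis .
  next
   case False
   have "(\<integral>\<^sup>+ls. ennreal (2 ^ a * vv W (Suc i) a ls L) \<partial>rl W p bs0) = 0"
    using False by (simp add: Cons)
   thus ?thesis by simp
  qed
 qed simp
qed

lemma V_ge_1:
 assumes "~ distinct L"
 shows "1 \<le> V W W L"
 using assms
proof (induction L)
 case (Cons x L)
 show ?case
 proof (cases "x \<in> set L")
  case True
  hence "NA W W x L ~= 0" by (auto simp: NA_def filter_empty_conv ag_def)
  thus ?thesis by simp
 qed (use Cons in auto)
qed simp

text \<open>Before the first frontier with a repetition all frontiers are distinct, so there
  \<open>vv\<close> is the true number of equal pairs, which is at least one.\<close>

lemma bad_le_vv: "of_bool (bad W ls L) \<le> (\<Sum>i<length ls. vv W i W ls L)"
proof (induction ls arbitrary: L)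
 case (Cons l ls)
 show ?case
 proof (cases "distinct L")
  case True
  have "(\<Sum>i<length (l # ls). vv W i W (l # ls) L) = V W W L + (\<Sum>i<length ls. vv W i W ls (nxt W l L))"
   unfolding length_Cons sum.lessThan_Suc_shift using True by simp
  thus ?thesis using Cons[of "nxt W l L"] True by simp
 next
  case False
  have "vv W 0 W (l # ls) L \<le> (\<Sum>i<length (l # ls). vv W i W (l # ls) L)"
   by (rule member_le_sum) auto
  moreover have "(of_bool (bad W (l # ls) L) :: nat) \<le> 1" by simp
  ultimately show ?thesis using V_ge_1[OF False, of W] by (simp only: vv.simps)
 qed
qed simp

lemma length_rl: "ls \<in> set_pmf (rl W p bs) ==> length ls = length bs"
 by (induction bs arbitrary: ls) auto

text \<open>A sibling pair is weighted by the growth before its birth and by the squared growth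
  after it. Each of the three factors is at most \<open>G\<close>, and there are \<open>i\<close>
  layers at which it can be born. The factor \<open>c\<close> carries the growth before the current
  layer through the induction.\<close>

lemma Ps_bound:
 assumes "0 \<le> p" "p \<le> 1" "0 \<le> c" "0 \<le> G" "\<forall>b\<in>set bs. b \<le> B"
  and "!!t. t \<le> i ==> c * Gm p t bs \<le> G"
  and "!!s t. s \<le> length bs ==> Gm p t (drop s bs) \<le> G"
 shows "c * Ps p i bs \<le> real i * (G ^ 3 * 4 ^ B)"
 using assms
proof (induction i arbitrary: bs c)
 case (Suc i bs0 c)
 show ?case
 proof (cases bs0)
  case (Cons b bs)
  have g: "0 \<le> Gm p i bs" "Gm p i bs \<le> G" using Gm_nonneg Suc.prems(1) Suc.prems(7)[of 1 i] Cons by auto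
  have c: "c \<le> G" using Suc.prems(6)[of 0] by simp
  have "c * (p * 2 ^ b) * Ps p i bs \<le> real i * (G ^ 3 * 4 ^ B)"
  proof (rule Suc.IH)
   show "c * (p * 2 ^ b) * Gm p t bs \<le> G" if "t \<le> i" for t
    using Suc.prems(6)[of "Suc t"] that Cons by (simp add: mult.assoc)
   show "Gm p t (drop s bs) \<le> G" if "s \<le> length bs" for s t
    using Suc.prems(7)[of "Suc s" t] that Cons by simp
  qed (use Suc.prems Cons in auto)
  moreover have "c * ((Gm p i bs)\<^sup>2 * (p * 4 ^ b)) \<le> G * (G\<^sup>2 * (1 * 4 ^ B))"
   using Suc.prems Cons g c
   by (intro mult_mono power_mono) (auto intro!: mult_nonneg_nonneg power_increasing)
  ultimately show ?thesis using Cons by (simp add: algebra_simps power3_eq_cube power2_eq_square)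
 qed (use Suc.prems in simp)
qed simp

text \<open>Markov's inequality for the number of equal pairs in each frontier:
  \<open>expect_vv\<close> is taken at \<open>a = W\<close> and \<open>2 ^ W\<close> is divided out.
  The search starts from the children of the window 0, so \<open>V_kids\<close> bounds the initial
  pairs for every length of agreement.\<close>

lemma prob_bad:
 assumes p: "0 \<le> p" "p \<le> 1" and W: "\<forall>b\<in>set bs. b \<le> W" "a0 \<le> W"
  and B: "\<forall>b\<in>set bs. b \<le> B" and G: "0 \<le> G"
  and Gm: "!!s t. s \<le> length bs ==> Gm p t (drop s bs) \<le> G"
 shows "(\<integral>\<^sup>+ls. of_bool (bad W ls (kids W a0 0)) \<partial>rl W p bs) \<le>
  ennreal (real (length bs) * (G\<^sup>2 * 4 ^ a0 + real (length bs) * (G ^ 3 * 4 ^ B) * 2 ^ a0) / 2 ^ W)"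
proof -
 let ?L = "kids W a0 0"
 have L: "\<forall>c\<in>set ?L. c < 2 ^ W" using kids_less[OF W(2), of 0] by auto
 have 1: "(\<integral>\<^sup>+ls. ennreal (2 ^ W * vv W i W ls ?L) \<partial>rl W p bs) \<le>
  ennreal (G\<^sup>2 * 4 ^ a0 + real (length bs) * (G ^ 3 * 4 ^ B) * 2 ^ a0)" if i: "i < length bs" for i
 proof -
  let ?S = "W - Sb i bs"
  have "(\<integral>\<^sup>+ls. ennreal (2 ^ W * vv W i W ls ?L) \<partial>rl W p bs) \<le>
   ennreal ((Gm p i bs)\<^sup>2 * (2 ^ ?S * V W ?S ?L) + Ps p i bs * length ?L)"
   by (rule expect_vv) (use p W L in auto)
  also have "... \<le> ennreal (G\<^sup>2 * 4 ^ a0 + real (length bs) * (G ^ 3 * 4 ^ B) * 2 ^ a0)"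
  proof -
   have "2 ^ ?S * V W ?S ?L \<le> 4 ^ a0" by (rule V_kids) (use W in auto)
   hence 1: "real (2 ^ ?S * V W ?S ?L) \<le> 4 ^ a0" by (metis of_nat_le_iff of_nat_numeral of_nat_power)
   have 2: "Gm p i bs \<le> G" using Gm[of 0 i] by simp
   have "1 * Ps p i bs \<le> real i * (G ^ 3 * 4 ^ B)"
    by (rule Ps_bound[OF p]) (use G B Gm Gm[of 0] in auto)
   also have "... \<le> real (length bs) * (G ^ 3 * 4 ^ B)" using i G by (intro mult_right_mono) auto
   finally have 3: "Ps p i bs * 2 ^ a0 \<le> real (length bs) * (G ^ 3 * 4 ^ B) * 2 ^ a0" by simp
   have "(Gm p i bs)\<^sup>2 * real (2 ^ ?S * V W ?S ?L) \<le> G\<^sup>2 * 4 ^ a0"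
    using 1 2 G p Gm_nonneg by (intro mult_mono power_mono) auto
   thus ?thesis using 3 by (intro ennreal_leI add_mono) simp_all
  qed
  finally show ?thesis .
 qed
 have "(\<integral>\<^sup>+ls. of_bool (bad W ls ?L) \<partial>rl W p bs) \<le>
  (\<integral>\<^sup>+ls. ennreal (1 / 2 ^ W) * (\<Sum>i<length bs. ennreal (2 ^ W * vv W i W ls ?L)) \<partial>rl W p bs)"
 proof (rule nn_integral_mono_AE, rule AE_pmfI)
  fix ls assume "ls \<in> set_pmf (rl W p bs)"
  hence "length ls = length bs" by (rule length_rl)
  hence "real (of_bool (bad W ls ?L)) \<le> (\<Sum>i<length bs. real (vv W i W ls ?L))"
   using bad_le_vv[of W ls ?L] by (metis of_nat_le_iff of_nat_sum)
  also have "... = 1 / 2 ^ W * (\<Sum>i<length bs. 2 ^ W * real (vv W i W ls ?L))"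
   by (simp add: sum_distrib_left)
  finally have "ennreal (of_bool (bad W ls ?L)) \<le> ennreal (1 / 2 ^ W * (\<Sum>i<length bs. 2 ^ W * real (vv W i W ls ?L)))"
   by (intro ennreal_leI) simp
  also have "... = ennreal (1 / 2 ^ W) * (\<Sum>i<length bs. ennreal (2 ^ W * vv W i W ls ?L))"
   by (subst ennreal_mult) (auto simp: sum_nonneg sum_ennreal)
  finally show "of_bool (bad W ls ?L) \<le> ennreal (1 / 2 ^ W) * (\<Sum>i<length bs. ennreal (2 ^ W * vv W i W ls ?L))"
   by (cases "bad W ls ?L") auto
 qed
 also have "... = ennreal (1 / 2 ^ W) * (\<Sum>i<length bs. \<integral>\<^sup>+ls. ennreal (2 ^ W * vv W i W ls ?L) \<partial>rl W p bs)"
  by (subst nn_integral_cmult, simp, subst nn_integral_sum, simp, rule refl)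
 also have "... \<le> ennreal (1 / 2 ^ W) * (\<Sum>i<length bs. ennreal (G\<^sup>2 * 4 ^ a0 + real (length bs) * (G ^ 3 * 4 ^ B) * 2 ^ a0))"
  by (intro mult_left_mono sum_mono 1) auto
 also have "... = ennreal (real (length bs) * (G\<^sup>2 * 4 ^ a0 + real (length bs) * (G ^ 3 * 4 ^ B) * 2 ^ a0) / 2 ^ W)"
 proof -
  let ?c = "G\<^sup>2 * 4 ^ a0 + real (length bs) * (G ^ 3 * 4 ^ B) * 2 ^ a0"
  have c: "0 \<le> ?c" using G by simp
  have "(\<Sum>i<length bs. ennreal ?c) = ennreal (real (length bs) * ?c)"
   using c by (subst sum_ennreal) (simp_all del: ennreal_plus)
  hence "ennreal (1 / 2 ^ W) * (\<Sum>i<length bs. ennreal ?c) = ennreal (1 / 2 ^ W * (real (length bs) * ?c))"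
   using c by (simp only:) (rule ennreal_mult[symmetric], simp_all)
  thus ?thesis by simp
 qed
 finally show ?thesis .
qed

section \<open>Reasoning about programs\<close>

fun loop_free :: "com => bool" where
 "loop_free (Seq a b) \<longleftrightarrow> loop_free a & loop_free b"
| "loop_free (Cond e a b) \<longleftrightarrow> loop_free a & loop_free b"
| "loop_free (While e a) \<longleftrightarrow> False"
| "loop_free _ \<longleftrightarrow> True"

text \<open>Programs without loops always terminate, so their effect is a function that the
  simplifier can evaluate; only loops need invariants.\<close>

fun den :: "nat => (nat => 'k => bool) => 'k list => com => state => state" where
 "den w H ks (Store a b) s = ((fst s)(aval w (fst s) a := aval w (fst s) b), snd s)"
| "den w H ks (Hash a b i) s =
  ((fst s)(aval w (fst s) a := take_bit w (hash_val H ks (snd s) (aval w (fst s) b) (aval w (fst s) i))), snd s)"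
| "den w H ks Rehash s = (fst s, Suc (snd s))"
| "den w H ks (Seq a b) s = den w H ks b (den w H ks a s)"
| "den w H ks (Cond e a b) s = (if aval w (fst s) e ~= 0 then den w H ks a s else den w H ks b s)"
| "den w H ks _ s = s"

fun tb :: "com => nat" where
 "tb (Store a b) = 1 + acost a + acost b"
| "tb (Hash a b i) = 1 + acost a + acost b + acost i"
| "tb (Seq a b) = tb a + tb b"
| "tb (Cond e a b) = 1 + acost e + max (tb a) (tb b)"
| "tb _ = 1"

lemma exec_den: "loop_free c ==> \<exists>t\<le>tb c. exec w H ks c s t (den w H ks c s)"
proof (induction c arbitrary: s)
 case Skip
 show ?case using exec.Skip[of w H ks s] by (intro exI[of _ 1]) simp
next
 case (Store a b)
 obtain m g where s: "s = (m, g)" by (cases s)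
 show ?case unfolding s using exec.Store[of w H ks a b m g] by (intro exI[of _ "1 + acost a + acost b"]) simp
next
 case (Hash a b i)
 obtain m g where s: "s = (m, g)" by (cases s)
 show ?case unfolding s using exec.Hash[of w H ks a b i m g]
  by (intro exI[of _ "1 + acost a + acost b + acost i"]) simp
next
 case Rehash
 obtain m g where s: "s = (m, g)" by (cases s)
 show ?case unfolding s using exec.Rehash[of w H ks m g] by (intro exI[of _ 1]) simp
next
 case (Seq c1 c2)
 obtain t1 where 1: "t1 \<le> tb c1" "exec w H ks c1 s t1 (den w H ks c1 s)" using Seq.IH(1)[of s] Seq.prems by auto
 obtain t2 where 2: "t2 \<le> tb c2" "exec w H ks c2 (den w H ks c1 s) t2 (den w H ks c2 (den w H ks c1 s))"
  using Seq.IH(2)[of "den w H ks c1 s"] Seq.prems by auto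
 show ?case using exec.Seq[OF 1(2) 2(2)] 1(1) 2(1) by (intro exI[of _ "t1 + t2"]) simp
next
 case (Cond e c1 c2)
 show ?case
 proof (cases "aval w (fst s) e ~= 0")
  case True
  obtain t where 1: "t \<le> tb c1" "exec w H ks c1 s t (den w H ks c1 s)" using Cond.IH(1)[of s] Cond.prems by auto
  show ?thesis using exec.CondTrue[OF True 1(2), of c2] True 1(1)
   by (intro exI[of _ "1 + acost e + t"]) simp
 next
  case False
  obtain t where 1: "t \<le> tb c2" "exec w H ks c2 s t (den w H ks c2 s)" using Cond.IH(2)[of s] Cond.prems by auto
  show ?thesis using exec.CondFalse[of w s e H ks c2 t _ c1, OF _ 1(2)] False 1(1)
   by (intro exI[of _ "1 + acost e + t"]) simp
 qed
qed simp

definition runs :: "nat => (nat => 'k => bool) => 'k list => com => state => nat => (state => bool) => bool" where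
 "runs w H ks c s T Q \<longleftrightarrow> (\<exists>t s'. exec w H ks c s t s' & t \<le> T & Q s')"

lemma runs_den: "loop_free c ==> tb c \<le> T ==> Q (den w H ks c s) ==> runs w H ks c s T Q"
 using exec_den[of c w H ks s] unfolding runs_def by (meson order_trans)

lemma runs_mono: "runs w H ks c s T Q ==> T \<le> T' ==> (!!s. Q s ==> Q' s) ==> runs w H ks c s T' Q'"
 unfolding runs_def by (meson order_trans)

lemma runs_Seq:
 assumes "runs w H ks a s T1 R" "!!s'. R s' ==> runs w H ks b s' T2 Q" "T1 + T2 \<le> T"
 shows "runs w H ks (Seq a b) s T Q"
proof -
 obtain t1 s1 where 1: "exec w H ks a s t1 s1" "t1 \<le> T1" "R s1" using assms(1) by (auto simp: runs_def)
 obtain t2 s2 where 2: "exec w H ks b s1 t2 s2" "t2 \<le> T2" "Q s2" using assms(2)[OF 1(3)] by (auto simp: runs_def)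
 show ?thesis unfolding runs_def using exec.Seq[OF 1(1) 2(1)] 1(2) 2(2,3) assms(3)
  by (intro exI[of _ "t1 + t2"] exI[of _ s2]) simp
qed

lemma runs_Cond:
 assumes "aval w (fst s) e ~= 0 ==> runs w H ks a s T1 Q" "aval w (fst s) e = 0 ==> runs w H ks b s T1 Q"
  "1 + acost e + T1 \<le> T"
 shows "runs w H ks (Cond e a b) s T Q"
proof (cases "aval w (fst s) e = 0")
 case True
 then obtain t1 s1 where 1: "exec w H ks b s t1 s1" "t1 \<le> T1" "Q s1" using assms(2) by (auto simp: runs_def)
 show ?thesis unfolding runs_def using exec.CondFalse[OF True 1(1)] 1(2,3) assms(3)
  by (intro exI[of _ "1 + acost e + t1"] exI[of _ s1]) simp
next
 case False
 then obtain t1 s1 where 1: "exec w H ks a s t1 s1" "t1 \<le> T1" "Q s1" using assms(1) by (auto simp: runs_def)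
 show ?thesis unfolding runs_def using exec.CondTrue[OF False 1(1)] 1(2,3) assms(3)
  by (intro exI[of _ "1 + acost e + t1"] exI[of _ s1]) simp
qed

lemma runs_While_done: "aval w (fst s) b = 0 ==> 1 + acost b \<le> T ==> Q s ==> runs w H ks (While b c) s T Q"
 unfolding runs_def using exec.WhileFalse[of w s b H ks c] by blast

lemma runs_While_step:
 assumes "aval w (fst s) b ~= 0" "runs w H ks c s T1 R"
  "!!s'. R s' ==> runs w H ks (While b c) s' T2 Q" "1 + acost b + T1 + T2 \<le> T"
 shows "runs w H ks (While b c) s T Q"
proof -
 obtain t1 s1 where 1: "exec w H ks c s t1 s1" "t1 \<le> T1" "R s1" using assms(2) by (auto simp: runs_def)
 obtain t2 s2 where 2: "exec w H ks (While b c) s1 t2 s2" "t2 \<le> T2" "Q s2" using assms(3)[OF 1(3)] by (auto simp: runs_def)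
 show ?thesis unfolding runs_def using exec.WhileTrue[OF assms(1) 1(1) 2(1)] 1(2) 2(2,3) assms(4)
  by (intro exI[of _ "1 + acost b + t1 + t2"] exI[of _ s2]) simp
qed

lemma runs_for:
 assumes "I 0 s"
  and "!!i s. i < N ==> I i s ==> aval w (fst s) b ~= 0 & runs w H ks c s (T i) (I (Suc i))"
  and "!!s. I N s ==> aval w (fst s) b = 0"
  and "(\<Sum>i<N. T i + (1 + acost b)) + (1 + acost b) \<le> T'"
  and "!!s. I N s ==> Q s"
 shows "runs w H ks (While b c) s T' Q"
proof -
 have "runs w H ks (While b c) s ((\<Sum>i=k..<N. T i + (1 + acost b)) + (1 + acost b)) (I N)" if "k \<le> N" "I k s" for k s
  using that
 proof (induction "N - k" arbitrary: k s)
  case 0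
  thus ?case using assms(3) by (intro runs_While_done) auto
 next
  case (Suc n)
  hence k: "k < N" by simp
  have 1: "aval w (fst s) b ~= 0" "runs w H ks c s (T k) (I (Suc k))" using assms(2)[OF k Suc.prems(2)] by auto
  show ?case
  proof (rule runs_While_step[OF 1])
   show "runs w H ks (While b c) s' ((\<Sum>i=Suc k..<N. T i + (1 + acost b)) + (1 + acost b)) (I N)"
    if "I (Suc k) s'" for s' using Suc.hyps(1)[of "Suc k" s'] Suc.hyps(2) k that by simp
   show "1 + acost b + T k + ((\<Sum>i=Suc k..<N. T i + (1 + acost b)) + (1 + acost b))
    \<le> (\<Sum>i=k..<N. T i + (1 + acost b)) + (1 + acost b)"
    using k by (subst (2) sum.atLeast_Suc_lessThan) auto
  qed
 qed
 from this[of 0 s] assms(1,4,5) show ?thesis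
  by (auto simp: atLeast0LessThan intro: runs_mono)
qed

lemma exec_bounded:
 assumes "exec w H ks c s t s'" "\<forall>a. fst s a < 2 ^ w"
 shows "\<forall>a. fst s' a < 2 ^ w"
proof -
 have av: "aval w m e < 2 ^ w" if "\<forall>a. m a < 2 ^ w" for m e
  using that by (induction e) (auto simp: take_bit_nat_less_exp)
 show ?thesis using assms
  by (induction rule: exec.induct) (auto simp: av take_bit_nat_less_exp)
qed

text \<open>A terminating run has finitely many steps and evaluates finitely many hash values. This
  is what makes the result of the construction measurable.\<close>

lemma exec_finite_use:
 assumes "exec w H ks c s t s'"
 shows "\<exists>N. \<forall>H'. (\<forall>i<N. \<forall>x\<in>set ks. H' i x = H i x) --> exec w H' ks c s t s'"
 using assms
proof (induction rule: exec.induct)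
 case (Hash a b i m g)
 let ?N = "Suc (prod_encode (g, aval w m b))"
 show ?case
 proof (intro exI[of _ ?N] allI impI)
  fix H' assume *: "\<forall>i<?N. \<forall>x\<in>set ks. H' i x = H i x"
  have "hash_val H' ks g (aval w m b) (aval w m i) = hash_val H ks g (aval w m b) (aval w m i)"
   using * by (simp add: hash_val_def)
  thus "exec w H' ks (Hash a b i) (m, g) (1 + acost a + acost b + acost i)
    (m(aval w m a := take_bit w (hash_val H ks g (aval w m b) (aval w m i))), g)"
   using exec.Hash[of w H' ks a b i m g] by simp
 qed
next
 case (Seq c1 s1 t1 s2 c2 t2 s3)
 obtain N1 where N1: "\<forall>H'. (\<forall>i<N1. \<forall>x\<in>set ks. H' i x = H i x) --> exec w H' ks c1 s1 t1 s2" using Seq.IH(1) ..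
 obtain N2 where N2: "\<forall>H'. (\<forall>i<N2. \<forall>x\<in>set ks. H' i x = H i x) --> exec w H' ks c2 s2 t2 s3" using Seq.IH(2) ..
 show ?case
 proof (intro exI[of _ "max N1 N2"] allI impI)
  fix H' assume "\<forall>i<max N1 N2. \<forall>x\<in>set ks. H' i x = H i x"
  thus "exec w H' ks (Seq c1 c2) s1 (t1 + t2) s3" using N1 N2 by (intro exec.Seq[of _ _ _ _ _ _ s2]) simp_all
 qed
next
 case (WhileTrue s1 b c t1 s2 t2 s3)
 obtain N1 where N1: "\<forall>H'. (\<forall>i<N1. \<forall>x\<in>set ks. H' i x = H i x) --> exec w H' ks c s1 t1 s2" using WhileTrue.IH(1) ..
 obtain N2 where N2: "\<forall>H'. (\<forall>i<N2. \<forall>x\<in>set ks. H' i x = H i x) --> exec w H' ks (While b c) s2 t2 s3" using WhileTrue.IH(2) ..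
 show ?case
 proof (intro exI[of _ "max N1 N2"] allI impI)
  fix H' assume "\<forall>i<max N1 N2. \<forall>x\<in>set ks. H' i x = H i x"
  thus "exec w H' ks (While b c) s1 (1 + acost b + t1 + t2) s3"
   using N1 N2 WhileTrue.hyps(1) by (intro exec.WhileTrue[of _ _ _ _ _ _ _ s2]) simp_all
 qed
next
 case (CondTrue s b c1 t s' c2)
 obtain N1 where N1: "\<forall>H'. (\<forall>i<N1. \<forall>x\<in>set ks. H' i x = H i x) --> exec w H' ks c1 s t s'" using CondTrue.IH ..
 show ?case using N1 CondTrue.hyps(1) by (intro exI[of _ N1] allI impI exec.CondTrue) simp_all
next
 case (CondFalse s b c2 t s' c1)
 obtain N1 where N1: "\<forall>H'. (\<forall>i<N1. \<forall>x\<in>set ks. H' i x = H i x) --> exec w H' ks c2 s t s'" using CondFalse.IH ..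
 show ?case using N1 CondFalse.hyps(1) by (intro exI[of _ N1] allI impI exec.CondFalse) simp_all
next
 case (Skip s)
 show ?case by (intro exI[of _ 0] allI impI exec.Skip)
next
 case (Store a b m g)
 show ?case by (intro exI[of _ 0] allI impI exec.Store)
next
 case (Rehash m g)
 show ?case by (intro exI[of _ 0] allI impI exec.Rehash)
next
 case (WhileFalse s b c)
 thus ?case by (intro exI[of _ 0] allI impI exec.WhileFalse)
qed

text \<open>The event is a countable union, over a bound \<open>N\<close> and a finite pattern
  \<open>T\<close> of the values below \<open>N\<close> that forces \<open>P\<close>, of events that
  fix finitely many hash values.\<close>

lemma measurable_finite_use:
 fixes h :: "nat => 'k => 'w => bool"
 assumes h: "!!s x. h s x \<in> measurable M (count_space UNIV)" and K: "finite K"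
  and P: "!!H. P H ==> \<exists>N. \<forall>H'. (\<forall>i<N. \<forall>x\<in>K. H' i x = H i x) --> P H'"
 shows "{om \<in> space M. P (%s x. h s x om)} \<in> sets M"
proof -
 define good where "good N T \<longleftrightarrow> (\<forall>H'. (\<forall>i<N. \<forall>x\<in>K. H' i x \<longleftrightarrow> (i, x) \<in> T) --> P H')" for N :: nat and T
 have "{om \<in> space M. P (%s x. h s x om)} =
  (\<Union>N. \<Union>T\<in>{T \<in> Pow ({..<N} \<times> K). good N T}. {om \<in> space M. \<forall>z\<in>{..<N} \<times> K. h (fst z) (snd z) om \<longleftrightarrow> z \<in> T})"
  (is "?A = ?B")
 proof (intro set_eqI iffI)
  fix om assume "om \<in> ?A"
  hence om: "om \<in> space M" "P (%s x. h s x om)" by auto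
  obtain N where N: "\<forall>H'. (\<forall>i<N. \<forall>x\<in>K. H' i x = h i x om) --> P H'" using P[OF om(2)] by auto
  let ?T = "{z \<in> {..<N} \<times> K. h (fst z) (snd z) om}"
  have "good N ?T" using N unfolding good_def by auto
  thus "om \<in> ?B" using om(1) by (intro UN_I[of N] UN_I[of ?T]) auto
 next
  fix om assume "om \<in> ?B"
  thus "om \<in> ?A" unfolding good_def by fastforce
 qed
 also have "... \<in> sets M"
 proof -
  have 1: "{om \<in> space M. \<forall>z\<in>{..<N} \<times> K. h (fst z) (snd z) om \<longleftrightarrow> z \<in> T} \<in> sets M" for N T
  proof (rule sets.sets_Collect_finite_All)
   fix z assume "z \<in> {..<N} \<times> K"
   have "Measurable.pred M (h (fst z) (snd z))" using h by auto
   thus "{om \<in> space M. h (fst z) (snd z) om \<longleftrightarrow> z \<in> T} \<in> sets M" by measurable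
  qed (use K in simp)
  have "(\<Union>T\<in>{T \<in> Pow ({..<N} \<times> K). good N T}. {om \<in> space M. \<forall>z\<in>{..<N} \<times> K. h (fst z) (snd z) om \<longleftrightarrow> z \<in> T}) \<in> sets M" for N
   by (rule sets.finite_UN) (use K 1 in auto)
  thus ?thesis by (intro sets.countable_UN) auto
 qed
 finally show ?thesis .
qed

section \<open>Success probabilities and slack\<close>

text \<open>The probability that \<open>2 * t\<close> fair bits are balanced.\<close>

definition cb :: "nat => real" where
 "cb t = real ((2 * t) choose t) / 4 ^ t"

lemma cb_0 [simp]: "cb 0 = 1"
 by (simp add: cb_def)

lemma cb_Suc: "cb (Suc t) = cb t * (2 * real t + 1) / (2 * real t + 2)"
proof -
 have f: "real ((2 * t) choose t) = fact (2 * t) / (fact t * fact t)" for t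
  by (simp add: binomial_fact)
 have "fact (2 * Suc t) = (2 * real t + 2) * (2 * real t + 1) * fact (2 * t)"
  by (simp add: algebra_simps)
 moreover have "fact (Suc t) = (real t + 1) * fact t" by (simp add: algebra_simps)
 ultimately show ?thesis unfolding cb_def f by (simp add: divide_simps) (simp add: algebra_simps)
qed

lemma cb_pos: "0 < cb t"
 by (simp add: cb_def)

lemma cb_decr: "cb (Suc t) \<le> cb t"
 using cb_pos[of t] unfolding cb_Suc by (simp add: divide_simps)

lemma cb_le_half: "1 \<le> t ==> cb t \<le> 1 / 2"
proof (induction t rule: nat_induct_at_least)
 case base
 show ?case by (simp add: cb_def)
next
 case (Suc t)
 thus ?case using cb_decr[of t] by linarith
qed

text \<open>Equality holds at \<open>t = 1\<close>, and consecutive values have the ratio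
  \<open>(2t+1)^2 / (4t(t+1))\<close>, which is at least 1. This elementary monotonicity replaces
  Stirling's formula.\<close>

lemma cb_lower: "1 \<le> t ==> 1 \<le> 4 * real t * (cb t)\<^sup>2"
proof (induction t rule: nat_induct_at_least)
 case base
 show ?case by (simp add: cb_def power2_eq_square)
next
 case (Suc t)
 have t: "0 < real t" using Suc by simp
 have "4 * real t * (cb t)\<^sup>2 * 1 \<le> 4 * real t * (cb t)\<^sup>2 * ((2 * real t + 1)\<^sup>2 / (4 * real t * (real t + 1)))"
 proof (intro mult_left_mono)
  have "0 < 4 * real t * (real t + 1)" using t by simp
  thus "1 \<le> (2 * real t + 1)\<^sup>2 / (4 * real t * (real t + 1))"
   by (subst le_divide_eq_1_pos) (auto simp: power2_eq_square algebra_simps)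
 qed (use t in simp)
 also have "... = 4 * real (Suc t) * (cb (Suc t))\<^sup>2"
 proof -
  have "4 * real (Suc t) * (cb (Suc t))\<^sup>2 = 4 * (real t + 1) * (cb t)\<^sup>2 * (2 * real t + 1)\<^sup>2 / (2 * (real t + 1))\<^sup>2"
  proof -
   have "cb (Suc t) = cb t * (2 * real t + 1) / (2 * (real t + 1))" by (simp add: cb_Suc)
   thus ?thesis by (simp add: power_divide power_mult_distrib)
  qed
  also have "... = (cb t)\<^sup>2 * (2 * real t + 1)\<^sup>2 / (real t + 1)"
  proof -
   have "4 * (real t + 1) * z / (2 * (real t + 1))\<^sup>2 = z / (real t + 1)" for z :: real
    using t by (simp add: divide_simps power2_eq_square) (simp add: algebra_simps)
   from this[of "(cb t)\<^sup>2 * (2 * real t + 1)\<^sup>2"] show ?thesis by (simp only: mult.assoc)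
  qed
  finally show ?thesis using t by (simp add: divide_simps)
 qed
 finally show ?case using Suc by linarith
qed

definition pr :: "nat => real" where
 "pr k = cb (2 ^ (k - 1))"

lemma pr_pos: "0 < pr k" and pr_le: "pr k \<le> 1 / 2"
 unfolding pr_def using cb_pos cb_le_half[of "2 ^ (k - 1)"] by auto

lemma pr_inverse: 
 assumes "1 \<le> k"
 shows "1 / pr k \<le> 2 * 2 powr (real k / 2)"
proof -
 let ?t = "2 ^ (k - 1) :: nat"
 have "1 \<le> 4 * real ?t * (pr k)\<^sup>2" unfolding pr_def by (rule cb_lower) simp
 also have "4 * real ?t = 2 * 2 ^ k" using assms by (cases k) auto
 also have "2 * 2 ^ k \<le> (2 * 2 powr (real k / 2))\<^sup>2"
 proof -
  have "(2 powr (real k / 2))\<^sup>2 = (2::real) ^ k"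
   by (simp add: power2_eq_square flip: powr_add powr_realpow)
  thus ?thesis by (simp add: power_mult_distrib)
 qed
 finally have "1 \<le> (2 * 2 powr (real k / 2) * pr k)\<^sup>2"
  by (simp add: power_mult_distrib mult_right_mono)
 hence "1 \<le> 2 * 2 powr (real k / 2) * pr k"
  using pr_pos[of k] abs_le_square_iff[of 1 "2 * 2 powr (real k / 2) * pr k"] by simp
 thus ?thesis using pr_pos[of k] by (simp add: divide_simps mult.commute)
qed

text \<open>For \<open>m = 2 ^ d\<close>, the quotient at \<open>2 * m\<close> is the square of
  \<open>m ^ m / fact m\<close> times \<open>1 / pr (Suc d)\<close>, since
  \<open>1 / pr (Suc d)\<close> is \<open>4 ^ m * (fact m)^2 / fact (2 * m)\<close>. The right-hand
  side is the inverse of the probability that a random map on \<open>2 ^ d\<close> keys is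
  bijective: perfect splitting wastes no information.\<close>

lemma sum_log_pr: "(\<Sum>k=1..d. 2 ^ (d - k) * log 2 (1 / pr k)) = log 2 ((2 ^ d) ^ (2 ^ d) / fact (2 ^ d))"
proof (induction d)
 case (Suc d)
 let ?m = "2 ^ d :: nat"
 have "(\<Sum>k=1..Suc d. 2 ^ (Suc d - k) * log 2 (1 / pr k)) =
  2 * (\<Sum>k=1..d. 2 ^ (d - k) * log 2 (1 / pr k)) + log 2 (1 / pr (Suc d))"
  by (simp add: sum_distrib_left Suc_diff_le mult.assoc)
 also have "... = 2 * log 2 (real ?m ^ ?m / fact ?m) + log 2 (1 / pr (Suc d))"
  using Suc by simp
 also have "... = log 2 ((real ?m ^ ?m / fact ?m)\<^sup>2 * (1 / pr (Suc d)))"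
 proof -
  have a: "0 < real ?m ^ ?m / fact ?m" by simp
  have "log 2 ((real ?m ^ ?m / fact ?m)\<^sup>2 * (1 / pr (Suc d))) = log 2 ((real ?m ^ ?m / fact ?m)\<^sup>2) + log 2 (1 / pr (Suc d))"
   using a pr_pos[of "Suc d"] by (subst log_mult) (auto simp del: of_nat_power)
  also have "log 2 ((real ?m ^ ?m / fact ?m)\<^sup>2) = 2 * log 2 (real ?m ^ ?m / fact ?m)"
   using log_nat_power[OF less_imp_le[OF a], of 2 2] by (simp only: of_nat_numeral)
  finally show ?thesis by simp
 qed
 also have "1 / pr (Suc d) = 4 ^ ?m * (fact ?m)\<^sup>2 / fact (2 * ?m)"
  by (simp add: pr_def cb_def binomial_fact power2_eq_square)
 also have "(real ?m ^ ?m / fact ?m)\<^sup>2 * (4 ^ ?m * (fact ?m)\<^sup>2 / fact (2 * ?m)) = (2 ^ Suc d) ^ (2 ^ Suc d) / fact (2 ^ Suc d)"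
 proof -
  have "(real ?m ^ ?m)\<^sup>2 * 4 ^ ?m = (2 * real ?m) ^ (2 * ?m)"
  proof -
   have "(2 * real ?m) ^ (2 * ?m) = 2 ^ (2 * ?m) * real ?m ^ (?m * 2)"
    by (simp only: power_mult_distrib mult.commute[of 2 ?m])
   also have "... = 4 ^ ?m * (real ?m ^ ?m)\<^sup>2"
    by (simp only: power_mult power2_eq_square) simp
   finally show ?thesis by (simp only: mult.commute)
  qed
  thus ?thesis by (simp add: power_divide field_simps)
 qed
 finally show ?case .
qed (simp add: pr_def)

text \<open>The left-hand side is the term of index \<open>n\<close> in the exponential series at
  \<open>n\<close>.\<close>

lemma pow_le_exp_fact: "real n ^ n / fact n \<le> exp (real n)"
proof -
 have "(\<Sum>i\<in>{n}. real n ^ i /\<^sub>R fact i) \<le> (\<Sum>i. real n ^ i /\<^sub>R fact i)"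
  by (rule sum_le_suminf[OF summable_exp_generic]) auto
 thus ?thesis by (simp add: exp_def divide_inverse mult.commute)
qed

lemma sum_log_pr_le: "(\<Sum>k=1..d. 2 ^ (d - k) * log 2 (1 / pr k)) \<le> 2 ^ d * log 2 (exp 1)"
proof -
 have "log 2 ((2 ^ d) ^ (2 ^ d) / fact (2 ^ d)) \<le> log 2 (exp (real (2 ^ d)))"
  using pow_le_exp_fact[of "2 ^ d"] by (intro log_mono) auto
 also have "... = 2 ^ d * log 2 (exp 1)" by (simp add: log_def)
 finally show ?thesis unfolding sum_log_pr .
qed

section \<open>Logarithms in fixed-point arithmetic\<close>

definition renorm :: "nat => nat => nat => nat \<times> nat" where
 "renorm q X E = (if X < 2 ^ (q - 1) then (2 * X, E + 1) else (X, E))"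

text \<open>A pair \<open>(X, E)\<close> stands for \<open>X / 2^(q + E)\<close> with
  \<open>X\<close> between \<open>2^(q-1)\<close> and \<open>2^q\<close>. \<open>pfix\<close>
  follows the recursion of \<open>cb\<close>. \<open>lfix\<close> squares \<open>i\<close> times,
  after which the exponent is, up to one, \<open>2^i\<close> times the binary logarithm of the
  inverse.\<close>

fun pfix :: "nat => nat => nat \<times> nat" where
 "pfix q 0 = (2 ^ q, 0)"
| "pfix q (Suc t) = renorm q (fst (pfix q t) * (2 * t + 1) div (2 * t + 2)) (snd (pfix q t))"

fun lfix :: "nat => nat \<times> nat => nat => nat \<times> nat" where
 "lfix q s 0 = s"
| "lfix q s (Suc i) = renorm q (fst (lfix q s i) * fst (lfix q s i) div 2 ^ q) (2 * snd (lfix q s i))"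

text \<open>Truncation only lowers the value, so the error is one-sided. Each rounding costs at most
  one factor \<open>1 + 1 / 2^(q-2)\<close>, and \<open>N\<close> counts these factors.\<close>

definition approx :: "nat => nat => nat \<times> nat => real => bool" where
 "approx q N s p \<longleftrightarrow> 2 ^ (q - 1) \<le> fst s & fst s \<le> 2 ^ q &
  fst s / 2 ^ (q + snd s) \<le> p & p \<le> fst s / 2 ^ (q + snd s) * (1 + 1 / 2 ^ (q - 2)) ^ N"

text \<open>One step at most quarters the mantissa's upper range, so \<open>Y\<close> is still at
  least \<open>2^(q-2)\<close>. There a truncation by less than one unit has relative error at most
  \<open>1 / 2^(q-2)\<close>, and a single doubling restores the normal range.\<close>

lemma approx_renorm:
 assumes q: "2 \<le> q" and Y: "2 ^ (q - 2) \<le> Y" "Y \<le> 2 ^ q"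
  and X: "real X \<le> Y" "Y < real X + 1"
  and p: "Y / 2 ^ (q + E) \<le> p" "p \<le> Y / 2 ^ (q + E) * (1 + 1 / 2 ^ (q - 2)) ^ N"
 shows "approx q (Suc N) (renorm q X E) p"
proof -
 have X2: "2 ^ (q - 2) \<le> X"
 proof -
  have "(2::real) ^ (q - 2) < real X + 1" using X Y by linarith
  hence "real (2 ^ (q - 2)) < real (X + 1)" by simp
  thus ?thesis by (simp only: of_nat_less_iff)
 qed
 have X3: "X \<le> 2 ^ q"
 proof -
  have "real X \<le> real (2 ^ q)" unfolding of_nat_power of_nat_numeral using X Y by linarith
  thus ?thesis by (simp only: of_nat_le_iff)
 qed
 have q1: "(2::nat) ^ (q - 1) = 2 * 2 ^ (q - 2)" "(2::nat) ^ q = 2 * 2 ^ (q - 1)"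
 proof -
  obtain r where "q = r + 2" using q by (metis add.commute le_Suc_ex)
  thus "(2::nat) ^ (q - 1) = 2 * 2 ^ (q - 2)" "(2::nat) ^ q = 2 * 2 ^ (q - 1)" by simp_all
 qed
 have r: "real (2 ^ (q - 2)) \<le> real X" using X2 by (simp only: of_nat_le_iff)
 have YX: "Y \<le> real X * (1 + 1 / 2 ^ (q - 2))"
 proof -
  have "1 \<le> real X / 2 ^ (q - 2)" using r by (subst le_divide_eq_1_pos) (simp_all only: of_nat_power of_nat_numeral, simp)
  moreover have "real X * (1 + 1 / 2 ^ (q - 2)) = real X + real X / 2 ^ (q - 2)" by (simp add: distrib_left)
  ultimately show ?thesis using X by linarith
 qed
 have lo: "real X / 2 ^ (q + E) \<le> p"
  using X(1) p(1) by (meson divide_right_mono order_trans zero_le_numeral zero_le_power)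
 have hi: "p \<le> real X / 2 ^ (q + E) * (1 + 1 / 2 ^ (q - 2)) ^ Suc N"
 proof -
  have "p \<le> (real X * (1 + 1 / 2 ^ (q - 2))) / 2 ^ (q + E) * (1 + 1 / 2 ^ (q - 2)) ^ N"
   using p(2) YX by (meson divide_right_mono mult_right_mono order_trans zero_le_numeral zero_le_power
     add_nonneg_nonneg zero_le_one divide_nonneg_nonneg)
  thus ?thesis by (simp add: mult_ac)
 qed
 show ?thesis
 proof (cases "X < 2 ^ (q - 1)")
  case True
  thus ?thesis using X2 q1 lo hi unfolding approx_def renorm_def by (simp add: field_simps)
 next
  case False
  thus ?thesis using X3 lo hi unfolding approx_def renorm_def by simp
 qed
qed

lemma real_div_nat:
 assumes "0 < b"
 shows "real (a div b) \<le> real a / real b" "real a / real b < real (a div b) + 1"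
proof -
 have "\<lfloor>real a / real b\<rfloor> = int (a div b)" by (rule floor_divide_of_nat_eq)
 thus "real (a div b) \<le> real a / real b" "real a / real b < real (a div b) + 1" by linarith+
qed

lemma approx_pfix:
 assumes q: "2 \<le> q"
 shows "approx q t (pfix q t) (cb t)"
proof (induction t)
 case 0
 show ?case by (simp add: approx_def)
next
 case (Suc t)
 obtain X E where XE: "pfix q t = (X, E)" by fastforce
 have IH: "2 ^ (q - 1) \<le> X" "X \<le> 2 ^ q" "X / 2 ^ (q + E) \<le> cb t" "cb t \<le> X / 2 ^ (q + E) * (1 + 1 / 2 ^ (q - 2)) ^ t"
  using Suc by (auto simp: approx_def XE)
 let ?f = "(2 * real t + 1) / (2 * real t + 2)"
 let ?Y = "real X * ?f"
 have f: "1 / 2 \<le> ?f" "?f \<le> 1" by (auto simp: divide_simps)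
 have IHr: "(2::real) ^ (q - 1) \<le> real X" "real X \<le> 2 ^ q"
  using IH(1,2) by (metis of_nat_le_iff of_nat_numeral of_nat_power)+
 have "approx q (Suc t) (renorm q (X * (2 * t + 1) div (2 * t + 2)) E) (cb (Suc t))"
 proof (rule approx_renorm[OF q, of ?Y])
  have "(2::real) ^ (q - 2) = 2 ^ (q - 1) * (1 / 2)"
  proof -
   obtain r where "q = r + 2" using q by (metis add.commute le_Suc_ex)
   thus ?thesis by simp
  qed
  also have "... \<le> ?Y" using IHr f by (intro mult_mono) auto
  finally show "2 ^ (q - 2) \<le> ?Y" .
  show "?Y \<le> 2 ^ q" using mult_mono[OF IHr(2) f(2)] by simp
  have Y: "?Y = real (X * (2 * t + 1)) / real (2 * t + 2)" by (simp add: algebra_simps)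
  show "real (X * (2 * t + 1) div (2 * t + 2)) \<le> ?Y" unfolding Y by (rule real_div_nat) simp
  show "?Y < real (X * (2 * t + 1) div (2 * t + 2)) + 1" unfolding Y by (rule real_div_nat) simp
  have cb: "cb (Suc t) = cb t * ?f" by (simp add: cb_Suc)
  show "?Y / 2 ^ (q + E) \<le> cb (Suc t)" unfolding cb
   using mult_right_mono[OF IH(3), of ?f] by (simp add: mult_ac)
  show "cb (Suc t) \<le> ?Y / 2 ^ (q + E) * (1 + 1 / 2 ^ (q - 2)) ^ t" unfolding cb
   using mult_right_mono[OF IH(4), of ?f] by (simp add: mult_ac)
 qed
 thus ?case by (simp add: XE)
qed

text \<open>Squaring doubles the number of error factors and its rounding adds one more, so the
  number plus one doubles.\<close>

lemma approx_lfix: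
 assumes q: "2 \<le> q" and s: "approx q N s p" and p: "0 \<le> p"
 shows "\<exists>M. M + 1 = 2 ^ i * (N + 1) & approx q M (lfix q s i) (p ^ 2 ^ i)"
proof (induction i)
 case 0
 show ?case using s by auto
next
 case (Suc i)
 then obtain M where M: "M + 1 = 2 ^ i * (N + 1)" "approx q M (lfix q s i) (p ^ 2 ^ i)" by blast
 obtain X E where XE: "lfix q s i = (X, E)" by fastforce
 let ?r = "p ^ 2 ^ i"
 have IH: "2 ^ (q - 1) \<le> X" "X \<le> 2 ^ q" "X / 2 ^ (q + E) \<le> ?r" "?r \<le> X / 2 ^ (q + E) * (1 + 1 / 2 ^ (q - 2)) ^ M"
  using M(2) by (auto simp: approx_def XE)
 let ?Y = "real X * real X / 2 ^ q"
 have IHr: "(2::real) ^ (q - 1) \<le> real X" "real X \<le> 2 ^ q"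
  using IH(1,2) by (metis of_nat_le_iff of_nat_numeral of_nat_power)+
 have "approx q (Suc (2 * M)) (renorm q (X * X div 2 ^ q) (2 * E)) (?r * ?r)"
 proof (rule approx_renorm[OF q, of ?Y])
  have "(2::real) ^ (q - 2) = 2 ^ (q - 1) * 2 ^ (q - 1) / 2 ^ q"
  proof -
   obtain r where "q = r + 2" using q by (metis add.commute le_Suc_ex)
   thus ?thesis by (simp add: power_add)
  qed
  also have "... \<le> ?Y" using IHr by (intro divide_right_mono mult_mono) auto
  finally show "2 ^ (q - 2) \<le> ?Y" .
  have "?Y \<le> 2 ^ q * 2 ^ q / 2 ^ q" using IHr by (intro divide_right_mono mult_mono) auto
  thus "?Y \<le> 2 ^ q" by simp
  have Y: "?Y = real (X * X) / real (2 ^ q)" by simp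
  show "real (X * X div 2 ^ q) \<le> ?Y" unfolding Y by (rule real_div_nat) simp
  show "?Y < real (X * X div 2 ^ q) + 1" unfolding Y by (rule real_div_nat) simp
  have e: "(2::real) ^ (q + 2 * E) = 2 ^ (q + E) * 2 ^ (q + E) / 2 ^ q" by (simp add: mult_2 power_add)
  show "?Y / 2 ^ (q + 2 * E) \<le> ?r * ?r"
   using mult_mono[OF IH(3) IH(3)] p unfolding e by simp
  have "?r * ?r \<le> (X / 2 ^ (q + E) * (1 + 1 / 2 ^ (q - 2)) ^ M) * (X / 2 ^ (q + E) * (1 + 1 / 2 ^ (q - 2)) ^ M)"
   using IH(4) p by (intro mult_mono) auto
  also have "... = ?Y / 2 ^ (q + 2 * E) * (1 + 1 / 2 ^ (q - 2)) ^ (2 * M)"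
   unfolding e mult_2 power_add by (simp add: mult_ac)
  finally show "?r * ?r \<le> ?Y / 2 ^ (q + 2 * E) * (1 + 1 / 2 ^ (q - 2)) ^ (2 * M)" .
 qed
 moreover have "?r * ?r = p ^ 2 ^ Suc i" by (simp add: mult_2 flip: power_add)
 ultimately show ?case using M(1) by (intro exI[of _ "Suc (2 * M)"]) (simp add: XE)
qed

text \<open>All error factors together amount to at most \<open>exp (1 / 2) \<le> 2\<close>, and the
  mantissa varies by a factor of two, so the exponent alone determines the logarithm up to
  one.\<close>

lemma approx_log:
 assumes q: "2 \<le> q" and a: "approx q N s p" and N: "2 * N \<le> 2 ^ (q - 2)"
 shows "log 2 (1 / p) \<le> real (snd s) + 1" "real (snd s) \<le> log 2 (1 / p) + 1" "0 < p"
proof -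
 obtain X E where s: "s = (X, E)" by fastforce
 have A: "2 ^ (q - 1) \<le> X" "X \<le> 2 ^ q" "X / 2 ^ (q + E) \<le> p" "p \<le> X / 2 ^ (q + E) * (1 + 1 / 2 ^ (q - 2)) ^ N"
  using a by (auto simp: approx_def s)
 have Ar: "(2::real) ^ (q - 1) \<le> real X" "real X \<le> 2 ^ q"
  using A(1,2) by (metis of_nat_le_iff of_nat_numeral of_nat_power)+
 have "(1 + 1 / 2 ^ (q - 2)) ^ N \<le> (exp (1 / 2 ^ (q - 2)) :: real) ^ N"
  by (intro power_mono exp_ge_add_one_self) auto
 also have "... = exp (real N / 2 ^ (q - 2))" by (simp add: exp_of_nat_mult[symmetric])
 also have "... \<le> exp (1 / 2 :: real)"
 proof -
  have "real (2 * N) \<le> real (2 ^ (q - 2))" using N by (simp only: of_nat_le_iff)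
  thus ?thesis by (simp add: divide_simps)
 qed
 also have "... \<le> (2::real)" using exp_bound[of "1/2 :: real"] by (simp add: power2_eq_square)
 finally have 2: "(1 + 1 / 2 ^ (q - 2)) ^ N \<le> (2::real)" .
 have hq: "(2::real) ^ q = 2 * 2 ^ (q - 1)" using q by (simp flip: power_Suc)
 have lo: "1 / (2::real) ^ (E + 1) \<le> p"
 proof -
  have "1 / 2 ^ (E + 1) = (2::real) ^ (q - 1) / 2 ^ (q + E)" by (simp add: power_add hq)
  also have "... \<le> X / 2 ^ (q + E)" using Ar by (intro divide_right_mono) auto
  finally show ?thesis using A(3) by linarith
 qed
 show p0: "0 < p" using lo by (smt (verit) divide_pos_pos zero_less_power)
 have hi: "p \<le> 2 / 2 ^ E"
 proof -
  have "p \<le> 2 ^ q / 2 ^ (q + E) * 2"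
  proof -
   have "p \<le> X / 2 ^ (q + E) * 2"
    using A(4) mult_left_mono[OF 2, of "X / 2 ^ (q + E)"] by simp
   also have "... \<le> 2 ^ q / 2 ^ (q + E) * 2" using Ar by (intro mult_right_mono divide_right_mono) auto
   finally show ?thesis .
  qed
  thus ?thesis by (simp add: power_add)
 qed
 have "log 2 (1 / 2 ^ (E + 1)) \<le> log 2 p" using lo p0 by (intro log_mono) auto
 moreover have "log 2 p \<le> log 2 (2 / 2 ^ E)" using hi p0 by (intro log_mono) auto
 moreover have "log 2 (1 / 2 ^ (E + 1)) = - (real E + 1)" by (simp add: log_divide log_nat_power del: power_Suc)
 moreover have "log 2 (2 / 2 ^ E) = 1 - real E" by (simp add: log_divide log_nat_power)
 moreover have "log 2 (1 / p) = - log 2 p" using p0 by (simp add: log_divide)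
 ultimately show "log 2 (1 / p) \<le> real (snd s) + 1" "real (snd s) \<le> log 2 (1 / p) + 1" by (simp_all add: s)
qed

text \<open>After \<open>d + 2\<close> squarings the exponent is the logarithm of
  \<open>1 / pr k\<close> in units of \<open>2^-(d+2)\<close>, up to one unit. The roundings number
  at most \<open>2^(2d+3)\<close>, which the precision \<open>2 * d + 8\<close> tolerates.\<close>

definition EE :: "nat => nat => nat" where
 "EE d k = snd (lfix (2 * d + 8) (pfix (2 * d + 8) (2 ^ (k - 1))) (d + 2))"

definition xx :: "nat => nat => nat" where
 "xx y k = y - 3 * k div 4"

text \<open>Fresh bits per node, in units of \<open>2^-(d+2)\<close>. The added 1 makes the estimate
  of the logarithm an upper bound; the power of two is the slack \<open>2^(-xx y k)\<close> in these
  units.\<close>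

definition ee :: "nat => nat => nat => nat" where
 "ee d y k = EE d k + 1 + 2 ^ (d + 2 - xx y k)"

lemma approx_EE:
 assumes "1 \<le> k" "k \<le> d"
 shows "\<exists>N. 2 * N \<le> 2 ^ (2 * d + 6) &
  approx (2 * d + 8) N (lfix (2 * d + 8) (pfix (2 * d + 8) (2 ^ (k - 1))) (d + 2)) (pr k ^ 2 ^ (d + 2))"
proof -
 let ?q = "2 * d + 8"
 obtain N where N: "N + 1 = 2 ^ (d + 2) * (2 ^ (k - 1) + 1)"
  "approx ?q N (lfix ?q (pfix ?q (2 ^ (k - 1))) (d + 2)) (pr k ^ 2 ^ (d + 2))"
  using approx_lfix[OF _ approx_pfix, of ?q "2 ^ (k - 1)" "d + 2"] cb_pos[of "2 ^ (k - 1)"]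
  by (auto simp: pr_def less_imp_le)
 have "2 ^ (k - 1) \<le> (2::nat) ^ d" "1 \<le> (2::nat) ^ d" using assms by (auto intro: power_increasing)
 hence "2 ^ (k - 1) + 1 \<le> (2::nat) ^ d + 2 ^ d" by (rule add_mono)
 hence "N + 1 \<le> 2 ^ (d + 2) * (2 ^ d + 2 ^ d)" unfolding N(1) by (rule mult_le_mono2)
 hence "N \<le> 2 ^ (d + 2) * (2 ^ d + 2 ^ d)" by (rule order_trans[OF le_add1])
 also have "... = 2 ^ (2 * d + 3)" by (simp add: power_add power_even_eq power2_eq_square)
 finally have "2 * N \<le> 2 * 2 ^ (2 * d + 3)" by (rule mult_le_mono2)
 also have "... = 2 ^ (2 * d + 4)" by (simp add: power_add)
 also have "... \<le> (2::nat) ^ (2 * d + 6)" by (rule power_increasing) auto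
 finally have "2 * N \<le> 2 ^ (2 * d + 6)" .
 thus ?thesis using N(2) by (intro exI[of _ N] conjI)
qed

text \<open>As \<open>xx y k \<le> d\<close>, the slack is at least four units. This covers the two
  units by which \<open>EE d k + 1\<close> may exceed the logarithm, so the total excess is at most
  twice the slack; here the summand 2 in \<open>d + 2\<close> pays off.\<close>

lemma ee_bounds:
 assumes "1 \<le> k" "k \<le> d" "y \<le> d"
 shows "log 2 (1 / pr k) + 1 / 2 ^ xx y k \<le> ee d y k / 2 ^ (d + 2)"
  "ee d y k / 2 ^ (d + 2) \<le> log 2 (1 / pr k) + 2 / 2 ^ xx y k"
proof -
 let ?J = "(2::real) ^ (d + 2)"
 obtain N where N: "2 * N \<le> 2 ^ (2 * d + 6)"
  "approx (2 * d + 8) N (lfix (2 * d + 8) (pfix (2 * d + 8) (2 ^ (k - 1))) (d + 2)) (pr k ^ 2 ^ (d + 2))"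
  using approx_EE[OF assms(1,2)] by blast
 have L: "log 2 (1 / pr k ^ 2 ^ (d + 2)) = ?J * log 2 (1 / pr k)"
 proof -
  have "1 / pr k ^ 2 ^ (d + 2) = (1 / pr k) ^ 2 ^ (d + 2)" by (simp add: power_divide)
  thus ?thesis using pr_pos[of k] by (simp add: log_nat_power)
 qed
 have q2: "2 \<le> 2 * d + 8" "2 * N \<le> 2 ^ (2 * d + 8 - 2)" using N(1) by (simp_all add: add.commute)
 have 1: "?J * log 2 (1 / pr k) \<le> real (EE d k) + 1" "real (EE d k) \<le> ?J * log 2 (1 / pr k) + 1"
  using approx_log(1,2)[OF q2(1) N(2) q2(2)] unfolding L EE_def by (simp_all only:)
 have x: "xx y k \<le> d" using assms by (simp add: xx_def)
 have S: "(2::real) ^ (d + 2 - xx y k) = ?J / 2 ^ xx y k" 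
 proof -
  have "?J = 2 ^ (d + 2 - xx y k) * 2 ^ xx y k" using x by (subst power_add[symmetric]) simp
  thus ?thesis by (simp only: nonzero_mult_div_cancel_right power_not_zero zero_neq_numeral not_False_eq_True simp_thms)
 qed
 have "(4::real) = ?J / 2 ^ d" by (simp add: power_add)
 also have "... \<le> ?J / 2 ^ xx y k" using x by (intro divide_left_mono power_increasing) auto
 finally have 4: "4 \<le> ?J / 2 ^ xx y k" .
 have E: "real (ee d y k) = real (EE d k) + 1 + ?J / 2 ^ xx y k"
  by (simp only: ee_def S of_nat_add of_nat_1 of_nat_power of_nat_numeral)
 have "?J * (log 2 (1 / pr k) + 1 / 2 ^ xx y k) \<le> ee d y k" using 1 E by (simp add: algebra_simps)
 thus "log 2 (1 / pr k) + 1 / 2 ^ xx y k \<le> ee d y k / 2 ^ (d + 2)" by (simp add: pos_le_divide_eq mult.commute)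
 have "ee d y k \<le> ?J * (log 2 (1 / pr k) + 2 / 2 ^ xx y k)" using 1 E 4 by (simp add: algebra_simps)
 thus "ee d y k / 2 ^ (d + 2) \<le> log 2 (1 / pr k) + 2 / 2 ^ xx y k" by (simp add: pos_divide_le_eq mult.commute)
qed

definition clg :: "nat => nat" where
 "clg n = (LEAST r. n \<le> 2 ^ r)"

lemma clg_le: "n \<le> 2 ^ clg n"
 unfolding clg_def by (rule LeastI[of _ n]) (simp add: less_imp_le)

lemma clg_gt: "r < clg n ==> 2 ^ r < n"
 unfolding clg_def using not_less_Least[of r "%r. n \<le> 2 ^ r"] by simp

lemma clg_less: "1 \<le> n ==> 2 ^ clg n < 2 * n"
 using clg_gt[of "clg n - 1" n] by (cases "clg n") auto

text \<open>A segment has \<open>2 ^ kap\<close> nodes. Its first node stores a full window of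
  \<open>64 * (d + 1)\<close> bits; spread over \<open>2 ^ xx * (d + 1)\<close> nodes this costs
  each of them only a multiple of the slack. Yet the segment is short enough for the growth of the
  frontier, whose exponent is of order slack times length, to stay polynomial in the number of keys.
  A level with fewer nodes forms one segment.\<close>

definition kap :: "nat => nat => nat => nat" where
 "kap d y k = min (d - k) (xx y k + clg (d + 1))"

definition po :: "nat => nat => nat => nat => nat" where
 "po d y k r = r * ee d y k div 2 ^ (d + 2)"

text \<open>The cumulative positions \<open>po\<close> are rounded, not the single bit numbers, so
  rounding errors do not accumulate. The last node has no successor in the segment; its entry 0
  turns each survivor into its own only child.\<close>

definition bl :: "nat => nat => nat => nat list" where
 "bl d y k = map (%r. po d y k (Suc r) - po d y k r) [0..<2 ^ kap d y k - 1] @ [0]"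

lemma length_bl [simp]: "length (bl d y k) = 2 ^ kap d y k"
 by (simp add: bl_def)

lemma po_mono: "r \<le> r' ==> po d y k r \<le> po d y k r'"
 unfolding po_def by (intro div_le_mono mult_le_mono1)

text \<open>For \<open>B\<close> children with survival probability \<open>t\<close>, Bernoulli's
  inequality gives \<open>(1 - t)^B * (1 + B * t) \<le> (1 - t^2)^B \<le> 1\<close>, so some child
  survives with probability at least \<open>B * t / (1 + B * t)\<close>. Taking inverses makes the
  recursion of \<open>th\<close> affine.\<close>

lemma th_step:
 assumes p: "0 < p" "p \<le> 1"
 shows "1 / th p (b # bs) \<le> 1 / p + 1 / th p bs / (p * 2 ^ b)"
proof -
 let ?t = "th p bs" and ?B = "2 ^ b :: nat"
 have t: "0 < ?t" "?t \<le> 1" using th_pos_le[OF p] by auto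
 have "(1 - ?t) ^ ?B * (1 + real ?B * ?t) \<le> (1 - ?t) ^ ?B * (1 + ?t) ^ ?B"
  using t Bernoulli_inequality[of ?t ?B] by (intro mult_left_mono) auto
 also have "... = (1 - ?t\<^sup>2) ^ ?B" by (simp add: power2_eq_square algebra_simps flip: power_mult_distrib)
 also have "... \<le> 1" using t by (intro power_le_one) (auto simp: abs_square_le_1)
 finally have 1: "(1 - ?t) ^ ?B * (1 + real ?B * ?t) \<le> 1" .
 have pos: "0 < 1 + real ?B * ?t" using t by (simp add: add_pos_nonneg)
 have "real ?B * ?t / (1 + real ?B * ?t) \<le> 1 - (1 - ?t) ^ ?B"
  using 1 pos by (subst pos_divide_le_eq) (auto simp: algebra_simps)
 from mult_left_mono[OF this, of p] have X: "p * (real ?B * ?t / (1 + real ?B * ?t)) \<le> th p (b # bs)"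
  using p unfolding th.simps by simp
 have Y: "0 < p * (real ?B * ?t / (1 + real ?B * ?t))" using p t pos by simp
 have "1 / th p (b # bs) \<le> 1 / (p * (real ?B * ?t / (1 + real ?B * ?t)))"
  by (rule frac_le[OF _ _ Y X]) simp_all
 also have "... = 1 / p + 1 / ?t / (p * 2 ^ b)" using p t pos by (simp add: field_simps)
 finally show ?thesis .
qed

lemma half_le_ln2: "1 / 2 \<le> ln (2::real)"
proof -
 have "exp (1 / 2 :: real) \<le> 2" using exp_bound[of "1/2 :: real"] by (simp add: power2_eq_square)
 thus ?thesis by (subst ln_ge_iff) auto
qed

section \<open>Expected tests and growth of the frontier in one segment\<close>

locale seg_params =
 fixes d y k :: nat
 assumes k1: "1 \<le> k" and kd: "k \<le> d" and yd: "y \<le> d"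
begin

abbreviation "p \<equiv> pr k"
abbreviation "e \<equiv> real (ee d y k) / 2 ^ (d + 2)"
abbreviation "K \<equiv> 2 ^ kap d y k :: nat"
abbreviation "sg \<equiv> 1 / 2 ^ xx y k :: real"

definition fr :: "nat => real" where
 "fr r = real r * e - real (po d y k r)"

text \<open>The growth factor per node if bit numbers could be fractional. The slack makes it
  slightly supercritical, between \<open>2 powr sg\<close> and \<open>2 powr (2 * sg)\<close>;
  rounding perturbs it only by powers of two with exponents \<open>fr\<close>, which telescope by
  \<open>mu_eq\<close>.\<close>

definition MM :: real where
 "MM = p * 2 powr e"

lemma fr_bounds: "0 \<le> fr r" "fr r < 1"
 using real_div_nat[of "2 ^ (d + 2)" "r * ee d y k"] unfolding fr_def po_def by simp_all

lemma MM_bounds: "2 powr sg \<le> MM" "MM \<le> 2 powr (2 * sg)"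
proof -
 have p: "p = 2 powr (- log 2 (1 / p))" using pr_pos[of k] by (simp add: log_divide powr_minus)
 have "MM = 2 powr (e - log 2 (1 / p))"
 proof -
  have "MM = 2 powr (- log 2 (1 / p)) * 2 powr e"
   unfolding MM_def by (rule arg_cong[where f = "%z. z * 2 powr e", OF p])
  also have "... = 2 powr (- log 2 (1 / p) + e)" by (rule powr_add[symmetric])
  finally show ?thesis by simp
 qed
 moreover have "sg \<le> e - log 2 (1 / p)" "e - log 2 (1 / p) \<le> 2 * sg" using ee_bounds[OF k1 kd yd] by auto
 ultimately show "2 powr sg \<le> MM" "MM \<le> 2 powr (2 * sg)" by simp_all
qed

lemma MM_ge: "1 + sg / 2 \<le> MM"
proof -
 have "1 + sg / 2 \<le> 1 + sg * ln 2" using half_le_ln2 mult_left_mono[of "1/2" "ln 2" sg] by simp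
 also have "... \<le> exp (sg * ln 2)" by (rule exp_ge_add_one_self)
 also have "... = 2 powr sg" by (simp add: powr_def)
 finally show ?thesis using MM_bounds by linarith
qed

lemma MM_ge1: "1 \<le> MM"
proof -
 have "0 \<le> sg / 2" by simp
 thus ?thesis using MM_ge by linarith
qed

lemma mu_eq: "p * 2 ^ (po d y k (Suc r) - po d y k r) = MM * 2 powr (fr r - fr (Suc r))"
proof -
 have "real (po d y k (Suc r) - po d y k r) = e + (fr r - fr (Suc r))"
  using po_mono[of r "Suc r" d y k] unfolding fr_def by (simp add: algebra_simps of_nat_diff add_divide_distrib)
 thus ?thesis unfolding MM_def by (simp add: powr_add flip: powr_realpow)
qed

lemma drop_bl:
 assumes "s < K"
 shows "drop s (bl d y k) = (if Suc s = K then 0 else po d y k (Suc s) - po d y k s) # drop (Suc s) (bl d y k)"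
proof -
 have "drop s (bl d y k) = bl d y k ! s # drop (Suc s) (bl d y k)"
  using assms by (intro Cons_nth_drop_Suc[symmetric]) simp
 thus ?thesis using assms by (auto simp: bl_def nth_append)
qed

text \<open>Backward induction along the affine recursion of \<open>th_step\<close>. The factor
  \<open>2 powr (- fr s)\<close> absorbs the rounding, for it telescopes with \<open>mu_eq\<close>.
  The constant is \<open>6 = 2 * 3\<close>, from \<open>2 powr (- fr s) \<ge> 1 / 2\<close> and
  \<open>1 - 1 / MM \<ge> sg / 3\<close>.\<close>

lemma inv_th:
 assumes "s < K"
 shows "1 / th p (drop s (bl d y k)) \<le> 6 * 2 ^ xx y k / p * 2 powr (- fr s)"
 using assms
proof (induction "K - s" arbitrary: s)
 case (Suc n)
 have p: "0 < p" "p \<le> 1" using pr_pos[of k] pr_le[of k] by auto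
 have f: "1 / 2 \<le> 2 powr (- fr s)"
 proof -
  have "1 / 2 = (2::real) powr (-1)" by (simp add: powr_minus)
  also have "... \<le> 2 powr (- fr s)" using fr_bounds[of s] by (intro powr_mono) auto
  finally show ?thesis .
 qed
 show ?case
 proof (cases "Suc s = K")
  case True
  hence "drop s (bl d y k) = [0]" using drop_bl[OF Suc.prems] by simp
  hence "1 / th p (drop s (bl d y k)) = 1 / p" by simp
  also have "... \<le> 1 / p * (6 * 2 ^ xx y k * 2 powr (- fr s))"
  proof -
   have "1 \<le> 6 * 2 ^ xx y k * 2 powr (- fr s)"
    using f mult_mono[of 6 "6 * 2 ^ xx y k" "1 / 2" "2 powr (- fr s)"] by simp
   thus ?thesis using p mult_left_mono[of 1 "6 * 2 ^ xx y k * 2 powr (- fr s)" "1 / p"] by simp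
  qed
  finally show ?thesis by simp
 next
  case False
  let ?b = "po d y k (Suc s) - po d y k s"
  have "1 / th p (drop s (bl d y k)) \<le> 1 / p + 1 / th p (drop (Suc s) (bl d y k)) / (p * 2 ^ ?b)"
   using th_step[OF p, of ?b "drop (Suc s) (bl d y k)"] drop_bl[OF Suc.prems] False by (simp del: th.simps)
  also have "... \<le> 1 / p + (6 * 2 ^ xx y k / p * 2 powr (- fr (Suc s))) / (p * 2 ^ ?b)"
   using Suc.hyps(1)[of "Suc s"] Suc.hyps(2) Suc.prems False p
   by (intro add_left_mono divide_right_mono) auto
  also have "... = 1 / p + (6 * 2 ^ xx y k / p * 2 powr (- fr (Suc s))) / (MM * 2 powr (fr s - fr (Suc s)))"
   by (simp only: mu_eq)
  also have "... = 1 / p + 6 * 2 ^ xx y k / p * 2 powr (- fr s) / MM"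
   by (simp add: powr_diff powr_minus field_simps)
  also have "... \<le> 6 * 2 ^ xx y k / p * 2 powr (- fr s)"
  proof -
   have M0: "0 < MM" using MM_ge1 by linarith
   have s1: "sg \<le> 1" by simp
   have "1 / MM \<le> 1 / (1 + sg / 2)" using MM_ge M0 by (intro divide_left_mono) (auto intro!: mult_pos_pos add_pos_nonneg)
   \<comment> \<open>Multiplied out, the claim reads \<open>0 \<le> sg / 6 - sg * sg / 6\<close>,
     which holds as \<open>sg \<le> 1\<close>.\<close>
   also have "... \<le> 1 - sg / 3"
   proof -
    have "1 \<le> (1 - sg / 3) * (1 + sg / 2)"
    proof -
     have "sg * sg \<le> sg" using s1 by (metis mult_left_le zero_le_divide_1_iff zero_le_numeral zero_le_power)
     thus ?thesis by (simp add: algebra_simps)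
    qed
    thus ?thesis by (subst pos_divide_le_eq) (auto intro: add_pos_nonneg)
   qed
   finally have "sg / 3 \<le> 1 - 1 / MM" by simp
   hence "6 * 2 ^ xx y k * (1 / 2) * (sg / 3) \<le> 6 * 2 ^ xx y k * 2 powr (- fr s) * (1 - 1 / MM)"
    using f by (intro mult_mono) auto
   hence "1 \<le> 6 * 2 ^ xx y k * 2 powr (- fr s) * (1 - 1 / MM)" by simp
   hence "1 / p * 1 \<le> 1 / p * (6 * 2 ^ xx y k * 2 powr (- fr s) * (1 - 1 / MM))"
    using p by (intro mult_left_mono) auto
   thus ?thesis by (simp add: algebra_simps)
  qed
  finally show ?thesis .
 qed
qed simp

lemma inv_th_le:
 assumes "s < K"
 shows "1 / th p (drop s (bl d y k)) \<le> 6 * 2 ^ xx y k / p"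
proof -
 have "2 powr (- fr s) \<le> 2 powr 0" using fr_bounds[of s] by (intro powr_mono) auto
 hence "6 * 2 ^ xx y k / p * 2 powr (- fr s) \<le> 6 * 2 ^ xx y k / p * 1"
  using pr_pos[of k] by (intro mult_left_mono) auto
 thus ?thesis using inv_th[OF assms] by simp
qed

lemma tsum_eq: "tsum q bs = (\<Sum>s<length bs. 1 / th q (drop s bs))"
 by (induction bs) (simp_all add: sum.lessThan_Suc_shift del: th.simps sum.lessThan_Suc)

lemma tsum_bl: "tsum p (bl d y k) \<le> real K * (6 * 2 ^ xx y k / p)"
proof -
 have "tsum p (bl d y k) \<le> (\<Sum>s<K. 6 * 2 ^ xx y k / p)"
  unfolding tsum_eq length_bl by (intro sum_mono inv_th_le) auto
 thus ?thesis by simp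
qed

lemma sgK: "sg * real K \<le> 2 * (real d + 1)"
proof -
 have "kap d y k \<le> xx y k + clg (d + 1)" by (simp add: kap_def)
 hence "real K \<le> 2 ^ xx y k * 2 ^ clg (d + 1)" by (simp flip: power_add)
 hence "sg * real K \<le> 2 ^ clg (d + 1)" by (simp add: divide_simps mult.commute)
 also have "... \<le> real (2 * (d + 1))"
  using clg_less[of "d + 1"] by (metis le_add2 less_imp_le of_nat_le_iff of_nat_numeral of_nat_power)
 finally show ?thesis by simp
qed

lemma Gm_bl_aux:
 assumes "s < K"
 shows "Gm p t (drop s (bl d y k)) \<le> MM ^ t * 2 powr fr s"
 using assms
proof (induction t arbitrary: s)
 case 0
 show ?case using fr_bounds[of s] by (simp add: ge_one_powr_ge_zero)
next
 case (Suc t)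
 have p: "0 < p" "p \<le> 1" using pr_pos[of k] pr_le[of k] by auto
 have M1: "1 \<le> MM" by (rule MM_ge1)
 show ?case
 proof (cases "Suc s = K")
  case True
  have "Gm p (Suc t) (drop s (bl d y k)) \<le> 1"
   using drop_bl[OF Suc.prems] True p by (cases t) auto
  also have "... \<le> MM ^ Suc t * 2 powr fr s"
   using mult_mono[of 1 "MM ^ Suc t" 1 "2 powr fr s"] M1 fr_bounds[of s]
   by (simp add: ge_one_powr_ge_zero one_le_power del: power_Suc)
  finally show ?thesis .
 next
  case False
  have "Gm p (Suc t) (drop s (bl d y k)) = MM * 2 powr (fr s - fr (Suc s)) * Gm p t (drop (Suc s) (bl d y k))"
   using drop_bl[OF Suc.prems] False by (simp add: mu_eq)
  also have "... \<le> MM * 2 powr (fr s - fr (Suc s)) * (MM ^ t * 2 powr fr (Suc s))"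
   using Suc.IH[of "Suc s"] Suc.prems False M1 by (intro mult_left_mono) auto
  also have "... = MM ^ Suc t * 2 powr fr s" by (simp add: powr_diff)
  finally show ?thesis .
 qed
qed

text \<open>The growth over at most \<open>K\<close> nodes is at most \<open>MM ^ K\<close> up to
  one rounding factor 2, and \<open>MM ^ K \<le> 2 powr (2 * sg * K)\<close> with
  \<open>sg * K \<le> 2 * (d + 1)\<close> by the choice of the segment length. Beyond the end of the
  list \<open>Gm\<close> is 0.\<close>

lemma Gm_bl:
 assumes "s \<le> length (bl d y k)"
 shows "Gm p t (drop s (bl d y k)) \<le> 2 ^ (5 * (d + 1))"
proof -
 have M1: "1 \<le> MM" by (rule MM_ge1)
 have z: "Gm q t bs = 0" if "length bs < t" for q bs
  using that by (induction q t bs rule: Gm.induct) auto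
 show ?thesis
 proof (cases "s < K & t \<le> K")
  case True
  have "Gm p t (drop s (bl d y k)) \<le> MM ^ t * 2 powr fr s" using True by (intro Gm_bl_aux) auto
  also have "... \<le> MM ^ K * 2 powr 1"
   using True M1 fr_bounds[of s] by (intro mult_mono power_increasing powr_mono) auto
  also have "... \<le> (2 powr (2 * sg)) ^ K * 2 powr 1"
   using M1 MM_bounds by (intro mult_right_mono power_mono) auto
  also have "... = 2 powr (2 * (sg * real K) + 1)"
   by (simp add: powr_powr powr_add mult_ac flip: powr_realpow)
  also have "... \<le> 2 powr (real (5 * (d + 1)))" using sgK by (intro powr_mono) auto
  also have "... = 2 ^ (5 * (d + 1))" by (simp only: powr_realpow zero_less_numeral)
  finally show ?thesis .
 next
  case False
  have "Gm p t (drop s (bl d y k)) \<le> 1"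
  proof (cases t)
   case (Suc t')
   have "length (drop s (bl d y k)) < t" using False Suc by auto
   thus ?thesis using z by simp
  qed simp
  also have "(1::real) \<le> 2 ^ (5 * (d + 1))" by (rule one_le_power) simp
  finally show ?thesis .
 qed
qed

lemma bl_le:
 assumes "b \<in> set (bl d y k)"
 shows "b \<le> 4 * (d + 1)"
proof -
 have "po d y k (Suc r) - po d y k r \<le> 4 * (d + 1)" for r
 proof -
  have "real (po d y k (Suc r) - po d y k r) = e + (fr r - fr (Suc r))"
   using po_mono[of r "Suc r" d y k] unfolding fr_def by (simp add: algebra_simps of_nat_diff add_divide_distrib)
  also have "... \<le> e + 1" using fr_bounds[of r] fr_bounds[of "Suc r"] by simp
  also have "e \<le> log 2 (1 / p) + 2 * sg" using ee_bounds(2)[OF k1 kd yd] by simp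
  also have "log 2 (1 / p) \<le> log 2 (2 * 2 powr (real k / 2))"
   using pr_inverse[OF k1] pr_pos[of k] by (intro log_mono) auto
  also have "... = 1 + real k / 2" by (subst log_mult) auto
  also have "sg \<le> 1" by simp
  finally have "real (po d y k (Suc r) - po d y k r) \<le> real (4 * (d + 1))" using kd by simp
  thus ?thesis by (simp only: of_nat_le_iff)
 qed
 thus ?thesis using assms by (auto simp: bl_def)
qed

lemma th_bl_ge: "1 / th p (bl d y k) \<le> 2 ^ (6 * (d + 1))"
proof -
 have "0 < K" by simp
 have "1 / th p (bl d y k) \<le> 6 * 2 ^ xx y k / p" using inv_th_le[OF \<open>0 < K\<close>] by simp
 also have "... = 6 * 2 ^ xx y k * (1 / p)" by simp
 also have "... \<le> 8 * 2 ^ d * (2 * 2 powr (real k / 2))"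
  using pr_inverse[OF k1] pr_pos[of k] yd by (intro mult_mono power_increasing) (auto simp: xx_def)
 also have "... \<le> 8 * 2 ^ d * (2 * 2 powr (real d))"
  using kd by (intro mult_left_mono powr_mono) auto
 also have "... = 2 ^ (2 * d + 4)" by (simp add: powr_realpow power_add power_even_eq power2_eq_square)
 also have "... \<le> (2::real) ^ (6 * (d + 1))" by (intro power_increasing) auto
 finally show ?thesis .
qed

end

section \<open>Sums over the levels\<close>

lemma sum_powr_half: "(\<Sum>k=1..d. 2 powr (real k / 2)) \<le> 4 * 2 powr (real d / 2)"
proof (induction d)
 case (Suc d)
 have s: "2 powr (real (Suc d) / 2) = 2 powr (real d / 2) * sqrt 2"
  by (simp add: add_divide_distrib powr_add powr_half_sqrt)
 have q: "4 + sqrt 2 \<le> 4 * sqrt (2::real)"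
 proof -
  have "4 / 3 \<le> sqrt (2::real)" by (rule real_le_rsqrt) (simp add: power2_eq_square)
  thus ?thesis by simp
 qed
 have "(\<Sum>k=1..Suc d. 2 powr (real k / 2)) \<le> 2 powr (real d / 2) * (4 + sqrt 2)"
  using Suc s by (simp add: algebra_simps)
 also have "... \<le> 2 powr (real d / 2) * (4 * sqrt 2)" using q by (intro mult_left_mono) auto
 finally show ?case using s by simp
qed simp

lemma sum_powr_quarter: "(\<Sum>k=1..d. 2 powr (- real k / 4)) \<le> 6"
proof -
 let ?r = "2 powr (- 1 / 4) :: real"
 \<comment> \<open>The fourth power of 6/7 is just above 1/2, and 6 is the sum of the geometric
   series with first term and ratio 6/7.\<close>
 have r: "?r \<le> 6 / 7"
 proof (rule ccontr)
  assume "~ ?thesis"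
  hence "(6 / 7) ^ 4 < ?r ^ 4" by (intro power_strict_mono) auto
  also have "?r ^ 4 = 2 powr (- 1)" by (subst powr_realpow[symmetric]) (simp_all add: powr_powr)
  finally show False by (simp add: powr_minus power4_eq_xxxx)
 qed
 have "(\<Sum>k=1..d. 2 powr (- real k / 4)) \<le> 6 - 6 * 2 powr (- real d / 4)"
 proof (induction d)
  case (Suc d)
  have s: "2 powr (- real (Suc d) / 4) = 2 powr (- real d / 4) * ?r"
   by (simp add: diff_divide_distrib add.commute flip: powr_add)
  have "2 powr (- real d / 4) * ?r \<le> 2 powr (- real d / 4) * (6 / 7)" using r by (intro mult_left_mono) auto
  moreover have "(\<Sum>k=1..Suc d. 2 powr (- real k / 4)) = 2 powr (- real (Suc d) / 4) + (\<Sum>k=1..d. 2 powr (- real k / 4))"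
   by (rule sum.nat_ivl_Suc') simp
  ultimately show ?case using Suc.IH s by linarith
 qed simp
 moreover have "0 \<le> 2 powr (- real d / 4)" by simp
 ultimately show ?thesis by linarith
qed

lemma pow_xx_le: "2 ^ xx y k \<le> 1 + 2 * 2 ^ y * 2 powr (- 3 * real k / 4)"
proof (cases "3 * k div 4 \<le> y")
 case True
 have f: "3 * real k / 4 - 1 \<le> real (3 * k div 4)" using real_div_nat[of 4 "3 * k"] by simp
 have "2 ^ xx y k = 2 powr (real y - real (3 * k div 4))"
  using True by (simp add: xx_def of_nat_diff flip: powr_realpow)
 also have "... \<le> 2 powr (real y + 1 + (- 3 * real k / 4))" using f by (intro powr_mono) auto
 also have "... = 2 * 2 ^ y * 2 powr (- 3 * real k / 4)"
  by (simp only: powr_add powr_realpow zero_less_numeral) simp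
 finally show ?thesis by simp
next
 case False
 thus ?thesis by (simp add: xx_def)
qed

lemma inv_pow_xx_le: "1 / 2 ^ xx y k \<le> 2 powr (3 * real k / 4) / 2 ^ y"
proof -
 have "real y - 3 * real k / 4 \<le> real (xx y k)"
  using real_div_nat[of 4 "3 * k"] unfolding xx_def by (cases "3 * k div 4 \<le> y") (auto simp: of_nat_diff)
 hence "2 powr (- real (xx y k)) \<le> 2 powr (3 * real k / 4 - real y)" by (intro powr_mono) auto
 moreover have "2 powr (- real (xx y k)) = 1 / 2 ^ xx y k" by (simp add: powr_minus_divide powr_realpow)
 moreover have "2 powr (3 * real k / 4 - real y) = 2 powr (3 * real k / 4) / 2 ^ y"
  by (subst powr_diff) (simp add: powr_realpow)
 ultimately show ?thesis by simp
qed

text \<open>All levels read the same number \<open>2 ^ d\<close> of keys in one round of tests, so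
  level \<open>k\<close> costs \<open>2 ^ d\<close> times \<open>2 ^ xx y k / pr k\<close>. In
  \<open>2 ^ xx y k\<close> the summand 1 stems from the cut-off at 0 and leads to the sum of
  \<open>2^(k/2)\<close>, dominated by the root; the other summand leads to the bounded sum of
  \<open>2^(-k/4)\<close>.\<close>

lemma sum_time: "(\<Sum>k=1..d. 2 ^ (d - k) * (2 ^ k * (6 * 2 ^ xx y k / pr k)))
 \<le> 48 * 2 powr (3 * real d / 2) + 144 * (2 ^ d * 2 ^ y)"
proof -
 have "(\<Sum>k=1..d. 2 ^ (d - k) * (2 ^ k * (6 * 2 ^ xx y k / pr k))) \<le>
  (\<Sum>k=1..d. 12 * 2 ^ d * (2 powr (real k / 2) + 2 * 2 ^ y * 2 powr (- real k / 4)))"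
 proof (rule sum_mono)
  fix k assume k: "k \<in> {1..d}"
  have "2 ^ (d - k) * (2 ^ k * (6 * 2 ^ xx y k / pr k)) = 6 * 2 ^ d * (2 ^ xx y k * (1 / pr k))"
  proof -
   have "(2::real) ^ (d - k) * 2 ^ k = 2 ^ d" using k by (simp flip: power_add)
   thus ?thesis by (simp add: mult.assoc[symmetric])
  qed
  also have "... \<le> 6 * 2 ^ d * ((1 + 2 * 2 ^ y * 2 powr (- 3 * real k / 4)) * (2 * 2 powr (real k / 2)))"
   using k pr_inverse[of k] pr_pos[of k] pow_xx_le[of y k]
   by (intro mult_left_mono mult_mono) auto
  also have "... = 12 * 2 ^ d * (2 powr (real k / 2) + 2 * 2 ^ y * (2 powr (- 3 * real k / 4) * 2 powr (real k / 2)))"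
   by (simp add: algebra_simps)
  also have "2 powr (- 3 * real k / 4) * 2 powr (real k / 2) = 2 powr (- real k / 4)"
   by (simp flip: powr_add)
  finally show "2 ^ (d - k) * (2 ^ k * (6 * 2 ^ xx y k / pr k)) \<le>
   12 * 2 ^ d * (2 powr (real k / 2) + 2 * 2 ^ y * 2 powr (- real k / 4))" .
 qed
 also have "... = 12 * 2 ^ d * ((\<Sum>k=1..d. 2 powr (real k / 2)) + 2 * 2 ^ y * (\<Sum>k=1..d. 2 powr (- real k / 4)))"
  by (simp only: sum_distrib_left[symmetric] sum.distrib)
 also have "... \<le> 12 * 2 ^ d * (4 * 2 powr (real d / 2) + 2 * 2 ^ y * 6)"
  using sum_powr_half[of d] sum_powr_quarter[of d] by (intro mult_left_mono add_mono) auto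
 also have "... = 48 * (2 ^ d * 2 powr (real d / 2)) + 144 * (2 ^ d * 2 ^ y)" by (simp add: algebra_simps)
 also have "2 ^ d * 2 powr (real d / 2) = 2 powr (3 * real d / 2)"
  by (simp flip: powr_realpow powr_add)
 finally show ?thesis .
qed

lemma sum_space: "(\<Sum>k=1..d. 2 ^ (d - k) * (1 / 2 ^ xx y k)) \<le> 6 * (2 ^ d / 2 ^ y :: real)"
proof -
 have "(\<Sum>k=1..d. 2 ^ (d - k) * (1 / 2 ^ xx y k)) \<le> (\<Sum>k=1..d. 2 ^ d / 2 ^ y * 2 powr (- real k / 4))"
 proof (rule sum_mono)
  fix k assume k: "k \<in> {1..d}"
  have "2 ^ (d - k) * (1 / 2 ^ xx y k) \<le> 2 ^ (d - k) * (2 powr (3 * real k / 4) / 2 ^ y)"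
   using inv_pow_xx_le by (intro mult_left_mono) auto
  also have "... = 2 ^ d / 2 ^ y * (2 powr (- real k) * 2 powr (3 * real k / 4))"
  proof -
   have "(2::real) ^ (d - k) = 2 ^ d * 2 powr (- real k)"
    using k by (simp add: power_diff powr_minus_divide powr_realpow)
   thus ?thesis by simp
  qed
  also have "2 powr (- real k) * 2 powr (3 * real k / 4) = 2 powr (- real k / 4)"
   by (simp flip: powr_add)
  finally show "2 ^ (d - k) * (1 / 2 ^ xx y k) \<le> 2 ^ d / 2 ^ y * 2 powr (- real k / 4)" .
 qed
 also have "... = 2 ^ d / 2 ^ y * (\<Sum>k=1..d. 2 powr (- real k / 4))" by (simp add: sum_distrib_left)
 also have "... \<le> 2 ^ d / 2 ^ y * 6" using sum_powr_quarter by (intro mult_left_mono) auto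
 also have "... = 6 * (2 ^ d / 2 ^ y)" by (rule mult.commute)
 finally show ?thesis .
qed

text \<open>The window of the last node starts at the last position \<open>po\<close> and still has
  full width, so this length covers all windows of the segment. \<open>OFF\<close> lays the levels
  out one after the other, beginning with the lowest, \<open>k = 1\<close>.\<close>

definition SL :: "nat => nat => nat => nat" where
 "SL d y k = 64 * (d + 1) + po d y k (2 ^ kap d y k - 1)"

definition OFF :: "nat => nat => nat => nat" where
 "OFF d y k = (\<Sum>i=1..<k. 2 ^ (d - i) div 2 ^ kap d y i * SL d y i)"

text \<open>On a level that is a single segment the leading window costs \<open>64 * (d + 1)\<close>
  bits, over all levels the squared logarithm. Elsewhere \<open>clg (d + 1)\<close> in
  \<open>kap\<close> reduces it to 64 slacks per node. The fresh bits exceed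
  \<open>log 2 (1 / pr k)\<close> by at most two slacks per node, which makes
  \<open>66 = 64 + 2\<close>, and \<open>sum_space\<close> turns this into
  \<open>396 = 66 * 6\<close>.\<close>

lemma OFF_bound:
 assumes "y \<le> d"
 shows "real (OFF d y (Suc d)) \<le> 2 ^ d * log 2 (exp 1) + 64 * real d * (real d + 1) + 396 * (2 ^ d / 2 ^ y)"
proof -
 have "real (OFF d y (Suc d)) \<le> (\<Sum>k=1..d. 64 * (real d + 1) + 2 ^ (d - k) * log 2 (1 / pr k) + 66 * (2 ^ (d - k) * (1 / 2 ^ xx y k)))"
 proof -
  have "real (2 ^ (d - k) div 2 ^ kap d y k * SL d y k) \<le>
   64 * (real d + 1) + 2 ^ (d - k) * log 2 (1 / pr k) + 66 * (2 ^ (d - k) * (1 / 2 ^ xx y k))" if k: "k \<in> {1..d}" for k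
  proof -
   let ?K = "2 ^ kap d y k :: real" and ?n = "2 ^ (d - k) :: real"
   have "kap d y k \<le> d - k" by (simp add: kap_def)
   hence q: "real (2 ^ (d - k) div 2 ^ kap d y k) = ?n / ?K"
    by (simp add: le_imp_power_dvd real_of_nat_div)
   have 1: "?n / ?K * (64 * (real d + 1)) \<le> 64 * (real d + 1) + 64 * (?n * (1 / 2 ^ xx y k))"
   proof (cases "kap d y k = d - k")
    case False
    hence "kap d y k = xx y k + clg (d + 1)" by (auto simp: kap_def min_def split: if_splits)
    hence "?n / ?K * (64 * (real d + 1)) = 64 * (?n * (1 / 2 ^ xx y k)) * ((real d + 1) / 2 ^ clg (d + 1))"
     by (simp add: power_add)
    also have "... \<le> 64 * (?n * (1 / 2 ^ xx y k)) * 1"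
    proof (rule mult_left_mono)
     show "(real d + 1) / 2 ^ clg (d + 1) \<le> 1"
    proof -
     have "real (d + 1) \<le> real (2 ^ clg (d + 1))" using clg_le[of "d + 1"] by (simp only: of_nat_le_iff)
     hence "real d + 1 \<le> 2 ^ clg (d + 1)" by (simp only: of_nat_power of_nat_numeral of_nat_add of_nat_1)
     thus ?thesis by (subst divide_le_eq_1_pos) simp_all
    qed
    qed simp
    finally have "?n / ?K * (64 * (real d + 1)) \<le> 64 * (?n * (1 / 2 ^ xx y k)) * 1" .
    moreover have "0 \<le> 64 * (real d + 1)" by simp
    ultimately show ?thesis by linarith
   qed simp
   have 2: "?n / ?K * real (po d y k (2 ^ kap d y k - 1)) \<le> ?n * (real (ee d y k) / 2 ^ (d + 2))"
   proof -
    have "real (po d y k (2 ^ kap d y k - 1)) \<le> real ((2 ^ kap d y k - 1) * ee d y k) / real (2 ^ (d + 2))"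
     unfolding po_def by (rule real_div_nat) simp
    also have "... = real (2 ^ kap d y k - 1) * (real (ee d y k) / 2 ^ (d + 2))"
     by (simp only: of_nat_mult of_nat_power of_nat_numeral times_divide_eq_right)
    also have "... \<le> ?K * (real (ee d y k) / 2 ^ (d + 2))" by (intro mult_right_mono) auto
    finally have "?n / ?K * real (po d y k (2 ^ kap d y k - 1)) \<le> ?n / ?K * (?K * (real (ee d y k) / 2 ^ (d + 2)))"
     by (intro mult_left_mono) auto
    thus ?thesis by simp
   qed
   have 3: "?n * (real (ee d y k) / 2 ^ (d + 2)) \<le> ?n * (log 2 (1 / pr k) + 2 / 2 ^ xx y k)"
    using ee_bounds(2)[of k d y] k assms by (intro mult_left_mono) auto
   have "real (2 ^ (d - k) div 2 ^ kap d y k * SL d y k) = ?n / ?K * (64 * (real d + 1)) + ?n / ?K * real (po d y k (2 ^ kap d y k - 1))"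
    unfolding of_nat_mult q SL_def by (simp add: algebra_simps)
   thus ?thesis using 1 2 3 by (simp add: algebra_simps)
  qed
  thus ?thesis unfolding OFF_def of_nat_sum atLeastLessThanSuc_atLeastAtMost by (intro sum_mono)
 qed
 also have "... = 64 * real d * (real d + 1) + (\<Sum>k=1..d. 2 ^ (d - k) * log 2 (1 / pr k)) + 66 * (\<Sum>k=1..d. 2 ^ (d - k) * (1 / 2 ^ xx y k))"
  by (simp add: sum.distrib sum_distrib_left algebra_simps)
 also have "... \<le> 64 * real d * (real d + 1) + 2 ^ d * log 2 (exp 1) + 66 * (6 * (2 ^ d / 2 ^ y))"
  using sum_log_pr_le[of d] sum_space[of d y] by (intro add_mono mult_left_mono) auto
 finally show ?thesis by simp
qed

section \<open>Word sizes of the parameters\<close>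

lemma renorm_snd: "snd (renorm q X E) \<le> E + 1"
 by (simp add: renorm_def)

lemma pfix_snd: "snd (pfix q t) \<le> t"
proof (induction t)
 case (Suc t)
 thus ?case using renorm_snd[of q "fst (pfix q t) * (2 * t + 1) div (2 * t + 2)" "snd (pfix q t)"] by simp
qed simp

lemma lfix_snd: "snd (lfix q s i) + 1 \<le> 2 ^ i * (snd s + 1)"
proof (induction i)
 case (Suc i)
 have "snd (lfix q s (Suc i)) + 1 \<le> 2 * (snd (lfix q s i) + 1)"
  using renorm_snd[of q "fst (lfix q s i) * fst (lfix q s i) div 2 ^ q" "2 * snd (lfix q s i)"] by simp
 also have "... \<le> 2 * (2 ^ i * (snd s + 1))" using Suc by (rule mult_le_mono2)
 finally show ?case by simp
qed simp

lemma lfix_fst: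
 assumes "2 \<le> q"
 shows "fst (lfix q (pfix q t) i) \<le> 2 ^ q" "fst (pfix q t) \<le> 2 ^ q"
proof -
 have "0 \<le> cb t" using cb_pos[of t] by simp
 from approx_lfix[OF assms approx_pfix[OF assms] this, of i]
 show "fst (lfix q (pfix q t) i) \<le> 2 ^ q" by (auto simp: approx_def)
 show "fst (pfix q t) \<le> 2 ^ q" using approx_pfix[OF assms, of t] by (auto simp: approx_def)
qed

lemma D1_le_pow: "d + 1 \<le> 2 ^ (d + 1)" for d :: nat
 using less_exp[of "d + 1"] by simp

lemma pow_bound: "(a::nat) \<le> b * (d + 1) ==> (2::nat) ^ a \<le> 2 ^ (b * (d + 1))"
 by (rule power_increasing) auto

lemma mult_bound:
 assumes "x \<le> 2 ^ (a * (d + 1))" "z \<le> (2::nat) ^ (b * (d + 1))" "a + b \<le> c"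
 shows "x * z \<le> 2 ^ (c * (d + 1))"
proof -
 have "x * z \<le> 2 ^ (a * (d + 1)) * 2 ^ (b * (d + 1))" using assms by (intro mult_le_mono)
 also have "... = 2 ^ ((a + b) * (d + 1))" by (simp only: power_add[symmetric] add_mult_distrib)
 also have "... \<le> 2 ^ (c * (d + 1))" using assms(3) by (intro power_increasing mult_le_mono1) auto
 finally show ?thesis .
qed

lemma add_bound:
 assumes "x \<le> 2 ^ (a * (d + 1))" "z \<le> (2::nat) ^ (b * (d + 1))" "max a b + 1 \<le> c"
 shows "x + z \<le> 2 ^ (c * (d + 1))"
proof -
 have "x \<le> 2 ^ (max a b * (d + 1))" "z \<le> 2 ^ (max a b * (d + 1))"
  by (rule order_trans[OF assms(1)], rule power_increasing, rule mult_le_mono1, simp, simp,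
    rule order_trans[OF assms(2)], rule power_increasing, rule mult_le_mono1, simp_all)
 hence "x + z \<le> 2 * 2 ^ (max a b * (d + 1))" by linarith
 also have "... = 2 ^ (max a b * (d + 1) + 1)" by simp
 also have "... \<le> 2 ^ (c * (d + 1))"
 proof (rule power_increasing)
  have "(max a b + 1) * (d + 1) \<le> c * (d + 1)" using assms(3) by (rule mult_le_mono1)
  thus "max a b * (d + 1) + 1 \<le> c * (d + 1)" by (simp add: algebra_simps)
 qed simp
 finally show ?thesis .
qed

lemma const_bound: "(x::nat) \<le> 2 ^ a ==> x \<le> 2 ^ (a * (d + 1))"
 by (rule order_trans, assumption, rule power_increasing) auto

lemma ee_le:
 assumes "k \<le> d"
 shows "ee d y k \<le> 2 ^ (8 * (d + 1))" "EE d k \<le> 2 ^ (6 * (d + 1))"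
proof -
 let ?q = "2 * d + 8"
 have "EE d k \<le> 2 ^ (d + 2) * (2 ^ (k - 1) + 1)"
  using lfix_snd[of ?q "pfix ?q (2 ^ (k - 1))" "d + 2"] pfix_snd[of ?q "2 ^ (k - 1)"]
  unfolding EE_def by (meson add_le_mono1 add_leD1 mult_le_mono2 order_trans)
 also have "... \<le> 2 ^ (5 * (d + 1))"
  by (rule mult_bound[where a = 2 and b = 2], rule pow_bound, simp,
    rule add_bound[where a = 1 and b = 0], rule pow_bound) (use assms in auto)
 finally have E: "EE d k \<le> 2 ^ (5 * (d + 1))" .
 show "EE d k \<le> 2 ^ (6 * (d + 1))" by (rule order_trans[OF E]) (rule power_increasing, auto)
 show "ee d y k \<le> 2 ^ (8 * (d + 1))" unfolding ee_def
  by (rule add_bound[where a = 6 and b = 2], rule add_bound[where a = 5 and b = 0], rule E, simp, simp, rule pow_bound) auto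
qed

lemma po_le:
 assumes "k \<le> d" "r \<le> 2 ^ d"
 shows "po d y k r \<le> 2 ^ (9 * (d + 1))" "r * ee d y k \<le> 2 ^ (9 * (d + 1))"
proof -
 show 1: "r * ee d y k \<le> 2 ^ (9 * (d + 1))"
  by (rule mult_bound[where a = 1 and b = 8]) (use assms ee_le[OF assms(1)] in \<open>auto intro: order_trans\<close>)
 show "po d y k r \<le> 2 ^ (9 * (d + 1))" unfolding po_def using 1 by (meson div_le_dividend order_trans)
qed

lemma kap_le: "kap d y k \<le> d - k"
 by (simp add: kap_def)

lemma SL_le:
 assumes "k \<le> d"
 shows "SL d y k \<le> 2 ^ (10 * (d + 1))"
proof -
 have "2 ^ kap d y k - 1 \<le> (2::nat) ^ d"
  using power_increasing[of "kap d y k" d "2::nat"] kap_le[of d y k] by linarith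
 from po_le(1)[OF assms this] have 1: "po d y k (2 ^ kap d y k - 1) \<le> 2 ^ (9 * (d + 1))" .
 have 2: "64 * (d + 1) \<le> 2 ^ (7 * (d + 1))"
  by (rule mult_bound[where a = 6 and b = 1], rule const_bound) (use D1_le_pow[of d] in auto)
 show ?thesis unfolding SL_def by (rule add_bound[OF 2 1]) simp
qed

lemma OFF_le:
 assumes "k \<le> Suc d"
 shows "OFF d y k \<le> 2 ^ (12 * (d + 1))"
proof -
 have "OFF d y k \<le> (\<Sum>i=1..<k. 2 ^ (11 * (d + 1)))" unfolding OFF_def
 proof (rule sum_mono)
  fix i assume "i \<in> {1..<k}"
  hence i: "i \<le> d" using assms by auto
  show "2 ^ (d - i) div 2 ^ kap d y i * SL d y i \<le> 2 ^ (11 * (d + 1))"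
  proof (rule mult_bound[where a = 1 and b = 10])
   have "(2::nat) ^ (d - i) div 2 ^ kap d y i \<le> 2 ^ (d - i)" by (rule div_le_dividend)
   also have "... \<le> 2 ^ (1 * (d + 1))" by (rule pow_bound) simp
   finally show "(2::nat) ^ (d - i) div 2 ^ kap d y i \<le> 2 ^ (1 * (d + 1))" .
  qed (use SL_le[OF i] in auto)
 qed
 also have "... = (k - 1) * 2 ^ (11 * (d + 1))" by simp
 also have "... \<le> 2 ^ (12 * (d + 1))"
  by (rule mult_bound[where a = 1 and b = 11]) (use D1_le_pow[of d] assms in auto)
 finally show ?thesis .
qed

section \<open>Computing the parameters\<close>

abbreviation vr :: "nat => aexp" where "vr k \<equiv> Load (Const k)"
abbreviation asg :: "nat => aexp => com" where "asg k e \<equiv> Store (Const k) e"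
abbreviation plus :: "aexp => aexp => aexp" where "plus \<equiv> Op Add"
abbreviation minus :: "aexp => aexp => aexp" where "minus \<equiv> Op Sub"
abbreviation times :: "aexp => aexp => aexp" where "times \<equiv> Op Mul"
abbreviation pow2 :: "aexp => aexp" where "pow2 e \<equiv> Op Shl (Const 1) e"
abbreviation less :: "aexp => aexp => aexp" where "less \<equiv> Op Less"
abbreviation inc :: "nat => com" where "inc k \<equiv> asg k (plus (vr k) (Const 1))"
abbreviation arr :: "nat => aexp => aexp" where "arr k e \<equiv> plus (times (Const k) (vr 6)) e"

fun seqs :: "com list => com" where
 "seqs [] = Skip"
| "seqs [c] = c"
| "seqs (c # cs) = Seq c (seqs cs)"

definition clog_prog :: "nat => nat => com" where
 "clog_prog z x = Seq (asg z (Const 0)) (While (less (pow2 (vr z)) (vr x)) (inc z))"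

definition renorm_prog :: "nat => nat => com" where
 "renorm_prog x z = Cond (less (vr x) (pow2 (minus (vr 8) (Const 1))))
  (Seq (asg x (times (Const 2) (vr x))) (inc z)) Skip"

text \<open>Here \<open>q\<close> counts the nodes of a level from the left. The first node of a
  segment takes a whole window of fresh bits. This value, which no other node attains, also marks
  the place where backtracking ends.\<close>

definition shq :: "nat => nat => nat => nat => nat" where
 "shq d y k q = (let r = q mod 2 ^ kap d y k in
  if r = 0 then 64 * (d + 1) else po d y k r - po d y k (r - 1))"

text \<open>The amount that, added to a window, produces the next value of its fresh bits. At the
  start of a segment only the top \<open>8 * (d + 1)\<close> of the \<open>64 * (d + 1)\<close> bits
  are varied.\<close>

definition incq :: "nat => nat => nat => nat => nat" where
 "incq d y k q = (if q mod 2 ^ kap d y k = 0 then 2 ^ (56 * (d + 1)) else 2 ^ (64 * (d + 1) - shq d y k q))"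

definition posq :: "nat => nat => nat => nat => nat" where
 "posq d y k q = OFF d y k + q div 2 ^ kap d y k * SL d y k + po d y k (q mod 2 ^ kap d y k)"

locale ram =
 fixes d w :: nat and H :: "nat => 'k => bool" and ks :: "'k list"
 assumes w: "w = 256 * (d + 1)"
begin

lemma small: "k < 2 ^ 256 ==> take_bit w k = k" for k :: nat
proof -
 assume k: "k < 2 ^ 256"
 have "(2::nat) ^ 256 \<le> 2 ^ w" unfolding w by (rule power_increasing) auto
 thus "take_bit w k = k" using k by (intro take_bit_nat_eq_self) linarith
qed

lemma fits: "(x::nat) \<le> 2 ^ (255 * (d + 1)) ==> x < 2 ^ w"
proof -
 have "(2::nat) ^ (255 * (d + 1)) < 2 ^ w" unfolding w by (intro power_strict_increasing) auto
 thus "x \<le> 2 ^ (255 * (d + 1)) ==> x < 2 ^ w" by linarith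
qed

lemma fit: "(x::nat) \<le> 2 ^ (a * (d + 1)) ==> a \<le> 255 ==> take_bit w x = x"
 by (intro take_bit_nat_eq_self fits, erule order_trans) (intro power_increasing mult_le_mono1, auto)

lemma w_pos [simp]: "0 < w" "w ~= 0" "256 \<le> w"
 by (simp_all add: w)

text \<open>Sizes are measured in multiples of \<open>d + 1\<close> bits, so that the simplifier can
  discharge the truncation \<open>take_bit w\<close> after each operation by arithmetic on numerals:
  addition costs 1, multiplication doubles, and 255 units still fit into a word of 256.\<close>

definition ub :: "nat => nat => bool" where
 "ub a x \<longleftrightarrow> x \<le> 2 ^ (a * (d + 1))"

lemma ub_fit [simp]: "ub 255 x ==> take_bit w x = x"
 unfolding ub_def by (erule fit) (rule order_refl)

lemma ub_less: "ub 255 x ==> x < 2 ^ w"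
 unfolding ub_def by (rule fits)

lemma ub_mono: "ub a x ==> a \<le> b ==> ub b x"
 unfolding ub_def by (erule order_trans) (intro power_increasing mult_le_mono1, auto)

lemma ub_le: "ub a x ==> z \<le> x ==> ub a z"
 unfolding ub_def by (rule order_trans)

lemma ub_add [simp]: "1 \<le> a ==> ub (a - 1) x ==> ub (a - 1) z ==> ub a (x + z)"
 unfolding ub_def by (rule add_bound[where a = "a - 1" and b = "a - 1"], assumption, assumption, simp)

lemma ub_Suc [simp]: "1 \<le> a ==> ub (a - 1) x ==> ub a (Suc x)"
 using ub_add[of a x 1] by (simp add: ub_def)

lemma ub_mult [simp]: "ub (a div 2) x ==> ub (a div 2) z ==> ub a (x * z)"
 unfolding ub_def by (rule mult_bound[where a = "a div 2" and b = "a div 2"], assumption, assumption, simp)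

lemma ub_div [simp]: "ub a x ==> ub a (x div z)" and ub_mod [simp]: "ub a x ==> ub a (x mod z)"
 and ub_minus [simp]: "ub a x ==> ub a (x - z)"
 by (erule ub_le, simp)+

lemma ub_pow [simp]: "e \<le> a * (d + 1) ==> ub a (2 ^ e)"
 unfolding ub_def by (rule power_increasing) auto

lemma ub_num [simp]: "(numeral k :: nat) \<le> 2 ^ a ==> ub a (numeral k)" "ub a 0" "ub a 1" "ub a (Suc 0)"
 unfolding ub_def by (rule const_bound, assumption) auto

declare take_bit_of_exp [simp del] take_bit_of_2 [simp del]

lemma ub_of_bool [simp]: "ub a (of_bool b)"
 by (cases b) auto

lemma d_le: "d \<le> 2 ^ d" "d + 1 \<le> 2 ^ (d + 1)"
 using less_exp[of d] D1_le_pow[of d] by auto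

lemma ub_d [simp]: "1 \<le> a ==> ub a d"
 by (rule ub_mono[of 1]) (use d_le in \<open>simp_all add: ub_def\<close>)

lemma small_0_1 [simp]: "take_bit w (0::nat) = 0" "take_bit w (Suc 0) = Suc 0"
 by simp_all

lemmas ev = push_bit_eq_mult drop_bit_eq_div

lemma clog_runs:
 assumes zx: "z ~= x" "z < 64" "x < 64" and n: "n \<le> 2 ^ (2 * (d + 1))" "m x = n"
 shows "runs w H ks (clog_prog z x) (m, g) (20 * clg n + 20) (%s. s = (m(z := clg n), g))"
proof -
 have z: "take_bit w z = z" "take_bit w x = x" using zx by (auto intro!: small)
 have r: "clg n \<le> 2 * (d + 1)"
  using clg_gt[of "2 * (d + 1)" n] n by (cases "2 * (d + 1) < clg n") auto
 have p: "take_bit w ((2::nat) ^ i) = 2 ^ i" if "i \<le> clg n" for i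
  by (rule fit[where a = 2], rule pow_bound) (use that r in auto)
 have p': "take_bit w (Suc i) = Suc i" if "i < clg n" for i
 proof (rule fit[where a = 3])
  have "Suc i \<le> 2 ^ Suc i" using less_exp[of "Suc i"] by simp
  also have "... \<le> 2 ^ (3 * (d + 1))" using that r by (intro power_increasing) auto
  finally show "Suc i \<le> 2 ^ (3 * (d + 1))" .
 qed simp
 show ?thesis unfolding clog_prog_def
 proof (rule runs_Seq)
  show "runs w H ks (asg z (Const 0)) (m, g) 10 (%s. s = (m(z := 0), g))"
   by (rule runs_den) (simp_all add: z)
  fix s assume s: "s = (m(z := 0), g)"
  show "runs w H ks (While (less (pow2 (vr z)) (vr x)) (inc z)) s (20 * clg n + 10) (%s. s = (m(z := clg n), g))"
  proof (rule runs_for[where I = "%i s. s = (m(z := i), g)" and N = "clg n" and T = "%_. 10"])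
   show "s = (m(z := 0), g)" by (rule s)
  next
   fix i s assume i: "i < clg n" and s: "s = (m(z := i), g)"
   have "2 ^ i < n" using clg_gt[OF i] .
   moreover have "runs w H ks (inc z) s 10 (%s. s = (m(z := Suc i), g))"
    by (rule runs_den) (simp_all add: s z p'[OF i] del: take_bit_Suc)
   ultimately show "aval w (fst s) (less (pow2 (vr z)) (vr x)) ~= 0 & runs w H ks (inc z) s 10 (%s. s = (m(z := Suc i), g))"
    using zx n by (simp add: s z push_bit_eq_mult p[OF less_imp_le[OF i]])
  next
   fix s assume s: "s = (m(z := clg n), g)"
   show "aval w (fst s) (less (pow2 (vr z)) (vr x)) = 0"
    using zx n clg_le[of n] by (simp add: s z push_bit_eq_mult p)
   show "s = (m(z := clg n), g)" by (rule s)
  qed simp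
 qed simp
qed

lemma renorm_den:
 assumes "x ~= z" "x < 64" "z < 64" "x ~= 8" "z ~= 8" "m 8 = 2 * d + 8" "ub 20 (m x)" "ub 20 (m z)"
 shows "den w H ks (renorm_prog x z) (m, g) =
  (m(x := fst (renorm (2 * d + 8) (m x) (m z)), z := snd (renorm (2 * d + 8) (m x) (m z))), g)"
proof -
 have c: "take_bit w x = x" "take_bit w z = z" using assms by (auto intro!: small)
 have u: "ub a (m x)" "ub a (m z)" if "20 \<le> a" for a using assms that by (auto intro: ub_mono)
 have e: "(2 * d + 8) - 1 = 2 * d + 7" by simp
 show ?thesis using assms(1-6) 
  by (auto simp: renorm_prog_def renorm_def c ev u fun_eq_iff)
qed

text \<open>The spacing of the arrays in memory, larger than every index that occurs. Registers
  occupy the cells below 64, followed by four header cells per level. Arrays 1 to 5 hold constants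
  of the nodes (fresh bits, increment, address and size of the key list, bit position), array 6 the
  windows, and array \<open>8 + j\<close> the key lists of the nodes at depth
  \<open>j\<close>.\<close>

definition UU :: nat where
 "UU = 2 ^ (20 * (d + 1))"

lemma ub_UU [simp]: "20 \<le> a ==> ub a UU"
 unfolding UU_def by (rule ub_mono[OF ub_pow]) simp_all

lemma UU_ge: "2 ^ 20 \<le> UU"
 unfolding UU_def by (rule power_increasing) auto

lemma less_UU: "ub a x ==> a \<le> 19 ==> x < UU"
proof -
 assume "ub a x" "a \<le> 19"
 hence "x \<le> 2 ^ (19 * (d + 1))" using ub_mono[of a x 19] by (simp add: ub_def)
 also have "... < UU" unfolding UU_def by (rule power_strict_increasing) auto
 finally show "x < UU" .
qed

definition P0 :: "nat => memory => bool" where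
 "P0 y m \<longleftrightarrow> m 0 = 2 ^ d & m 2 = d & m 3 = y & m 4 = clg (d + 1) & m 5 = 64 * (d + 1) &
  m 6 = UU & m 7 = d + 2 & m 8 = 2 * d + 8 & m 44 = 256 * (d + 1)"

definition pl_body :: com where
 "pl_body = Seq (asg 17 (Op Div (times (vr 17) (plus (times (Const 2) (vr 16)) (Const 1))) (plus (times (Const 2) (vr 16)) (Const 2))))
   (Seq (renorm_prog 17 18) (inc 16))"

definition pl_prog :: com where
 "pl_prog = While (less (vr 16) (pow2 (minus (vr 15) (Const 1)))) pl_body"

text \<open>The recursion for \<open>cb\<close> is not restarted on each level: the loop continues
  from the index \<open>t0\<close> that the level below has reached.\<close>

lemma pl_runs:
 assumes P: "P0 y m" and k: "1 \<le> k" "k \<le> d" "m 15 = k" and t: "t0 \<le> 2 ^ (k - 1)" "m 16 = t0"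
  and X: "m 17 = fst (pfix (2 * d + 8) t0)" "m 18 = snd (pfix (2 * d + 8) t0)"
 shows "runs w H ks pl_prog (m, g) (60 * 2 ^ k + 60)
  (%s. s = (m(16 := 2 ^ (k - 1), 17 := fst (pfix (2 * d + 8) (2 ^ (k - 1))), 18 := snd (pfix (2 * d + 8) (2 ^ (k - 1)))), g))"
proof -
 let ?q = "2 * d + 8"
 let ?st = "%i. (m(16 := i, 17 := fst (pfix ?q i), 18 := snd (pfix ?q i)), g)"
 have kk: "(2::nat) ^ (k - 1) \<le> 2 ^ d" using k by (intro power_increasing) auto
 have uk: "ub a k" if "1 \<le> a" for a using ub_le[OF ub_d[OF that] k(2)] .
 have uk2: "ub a ((2::nat) ^ (k - Suc 0))" if "1 \<le> a" for a
  by (rule ub_mono[OF ub_pow that]) (use k in auto)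
 have P8: "m 8 = ?q" using P by (simp add: P0_def)
 show ?thesis unfolding pl_prog_def
 proof (rule runs_for[where I = "%i s. s = ?st (t0 + i)" and N = "2 ^ (k - 1) - t0" and T = "%_. 50"])
  show "(m, g) = ?st (t0 + 0)" using t X by (auto simp: fun_eq_iff)
 next
  fix i s assume i: "i < 2 ^ (k - 1) - t0" and s: "s = ?st (t0 + i)"
  define t where "t = t0 + i"
  have tl: "t < 2 ^ (k - 1)" using i by (simp add: t_def)
  have ut: "ub a t" if "1 \<le> a" for a using ub_le[OF uk2[OF that], of t] tl by simp
  let ?X = "fst (pfix ?q t)" and ?E = "snd (pfix ?q t)"
  have X: "?X \<le> 2 ^ ?q" by (rule lfix_fst) simp
  have uX: "ub a ?X" if "8 \<le> a" for a
   by (rule ub_le[OF _ X], rule ub_mono[OF ub_pow that]) simp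
  have E: "?E \<le> t" by (rule pfix_snd)
  have uE: "ub a ?E" if "1 \<le> a" for a by (rule ub_le[OF ut[OF that] E])
  have Y: "ub a (?X * Suc (2 * t) div Suc (Suc (2 * t)))" if "20 \<le> a" for a
   by (rule ub_mono[OF _ that]) (simp add: uX ut)
  let ?m1 = "m(16 := t, 17 := ?X * Suc (2 * t) div Suc (Suc (2 * t)), 18 := ?E)"
  have "runs w H ks pl_body s 50 (%s. s = ?st (Suc t))"
  proof (rule runs_den)
   have 1: "den w H ks (asg 17 (Op Div (times (vr 17) (plus (times (Const 2) (vr 16)) (Const 1))) (plus (times (Const 2) (vr 16)) (Const 2)))) s = (?m1, g)"
    by (simp add: s fun_eq_iff ut uX flip: t_def)
   have 2: "den w H ks (renorm_prog 17 18) (?m1, g) = (?m1(17 := fst (renorm ?q (?m1 17) (?m1 18)), 18 := snd (renorm ?q (?m1 17) (?m1 18))), g)"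
    by (rule renorm_den) (use P8 Y uE in \<open>auto simp del: mult_Suc_right\<close>)
   show "den w H ks pl_body s = ?st (Suc t)"
    unfolding pl_body_def den.simps(4) 1 2 by (auto simp: fun_eq_iff ut)
  qed (simp_all add: renorm_prog_def pl_body_def)
  moreover have "aval w (fst s) (less (vr 16) (pow2 (minus (vr 15) (Const 1)))) ~= 0"
   using k tl by (simp add: s ev uk uk2 flip: t_def)
  ultimately show "aval w (fst s) (less (vr 16) (pow2 (minus (vr 15) (Const 1)))) ~= 0 &
   runs w H ks pl_body s 50 (%s. s = ?st (t0 + Suc i))"
   by (simp add: t_def)
 next
  fix s assume s: "s = ?st (t0 + (2 ^ (k - 1) - t0))"
  show "aval w (fst s) (less (vr 16) (pow2 (minus (vr 15) (Const 1)))) = 0"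
   using t k by (simp add: s ev uk uk2)
  show "s = ?st (2 ^ (k - 1))" using s t by simp
 next
  have "(2::nat) ^ k = 2 * 2 ^ (k - 1)" using k by (cases k) auto
  thus "(\<Sum>i<2 ^ (k - 1) - t0. 50 + (1 + acost (less (vr 16) (pow2 (minus (vr 15) (Const 1)))))) +
   (1 + acost (less (vr 16) (pow2 (minus (vr 15) (Const 1))))) \<le> 60 * 2 ^ k + 60" by simp
 qed
qed

definition sl_body :: com where
 "sl_body = Seq (Seq (asg 19 (Op Shr (times (vr 19) (vr 19)) (vr 8))) (asg 20 (times (Const 2) (vr 20)))) (Seq (renorm_prog 19 20) (inc 21))"

definition sl_prog :: com where
 "sl_prog = Seq (seqs [asg 19 (vr 17), asg 20 (vr 18), asg 21 (Const 0)]) (While (less (vr 21) (vr 7)) sl_body)"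

lemma sl_runs:
 assumes P: "P0 y m" and k: "k \<le> d"
  and X: "m 17 = fst (pfix (2 * d + 8) (2 ^ (k - 1)))" "m 18 = snd (pfix (2 * d + 8) (2 ^ (k - 1)))"
 shows "runs w H ks sl_prog (m, g) (100 * (d + 3)) (%s. \<exists>u. s = (m(19 := u, 20 := EE d k, 21 := d + 2), g))"
proof -
 let ?q = "2 * d + 8"
 define F where "F = (%i. lfix ?q (pfix ?q (2 ^ (k - 1))) i)"
 let ?st = "%i. (m(19 := fst (F i), 20 := snd (F i), 21 := i), g)"
 have P8: "m 8 = ?q" "m 7 = d + 2" using P by (simp_all add: P0_def)
 have uk2: "ub a ((2::nat) ^ (k - Suc 0))" if "1 \<le> a" for a
  by (rule ub_mono[OF ub_pow that]) (use k in auto)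
 have FE: "ub a (snd (F i))" if "i \<le> d + 2" "10 \<le> a" for i a
 proof -
  have "snd (F i) + 1 \<le> 2 ^ i * (snd (pfix ?q (2 ^ (k - 1))) + 1)" unfolding F_def by (rule lfix_snd)
  moreover have "ub 4 (snd (pfix ?q (2 ^ (k - 1))))"
   by (rule ub_le[OF _ pfix_snd]) (simp add: uk2)
  hence "ub 10 (2 ^ i * (snd (pfix ?q (2 ^ (k - 1))) + 1))"
   using that(1) by (intro ub_mult ub_pow ub_add) simp_all
  ultimately have "ub 10 (snd (F i) + 1)" using ub_le by blast
  hence "ub 10 (snd (F i))" by (rule ub_le) simp
  thus ?thesis using that(2) by (rule ub_mono)
 qed
 have FX: "fst (F i) \<le> 2 ^ ?q" for i unfolding F_def by (rule lfix_fst) simp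
 have uX: "ub a (fst (F i))" if "8 \<le> a" for a i
  by (rule ub_le[OF _ FX], rule ub_mono[OF ub_pow that]) simp
 have L: "runs w H ks (While (less (vr 21) (vr 7)) sl_body) (?st 0) (100 * (d + 3) - 30) (%s. s = ?st (d + 2))"
 proof (rule runs_for[where I = "%i s. s = ?st i" and N = "d + 2" and T = "%_. 60"])
  fix i s assume i: "i < d + 2" and s: "s = ?st i"
  let ?X = "fst (F i)" and ?E = "snd (F i)"
  have ui: "ub a i" if "3 \<le> a" for a
   by (rule ub_mono[OF ub_le that, of "d + 2"]) (use i in simp_all)
  let ?m1 = "m(19 := ?X * ?X div 2 ^ ?q, 20 := 2 * ?E, 21 := i)"
  have "runs w H ks sl_body s 60 (%s. s = ?st (Suc i))"
  proof (rule runs_den)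
   have 1: "den w H ks (Seq (asg 19 (Op Shr (times (vr 19) (vr 19)) (vr 8))) (asg 20 (times (Const 2) (vr 20)))) s = (?m1, g)"
    using P8 i by (simp add: s fun_eq_iff ev uX FE)
   have 2: "den w H ks (renorm_prog 19 20) (?m1, g) = (?m1(19 := fst (renorm ?q (?m1 19) (?m1 20)), 20 := snd (renorm ?q (?m1 19) (?m1 20))), g)"
    by (rule renorm_den) (use P8 i in \<open>auto simp: uX FE\<close>)
   have FS: "F (Suc i) = renorm ?q (?X * ?X div 2 ^ ?q) (2 * ?E)" by (simp add: F_def)
   show "den w H ks sl_body s = ?st (Suc i)"
    unfolding sl_body_def den.simps(4)[of _ _ _ _ "Seq (renorm_prog 19 20) (inc 21)"] 1 den.simps(4)[of _ _ _ "renorm_prog 19 20"] 2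
    by (auto simp: FS fun_eq_iff ui)
  qed (simp_all add: renorm_prog_def sl_body_def)
  thus "aval w (fst s) (less (vr 21) (vr 7)) ~= 0 & runs w H ks sl_body s 60 (%s. s = ?st (Suc i))"
   using i P8 by (simp add: s)
 next
  fix s assume s: "s = ?st (d + 2)"
  show "aval w (fst s) (less (vr 21) (vr 7)) = 0" using P8 by (simp add: s)
 qed (simp_all)
 show ?thesis unfolding sl_prog_def
 proof (rule runs_Seq[where ?T1.0 = 20, OF runs_den])
  show "den w H ks (seqs [asg 19 (vr 17), asg 20 (vr 18), asg 21 (Const 0)]) (m, g) = ?st 0"
   using X by (simp add: F_def fun_eq_iff)
  fix s assume "s = ?st 0"
  thus "runs w H ks (While (less (vr 21) (vr 7)) sl_body) s (100 * (d + 3) - 30) (%s. \<exists>u. s = (m(19 := u, 20 := EE d k, 21 := d + 2), g))"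
   using L by (auto intro: runs_mono simp: EE_def F_def)
 qed simp_all
qed

definition prm_prog :: com where
 "prm_prog = seqs [asg 22 (minus (vr 2) (vr 15)), asg 23 (minus (vr 3) (Op Div (times (Const 3) (vr 15)) (Const 4))),
  asg 24 (plus (plus (vr 20) (Const 1)) (pow2 (minus (vr 7) (vr 23)))),
  asg 25 (plus (vr 23) (vr 4)), Cond (less (vr 22) (vr 25)) (asg 25 (vr 22)) Skip,
  asg 26 (plus (vr 5) (Op Shr (times (minus (pow2 (vr 25)) (Const 1)) (vr 24)) (vr 7))),
  asg 14 (plus (Const 64) (times (Const 4) (vr 22))),
  Store (vr 14) (vr 27), Store (plus (vr 14) (Const 1)) (vr 24), Store (plus (vr 14) (Const 2)) (vr 25),
  Store (plus (vr 14) (Const 3)) (vr 26)]"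

lemma prm_runs:
 assumes P: "P0 y m" and k: "1 \<le> k" "k \<le> d" "m 15 = k" "y \<le> d" and E: "m 20 = EE d k"
 defines "a \<equiv> 64 + 4 * (d - k)"
 shows "runs w H ks prm_prog (m, g) 200 (%s. \<exists>m'. s = (m', g) &
  m' 22 = d - k & m' 24 = ee d y k & m' 25 = kap d y k & m' 26 = SL d y k &
  m' a = m 27 & m' (a + 1) = ee d y k & m' (a + 2) = kap d y k & m' (a + 3) = SL d y k &
  (\<forall>b. b \<notin> {14, 22, 23, 24, 25, 26, a, a + 1, a + 2, a + 3} --> m' b = m b))"
proof -
 have P': "m 2 = d" "m 3 = y" "m 4 = clg (d + 1)" "m 5 = 64 * (d + 1)" "m 7 = d + 2" using P by (simp_all add: P0_def)
 have uk: "ub c k" "ub c y" if "1 \<le> c" for c using ub_le[OF ub_d[OF that]] k by auto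
 have uE: "ub c (EE d k)" if "6 \<le> c" for c
  by (rule ub_mono[OF _ that]) (use ee_le(2)[OF k(2)] in \<open>simp add: ub_def\<close>)
 have ue: "ub c (ee d y k)" if "8 \<le> c" for c
  by (rule ub_mono[OF _ that]) (use ee_le(1)[OF k(2)] in \<open>simp add: ub_def\<close>)
 have uz: "ub c (clg (Suc d))" if "6 \<le> c" for c
 proof (rule ub_mono[OF ub_le that])
  have "2 ^ clg (Suc d) < 2 * Suc d" by (rule clg_less) simp
  with less_exp[of "clg (Suc d)"] have "clg (Suc d) < 2 * Suc d" by (rule less_trans)
  thus "clg (Suc d) \<le> 2 * (d + 1)" by simp
 qed (simp)
 have x: "y - 3 * k div 4 = xx y k" by (simp add: xx_def)
 have kp: "kap d y k \<le> d" using kap_le[of d y k] by simp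
 have ukp: "ub c ((2::nat) ^ kap d y k)" if "1 \<le> c" for c
  by (rule ub_mono[OF ub_pow that]) (use kp in simp)
 have mn: "kap d y k = (if d - k < xx y k + clg (d + 1) then d - k else xx y k + clg (d + 1))"
  by (simp add: kap_def min_def)
 have px: "ub c ((2::nat) ^ (Suc (Suc d) - xx y k))" if "2 \<le> c" for c
  by (rule ub_mono[OF ub_pow that]) simp
 have ux: "ub c (xx y k)" if "1 \<le> c" for c using ub_le[OF uk(2)[OF that], of "xx y k"] by (simp add: xx_def)
 have s1: "den w H ks (seqs [asg 22 (minus (vr 2) (vr 15)), asg 23 (minus (vr 3) (Op Div (times (Const 3) (vr 15)) (Const 4))),
  asg 24 (plus (plus (vr 20) (Const 1)) (pow2 (minus (vr 7) (vr 23)))),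
  asg 25 (plus (vr 23) (vr 4)), Cond (less (vr 22) (vr 25)) (asg 25 (vr 22)) Skip]) (m, g) =
  (m(22 := d - k, 23 := xx y k, 24 := ee d y k, 25 := kap d y k), g)"
  using P' k(3) E by (simp add: x ev uk uE uz px ux mn ee_def fun_eq_iff)
 have s2: "den w H ks (seqs [asg 26 (plus (vr 5) (Op Shr (times (minus (pow2 (vr 25)) (Const 1)) (vr 24)) (vr 7))),
  asg 14 (plus (Const 64) (times (Const 4) (vr 22)))]) (m(22 := d - k, 23 := xx y k, 24 := ee d y k, 25 := kap d y k), g) =
  (m(22 := d - k, 23 := xx y k, 24 := ee d y k, 25 := kap d y k, 26 := SL d y k, 14 := a), g)"
  using P' by (simp add: ev ue ukp SL_def po_def a_def fun_eq_iff)
 have "den w H ks prm_prog (m, g) = (m(22 := d - k, 23 := xx y k, 24 := ee d y k, 25 := kap d y k, 26 := SL d y k, 14 := a,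
  a := m 27, a + 1 := ee d y k, a + 2 := kap d y k, a + 3 := SL d y k), g)"
 proof -
  have "64 \<le> a" "ub 30 a" by (simp_all add: a_def)
  have ua: "ub c a" if "30 \<le> c" for c using \<open>ub 30 a\<close> that by (rule ub_mono)
  have "den w H ks prm_prog (m, g) = den w H ks (seqs [Store (vr 14) (vr 27), Store (plus (vr 14) (Const 1)) (vr 24), Store (plus (vr 14) (Const 2)) (vr 25),
  Store (plus (vr 14) (Const 3)) (vr 26)]) (m(22 := d - k, 23 := xx y k, 24 := ee d y k, 25 := kap d y k, 26 := SL d y k, 14 := a), g)"
   unfolding prm_prog_def seqs.simps den.simps(4) using s1 s2 by (simp only: seqs.simps den.simps(4))
  also have "... = (m(22 := d - k, 23 := xx y k, 24 := ee d y k, 25 := kap d y k, 26 := SL d y k, 14 := a,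
  a := m 27, a + 1 := ee d y k, a + 2 := kap d y k, a + 3 := SL d y k), g)"
   using \<open>64 \<le> a\<close> by (simp add: ua)
  finally show ?thesis .
 qed
 note eq = this
 have a64: "64 \<le> a" by (simp add: a_def)
 show ?thesis
 proof (rule runs_den)
  show "loop_free prm_prog" "tb prm_prog \<le> 200" by (simp_all add: prm_prog_def)
 qed (unfold eq, use a64 in simp)
qed

definition q_body :: com where
 "q_body = seqs [asg 29 (plus (pow2 (vr 22)) (vr 28)), asg 30 (Op Mod (vr 28) (pow2 (vr 25))),
  asg 31 (Op Shr (times (vr 30) (vr 24)) (vr 7)),
  Store (arr 5 (vr 29)) (plus (plus (vr 27) (times (Op Shr (vr 28) (vr 25)) (vr 26))) (vr 31)),
  Cond (vr 30) (Seq (asg 32 (minus (vr 31) (Op Shr (times (minus (vr 30) (Const 1)) (vr 24)) (vr 7))))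
    (Store (arr 2 (vr 29)) (pow2 (minus (vr 5) (vr 32)))))
   (Seq (asg 32 (vr 5)) (Store (arr 2 (vr 29)) (pow2 (times (Const 56) (plus (vr 2) (Const 1)))))),
  Store (arr 1 (vr 29)) (vr 32),
  Store (arr 3 (vr 29)) (plus (times (plus (Const 8) (vr 22)) (vr 6)) (Op Shl (vr 28) (vr 15))),
  Store (arr 4 (vr 29)) (pow2 (vr 15)), inc 28]"

lemma q_iter:
 assumes P: "P0 y m" and k: "1 \<le> k" "k \<le> d" "y \<le> d"
  and m: "m 15 = k" "m 22 = d - k" "m 24 = ee d y k" "m 25 = kap d y k" "m 26 = SL d y k" "m 27 = OFF d y k" "m 28 = q"
  and q: "q < 2 ^ (d - k)"
 defines "v \<equiv> 2 ^ (d - k) + q"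
 shows "runs w H ks q_body (m, g) 200 (%s. \<exists>m'. s = (m', g) & m' 28 = Suc q &
  m' (UU + v) = shq d y k q & m' (2 * UU + v) = incq d y k q & m' (3 * UU + v) = (8 + (d - k)) * UU + q * 2 ^ k &
  m' (4 * UU + v) = 2 ^ k & m' (5 * UU + v) = posq d y k q &
  (\<forall>b. b \<notin> {28, 29, 30, 31, 32, UU + v, 2 * UU + v, 3 * UU + v, 4 * UU + v, 5 * UU + v} --> m' b = m b))"
proof -
 have P': "m 2 = d" "m 5 = 64 * (d + 1)" "m 6 = UU" "m 7 = d + 2" using P by (simp_all add: P0_def)
 have kp: "kap d y k \<le> d - k" by (rule kap_le)
 have u2: "ub c ((2::nat) ^ (d - k))" "ub c ((2::nat) ^ kap d y k)" "ub c ((2::nat) ^ k)" if "1 \<le> c" for c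
  using kp k by (auto intro!: ub_mono[OF ub_pow that])
 have uq: "ub c q" if "1 \<le> c" for c using ub_le[OF u2(1)[OF that]] q by simp
 have uv: "ub c v" if "2 \<le> c" for c unfolding v_def by (rule ub_mono[OF _ that]) (simp add: u2 uq)
 have uk: "ub c k" if "1 \<le> c" for c using ub_le[OF ub_d[OF that]] k by auto
 have ue: "ub c (ee d y k)" if "8 \<le> c" for c
  by (rule ub_mono[OF _ that]) (use ee_le(1)[OF k(2)] in \<open>simp add: ub_def\<close>)
 have uS: "ub c (SL d y k)" if "10 \<le> c" for c
  by (rule ub_mono[OF _ that]) (use SL_le[OF k(2)] in \<open>simp add: ub_def\<close>)
 have uO: "ub c (OFF d y k)" if "12 \<le> c" for c
  by (rule ub_mono[OF _ that]) (use OFF_le[of k d] k in \<open>simp add: ub_def\<close>)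
 have uP: "ub c (po d y k r)" if "9 \<le> c" "r \<le> q" for c r
 proof (rule ub_mono[OF _ that(1)])
  have "(2::nat) ^ (d - k) \<le> 2 ^ d" by (rule power_increasing) auto
  hence "r \<le> 2 ^ d" using that(2) q by linarith
  from po_le(1)[OF k(2) this] show "ub 9 (po d y k r)" by (simp add: ub_def)
 qed
 have vU: "v < UU" by (rule less_UU[OF uv]) auto
 let ?r = "q mod 2 ^ kap d y k"
 have r: "?r \<le> q" by simp
 note facts = P' m ev u2 uq uv uk ue uS uO
 have s1: "den w H ks (seqs [asg 29 (plus (pow2 (vr 22)) (vr 28)), asg 30 (Op Mod (vr 28) (pow2 (vr 25))),
  asg 31 (Op Shr (times (vr 30) (vr 24)) (vr 7))]) (m, g) = (m(29 := v, 30 := ?r, 31 := po d y k ?r), g)"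
  by (simp add: facts po_def flip: v_def)
 let ?m1 = "m(29 := v, 30 := ?r, 31 := po d y k ?r)"
 have s2: "den w H ks (Store (arr 5 (vr 29)) (plus (plus (vr 27) (times (Op Shr (vr 28) (vr 25)) (vr 26))) (vr 31))) (?m1, g) =
  (?m1(5 * UU + v := posq d y k q), g)"
  using uP[OF _ r] by (simp add: facts posq_def)
 let ?m2 = "?m1(5 * UU + v := posq d y k q)"
 have UU: "64 < UU" using UU_ge by simp
 have s3: "den w H ks (Cond (vr 30) (Seq (asg 32 (minus (vr 31) (Op Shr (times (minus (vr 30) (Const 1)) (vr 24)) (vr 7))))
    (Store (arr 2 (vr 29)) (pow2 (minus (vr 5) (vr 32)))))
   (Seq (asg 32 (vr 5)) (Store (arr 2 (vr 29)) (pow2 (times (Const 56) (plus (vr 2) (Const 1))))))) (?m2, g) =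
  (?m2(32 := shq d y k q, 2 * UU + v := incq d y k q), g)"
 proof (cases "?r = 0")
  case True
  thus ?thesis using UU by (simp add: facts shq_def incq_def)
 next
  case False
  have "ub c (po d y k ?r - po d y k (?r - Suc 0))" if "9 \<le> c" for c
   using uP[OF that r] by (rule ub_minus)
  hence us: "ub c (shq d y k q)" if "9 \<le> c" for c using that False by (simp add: shq_def Let_def)
  have e: "po d y k ?r - (?r - Suc 0) * ee d y k div 2 ^ Suc (Suc d) = shq d y k q"
   using False by (simp add: shq_def Let_def po_def)
  have p2: "ub c ((2::nat) ^ (64 + 64 * d - shq d y k q))" if "64 \<le> c" for c
   by (rule ub_mono[OF ub_pow that]) simp
  show ?thesis using UU False uP[OF _ r]
   by (simp add: facts incq_def e[simplified] us p2)
 qed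
 let ?m3 = "?m2(32 := shq d y k q, 2 * UU + v := incq d y k q)"
 have s4: "den w H ks (seqs [Store (arr 1 (vr 29)) (vr 32),
  Store (arr 3 (vr 29)) (plus (times (plus (Const 8) (vr 22)) (vr 6)) (Op Shl (vr 28) (vr 15))),
  Store (arr 4 (vr 29)) (pow2 (vr 15)), inc 28]) (?m3, g) =
  (?m3(UU + v := shq d y k q, 3 * UU + v := (8 + (d - k)) * UU + q * 2 ^ k, 4 * UU + v := 2 ^ k, 28 := Suc q), g)"
  using UU by (simp add: facts)
 have "den w H ks q_body (m, g) = (?m3(UU + v := shq d y k q, 3 * UU + v := (8 + (d - k)) * UU + q * 2 ^ k, 4 * UU + v := 2 ^ k, 28 := Suc q), g)"
  unfolding q_body_def seqs.simps den.simps(4)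
  using s1 s2 s3 s4 by (simp only: seqs.simps den.simps(4))
 note eq = this
 show ?thesis
 proof (rule runs_den)
  show "loop_free q_body" "tb q_body \<le> 200" by (simp_all add: q_body_def)
 qed (unfold eq, use UU vU in simp)
qed

definition ql_prog :: com where
 "ql_prog = Seq (asg 28 (Const 0)) (While (less (vr 28) (pow2 (vr 22))) q_body)"

definition node_ok :: "nat => nat => nat => memory => bool" where
 "node_ok y k q m \<longleftrightarrow> (let v = 2 ^ (d - k) + q in
  m (UU + v) = shq d y k q & m (2 * UU + v) = incq d y k q & m (3 * UU + v) = (8 + (d - k)) * UU + q * 2 ^ k &
  m (4 * UU + v) = 2 ^ k & m (5 * UU + v) = posq d y k q)"

definition nodecells :: "nat => nat => nat set" where
 "nodecells k q = (%c. c * UU + (2 ^ (d - k) + q)) ` {1..5}"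

lemma nodecells_iff: "b \<in> nodecells k q \<longleftrightarrow> (let v = 2 ^ (d - k) + q in b = UU + v \<or> b = 2 * UU + v \<or> b = 3 * UU + v \<or> b = 4 * UU + v \<or> b = 5 * UU + v)"
proof -
 have "{1..5} = {1, 2, 3, 4, 5::nat}" by auto
 thus ?thesis by (simp add: nodecells_def Let_def)
qed

lemma P0_cong: "(!!b. b \<in> {0, 2, 3, 4, 5, 6, 7, 8, 44} ==> m' b = m b) ==> P0 y m' = P0 y m"
 by (simp add: P0_def)

lemma node_bound: "k \<le> d ==> q < 2 ^ (d - k) ==> 2 ^ (d - k) + q < UU"
proof -
 assume k: "k \<le> d" and q: "q < 2 ^ (d - k)"
 have "(2::nat) ^ (d - k) + q \<le> 2 ^ (d - k) + 2 ^ (d - k)" using q by simp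
 moreover have "ub 3 ((2::nat) ^ (d - k) + 2 ^ (d - k))" by simp
 ultimately have "ub 3 (2 ^ (d - k) + q)" by (rule ub_le[rotated])
 thus ?thesis by (rule less_UU) simp
qed

lemma ql_runs:
 assumes P: "P0 y m" and k: "1 \<le> k" "k \<le> d" "y \<le> d"
  and m: "m 15 = k" "m 22 = d - k" "m 24 = ee d y k" "m 25 = kap d y k" "m 26 = SL d y k" "m 27 = OFF d y k"
 shows "runs w H ks ql_prog (m, g) (220 * 2 ^ (d - k) + 50) (%s. \<exists>m'. s = (m', g) &
  (\<forall>q<2 ^ (d - k). node_ok y k q m') &
  (\<forall>b. b \<notin> {28, 29, 30, 31, 32} --> (\<forall>q<2 ^ (d - k). b \<notin> nodecells k q) --> m' b = m b))"
proof -
 let ?I = "%i s. \<exists>m'. s = (m', g) & m' 28 = i & (\<forall>q<i. node_ok y k q m') &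
  (\<forall>b. b \<notin> {28, 29, 30, 31, 32} --> (\<forall>q<i. b \<notin> nodecells k q) --> m' b = m b)"
 have UU: "64 < UU" using UU_ge by simp
 have nc: "b \<notin> nodecells k q" if "b < UU" for b q using that by (auto simp: nodecells_iff Let_def)
 have u2: "ub c ((2::nat) ^ (d - k))" if "1 \<le> c" for c by (auto intro!: ub_mono[OF ub_pow that])
 show ?thesis unfolding ql_prog_def
 proof (rule runs_Seq[where ?T1.0 = 10, OF runs_den])
  show "?I 0 (den w H ks (asg 28 (Const 0)) (m, g))" by simp
  fix s assume I0: "?I 0 s"
  show "runs w H ks (While (less (vr 28) (pow2 (vr 22))) q_body) s (220 * 2 ^ (d - k) + 40) (%s. \<exists>m'. s = (m', g) &
  (\<forall>q<2 ^ (d - k). node_ok y k q m') &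
  (\<forall>b. b \<notin> {28, 29, 30, 31, 32} --> (\<forall>q<2 ^ (d - k). b \<notin> nodecells k q) --> m' b = m b))"
  proof (rule runs_for[where I = ?I and N = "2 ^ (d - k)" and T = "%_. 200"])
   show "?I 0 s" by (rule I0)
  next
   fix i s assume i: "i < 2 ^ (d - k)" and "?I i s"
   then obtain m' where s: "s = (m', g)" and m': "m' 28 = i" "\<forall>q<i. node_ok y k q m'"
    and fr: "!!b. b \<notin> {28, 29, 30, 31, 32} ==> (\<forall>q<i. b \<notin> nodecells k q) ==> m' b = m b" by blast
   have fr': "m' b = m b" if "b < 64" "b \<notin> {28, 29, 30, 31, 32}" for b
    using that UU by (intro fr) (auto intro!: nc)
   have P': "P0 y m'" using P by (subst P0_cong[of m' m]) (auto intro: fr')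
   have "runs w H ks q_body (m', g) 200 (?I (Suc i))"
   proof (rule runs_mono[OF q_iter[OF P' k _ _ _ _ _ _ m'(1) i]])
    fix s assume "\<exists>m''. s = (m'', g) & m'' 28 = Suc i &
     m'' (UU + (2 ^ (d - k) + i)) = shq d y k i & m'' (2 * UU + (2 ^ (d - k) + i)) = incq d y k i & m'' (3 * UU + (2 ^ (d - k) + i)) = (8 + (d - k)) * UU + i * 2 ^ k &
     m'' (4 * UU + (2 ^ (d - k) + i)) = 2 ^ k & m'' (5 * UU + (2 ^ (d - k) + i)) = posq d y k i &
     (\<forall>b. b \<notin> {28, 29, 30, 31, 32, UU + (2 ^ (d - k) + i), 2 * UU + (2 ^ (d - k) + i), 3 * UU + (2 ^ (d - k) + i), 4 * UU + (2 ^ (d - k) + i), 5 * UU + (2 ^ (d - k) + i)} --> m'' b = m' b)"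
    then obtain m'' where s: "s = (m'', g)" and n: "m'' 28 = Suc i" "node_ok y k i m''"
     and fr2: "!!b. b \<notin> {28, 29, 30, 31, 32} ==> b \<notin> nodecells k i ==> m'' b = m' b"
     unfolding node_ok_def nodecells_iff Let_def by auto
    have "node_ok y k q m''" if q: "q < i" for q
    proof -
     have vq: "2 ^ (d - k) + q < UU" "2 ^ (d - k) + i < UU" using node_bound[OF k(2)] q i by auto
     have "m'' b = m' b" if b: "b \<in> nodecells k q" for b
      using b vq UU q by (intro fr2) (auto simp: nodecells_iff Let_def)
     hence "node_ok y k q m'' = node_ok y k q m'" by (simp add: node_ok_def nodecells_iff Let_def)
     thus ?thesis using m'(2) q by simp
    qed
    hence "\<forall>q<Suc i. node_ok y k q m''" using n(2) by (auto simp: less_Suc_eq)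
    moreover have "m'' b = m b" if "b \<notin> {28, 29, 30, 31, 32}" "\<forall>q<Suc i. b \<notin> nodecells k q" for b
     using fr2[of b] fr[of b] that by auto
    ultimately show "?I (Suc i) s" using s n(1) by blast
   qed (use m fr' in auto)
   moreover have "aval w (fst s) (less (vr 28) (pow2 (vr 22))) ~= 0"
    using i m'(1) fr'[of 22] m(2) by (simp add: s ev u2)
   ultimately show "aval w (fst s) (less (vr 28) (pow2 (vr 22))) ~= 0 & runs w H ks q_body s 200 (?I (Suc i))"
    using s by blast
  next
   fix s assume I: "?I (2 ^ (d - k)) s"
   then obtain m' where s: "s = (m', g)" and m': "m' 28 = 2 ^ (d - k)"
    and fr: "!!b. b \<notin> {28, 29, 30, 31, 32} ==> (\<forall>q<2 ^ (d - k). b \<notin> nodecells k q) ==> m' b = m b" by blast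
   have "m' 22 = m 22" using UU by (intro fr) (auto intro!: nc)
   thus "aval w (fst s) (less (vr 28) (pow2 (vr 22))) = 0" using m' m(2) by (simp add: s ev u2)
   show "\<exists>m'. s = (m', g) & (\<forall>q<2 ^ (d - k). node_ok y k q m') &
    (\<forall>b. b \<notin> {28, 29, 30, 31, 32} --> (\<forall>q<2 ^ (d - k). b \<notin> nodecells k q) --> m' b = m b)" using I by blast
  qed simp
 qed simp_all
qed

end

context ram
begin

definition hdr_ok :: "nat => nat => memory => bool" where
 "hdr_ok y k m \<longleftrightarrow> (let a = 64 + 4 * (d - k) in
  m a = OFF d y k & m (a + 1) = ee d y k & m (a + 2) = kap d y k & m (a + 3) = SL d y k)"

definition fin_prog :: com where
 "fin_prog = Seq (asg 27 (plus (vr 27) (times (Op Shr (pow2 (vr 22)) (vr 25)) (vr 26)))) (inc 15)"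

definition k_body :: com where
 "k_body = Seq pl_prog (Seq sl_prog (Seq prm_prog (Seq ql_prog fin_prog)))"

definition pre_t :: "nat => nat" where
 "pre_t i = (if i = 0 then 0 else 2 ^ (i - 1))"

text \<open>The last clause compares with the memory \<open>m0\<close> at the start of the loop. It
  preserves the key list of the root and the zeros in the area of the later bit string.\<close>

definition KI :: "nat => memory => nat => memory => bool" where
 "KI y m0 i m \<longleftrightarrow> m 15 = Suc i & m 16 = pre_t i & m 17 = fst (pfix (2 * d + 8) (pre_t i)) &
  m 18 = snd (pfix (2 * d + 8) (pre_t i)) & m 27 = OFF d y (Suc i) & P0 y m &
  (\<forall>k\<in>{1..i}. (\<forall>q<2 ^ (d - k). node_ok y k q m) & hdr_ok y k m) &
  (\<forall>b. 64 \<le> b --> ~ b < 64 + 4 * d --> (\<forall>k\<in>{1..d}. \<forall>q<2 ^ (d - k). b \<notin> nodecells k q) --> m b = m0 b)"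

lemma node_inj:
 assumes "q < 2 ^ a" "q' < 2 ^ b" "2 ^ a + q = 2 ^ b + (q'::nat)"
 shows "a = b & q = q'"
proof -
 have "floor_log (2 ^ a + q) = a" "floor_log (2 ^ b + q') = b"
  using assms by (auto intro!: floor_log_eqI)
 hence "a = b" using assms(3) by metis
 thus ?thesis using assms(3) by simp
qed

lemma nodecells_disjoint:
 assumes "k \<in> {1..d}" "k' \<in> {1..d}" "q < 2 ^ (d - k)" "q' < 2 ^ (d - k')" "b \<in> nodecells k q" "b \<in> nodecells k' q'"
 shows "k = k' & q = q'"
proof -
 obtain c where c: "b = c * UU + (2 ^ (d - k) + q)" using assms(5) unfolding nodecells_def by blast
 obtain c' where c': "b = c' * UU + (2 ^ (d - k') + q')" using assms(6) unfolding nodecells_def by blast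
 have "2 ^ (d - k) + q < UU" "2 ^ (d - k') + q' < UU" using assms by (auto intro!: node_bound)
 hence "b mod UU = 2 ^ (d - k) + q" "b mod UU = 2 ^ (d - k') + q'" unfolding c by (simp, unfold c[symmetric] c') simp
 hence "2 ^ (d - k) + q = 2 ^ (d - k') + q'" by simp
 from node_inj[OF assms(3,4) this] show ?thesis using assms(1,2) by auto
qed

lemma nodecells_ge: "b \<in> nodecells k q ==> UU \<le> b"
 by (auto simp: nodecells_iff Let_def)

lemma d4_UU: "64 + 4 * d < UU"
 by (rule less_UU[where a = 19]) simp_all

lemma k_iter:
 assumes I: "KI y m0 i m" and i: "i < d" and y: "y \<le> d"
 shows "runs w H ks k_body (m, g) (60 * 2 ^ Suc i + 220 * 2 ^ (d - Suc i) + 100 * d + 800)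
  (%s. \<exists>m'. s = (m', g) & KI y m0 (Suc i) m')"
proof -
 let ?k = "Suc i" and ?q = "2 * d + 8"
 have k: "1 \<le> ?k" "?k \<le> d" using i by auto
 have m: "m 15 = ?k" "m 16 = pre_t i" "m 17 = fst (pfix ?q (pre_t i))" "m 18 = snd (pfix ?q (pre_t i))"
  "m 27 = OFF d y ?k" and P: "P0 y m"
  and ok: "!!k q. k \<in> {1..i} ==> q < 2 ^ (d - k) ==> node_ok y k q m" "!!k. k \<in> {1..i} ==> hdr_ok y k m"
  and fr: "!!b. 64 \<le> b ==> ~ b < 64 + 4 * d ==> (\<forall>k\<in>{1..d}. \<forall>q<2 ^ (d - k). b \<notin> nodecells k q) ==> m b = m0 b"
  using I unfolding KI_def by auto
 have pt: "pre_t i \<le> 2 ^ (?k - 1)" by (auto simp: pre_t_def)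
 let ?m1 = "m(16 := 2 ^ (?k - 1), 17 := fst (pfix ?q (2 ^ (?k - 1))), 18 := snd (pfix ?q (2 ^ (?k - 1))))"
 have P1: "P0 y ?m1" using P by (simp add: P0_def)
 let ?a = "64 + 4 * (d - ?k)"
 have UU: "64 + 4 * d < UU" by (rule d4_UU)
 show ?thesis unfolding k_body_def
 proof (rule runs_Seq[OF pl_runs[OF P k m(1) pt m(2-4)]])
  fix s assume s: "s = (?m1, g)"
  show "runs w H ks (Seq sl_prog (Seq prm_prog (Seq ql_prog fin_prog))) s (220 * 2 ^ (d - Suc i) + 100 * d + 740)
   (%s. \<exists>m'. s = (m', g) & KI y m0 (Suc i) m')" unfolding s
  proof (rule runs_Seq[OF sl_runs[OF P1 k(2)]])
   fix s assume "\<exists>u. s = (?m1(19 := u, 20 := EE d ?k, 21 := d + 2), g)"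
   then obtain u where s: "s = (?m1(19 := u, 20 := EE d ?k, 21 := d + 2), g)" by blast
   let ?m2 = "?m1(19 := u, 20 := EE d ?k, 21 := d + 2)"
   have P2: "P0 y ?m2" using P by (simp add: P0_def)
   show "runs w H ks (Seq prm_prog (Seq ql_prog fin_prog)) s (220 * 2 ^ (d - Suc i) + 440)
    (%s. \<exists>m'. s = (m', g) & KI y m0 (Suc i) m')" unfolding s
   proof (rule runs_Seq[OF prm_runs[OF P2 k _ y]])
    fix s assume "\<exists>m'. s = (m', g) & m' 22 = d - ?k & m' 24 = ee d y ?k & m' 25 = kap d y ?k & m' 26 = SL d y ?k &
     m' ?a = ?m2 27 & m' (?a + 1) = ee d y ?k & m' (?a + 2) = kap d y ?k & m' (?a + 3) = SL d y ?k &
     (\<forall>b. b \<notin> {14, 22, 23, 24, 25, 26, ?a, ?a + 1, ?a + 2, ?a + 3} --> m' b = ?m2 b)"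
    then obtain m3 where s: "s = (m3, g)" and m3: "m3 22 = d - ?k" "m3 24 = ee d y ?k" "m3 25 = kap d y ?k" "m3 26 = SL d y ?k"
     "m3 ?a = OFF d y ?k" "m3 (?a + 1) = ee d y ?k" "m3 (?a + 2) = kap d y ?k" "m3 (?a + 3) = SL d y ?k"
     and fr3: "!!b. b \<notin> {14, 22, 23, 24, 25, 26, ?a, ?a + 1, ?a + 2, ?a + 3} ==> m3 b = ?m2 b" using m(5) by auto
    have "m3 b = ?m2 b" if "b \<in> {0, 2, 3, 4, 5, 6, 7, 8, 44}" for b
     by (rule fr3) (use that in auto)
    hence "P0 y m3 = P0 y ?m2" by (rule P0_cong)
    hence P3: "P0 y m3" using P2 by (simp only:)
    have "m3 15 = ?m2 15" by (rule fr3) simp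
    moreover have "m3 27 = ?m2 27" by (rule fr3) simp
    ultimately have m3': "m3 15 = ?k" "m3 27 = OFF d y ?k" using m by simp_all
    show "runs w H ks (Seq ql_prog fin_prog) s (220 * 2 ^ (d - Suc i) + 240) (%s. \<exists>m'. s = (m', g) & KI y m0 (Suc i) m')" unfolding s
    proof (rule runs_Seq[OF ql_runs[OF P3 k y m3'(1) m3(1-4) m3'(2)]])
     fix s assume "\<exists>m'. s = (m', g) & (\<forall>q<2 ^ (d - ?k). node_ok y ?k q m') &
      (\<forall>b. b \<notin> {28, 29, 30, 31, 32} --> (\<forall>q<2 ^ (d - ?k). b \<notin> nodecells ?k q) --> m' b = m3 b)"
     then obtain m4 where s: "s = (m4, g)" and n4: "!!q. q < 2 ^ (d - ?k) ==> node_ok y ?k q m4"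
      and fr4: "!!b. b \<notin> {28, 29, 30, 31, 32} ==> (\<forall>q<2 ^ (d - ?k). b \<notin> nodecells ?k q) ==> m4 b = m3 b" by blast
     have fr4': "m4 b = m3 b" if "b \<notin> {28, 29, 30, 31, 32}" "b < UU" for b
      using that nodecells_ge by (intro fr4) (auto simp: leD)
     have U64: "64 < UU" using UU by simp
     have m4: "m4 22 = d - ?k" "m4 25 = kap d y ?k" "m4 26 = SL d y ?k" "m4 27 = OFF d y ?k" "m4 15 = ?k"
      using m3(1,3,4) m3' fr4'[of 22] fr4'[of 25] fr4'[of 26] fr4'[of 27] fr4'[of 15] U64 by simp_all
     let ?m5 = "m4(27 := OFF d y (Suc ?k), 15 := Suc ?k)"
     have P4: "P0 y ?m5"
     proof -
      have "m4 b = m3 b" if "b \<in> {0, 2, 3, 4, 5, 6, 7, 8, 44}" for b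
       by (rule fr4') (use that U64 in auto)
      hence "P0 y m4 = P0 y m3" by (rule P0_cong)
      hence "P0 y m4" using P3 by (simp only:)
      thus ?thesis by (simp add: P0_def)
     qed
     have "den w H ks fin_prog (m4, g) = (?m5, g)"
     proof -
      have u: "ub c ((2::nat) ^ (d - ?k))" "ub c ((2::nat) ^ kap d y ?k)" if "1 \<le> c" for c
       using kap_le[of d y ?k] by (auto intro!: ub_mono[OF ub_pow that])
      have uS: "ub c (SL d y ?k)" if "10 \<le> c" for c
       by (rule ub_mono[OF _ that]) (use SL_le[OF k(2)] in \<open>simp add: ub_def\<close>)
      have uO: "ub c (OFF d y ?k)" if "12 \<le> c" for c
       by (rule ub_mono[OF _ that]) (use OFF_le[of ?k d] k in \<open>simp add: ub_def\<close>)
      have ui: "ub c i" if "1 \<le> c" for c using ub_le[OF ub_d[OF that]] i by simp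
      have "OFF d y (Suc ?k) = OFF d y ?k + 2 ^ (d - ?k) div 2 ^ kap d y ?k * SL d y ?k"
       by (simp add: OFF_def)
      thus ?thesis using m4 by (simp add: fin_prog_def ev u uS uO ui)
     qed
     moreover have "KI y m0 (Suc i) ?m5"
      unfolding KI_def
     proof (intro conjI ballI allI impI)
      show "?m5 16 = pre_t (Suc i)" "?m5 17 = fst (pfix ?q (pre_t (Suc i)))" "?m5 18 = snd (pfix ?q (pre_t (Suc i)))"
      proof -
       have "m4 b = ?m2 b" if "b \<in> {16, 17, 18}" for b
       proof -
        have "m4 b = m3 b" by (rule fr4') (use that U64 in auto)
        also have "... = ?m2 b" by (rule fr3) (use that in auto)
        finally show ?thesis .
       qed
       thus "?m5 16 = pre_t (Suc i)" "?m5 17 = fst (pfix ?q (pre_t (Suc i)))" "?m5 18 = snd (pfix ?q (pre_t (Suc i)))"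
        by (simp_all add: pre_t_def)
      qed
      show "P0 y ?m5" by (rule P4)
     next
      fix k q :: nat assume kq: "k \<in> {1..Suc i}" "q < 2 ^ (d - k)"
      show "node_ok y k q ?m5"
      proof (cases "k = Suc i")
       case True
       have "?m5 b = m4 b" if "b \<in> nodecells k q" for b using nodecells_ge[OF that] U64 by auto
       hence "node_ok y k q ?m5 = node_ok y k q m4" by (simp add: node_ok_def nodecells_iff Let_def)
       thus ?thesis using n4 kq True by simp
      next
       case False
       have "?m5 b = m b" if b: "b \<in> nodecells k q" for b
       proof -
        have bU: "64 + 4 * d < b" using nodecells_ge[OF b] UU by simp
        have "b \<notin> nodecells ?k q'" if "q' < 2 ^ (d - ?k)" for q'
         using nodecells_disjoint[of k ?k q q' b] kq that b False k by auto
        hence "m4 b = m3 b" using bU by (intro fr4) auto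
        also have "m3 b = ?m2 b" by (rule fr3) (use bU k in auto)
        also have "... = m b" using bU by simp
        finally show ?thesis using bU by simp
       qed
       hence "node_ok y k q ?m5 = node_ok y k q m" by (simp add: node_ok_def nodecells_iff Let_def)
       thus ?thesis using ok(1)[of k q] kq False by simp
      qed
     next
      fix k :: nat assume k': "k \<in> {1..Suc i}"
      let ?b = "64 + 4 * (d - k)"
      have bU: "?b + 3 < UU" using UU k' i by (auto simp: diff_mult_distrib2)
      show "hdr_ok y k ?m5"
      proof (cases "k = Suc i")
       case True
       have e: "m4 b = m3 b" if "b \<in> {?b, ?b + 1, ?b + 2, ?b + 3}" for b
        by (rule fr4') (use that bU in auto)
       show ?thesis using m3 True e[of ?b] e[of "?b + 1"] e[of "?b + 2"] e[of "?b + 3"] by (simp add: hdr_ok_def Let_def)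
      next
       case False
       have ne: "?b + 4 \<le> ?a \<or> ?a + 4 \<le> ?b" using False k' k by auto
       have e: "m4 b = m b" if b: "b \<in> {?b, ?b + 1, ?b + 2, ?b + 3}" for b
       proof -
        have "m4 b = m3 b" using b bU by (intro fr4') auto
        also have "m3 b = ?m2 b" by (rule fr3) (use b ne in auto)
        also have "... = m b" using b by auto
        finally show ?thesis .
       qed
       show ?thesis using ok(2)[of k] k' False e[of ?b] e[of "?b + 1"] e[of "?b + 2"] e[of "?b + 3"] by (simp add: hdr_ok_def Let_def)
      qed
     next
      fix b :: nat assume b: "64 \<le> b" "~ b < 64 + 4 * d" "\<forall>k\<in>{1..d}. \<forall>q<2 ^ (d - k). b \<notin> nodecells k q"
      have "m4 b = m3 b" using b k by (intro fr4) auto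
      also have "m3 b = ?m2 b" by (rule fr3) (use b k in auto)
      also have "... = m b" using b by simp
      finally show "?m5 b = m0 b" using fr[OF b] b by simp
     qed auto
     ultimately have *: "\<exists>m'. den w H ks fin_prog (m4, g) = (m', g) & KI y m0 (Suc i) m'" by blast
     show "runs w H ks fin_prog s 50 (%s. \<exists>m'. s = (m', g) & KI y m0 (Suc i) m')" unfolding s
     proof (rule runs_den)
      show "loop_free fin_prog" "tb fin_prog \<le> 50" by (simp_all add: fin_prog_def)
     qed (rule *)
    qed simp
   qed (use m in auto)
  qed auto
 qed simp
qed

definition k_prog :: com where
 "k_prog = Seq (seqs [asg 15 (Const 1), asg 16 (Const 0), asg 17 (pow2 (vr 8)), asg 18 (Const 0), asg 27 (Const 0)])
  (While (less (vr 15) (plus (vr 2) (Const 1))) k_body)"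

lemma k_runs:
 assumes P: "P0 y m0" and y: "y \<le> d"
 shows "runs w H ks k_prog (m0, g) (400 * 2 ^ d + 100 * (d * d) + 1000 * d + 100) (%s. \<exists>m'. s = (m', g) & KI y m0 d m')"
 unfolding k_prog_def
proof (rule runs_Seq[where ?T1.0 = 50 and R = "%s. \<exists>m'. s = (m', g) & KI y m0 0 m'", OF runs_den])
 have "den w H ks (seqs [asg 15 (Const 1), asg 16 (Const 0), asg 17 (pow2 (vr 8)), asg 18 (Const 0), asg 27 (Const 0)]) (m0, g) =
  (m0(15 := 1, 16 := 0, 17 := 2 ^ (2 * d + 8), 18 := 0, 27 := 0), g)"
  using P by (simp add: P0_def ev)
 moreover have "KI y m0 0 (m0(15 := 1, 16 := 0, 17 := 2 ^ (2 * d + 8), 18 := 0, 27 := 0))"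
  using P by (auto simp: KI_def pre_t_def P0_def OFF_def)
 ultimately show "\<exists>m'. den w H ks (seqs [asg 15 (Const 1), asg 16 (Const 0), asg 17 (pow2 (vr 8)), asg 18 (Const 0), asg 27 (Const 0)]) (m0, g) = (m', g) & KI y m0 0 m'"
  by blast
next
 fix s assume s0: "\<exists>m'. s = (m', g) & KI y m0 0 m'"
 show "runs w H ks (While (less (vr 15) (plus (vr 2) (Const 1))) k_body) s (400 * 2 ^ d + 100 * (d * d) + 1000 * d + 50) (%s. \<exists>m'. s = (m', g) & KI y m0 d m')"
 proof (rule runs_for[where I = "%i s. \<exists>m'. s = (m', g) & KI y m0 i m'" and N = d
    and T = "%i. 60 * 2 ^ Suc i + 220 * 2 ^ (d - Suc i) + 100 * d + 800"])
  fix i s assume i: "i < d" and "\<exists>m'. s = (m', g) & KI y m0 i m'"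
  then obtain m' where s: "s = (m', g)" "KI y m0 i m'" by blast
  have "m' 15 = Suc i" "m' 2 = d" using s(2) by (auto simp: KI_def P0_def)
  thus "aval w (fst s) (less (vr 15) (plus (vr 2) (Const 1))) ~= 0 &
   runs w H ks k_body s (60 * 2 ^ Suc i + 220 * 2 ^ (d - Suc i) + 100 * d + 800) (%s. \<exists>m'. s = (m', g) & KI y m0 (Suc i) m')"
   using k_iter[OF s(2) i y] i by (simp add: s(1))
 next
  fix s assume "\<exists>m'. s = (m', g) & KI y m0 d m'"
  then obtain m' where s: "s = (m', g)" "KI y m0 d m'" by blast
  have "m' 15 = Suc d" "m' 2 = d" using s(2) by (auto simp: KI_def P0_def)
  thus "aval w (fst s) (less (vr 15) (plus (vr 2) (Const 1))) = 0" by (simp add: s(1))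
 next
  have 1: "(\<Sum>i<d. (2::nat) ^ Suc i) \<le> 2 * 2 ^ d" by (induction d) auto
  have "(\<Sum>i<d. (2::nat) ^ (d - Suc i)) = (\<Sum>i<d. 2 ^ i)" by (rule sum.nat_diff_reindex)
  also have "... \<le> 2 ^ d" by (induction d) auto
  finally have 2: "(\<Sum>i<d. (2::nat) ^ (d - Suc i)) \<le> 2 ^ d" .
  have "(\<Sum>i<d. 60 * 2 ^ Suc i + 220 * 2 ^ (d - Suc i) + 100 * d + 800 + (1 + acost (less (vr 15) (plus (vr 2) (Const 1))))) =
   60 * (\<Sum>i<d. 2 ^ Suc i) + 220 * (\<Sum>i<d. 2 ^ (d - Suc i)) + d * (100 * d + 808)"
   by (simp add: sum.distrib sum_distrib_left algebra_simps)
  also have "... \<le> 60 * (2 * 2 ^ d) + 220 * 2 ^ d + d * (100 * d + 808)"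
   using 1 2 by (intro add_mono mult_le_mono2) auto
  finally show "(\<Sum>i<d. 60 * 2 ^ Suc i + 220 * 2 ^ (d - Suc i) + 100 * d + 800 + (1 + acost (less (vr 15) (plus (vr 2) (Const 1))))) +
   (1 + acost (less (vr 15) (plus (vr 2) (Const 1)))) \<le> 400 * 2 ^ d + 100 * (d * d) + 1000 * d + 50"
   by (simp add: algebra_simps)
 qed (use s0 in auto)
qed simp_all

definition id_prog :: com where
 "id_prog = Seq (asg 10 (Const 0)) (While (less (vr 10) (vr 0)) (Seq (Store (arr 8 (vr 10)) (vr 10)) (inc 10)))"

lemma id_runs:
 assumes P: "P0 y m"
 shows "runs w H ks id_prog (m, g) (50 * 2 ^ d + 50) (%s. \<exists>m'. s = (m', g) &
  (\<forall>v<2 ^ d. m' (8 * UU + v) = v) & (\<forall>b. b ~= 10 --> b < 8 * UU --> m' b = m b))"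
proof -
 let ?I = "%i s. \<exists>m'. s = (m', g) & m' 10 = i & (\<forall>v<i. m' (8 * UU + v) = v) & (\<forall>b. b ~= 10 --> b < 8 * UU --> m' b = m b)"
 have U: "64 < UU" using d4_UU by simp
 show ?thesis unfolding id_prog_def
 proof (rule runs_Seq[where ?T1.0 = 10 and R = "?I 0", OF runs_den])
  show "?I 0 (den w H ks (asg 10 (Const 0)) (m, g))" by simp
  fix s assume s0: "?I 0 s"
  show "runs w H ks (While (less (vr 10) (vr 0)) (Seq (Store (arr 8 (vr 10)) (vr 10)) (inc 10))) s (50 * 2 ^ d + 40)
   (%s. \<exists>m'. s = (m', g) & (\<forall>v<2 ^ d. m' (8 * UU + v) = v) & (\<forall>b. b ~= 10 --> b < 8 * UU --> m' b = m b))"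
  proof (rule runs_for[where I = ?I and N = "2 ^ d" and T = "%_. 30"])
   fix i s assume i: "i < 2 ^ d" and "?I i s"
   then obtain m' where s: "s = (m', g)" and m': "m' 10 = i" "\<forall>v<i. m' (8 * UU + v) = v" "\<forall>b. b ~= 10 --> b < 8 * UU --> m' b = m b" by blast
   have ui: "ub c i" if "1 \<le> c" for c
    by (rule ub_le[OF ub_mono[OF ub_pow that, of d]]) (use i in auto)
   have e: "m' 6 = UU" "m' 0 = 2 ^ d" using m'(3) P U by (auto simp: P0_def)
   have "runs w H ks (Seq (Store (arr 8 (vr 10)) (vr 10)) (inc 10)) s 30 (?I (Suc i))"
    by (rule runs_den) (use m' e U in \<open>auto simp: s ui less_Suc_eq\<close>)
   thus "aval w (fst s) (less (vr 10) (vr 0)) ~= 0 & runs w H ks (Seq (Store (arr 8 (vr 10)) (vr 10)) (inc 10)) s 30 (?I (Suc i))"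
    using i e m' by (simp add: s)
  next
   fix s assume "?I (2 ^ d) s"
   then obtain m' where s: "s = (m', g)" and m': "m' 10 = 2 ^ d" "\<forall>b. b ~= 10 --> b < 8 * UU --> m' b = m b" by blast
   have "m' 0 = 2 ^ d" using m'(2) P U by (auto simp: P0_def)
   thus "aval w (fst s) (less (vr 10) (vr 0)) = 0" using m' by (simp add: s)
  qed (use s0 in auto)
 qed simp_all
qed

definition init_prog :: com where
 "init_prog = Seq (clog_prog 2 0) (Seq (clog_prog 3 1) (Seq (asg 14 (plus (vr 2) (Const 1))) (Seq (clog_prog 4 14)
  (seqs [asg 5 (times (Const 64) (vr 14)), asg 6 (pow2 (times (Const 20) (vr 14))), asg 7 (plus (vr 2) (Const 2)),
   asg 8 (plus (times (Const 2) (vr 2)) (Const 8)), asg 44 (times (Const 256) (vr 14))]))))"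

definition prep_prog :: com where
 "prep_prog = Seq init_prog (Seq id_prog k_prog)"

text \<open>The part of memory that all attempts share. The cells from \<open>64 + 4 * d\<close> up
  to \<open>UU\<close> are required to be zero because the bit string is written there by
  disjunction.\<close>

definition PRE :: "nat => memory => bool" where
 "PRE y m \<longleftrightarrow> P0 y m & m 27 = OFF d y (Suc d) &
  (\<forall>k\<in>{1..d}. (\<forall>q<2 ^ (d - k). node_ok y k q m) & hdr_ok y k m) &
  (\<forall>v<2 ^ d. m (8 * UU + v) = v) & (\<forall>b. 64 + 4 * d \<le> b --> b < UU --> m b = 0)"

lemma clg_pow: "clg (2 ^ d) = d"
proof (rule antisym)
 show "clg (2 ^ d) \<le> d" unfolding clg_def by (rule Least_le) simp
 have "(2::nat) ^ d \<le> 2 ^ clg (2 ^ d)" by (rule clg_le)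
 thus "d \<le> clg (2 ^ d)" by simp
qed

lemma init_runs:
 assumes E: "E \<le> 2 ^ d"
 shows "runs w H ks init_prog ((%_. 0)(0 := 2 ^ d, 1 := E), g) (100 * d + 300) (%s. \<exists>m'. s = (m', g) &
  P0 (clg E) m' & (\<forall>b\<ge>64. m' b = 0))"
proof -
 have b: "(2::nat) ^ d \<le> 2 ^ (2 * (d + 1))" by (rule power_increasing) auto
 have c: "clg E \<le> d"
 proof (rule ccontr)
  assume "~ ?thesis"
  hence "2 ^ d < E" by (intro clg_gt) simp
  thus False using E by simp
 qed
 have c2: "clg (Suc d) \<le> d + 1" unfolding clg_def using d_le by (intro Least_le) simp
 let ?m = "(%_. 0)(0 := 2 ^ d, 1 := E) :: memory"
 let ?m3 = "?m(2 := d, 3 := clg E, 14 := Suc d)"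
 have uz: "ub c (clg (Suc d))" if "2 \<le> c" for c
  by (rule ub_mono[OF ub_le[OF _ c2] that]) simp
 show ?thesis unfolding init_prog_def
 proof (rule runs_Seq[where ?T1.0 = "20 * d + 20" and R = "%s. s = (?m(2 := d), g)"])
  show "runs w H ks (clog_prog 2 0) (?m, g) (20 * d + 20) (%s. s = (?m(2 := d), g))"
   using clog_runs[of 2 0 "2 ^ d" ?m g] b by (simp add: clg_pow)
  fix s assume s: "s = (?m(2 := d), g)"
  show "runs w H ks (Seq (clog_prog 3 1) (Seq (asg 14 (plus (vr 2) (Const 1))) (Seq (clog_prog 4 14)
  (seqs [asg 5 (times (Const 64) (vr 14)), asg 6 (pow2 (times (Const 20) (vr 14))), asg 7 (plus (vr 2) (Const 2)),
   asg 8 (plus (times (Const 2) (vr 2)) (Const 8)), asg 44 (times (Const 256) (vr 14))])))) s (60 * d + 250)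
   (%s. \<exists>m'. s = (m', g) & P0 (clg E) m' & (\<forall>b\<ge>64. m' b = 0))"
  proof (rule runs_Seq[where ?T1.0 = "20 * d + 20" and R = "%s. s = (?m(2 := d, 3 := clg E), g)"])
   show "runs w H ks (clog_prog 3 1) s (20 * d + 20) (%s. s = (?m(2 := d, 3 := clg E), g))" unfolding s
    by (rule runs_mono[OF clog_runs[of 3 1 E]]) (use E b c in auto)
   fix s assume s: "s = (?m(2 := d, 3 := clg E), g)"
   show "runs w H ks (Seq (asg 14 (plus (vr 2) (Const 1))) (Seq (clog_prog 4 14)
  (seqs [asg 5 (times (Const 64) (vr 14)), asg 6 (pow2 (times (Const 20) (vr 14))), asg 7 (plus (vr 2) (Const 2)),
   asg 8 (plus (times (Const 2) (vr 2)) (Const 8)), asg 44 (times (Const 256) (vr 14))]))) s (40 * d + 230)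
   (%s. \<exists>m'. s = (m', g) & P0 (clg E) m' & (\<forall>b\<ge>64. m' b = 0))"
   proof (rule runs_Seq[where ?T1.0 = 20 and R = "%s. s = (?m3, g)", OF runs_den])
    show "den w H ks (asg 14 (plus (vr 2) (Const 1))) s = (?m3, g)" by (simp add: s)
    fix s assume s: "s = (?m3, g)"
    show "runs w H ks (Seq (clog_prog 4 14)
  (seqs [asg 5 (times (Const 64) (vr 14)), asg 6 (pow2 (times (Const 20) (vr 14))), asg 7 (plus (vr 2) (Const 2)),
   asg 8 (plus (times (Const 2) (vr 2)) (Const 8)), asg 44 (times (Const 256) (vr 14))])) s (40 * d + 210)
   (%s. \<exists>m'. s = (m', g) & P0 (clg E) m' & (\<forall>b\<ge>64. m' b = 0))"
    proof (rule runs_Seq[where ?T1.0 = "20 * d + 40" and R = "%s. s = (?m3(4 := clg (Suc d)), g)"])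
     have "Suc d \<le> 2 ^ (2 * (d + 1))" using d_le(2) power_increasing[of "d + 1" "2 * (d + 1)" "2::nat"] by simp
     thus "runs w H ks (clog_prog 4 14) s (20 * d + 40) (%s. s = (?m3(4 := clg (Suc d)), g))" unfolding s
      by (intro runs_mono[OF clog_runs[of 4 14 "Suc d"]]) (use c2 in auto)
     fix s assume s: "s = (?m3(4 := clg (Suc d)), g)"
     show "runs w H ks (seqs [asg 5 (times (Const 64) (vr 14)), asg 6 (pow2 (times (Const 20) (vr 14))), asg 7 (plus (vr 2) (Const 2)),
      asg 8 (plus (times (Const 2) (vr 2)) (Const 8)), asg 44 (times (Const 256) (vr 14))]) s 150
      (%s. \<exists>m'. s = (m', g) & P0 (clg E) m' & (\<forall>b\<ge>64. m' b = 0))"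
     proof (rule runs_den)
      have p: "ub a ((2::nat) ^ (20 + 20 * d))" if "20 \<le> a" for a by (rule ub_mono[OF ub_pow that]) simp
      have "den w H ks (seqs [asg 5 (times (Const 64) (vr 14)), asg 6 (pow2 (times (Const 20) (vr 14))), asg 7 (plus (vr 2) (Const 2)),
      asg 8 (plus (times (Const 2) (vr 2)) (Const 8)), asg 44 (times (Const 256) (vr 14))]) s =
      (?m3(4 := clg (Suc d), 5 := 64 * (d + 1), 6 := UU, 7 := d + 2, 8 := 2 * d + 8, 44 := 256 * (d + 1)), g)"
       by (simp add: s ev UU_def p)
      moreover have "P0 (clg E) (?m3(4 := clg (Suc d), 5 := 64 * (d + 1), 6 := UU, 7 := d + 2, 8 := 2 * d + 8, 44 := 256 * (d + 1)))"
       by (simp add: P0_def)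
      ultimately show "\<exists>m'. den w H ks (seqs [asg 5 (times (Const 64) (vr 14)), asg 6 (pow2 (times (Const 20) (vr 14))), asg 7 (plus (vr 2) (Const 2)),
      asg 8 (plus (times (Const 2) (vr 2)) (Const 8)), asg 44 (times (Const 256) (vr 14))]) s = (m', g) & P0 (clg E) m' & (\<forall>b\<ge>64. m' b = 0)"
       by auto
     qed simp_all
    qed simp
   qed simp_all
  qed simp
 qed simp
qed

lemma prep_runs:
 assumes E: "E \<le> 2 ^ d"
 shows "runs w H ks prep_prog ((%_. 0)(0 := 2 ^ d, 1 := E), g) (450 * 2 ^ d + 100 * (d * d) + 1100 * d + 500)
  (%s. \<exists>m'. s = (m', g) & PRE (clg E) m')"
 unfolding prep_prog_def
proof (rule runs_Seq[OF init_runs[OF E]])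
 have c: "clg E \<le> d"
 proof (rule ccontr)
  assume "~ ?thesis"
  hence "2 ^ d < E" by (intro clg_gt) simp
  thus False using E by simp
 qed
 fix s assume "\<exists>m'. s = (m', g) & P0 (clg E) m' & (\<forall>b\<ge>64. m' b = 0)"
 then obtain m where s: "s = (m, g)" and m: "P0 (clg E) m" "!!b. 64 \<le> b ==> m b = 0" by blast
 show "runs w H ks (Seq id_prog k_prog) s (450 * 2 ^ d + 100 * (d * d) + 1000 * d + 200) (%s. \<exists>m'. s = (m', g) & PRE (clg E) m')"
  unfolding s
 proof (rule runs_Seq[OF id_runs[OF m(1)]])
  fix s assume "\<exists>m'. s = (m', g) & (\<forall>v<2 ^ d. m' (8 * UU + v) = v) & (\<forall>b. b ~= 10 --> b < 8 * UU --> m' b = m b)"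
  then obtain m' where s: "s = (m', g)" and m': "\<forall>v<2 ^ d. m' (8 * UU + v) = v" "!!b. b ~= 10 ==> b < 8 * UU ==> m' b = m b" by blast
  have U: "64 + 4 * d < UU" by (rule d4_UU)
  have P: "P0 (clg E) m'" using m(1) U by (subst P0_cong[of m' m]) (auto intro!: m'(2))
  show "runs w H ks k_prog s (400 * 2 ^ d + 100 * (d * d) + 1000 * d + 100) (%s. \<exists>m'. s = (m', g) & PRE (clg E) m')" unfolding s
  proof (rule runs_mono[OF k_runs[OF P c]])
   fix s assume "\<exists>m''. s = (m'', g) & KI (clg E) m' d m''"
   then obtain m'' where s: "s = (m'', g)" and K: "KI (clg E) m' d m''" by blast
   have fr: "m'' b = m' b" if "64 + 4 * d \<le> b" "!!k q. k \<in> {1..d} ==> q < 2 ^ (d - k) ==> b \<notin> nodecells k q" for b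
    using K that by (auto simp: KI_def)
   have "m'' (8 * UU + v) = v" if v: "v < 2 ^ d" for v
   proof -
    have "8 * UU + v \<notin> nodecells k q" if "k \<in> {1..d}" "q < 2 ^ (d - k)" for k q
     using node_bound[of k q] that by (auto simp: nodecells_iff Let_def)
    hence "m'' (8 * UU + v) = m' (8 * UU + v)" using U by (intro fr) auto
    thus ?thesis using m' v by simp
   qed
   moreover have "m'' b = 0" if b: "64 + 4 * d \<le> b" "b < UU" for b
   proof -
    have "m'' b = m' b" using b nodecells_ge by (intro fr) (auto simp: leD)
    also have "... = m b" using b U by (intro m'(2)) auto
    finally show ?thesis using m(2) b by simp
   qed
   ultimately have "PRE (clg E) m''" using K by (simp add: PRE_def KI_def)
   thus "\<exists>m'. s = (m', g) & PRE (clg E) m'" using s by blast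
  qed simp
 qed simp
qed simp

end

section \<open>The search machine\<close>

text \<open>Keys are opaque to the machine, so a node owns a set of positions in the key list.
  \<open>tu v c\<close> is the hash function that node \<open>v\<close> uses when its window is
  \<open>c\<close>.\<close>

definition Xset :: "(nat => nat => 'k => bool) => 'k list => (nat => nat) => nat => nat set" where
 "Xset tu keys win v = {i. i < length keys & node_at (%u. tu u (win u)) (floor_log v) (keys ! i) = v}"

definition tst :: "(nat => nat => 'k => bool) => 'k list => (nat => nat) => nat => bool" where
 "tst tu keys win v \<longleftrightarrow> 2 * card {i \<in> Xset tu keys win v. tu v (win v) (keys ! i)} = card (Xset tu keys win v)"

lemma Xset_child:
 assumes "1 \<le> v" "b \<le> 1"
 shows "Xset tu keys win (2 * v + b) = {i \<in> Xset tu keys win v. tu v (win v) (keys ! i) \<longleftrightarrow> b = 1}"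
proof -
 have fl: "floor_log (2 * v + b) = Suc (floor_log v)"
  using assms floor_log_rec[of "2 * v + b"] by simp
 have E: "2 * x + of_bool c = 2 * v + b \<longleftrightarrow> x = v & (c \<longleftrightarrow> b = 1)" for x c
  using assms(2) by (cases c) (auto, presburger+)
 show ?thesis unfolding Xset_def fl node_at.simps E
 proof (rule set_eqI)
  fix i
  show "i \<in> {i. i < length keys & node_at (%u. tu u (win u)) (floor_log v) (keys ! i) = v &
    tu (node_at (%u. tu u (win u)) (floor_log v) (keys ! i)) (win (node_at (%u. tu u (win u)) (floor_log v) (keys ! i))) (keys ! i) = (b = 1)} \<longleftrightarrow>
   i \<in> {i \<in> {i. i < length keys & node_at (%u. tu u (win u)) (floor_log v) (keys ! i) = v}. tu v (win v) (keys ! i) = (b = 1)}"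
   by (cases "node_at (%u. tu u (win u)) (floor_log v) (keys ! i) = v") simp_all
 qed
qed

text \<open>The path to \<open>v\<close> passes only through its proper ancestors, all of which are
  at most \<open>v div 2\<close>.\<close>

lemma Xset_cong:
 assumes "!!u. 1 \<le> u ==> u \<le> v div 2 ==> win u = win' u"
 shows "Xset tu keys win v = Xset tu keys win' v"
 using assms
proof (induction v rule: less_induct)
 case (less v)
 show ?case
 proof (cases "v \<le> 1")
  case True
  hence "floor_log v = 0" by (cases v) auto
  thus ?thesis by (simp add: Xset_def)
 next
  case False
  have v: "v = 2 * (v div 2) + v mod 2" "v mod 2 \<le> 1" "1 \<le> v div 2" "v div 2 < v" using False by auto
  have "Xset tu keys win (v div 2) = Xset tu keys win' (v div 2)"
   using less.IH[OF v(4)] less.prems by auto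
  moreover have "win (v div 2) = win' (v div 2)" using less.prems v(3) by auto
  ultimately show ?thesis using Xset_child[OF v(3,2), of tu keys win] Xset_child[OF v(3,2), of tu keys win'] v(1) by auto
 qed
qed

lemma finite_Xset [simp]: "finite (Xset tu keys win v)"
 by (simp add: Xset_def)

type_synonym mstate = "nat \<times> (nat => nat) \<times> nat \<times> nat \<times> nat"

text \<open>The state consists of the current node, the windows, the mode (1 calls for the next
  candidate at the node, 0 for a test), the remaining budget and a flag for failure. Nodes are
  handled in heap order, so the previous node of the segment is \<open>v - 1\<close>; at a node with
  \<open>sh v = W\<close> the segment starts, and running out of candidates there is
  failure.\<close>

definition mstep :: "nat => (nat => nat) => (nat => nat) => ((nat => nat) => nat => bool) => mstate => mstate" where
 "mstep W sh ic ts sm = (case sm of (v, win, md, fu, st) =>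
  if md = 1 then
   if win v + ic v < 2 ^ W then (v, win(v := win v + ic v), 0, fu, st)
   else if sh v = W then (v, win, 1, fu, 1) else (v - 1, win, 1, fu, st)
  else if fu = 0 then (v, win, md, fu, 1)
  else if ts win v then (Suc v, win(Suc v := win v div 2 ^ sh (Suc v)), 0, fu - 1, st)
  else (v, win, 1, fu - 1, st))"

definition shf :: "nat => nat => nat => nat" where
 "shf d y v = shq d y (d - floor_log v) (v - 2 ^ floor_log v)"

definition incf :: "nat => nat => nat => nat" where
 "incf d y v = incq d y (d - floor_log v) (v - 2 ^ floor_log v)"

definition posf :: "nat => nat => nat => nat" where
 "posf d y v = posq d y (d - floor_log v) (v - 2 ^ floor_log v)"

lemma floor_log_bounds: "1 \<le> v ==> 2 ^ floor_log v \<le> v" "v < 2 * 2 ^ floor_log v"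
 using floor_log_exp2_le[of v] floor_log_exp2_gt[of v] by auto

lemma floor_log_less: "1 \<le> v ==> v < 2 ^ d ==> floor_log v < d"
proof -
 assume v: "1 \<le> v" "v < 2 ^ d"
 have "(2::nat) ^ floor_log v < 2 ^ d" using floor_log_bounds(1)[OF v(1)] v(2) by (rule le_less_trans)
 thus "floor_log v < d" by simp
qed

context ram
begin

definition t_body :: com where
 "t_body = Seq (asg 40 (Load (plus (vr 34) (vr 36)))) (Seq (Hash (Const 39) (vr 33) (vr 40))
  (Seq (Cond (vr 39) (Seq (Store (vr 38) (vr 40)) (inc 38)) (Seq (Store (vr 37) (vr 40)) (inc 37))) (inc 36)))"

definition t_loop :: com where
 "t_loop = While (less (vr 36) (vr 35)) t_body"

text \<open>The keys are distributed directly into the lists of the two children. An unbalanced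
  split damages memory: surplus left keys spoil the right half, and surplus right keys run up to
  \<open>mm div 2\<close> cells past the block. Contents are therefore claimed only if the left half
  does not overflow, and the frame condition leaves out the enlarged block.\<close>

lemma t_runs:
 fixes mm a sd g :: nat and m :: memory
 defines "kl \<equiv> (%m :: memory. map (%t. m (a + t)) [0..<mm])"
  and "bt \<equiv> (%x :: nat. H (prod_encode (g, sd)) (ks ! x))"
 assumes m: "m 6 = UU" "m 33 = sd" "m 34 = a" "m 35 = mm" "m 36 = 0" "m 37 = a + UU" "m 38 = a + UU + mm div 2"
  and a: "UU \<le> a" "ub 60 a" and mm: "ub 1 mm" and keys: "\<forall>x\<in>set (kl m). x < length ks" and n: "length ks = 2 ^ d"
 shows "runs w H ks t_loop (m, g) (60 * mm + 20) (%s. \<exists>m' :: memory. s = (m', g) &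
  m' 38 = a + UU + mm div 2 + length (filter bt (kl m)) &
  (length (filter (%x. ~ bt x) (kl m)) \<le> mm div 2 -->
   (\<forall>t<length (filter (%x. ~ bt x) (kl m)). m' (a + UU + t) = filter (%x. ~ bt x) (kl m) ! t) &
   (\<forall>t<length (filter bt (kl m)). m' (a + UU + mm div 2 + t) = filter bt (kl m) ! t)) &
  (\<forall>b::nat. b \<notin> {36, 37, 38, 39, 40} --> ~ (a + UU \<le> b & b < a + UU + mm + mm div 2) --> m' b = m b))"
proof -
 let ?k = "kl m"
 let ?L = "%i. filter (%x. ~ bt x) (take i ?k)" and ?R = "%i. filter bt (take i ?k)"
 define J where "J i m' \<longleftrightarrow> m' 36 = i & m' 37 = a + UU + length (?L i) & m' 38 = a + UU + mm div 2 + length (?R i) &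
  (length (?L i) \<le> mm div 2 --> (\<forall>t<length (?L i). m' (a + UU + t) = ?L i ! t) &
   (\<forall>t<length (?R i). m' (a + UU + mm div 2 + t) = ?R i ! t)) &
  (\<forall>b::nat. b \<notin> {36, 37, 38, 39, 40} --> ~ (a + UU \<le> b & b < a + UU + mm + mm div 2) --> m' b = m b)"
  for i and m' :: memory
 let ?I = "%i s. \<exists>m' :: memory. s = (m', g) & J i m'"
 have lk: "length ?k = mm" by (simp add: kl_def)
 have U: "64 < UU" using UU_ge by simp
 have mmU: "mm + mm < UU" by (rule less_UU[where a = 2]) (use mm in \<open>simp_all add: ub_mono[OF mm]\<close>)
 show ?thesis unfolding t_loop_def
 proof (rule runs_for[where I = ?I and N = mm and T = "%_. 50"])
  show "?I 0 (m, g)" using m by (auto simp: J_def)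
 next
  fix i s assume i: "i < mm" and "?I i s"
  then obtain m' where s: "s = (m', g)" and J: "J i m'" by blast
  note c = J[unfolded J_def]
  have m': "m' 36 = i" "m' 37 = a + UU + length (?L i)" "m' 38 = a + UU + mm div 2 + length (?R i)"
   by (rule c[THEN conjunct1] c[THEN conjunct2, THEN conjunct1] c[THEN conjunct2, THEN conjunct2, THEN conjunct1])+
  note ct = c[THEN conjunct2, THEN conjunct2, THEN conjunct2, THEN conjunct1, rule_format]
  note fr = c[THEN conjunct2, THEN conjunct2, THEN conjunct2, THEN conjunct2, rule_format]
  have fr': "m' b = m b" if "b < 36" for b using that a U by (intro fr) auto
  have e: "m' 6 = UU" "m' 33 = sd" "m' 34 = a" "m' 35 = mm" using m fr' by simp_all
  define x where "x = m (a + i)"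
  have xk: "?k ! i = x" using i by (simp add: kl_def x_def)
  have x: "m' (a + i) = x" unfolding x_def by (rule fr) (use a U mmU i in auto)
  have xn: "x < 2 ^ d" using keys n i xk lk by (metis nth_mem)
  have tk: "take (Suc i) ?k = take i ?k @ [x]" using i lk xk by (simp add: take_Suc_conv_app_nth)
  have LR: "length (?L i) + length (?R i) = i"
   using sum_length_filter_compl[of bt "take i ?k"] i lk by simp
  have ui: "ub c i" if "1 \<le> c" for c using ub_mono[OF ub_le[OF mm] that, of i] i by simp
  have umm: "ub c mm" if "1 \<le> c" for c using ub_mono[OF mm that] .
  have uL: "ub c (length (?L i))" "ub c (length (?R i))" if "1 \<le> c" for c
   using ub_le[OF ui[OF that]] LR by auto
  have ua: "ub c a" if "60 \<le> c" for c using ub_mono[OF a(2) that] .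
  have hv: "hash_val H ks g sd x = of_bool (bt x)" using xn n by (simp add: hash_val_def bt_def)
  have "runs w H ks t_body s 50 (?I (Suc i))"
  proof (rule runs_den)
   have s1: "den w H ks (Seq (asg 40 (Load (plus (vr 34) (vr 36)))) (Hash (Const 39) (vr 33) (vr 40))) s =
    (m'(40 := x, 39 := of_bool (bt x)), g)"
    using m' e by (simp add: s ui ua x hv)
   have "den w H ks t_body s = den w H ks (Seq (Cond (vr 39) (Seq (Store (vr 38) (vr 40)) (inc 38)) (Seq (Store (vr 37) (vr 40)) (inc 37))) (inc 36)) (m'(40 := x, 39 := of_bool (bt x)), g)"
    using s1 by (simp only: t_body_def den.simps(4))
   also have "... = (if bt x then m'(40 := x, 39 := 1, m' 38 := x, 38 := Suc (m' 38), 36 := Suc i)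
    else m'(40 := x, 39 := 0, m' 37 := x, 37 := Suc (m' 37), 36 := Suc i), g)"
    using m' a(1) U by (simp add: ui ua umm uL)
   finally have den: "den w H ks t_body s = (if bt x then m'(40 := x, 39 := 1, m' 38 := x, 38 := Suc (m' 38), 36 := Suc i)
    else m'(40 := x, 39 := 0, m' 37 := x, 37 := Suc (m' 37), 36 := Suc i), g)" .
   have Llt: "length (?L i) < mm" "length (?R i) < mm" using LR i by auto
   show "?I (Suc i) (den w H ks t_body s)"
   proof (cases "bt x")
    case True
    have L: "?L (Suc i) = ?L i" and R: "?R (Suc i) = ?R i @ [x]" using True by (simp_all add: tk)
    let ?m = "m'(40 := x, 39 := 1, m' 38 := x, 38 := Suc (m' 38), 36 := Suc i)"
    have "(\<forall>t<length (?L i). ?m (a + UU + t) = ?L i ! t) & (\<forall>t<length (?R i @ [x]). ?m (a + UU + mm div 2 + t) = (?R i @ [x]) ! t)"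
     if "length (?L i) \<le> mm div 2"
     using ct that m'(3) a(1) U by (auto simp: nth_append less_Suc_eq)
    moreover have "?m b = m b" if "b \<notin> {36, 37, 38, 39, 40}" "~ (a + UU \<le> b & b < a + UU + mm + mm div 2)" for b
     using fr[OF that] that m'(3) Llt by auto
    moreover have "?m 36 = Suc i" "?m 37 = a + UU + length (?L i)" "?m 38 = a + UU + mm div 2 + length (?R i @ [x])"
     using m' a(1) U by auto
    ultimately have "J (Suc i) ?m" unfolding J_def L R by blast
    thus ?thesis unfolding den using True by simp
   next
    case False
    have R: "?R (Suc i) = ?R i" and L: "?L (Suc i) = ?L i @ [x]" using False by (simp_all add: tk)
    let ?m = "m'(40 := x, 39 := 0, m' 37 := x, 37 := Suc (m' 37), 36 := Suc i)"
    have "(\<forall>t<length (?L i @ [x]). ?m (a + UU + t) = (?L i @ [x]) ! t) & (\<forall>t<length (?R i). ?m (a + UU + mm div 2 + t) = ?R i ! t)"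
     if "length (?L i @ [x]) \<le> mm div 2"
     using ct that m'(2) a(1) U by (auto simp: nth_append less_Suc_eq)
    moreover have "?m b = m b" if "b \<notin> {36, 37, 38, 39, 40}" "~ (a + UU \<le> b & b < a + UU + mm + mm div 2)" for b
     using fr[OF that] that m'(2) Llt by auto
    moreover have "?m 36 = Suc i" "?m 38 = a + UU + mm div 2 + length (?R i)" "?m 37 = a + UU + length (?L i @ [x])"
     using m' a(1) U by auto
    ultimately have "J (Suc i) ?m" unfolding J_def L R by blast
    thus ?thesis unfolding den using False by simp
   qed
  qed (simp_all add: t_body_def)
  thus "aval w (fst s) (less (vr 36) (vr 35)) ~= 0 & runs w H ks t_body s 50 (?I (Suc i))"
   using i m' e by (simp add: s)
 next
  fix s assume I: "?I mm s"
  then obtain m' where s: "s = (m', g)" and J: "J mm m'" by blast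
  note c = J[unfolded J_def]
  have m': "m' 36 = mm" by (rule c[THEN conjunct1])
  have "m' 35 = m 35" by (rule c[THEN conjunct2, THEN conjunct2, THEN conjunct2, THEN conjunct2, rule_format]) (use a U in auto)
  hence "m' 35 = mm" using m by simp
  thus "aval w (fst s) (less (vr 36) (vr 35)) = 0" using m' by (simp add: s)
  have tk: "take mm ?k = ?k" using lk by simp
  show "\<exists>m' :: memory. s = (m', g) & m' 38 = a + UU + mm div 2 + length (filter bt (kl m)) &
   (length (filter (%x. ~ bt x) (kl m)) \<le> mm div 2 -->
   (\<forall>t<length (filter (%x. ~ bt x) (kl m)). m' (a + UU + t) = filter (%x. ~ bt x) (kl m) ! t) &
   (\<forall>t<length (filter bt (kl m)). m' (a + UU + mm div 2 + t) = filter bt (kl m) ! t)) &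
   (\<forall>b::nat. b \<notin> {36, 37, 38, 39, 40} --> ~ (a + UU \<le> b & b < a + UU + mm + mm div 2) --> m' b = m b)"
   using s c[THEN conjunct2, THEN conjunct2, unfolded tk] by (intro exI[of _ m'] conjI) (rule s | erule conjunct1 conjunct2 | blast)+
 qed simp
qed

end

definition final :: "nat => mstate => bool" where
 "final n sm \<longleftrightarrow> (case sm of (v, win, md, fu, st) => n \<le> v \<or> st ~= 0)"

definition is_test :: "mstate => bool" where
 "is_test sm \<longleftrightarrow> (case sm of (v, win, md, fu, st) => md ~= 1 & fu ~= 0)"

text \<open>The three numbers are the weight of the tests, their number, and the number of all other
  steps. A run may stop anywhere, so runs can be composed.\<close>

inductive ms :: "nat => nat => (nat => nat) => (nat => nat) => ((nat => nat) => nat => bool) => (nat => nat) =>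
  mstate => nat => nat => nat => mstate => bool"
 for n W sh ic ts wt where
 stop: "ms n W sh ic ts wt sm 0 0 0 sm"
| go: "~ final n sm ==> ms n W sh ic ts wt (mstep W sh ic ts sm) A a k sm' ==>
  ms n W sh ic ts wt sm (A + (if is_test sm then wt (fst sm) else 0)) (a + (if is_test sm then 1 else 0))
   (k + (if is_test sm then 0 else 1)) sm'"

lemma ms_trans:
 assumes "ms n W sh ic ts wt sm A a k sm'" "ms n W sh ic ts wt sm' A' a' k' sm''"
 shows "ms n W sh ic ts wt sm (A + A') (a + a') (k + k') sm''"
 using assms
proof (induction rule: ms.induct)
 case (go sm A a k sm')
 from ms.go[OF go.hyps(1) go.IH[OF go.prems]] show ?case by (simp add: ac_simps)
qed simp

text \<open>Amortisation with the potential \<open>v + md\<close>: a test raises it by one, and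
  every other step lowers it by one or sets the failure flag. The assumption \<open>sh 0 = W\<close>
  rules out the truncated subtraction \<open>0 - 1\<close>.\<close>

lemma ms_potential:
 assumes "ms n W sh ic ts wt sm A a k sm'" and sh0: "sh 0 = W" and "fst (snd (snd sm)) \<le> 1"
 shows "k + fst sm' + fst (snd (snd sm')) + snd (snd (snd (snd sm))) \<le>
  fst sm + fst (snd (snd sm)) + 2 * a + snd (snd (snd (snd sm')))"
 using assms(1,3)
proof (induction rule: ms.induct)
 case (go sm A a k sm')
 obtain v win md fu st where sm: "sm = (v, win, md, fu, st)" by (cases sm) auto
 have st: "st = 0" "md \<le> 1" using go.hyps(1) go.prems by (auto simp: sm final_def)
 have v0: "sh v ~= W ==> 0 < v" using sh0 by (cases v) auto
 have "fst (snd (snd (mstep W sh ic ts sm))) \<le> 1" using st by (auto simp: sm mstep_def)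
 note IH = go.IH[OF this]
 show ?case using IH st v0 unfolding sm mstep_def is_test_def
  by (auto split: if_splits)
qed simp

section \<open>Simulation of the search machine in memory\<close>

context ram
begin

text \<open>Within a batch every node owns a block of \<open>2 ^ (64 * (d + 1))\<close> seeds, so
  different nodes use independent hash functions even if their windows are equal.\<close>

definition tau :: "nat => nat => nat => 'k => bool" where
 "tau g v c = H (prod_encode (g, v * 2 ^ (64 * (d + 1)) + c))"

definition addr :: "nat => nat" where
 "addr u = (8 + floor_log u) * UU + (u - 2 ^ floor_log u) * 2 ^ (d - floor_log u)"

text \<open>Valid key lists are demanded for the root and for the children of nodes before
  \<open>v\<close>, whose windows are currently accepted. A bijection suffices, since the order of a
  list has no influence on the tests.\<close>

definition REG :: "memory => nat => (nat => nat) => nat => bool" where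
 "REG m g win v \<longleftrightarrow> (\<forall>u. 1 \<le> u --> u < 2 * 2 ^ d --> u div 2 < v -->
  bij_betw (%t. m (addr u + t)) {..<2 ^ (d - floor_log u)} (Xset (tau g) ks win u))"

definition SIM :: "nat => nat => mstate => memory => bool" where
 "SIM y g sm m \<longleftrightarrow> (case sm of (v, win, md, fu, st) =>
  PRE y m & m 9 = fu & m 10 = v & m 11 = md & m 12 = st & 1 \<le> v & v \<le> 2 ^ d & md \<le> 1 & st \<le> 1 & fu \<le> 2 ^ (8 * (d + 1)) &
  (\<forall>u. 1 \<le> u --> u \<le> v --> u < 2 ^ d --> m (6 * UU + u) = win u & win u < 2 ^ (64 * (d + 1))) &
  REG m g win v)"

lemma PRE_cong:
 assumes "!!b. b \<notin> {9, 10, 11, 12, 13, 14, 33, 34, 35, 36, 37, 38, 39, 40} ==> b < 6 * UU \<or> 8 * UU \<le> b & b < 9 * UU ==> m' b = m b"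
  and P: "PRE y m"
 shows "PRE y m'"
proof -
 have U: "64 + 4 * d < UU" by (rule d4_UU)
 have 1: "P0 y m'" 
 proof -
  have "P0 y m' = P0 y m" by (rule P0_cong) (use U in \<open>auto intro!: assms(1)\<close>)
  thus ?thesis using P by (simp add: PRE_def)
 qed
 have 2: "m' 27 = OFF d y (Suc d)" using assms(1)[of 27] P U by (simp add: PRE_def)
 have 3: "node_ok y k q m'" if "k \<in> {1..d}" "q < 2 ^ (d - k)" for k q
 proof -
  have b: "2 ^ (d - k) + q < UU" using that by (intro node_bound) auto
  have "m' b = m b" if "b \<in> nodecells k q" for b
   by (rule assms(1)) (use that b U in \<open>auto simp: nodecells_iff Let_def\<close>)
  hence "node_ok y k q m' = node_ok y k q m" by (simp add: node_ok_def nodecells_iff Let_def)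
  thus ?thesis using P that by (simp add: PRE_def)
 qed
 have 4: "hdr_ok y k m'" if "k \<in> {1..d}" for k
 proof -
  let ?b = "64 + 4 * (d - k)"
  have "?b + 3 < UU" using U that by auto
  hence e: "m' b = m b" if "b \<in> {?b, ?b + 1, ?b + 2, ?b + 3}" for b using that by (intro assms(1)) auto
  show ?thesis using P that e[of ?b] e[of "?b + 1"] e[of "?b + 2"] e[of "?b + 3"] by (simp add: PRE_def hdr_ok_def Let_def)
 qed
 have dU: "(2::nat) ^ d < UU" by (rule less_UU[where a = 1]) auto
 have 5: "m' (8 * UU + v) = v" if "v < 2 ^ d" for v
  using assms(1)[of "8 * UU + v"] that dU P U by (simp add: PRE_def)
 have 6: "m' b = 0" if "64 + 4 * d \<le> b" "b < UU" for b
  using assms(1)[of b] that P by (auto simp: PRE_def)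
 show ?thesis unfolding PRE_def using 1 2 3 4 5 6 by blast
qed

lemma addr_decomp:
 assumes "1 \<le> u" "floor_log u \<le> d" "t < 2 ^ (d - floor_log u)"
 shows "(u - 2 ^ floor_log u) * 2 ^ (d - floor_log u) + t < 2 ^ d"
proof -
 have "u - 2 ^ floor_log u + 1 \<le> 2 ^ floor_log u" using floor_log_bounds[of u] assms(1) by simp
 hence "(u - 2 ^ floor_log u + 1) * 2 ^ (d - floor_log u) \<le> 2 ^ floor_log u * 2 ^ (d - floor_log u)" by (rule mult_le_mono1)
 also have "... = 2 ^ d" using assms(2) by (simp flip: power_add)
 finally show ?thesis using assms(3) by (simp add: algebra_simps)
qed

lemma floor_log_le_d: "1 \<le> u ==> u < 2 * 2 ^ d ==> floor_log u \<le> d"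
 using floor_log_less[of u "Suc d"] by simp

lemma pow_d_UU: "4 * 2 ^ d < UU"
 by (rule less_UU[where a = 4]) simp_all

text \<open>A test at \<open>v\<close> writes, overflow included, from the start of the list of its
  left child onwards. On that level the lists of children of earlier nodes lie entirely before this
  point; all other levels have blocks of their own.\<close>

lemma addr_disj:
 assumes u: "1 \<le> u" "u < 2 * 2 ^ d" "u div 2 < v" and v: "v < 2 ^ d"
  and t: "t < 2 ^ (d - floor_log u)"
 defines "mm \<equiv> 2 ^ (d - floor_log v)"
 shows "~ (addr v + UU \<le> addr u + t & addr u + t < addr v + UU + mm + mm div 2)"
proof
 assume A: "addr v + UU \<le> addr u + t & addr u + t < addr v + UU + mm + mm div 2"
 have v1: "1 \<le> v" using u by simp
 let ?j = "floor_log v" and ?i = "floor_log u"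
 have j: "?j < d" using floor_log_less[OF v1 v] .
 have i: "?i \<le> d" by (rule floor_log_le_d[OF u(1,2)])
 have mm: "0 < mm" "mm \<le> 2 ^ d" unfolding mm_def by (auto intro: power_increasing)
 let ?r = "(u - 2 ^ ?i) * 2 ^ (d - ?i) + t" and ?s = "(v - 2 ^ ?j) * mm"
 have r: "?r < 2 ^ d" by (rule addr_decomp[OF u(1) i t])
 have s: "?s + 0 < 2 ^ d" unfolding mm_def by (rule addr_decomp[OF v1]) (use j in auto)
 obtain x where x: "addr u + t = addr v + UU + x" "x < mm + mm div 2" using A by (metis add.assoc le_iff_add nat_add_left_cancel_less)
 have e: "(8 + ?i) * UU + ?r = (9 + ?j) * UU + (?s + x)"
  using x(1) unfolding addr_def mm_def by (simp add: algebra_simps)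
 have sx: "?s + x < UU" using s x(2) mm pow_d_UU by linarith
 have rU: "?r < UU" using r pow_d_UU by linarith
 have "8 + ?i = ((8 + ?i) * UU + ?r) div UU" using rU by simp
 also have "... = 9 + ?j" unfolding e using sx by simp
 finally have ij: "?i = Suc ?j" by simp
 hence rs: "?r = ?s + x" using e by simp
 let ?p = "u div 2"
 have p1: "1 \<le> ?p" using ij u(1) by (cases "u = 1") auto
 have fp: "floor_log ?p = ?j" using ij floor_log_half[of u] by simp
 have pj: "2 ^ ?j \<le> ?p" using floor_log_bounds(1)[OF p1] fp by simp
 have h: "mm = 2 * 2 ^ (d - ?i)" unfolding mm_def ij using j by (simp flip: power_Suc add: Suc_diff_Suc)
 have "u - 2 ^ ?i + 1 \<le> 2 * (?p - 2 ^ ?j + 1)" unfolding ij using pj by simp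
 hence "(u - 2 ^ ?i + 1) * 2 ^ (d - ?i) \<le> 2 * (?p - 2 ^ ?j + 1) * 2 ^ (d - ?i)" by (rule mult_le_mono1)
 also have "... = (?p - 2 ^ ?j + 1) * mm" by (simp add: h)
 also have "... \<le> ?s" using u(3) pj by (intro mult_le_mono1) simp
 finally show False using rs t by (simp add: algebra_simps)
qed

lemma node_vals:
 assumes P: "PRE y m" and v: "1 \<le> v" "v < 2 ^ d"
 shows "m (UU + v) = shf d y v" "m (2 * UU + v) = incf d y v" "m (3 * UU + v) = addr v"
  "m (4 * UU + v) = 2 ^ (d - floor_log v)" "m (5 * UU + v) = posf d y v"
proof -
 let ?j = "floor_log v" and ?q = "v - 2 ^ floor_log v"
 have j: "?j < d" using floor_log_less[OF v] .
 have q: "?q < 2 ^ ?j" "2 ^ ?j + ?q = v" using floor_log_bounds[of v] v by auto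
 have "node_ok y (d - ?j) ?q m" using P j q by (simp add: PRE_def)
 thus "m (UU + v) = shf d y v" "m (2 * UU + v) = incf d y v" "m (3 * UU + v) = addr v"
  "m (4 * UU + v) = 2 ^ (d - floor_log v)" "m (5 * UU + v) = posf d y v"
  using j q by (simp_all add: node_ok_def Let_def shf_def incf_def posf_def addr_def)
qed

lemma incf_le: "incf d y v \<le> 2 ^ (64 * (d + 1))"
 unfolding incf_def incq_def by (auto intro: power_increasing)

definition adv_prog :: com where
 "adv_prog = Seq (asg 14 (plus (Load (arr 6 (vr 10))) (Load (arr 2 (vr 10)))))
  (Cond (less (vr 14) (pow2 (vr 5))) (Seq (Store (arr 6 (vr 10)) (vr 14)) (asg 11 (Const 0)))
   (Cond (Op Equal (Load (arr 1 (vr 10))) (vr 5)) (asg 12 (Const 1)) (asg 10 (minus (vr 10) (Const 1)))))"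

lemma REG_cong:
 assumes "!!u t. 1 \<le> u ==> u < 2 * 2 ^ d ==> u div 2 < v ==> t < 2 ^ (d - floor_log u) ==> m' (addr u + t) = m (addr u + t)"
  and "!!u. 1 \<le> u ==> u < v ==> win' u = win u" and R: "REG m g win v"
 shows "REG m' g win' v"
 unfolding REG_def
proof (intro allI impI)
 fix u assume u: "1 \<le> u" "u < 2 * 2 ^ d" "u div 2 < v"
 have X: "Xset (tau g) ks win' u = Xset (tau g) ks win u" by (rule Xset_cong) (use u assms(2) in auto)
 have "bij_betw (%t. m (addr u + t)) {..<2 ^ (d - floor_log u)} (Xset (tau g) ks win u)" using R u by (simp add: REG_def)
 thus "bij_betw (%t. m' (addr u + t)) {..<2 ^ (d - floor_log u)} (Xset (tau g) ks win' u)"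
  unfolding X by (subst bij_betw_cong[of _ _ "%t. m (addr u + t)"]) (use assms(1) u in auto)
qed

lemma addr_ge: "8 * UU \<le> addr u"
 unfolding addr_def by (simp add: add_mult_distrib)

lemma sim_adv:
 assumes S: "SIM y g (v, win, 1, fu, 0) m" and v: "v < 2 ^ d"
 shows "runs w H ks adv_prog (m, g) 80 (%s. \<exists>m' :: memory. s = (m', g) & SIM y g (mstep (64 * (d + 1)) (shf d y) (incf d y) ts (v, win, 1, fu, 0)) m')"
proof -
 let ?W = "64 * (d + 1)"
 have P: "PRE y m" and m: "m 9 = fu" "m 10 = v" "m 11 = 1" "m 12 = 0" and v1: "1 \<le> v" and fu: "fu \<le> 2 ^ (8 * (d + 1))"
  and win: "!!u. 1 \<le> u ==> u \<le> v ==> u < 2 ^ d ==> m (6 * UU + u) = win u & win u < 2 ^ ?W" and R: "REG m g win v"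
  using S by (auto simp: SIM_def)
 have P0: "m 5 = ?W" "m 6 = UU" using P by (auto simp: PRE_def P0_def)
 note nv = node_vals[OF P v1 v]
 have U: "64 < UU" "4 * 2 ^ d < UU" using d4_UU pow_d_UU by auto
 have vU: "v < UU" using v U by simp
 have uv: "ub c v" if "1 \<le> c" for c by (rule ub_le[OF ub_mono[OF ub_pow that, of d]]) (use v in auto)
 have uw: "ub c (win v)" if "64 \<le> c" for c
  by (rule ub_mono[OF _ that]) (use win[OF v1 order_refl v] in \<open>simp add: ub_def\<close>)
 have ui: "ub c (incf d y v)" if "64 \<le> c" for c
  by (rule ub_mono[OF _ that]) (use incf_le[of y v] in \<open>simp add: ub_def\<close>)
 have uW: "ub c ((2::nat) ^ (64 + 64 * d))" if "64 \<le> c" for c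
  by (rule ub_mono[OF ub_pow that]) simp
 have wv: "m (6 * UU + v) = win v" using win[OF v1 order_refl v] by simp
 have d1: "den w H ks (asg 14 (plus (Load (arr 6 (vr 10))) (Load (arr 2 (vr 10))))) (m, g) = (m(14 := win v + incf d y v), g)"
  using m P0 nv wv by (simp add: uv uw ui)
 let ?m1 = "m(14 := win v + incf d y v)"
 have "den w H ks adv_prog (m, g) = (if win v + incf d y v < 2 ^ ?W then ?m1(6 * UU + v := win v + incf d y v, 11 := 0)
  else if shf d y v = ?W then ?m1(12 := 1) else ?m1(10 := v - 1), g)"
  unfolding adv_prog_def den.simps(4)[of w H ks "asg 14 (plus (Load (arr 6 (vr 10))) (Load (arr 2 (vr 10))))"] d1
  using m P0 nv wv U by (simp add: ev uv uw ui uW)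
 moreover have "SIM y g (mstep ?W (shf d y) (incf d y) ts (v, win, 1, fu, 0)) (if win v + incf d y v < 2 ^ ?W then ?m1(6 * UU + v := win v + incf d y v, 11 := 0)
  else if shf d y v = ?W then ?m1(12 := 1) else ?m1(10 := v - 1))"
 proof (cases "win v + incf d y v < 2 ^ ?W")
  case True
  let ?m = "?m1(6 * UU + v := win v + incf d y v, 11 := 0)" and ?win = "win(v := win v + incf d y v)"
  have "PRE y ?m" by (rule PRE_cong[OF _ P]) (use U vU in auto)
  moreover have "REG ?m g ?win v"
  proof (rule REG_cong[OF _ _ R])
   fix u t show "?m (addr u + t) = m (addr u + t)" using addr_ge[of u] U vU by auto
  qed auto
  moreover have "?m (6 * UU + u) = ?win u & ?win u < 2 ^ ?W" if "1 \<le> u" "u \<le> v" "u < 2 ^ d" for u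
   using win[OF that] U True by auto
  moreover have "?m 9 = fu" "?m 10 = v" "?m 11 = 0" "?m 12 = 0" using m U by auto
  ultimately have "SIM y g (v, ?win, 0, fu, 0) ?m" unfolding SIM_def using v1 v fu by auto
  thus ?thesis using True by (simp add: mstep_def)
 next
  case False
  show ?thesis
  proof (cases "shf d y v = ?W")
   case True
   let ?m = "?m1(12 := 1)"
   have "PRE y ?m" by (rule PRE_cong[OF _ P]) auto
   moreover have "REG ?m g win v"
   proof (rule REG_cong[OF _ _ R])
    fix u t show "?m (addr u + t) = m (addr u + t)" using addr_ge[of u] U by auto
   qed auto
   moreover have "?m (6 * UU + u) = win u & win u < 2 ^ ?W" if "1 \<le> u" "u \<le> v" "u < 2 ^ d" for u
    using win[OF that] U by auto
   moreover have "?m 9 = fu" "?m 10 = v" "?m 11 = 1" "?m 12 = 1" using m U by auto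
   ultimately have "SIM y g (v, win, 1, fu, 1) ?m" unfolding SIM_def using v1 v fu by auto
   thus ?thesis using True False by (simp add: mstep_def)
  next
   case F2: False
   \<comment> \<open>Node 1 starts a segment, so the machine never steps back out of the
     tree.\<close>
   have "shf d y 1 = ?W" by (simp add: shf_def shq_def)
   hence v2: "1 \<le> v - 1" using F2 v1 by (cases "v = 1") auto
   let ?m = "?m1(10 := v - 1)"
   have "PRE y ?m" by (rule PRE_cong[OF _ P]) auto
   moreover have "REG ?m g win (v - 1)"
   proof (rule REG_cong)
    fix u t show "?m (addr u + t) = m (addr u + t)" using addr_ge[of u] U by auto
    show "REG m g win (v - 1)" using R unfolding REG_def by auto
   qed auto
   moreover have "?m (6 * UU + u) = win u & win u < 2 ^ ?W" if "1 \<le> u" "u \<le> v - 1" "u < 2 ^ d" for u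
    using win[of u] that U by auto
   moreover have "?m 9 = fu" "?m 10 = v - 1" "?m 11 = 1" "?m 12 = 0" using m U by auto
   ultimately have "SIM y g (v - 1, win, 1, fu, 0) ?m" unfolding SIM_def using v2 v fu by auto
   thus ?thesis using F2 False by (simp add: mstep_def)
  qed
 qed
 ultimately have *: "\<exists>m' :: memory. den w H ks adv_prog (m, g) = (m', g) & SIM y g (mstep ?W (shf d y) (incf d y) ts (v, win, 1, fu, 0)) m'"
  by (intro exI conjI)
 show ?thesis
 proof (rule runs_den)
  show "loop_free adv_prog" "tb adv_prog \<le> 80" by (simp_all add: adv_prog_def)
 qed (rule *)
qed

definition setup_prog :: com where
 "setup_prog = seqs [asg 9 (minus (vr 9) (Const 1)), asg 33 (plus (Op Shl (vr 10) (vr 5)) (Load (arr 6 (vr 10)))),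
  asg 34 (Load (arr 3 (vr 10))), asg 35 (Load (arr 4 (vr 10))), asg 36 (Const 0), asg 37 (plus (vr 34) (vr 6)),
  asg 38 (plus (vr 37) (Op Shr (vr 35) (Const 1)))]"

definition verdict_prog :: com where
 "verdict_prog = Cond (Op Equal (vr 38) (plus (plus (vr 34) (vr 6)) (vr 35)))
  (Seq (inc 10) (Store (arr 6 (vr 10)) (Op Shr (Load (minus (arr 6 (vr 10)) (Const 1))) (Load (arr 1 (vr 10)))))) (asg 11 (Const 1))"

definition test_prog :: com where
 "test_prog = Cond (vr 9) (Seq setup_prog (Seq t_loop verdict_prog)) (asg 12 (Const 1))"

lemma Xset_1: "length ks = 2 ^ d ==> Xset tu ks win 1 = {..<2 ^ d}"
 by (auto simp: Xset_def)

lemma addr_child: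
 assumes "1 \<le> v" "v < 2 ^ d" "b \<le> 1"
 shows "addr (2 * v + b) = addr v + UU + b * 2 ^ (d - Suc (floor_log v))" "floor_log (2 * v + b) = Suc (floor_log v)"
proof -
 let ?j = "floor_log v"
 show fl: "floor_log (2 * v + b) = Suc ?j" using assms floor_log_rec[of "2 * v + b"] by simp
 have j: "?j < d" using floor_log_less[OF assms(1,2)] .
 have h: "(2::nat) ^ (d - ?j) = 2 * 2 ^ (d - Suc ?j)" using j by (simp flip: power_Suc add: Suc_diff_Suc)
 have "2 * v + b - 2 ^ Suc ?j = 2 * (v - 2 ^ ?j) + b" using floor_log_bounds(1)[OF assms(1)] by simp
 thus "addr (2 * v + b) = addr v + UU + b * 2 ^ (d - Suc ?j)"
  unfolding addr_def fl h by (simp add: algebra_simps)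
qed

text \<open>Testing is partitioning. The split is perfect exactly if the pointer for right keys ends
  at the end of the children's block, and then both lists are already in place. Otherwise the damage
  concerns only lists that \<open>REG\<close> does not cover, by \<open>addr_disj\<close>.\<close>

lemma sim_test:
 assumes S: "SIM y g (v, win, 0, fu, 0) m" and v: "v < 2 ^ d" and n: "length ks = 2 ^ d"
 shows "runs w H ks test_prog (m, g) (if fu = 0 then 30 else 60 * 2 ^ (d - floor_log v) + 200) (%s. \<exists>m' :: memory. s = (m', g) &
  SIM y g (mstep (64 * (d + 1)) (shf d y) (incf d y) (tst (tau g) ks) (v, win, 0, fu, 0)) m')"
proof -
 let ?W = "64 * (d + 1)" and ?j = "floor_log v"
 let ?ts = "tst (tau g) ks"
 have P: "PRE y m" and m: "m 9 = fu" "m 10 = v" "m 11 = 0" "m 12 = 0" and v1: "1 \<le> v" and fu: "fu \<le> 2 ^ (8 * (d + 1))"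
  and win: "!!u. 1 \<le> u ==> u \<le> v ==> u < 2 ^ d ==> m (6 * UU + u) = win u & win u < 2 ^ ?W" and R: "REG m g win v"
  using S by (auto simp: SIM_def)
 have P0: "m 5 = ?W" "m 6 = UU" using P by (auto simp: PRE_def P0_def)
 note nv = node_vals[OF P v1 v]
 have U: "64 < UU" "4 * 2 ^ d < UU" using d4_UU pow_d_UU by auto
 have vU: "v < UU" "Suc v < UU" using v U by auto
 have j: "?j < d" using floor_log_less[OF v1 v] .
 define h where "h = (2::nat) ^ (d - Suc ?j)"
 define a where "a = addr v"
 have mm: "(2::nat) ^ (d - ?j) = 2 * h" unfolding h_def using j by (simp flip: power_Suc add: Suc_diff_Suc)
 have uh: "ub c h" if "1 \<le> c" for c unfolding h_def by (rule ub_mono[OF ub_pow that]) simp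
 have ua: "ub c a" if "60 \<le> c" for c
 proof (rule ub_mono[OF _ that])
  have "ub 29 (8 + ?j)" using ub_le[OF ub_d, of 28 ?j] j by simp
  moreover have "ub 59 ((v - 2 ^ ?j) * 2 ^ (d - ?j))"
   by (rule ub_le[of _ "2 ^ d"]) (use addr_decomp[OF v1, of 0] j in simp_all)
  ultimately show "ub 60 a" unfolding a_def addr_def by simp
 qed
 have uv: "ub c v" if "1 \<le> c" for c by (rule ub_le[OF ub_mono[OF ub_pow that, of d]]) (use v in auto)
 have uw: "ub c (win v)" if "64 \<le> c" for c
  by (rule ub_mono[OF _ that]) (use win[OF v1 order_refl v] in \<open>simp add: ub_def\<close>)
 have ufu: "ub c fu" if "8 \<le> c" for c by (rule ub_mono[OF _ that]) (use fu in \<open>simp add: ub_def\<close>)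
 have uW: "ub c ((2::nat) ^ (64 + 64 * d))" if "64 \<le> c" for c by (rule ub_mono[OF ub_pow that]) simp
 have wv: "m (6 * UU + v) = win v" using win[OF v1 order_refl v] by simp
 have aU: "8 * UU \<le> a" unfolding a_def by (rule addr_ge)
 show ?thesis
 proof (cases "fu = 0")
  case True
  let ?m = "m(12 := 1)"
  have "PRE y ?m" by (rule PRE_cong[OF _ P]) auto
  moreover have "REG ?m g win v"
  proof (rule REG_cong[OF _ _ R])
   fix u t show "?m (addr u + t) = m (addr u + t)" using addr_ge[of u] U by auto
  qed auto
  moreover have "?m (6 * UU + u) = win u & win u < 2 ^ ?W" if "1 \<le> u" "u \<le> v" "u < 2 ^ d" for u
   using win[OF that] U by auto
  moreover have "?m 9 = fu" "?m 10 = v" "?m 11 = 0" "?m 12 = 1" using m U by auto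
  ultimately have "SIM y g (v, win, 0, fu, 1) ?m" unfolding SIM_def using v1 v fu by auto
  hence "SIM y g (mstep ?W (shf d y) (incf d y) ?ts (v, win, 0, fu, 0)) ?m" using True by (simp add: mstep_def)
  hence Q: "\<exists>m' :: memory. den w H ks (asg 12 (Const 1)) (m, g) = (m', g) & SIM y g (mstep ?W (shf d y) (incf d y) ?ts (v, win, 0, fu, 0)) m'"
   by simp
  show ?thesis unfolding test_prog_def
  proof (rule runs_Cond[where ?T1.0 = 10])
   show "runs w H ks (asg 12 (Const 1)) (m, g) 10 (%s. \<exists>m' :: memory. s = (m', g) & SIM y g (mstep ?W (shf d y) (incf d y) ?ts (v, win, 0, fu, 0)) m')"
    by (rule runs_den) (use Q in simp_all)
  qed (use m True in simp_all)
 next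
  case False
  let ?sd = "v * 2 ^ ?W + win v"
  let ?m1 = "m(9 := fu - 1, 33 := ?sd, 34 := a, 35 := 2 * h, 36 := 0, 37 := a + UU, 38 := a + UU + h)"
  have d1: "den w H ks setup_prog (m, g) = (?m1, g)"
   using m P0 nv wv U aU False mm by (simp add: setup_prog_def ev uv uw ufu ua uh uW a_def[symmetric])
  let ?kl = "map (%t. ?m1 (a + t)) [0..<2 * h]"
  let ?bt = "%x. H (prod_encode (g, ?sd)) (ks ! x)"
  let ?X = "Xset (tau g) ks win v"
  have btt: "H (prod_encode (g, ?sd)) = tau g v (win v)" by (simp add: tau_def)
  have kl: "?kl = map (%t. m (a + t)) [0..<2 * h]" using aU U by auto
  have bij: "bij_betw (%t. m (a + t)) {..<2 * h} ?X"
  proof -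
   have "v div 2 < v" "v < 2 * 2 ^ d" using v1 v by auto
   thus ?thesis using R v1 unfolding REG_def a_def mm[symmetric] by blast
  qed
  have kd: "distinct ?kl" and ks: "set ?kl = ?X"
   unfolding kl using bij by (auto simp: distinct_map bij_betw_def atLeast0LessThan)
  have cX: "card ?X = 2 * h" using distinct_card[OF kd] ks by simp
  define L where "L = filter (%x. ~ ?bt x) ?kl"
  define R' where "R' = filter ?bt ?kl"
  have sL: "set L = {x \<in> ?X. ~ ?bt x}" unfolding L_def set_filter ks ..
  have sR: "set R' = {x \<in> ?X. ?bt x}" unfolding R'_def set_filter ks ..
  have dL: "distinct L" and dR: "distinct R'" unfolding L_def R'_def using kd by (auto intro: distinct_filter)
  have LR: "length L + length R' = 2 * h" unfolding L_def R'_def using sum_length_filter_compl[of ?bt ?kl] by simp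
  have tsR: "?ts win v \<longleftrightarrow> length R' = h"
  proof -
   have "{i \<in> ?X. tau g v (win v) (ks ! i)} = set R'" unfolding sR btt ..
   hence "card {i \<in> ?X. tau g v (win v) (ks ! i)} = length R'" using distinct_card[OF dR] by simp
   thus ?thesis by (simp add: tst_def cX)
  qed
  have h2: "2 * h div 2 = h" by simp
  have T: "runs w H ks t_loop (?m1, g) (60 * (2 * h) + 20) (%s. \<exists>m' :: memory. s = (m', g) &
   m' 38 = a + UU + (2 * h) div 2 + length R' &
   (length L \<le> (2 * h) div 2 --> (\<forall>t<length L. m' (a + UU + t) = L ! t) & (\<forall>t<length R'. m' (a + UU + (2 * h) div 2 + t) = R' ! t)) &
   (\<forall>b::nat. b \<notin> {36, 37, 38, 39, 40} --> ~ (a + UU \<le> b & b < a + UU + 2 * h + (2 * h) div 2) --> m' b = ?m1 b))"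
   unfolding L_def R'_def
  proof (rule t_runs)
   show "?m1 6 = UU" using P0 by simp
   show "UU \<le> a" using aU by simp
   show "ub 60 a" by (rule ua) simp
   show "ub 1 (2 * h)" unfolding mm[symmetric] by (rule ub_pow) simp
   show "\<forall>x\<in>set ?kl. x < length ks" unfolding ks by (simp add: Xset_def)
  qed (use n in simp_all)
  have V: "runs w H ks verdict_prog (m', g) 80 (%s. \<exists>m' :: memory. s = (m', g) & SIM y g (mstep ?W (shf d y) (incf d y) ?ts (v, win, 0, fu, 0)) m')"
   if m38: "m' 38 = a + UU + h + length R'"
    and ct: "length L \<le> h ==> (\<forall>t<length L. m' (a + UU + t) = L ! t) & (\<forall>t<length R'. m' (a + UU + h + t) = R' ! t)"
    and fr: "!!b::nat. b \<notin> {36, 37, 38, 39, 40} ==> ~ (a + UU \<le> b & b < a + UU + 2 * h + h) ==> m' b = ?m1 b"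
   for m' :: memory
  proof -
   have fr1: "m' b = m b" if "b \<notin> {9, 33, 34, 35, 36, 37, 38, 39, 40}" "b < 9 * UU" for b
    using fr[of b] that aU by auto
   have fr2: "m' (addr u + t) = m (addr u + t)" if "1 \<le> u" "u < 2 * 2 ^ d" "u div 2 < v" "t < 2 ^ (d - floor_log u)" for u t
   proof -
    have "~ (a + UU \<le> addr u + t & addr u + t < a + UU + 2 * h + h)"
     using addr_disj[OF that(1-3) v that(4)] unfolding mm a_def by simp
    hence "m' (addr u + t) = ?m1 (addr u + t)" using addr_ge[of u] U by (intro fr) auto
    thus ?thesis using addr_ge[of u] U by auto
   qed
   have e: "m' 34 = a" "m' 35 = 2 * h" "m' 9 = fu - 1" using fr[of 34] fr[of 35] fr[of 9] aU U by auto
   have e2: "m' 6 = UU" "m' 10 = v" "m' 11 = 0" "m' 12 = 0" using fr1 P0 m U by auto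
   have P': "PRE y m'" by (rule PRE_cong[OF _ P]) (use fr1 U in auto)
   have win': "m' (6 * UU + u) = win u & win u < 2 ^ ?W" if "1 \<le> u" "u \<le> v" "u < 2 ^ d" for u
    using fr1[of "6 * UU + u"] win[OF that] that U by auto
   have uR: "ub c (length R')" if "2 \<le> c" for c
    by (rule ub_mono[OF ub_le[of 2 "2 * h"] that]) (use LR uh in simp_all)
   show ?thesis
   proof (cases "length R' = h")
    case True
    define z where "z = take_bit w (drop_bit (m' (UU + Suc v)) (win v))"
    let ?m3 = "m'(10 := Suc v, 6 * UU + Suc v := z)" and ?win = "win(Suc v := win v div 2 ^ shf d y (Suc v))"
    have "den w H ks verdict_prog (m', g) = (?m3, g)"
     using e e2 m38 True win'[OF v1 order_refl v] U
     by (simp add: verdict_prog_def ua uh uv z_def)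
    moreover have "SIM y g (Suc v, ?win, 0, fu - 1, 0) ?m3"
    proof -
     have P3: "PRE y ?m3" by (rule PRE_cong[OF _ P']) (use U vU in auto)
     have R3: "REG ?m3 g ?win (Suc v)" unfolding REG_def
     proof (intro allI impI)
      fix u assume u: "1 \<le> u" "u < 2 * 2 ^ d" "u div 2 < Suc v"
      have X: "Xset (tau g) ks ?win u = Xset (tau g) ks win u" by (rule Xset_cong) (use u in auto)
      have nz: "?m3 (addr u + t) = m' (addr u + t)" for t using addr_ge[of u] U vU by auto
      show "bij_betw (%t. ?m3 (addr u + t)) {..<2 ^ (d - floor_log u)} (Xset (tau g) ks ?win u)"
      proof (cases "u div 2 < v")
       case True
       have "bij_betw (%t. m (addr u + t)) {..<2 ^ (d - floor_log u)} (Xset (tau g) ks win u)" using R u True by (simp add: REG_def)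
       thus ?thesis unfolding X nz by (subst bij_betw_cong[of _ _ "%t. m (addr u + t)"]) (use fr2 u True in auto)
      next
       case False
       define b where "b = u mod 2"
       have b: "u = 2 * v + b" "b \<le> 1" using u(3) False unfolding b_def by (auto, presburger)
       have Lh: "length L = h" using LR True by simp
       have fl: "2 ^ (d - floor_log u) = h" unfolding b(1) addr_child(2)[OF v1 v b(2)] h_def ..
       let ?xs = "if b = 1 then R' else L"
       have xs: "length ?xs = h" "distinct ?xs" using Lh True dL dR by auto
       have ad: "addr u = a + UU + b * h" unfolding b(1) addr_child(1)[OF v1 v b(2)] h_def a_def ..
       note c = ct[OF eq_refl[OF Lh], unfolded Lh True]
       have eq: "m' (addr u + t) = ?xs ! t" if "t \<in> {..<h}" for t
       proof (cases "b = 1")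
        case b1: True
        have "m' (a + UU + h + t) = R' ! t" using c[THEN conjunct2] that by blast
        thus ?thesis unfolding ad using b1 by (simp only: mult_1 if_True simp_thms)
       next
        case b0: False
        hence "b = 0" using b(2) by simp
        have "m' (a + UU + t) = L ! t" using c[THEN conjunct1] that by blast
        thus ?thesis unfolding ad using \<open>b = 0\<close> b0 by (simp only: mult_0 add_0_right if_False simp_thms)
       qed
       have "bij_betw ((!) ?xs) {..<h} (set ?xs)" using bij_betw_nth[OF xs(2) _ refl] xs(1) by simp
       moreover have "set ?xs = Xset (tau g) ks win u"
       proof -
        show ?thesis unfolding b(1) Xset_child[OF v1 b(2)] using sL sR unfolding btt by (cases "b = 1") (simp_all only: if_True if_False simp_thms)
       qed
       ultimately have "bij_betw ((!) ?xs) {..<h} (Xset (tau g) ks win u)" by (simp only:)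
       thus ?thesis unfolding X nz fl using bij_betw_cong[of "{..<h}" "%t. m' (addr u + t)" "(!) ?xs"] eq by blast
      qed
     qed
     have W3: "?m3 (6 * UU + u) = ?win u & ?win u < 2 ^ ?W" if u: "1 \<le> u" "u \<le> Suc v" "u < 2 ^ d" for u
     proof (cases "u = Suc v")
      case True
      have "m' (UU + Suc v) = shf d y (Suc v)" by (rule node_vals(1)[OF P']) (use True u in simp_all)
      moreover have "win v div 2 ^ shf d y (Suc v) < 2 ^ ?W"
       using win[OF v1 order_refl v] by (intro le_less_trans[OF div_le_dividend]) simp
      moreover have "ub 255 (win v div 2 ^ shf d y (Suc v))" by (rule ub_div) (simp add: uw)
      ultimately show ?thesis using True win[OF v1 order_refl v] by (simp add: z_def ev del: add_Suc_right)
     next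
      case False
      thus ?thesis using win'[of u] u U by auto
     qed
     have "?m3 9 = fu - 1" "?m3 10 = Suc v" "?m3 11 = 0" "?m3 12 = 0" using e e2 U by auto
     thus ?thesis unfolding SIM_def using P3 R3 W3 v fu by auto
    qed
    moreover have "mstep ?W (shf d y) (incf d y) ?ts (v, win, 0, fu, 0) = (Suc v, ?win, 0, fu - 1, 0)"
     using tsR True False by (simp add: mstep_def)
    ultimately have *: "\<exists>m'' :: memory. den w H ks verdict_prog (m', g) = (m'', g) & SIM y g (mstep ?W (shf d y) (incf d y) ?ts (v, win, 0, fu, 0)) m''"
     by (intro exI[of _ ?m3]) simp
    show ?thesis
    proof (rule runs_den)
     show "loop_free verdict_prog" "tb verdict_prog \<le> 80" by (simp_all add: verdict_prog_def)
    qed (rule *)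
   next
    case nR: False
    let ?m3 = "m'(11 := 1)"
    have "den w H ks verdict_prog (m', g) = (?m3, g)"
     using e e2 m38 nR by (simp add: verdict_prog_def ua uh uR)
    moreover have "SIM y g (v, win, 1, fu - 1, 0) ?m3"
    proof -
     have P3: "PRE y ?m3" by (rule PRE_cong[OF _ P']) auto
     have R3: "REG ?m3 g win v"
     proof (rule REG_cong[OF _ _ R])
      fix u t :: nat assume "1 \<le> u" "u < 2 * 2 ^ d" "u div 2 < v" "t < 2 ^ (d - floor_log u)"
      thus "?m3 (addr u + t) = m (addr u + t)" using fr2[of u t] addr_ge[of u] U by auto
     qed auto
     have W3: "?m3 (6 * UU + u) = win u & win u < 2 ^ ?W" if u: "1 \<le> u" "u \<le> v" "u < 2 ^ d" for u
      using win'[OF u] U by auto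
     have "?m3 9 = fu - 1" "?m3 10 = v" "?m3 11 = 1" "?m3 12 = 0" using e e2 U by auto
     thus ?thesis unfolding SIM_def using P3 R3 W3 v v1 fu by auto
    qed
    moreover have "mstep ?W (shf d y) (incf d y) ?ts (v, win, 0, fu, 0) = (v, win, 1, fu - 1, 0)"
     using tsR nR False by (simp add: mstep_def)
    ultimately have *: "\<exists>m'' :: memory. den w H ks verdict_prog (m', g) = (m'', g) & SIM y g (mstep ?W (shf d y) (incf d y) ?ts (v, win, 0, fu, 0)) m''"
     by (intro exI[of _ ?m3]) simp
    show ?thesis
    proof (rule runs_den)
     show "loop_free verdict_prog" "tb verdict_prog \<le> 80" by (simp_all add: verdict_prog_def)
    qed (rule *)
   qed
  qed
  show ?thesis unfolding test_prog_def
  proof (rule runs_Cond[where ?T1.0 = "60 * 2 ^ (d - ?j) + 190"])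
   show "runs w H ks (Seq setup_prog (Seq t_loop verdict_prog)) (m, g) (60 * 2 ^ (d - ?j) + 190)
    (%s. \<exists>m' :: memory. s = (m', g) & SIM y g (mstep ?W (shf d y) (incf d y) ?ts (v, win, 0, fu, 0)) m')"
   proof (rule runs_Seq[where R = "%s. s = (?m1, g)" and ?T1.0 = 90, OF runs_den])
    show "loop_free setup_prog" "tb setup_prog \<le> 90" by (simp_all add: setup_prog_def)
    show "den w H ks setup_prog (m, g) = (?m1, g)" by (rule d1)
    fix s assume s: "s = (?m1, g)"
    show "runs w H ks (Seq t_loop verdict_prog) s (60 * 2 ^ (d - ?j) + 100)
     (%s. \<exists>m' :: memory. s = (m', g) & SIM y g (mstep ?W (shf d y) (incf d y) ?ts (v, win, 0, fu, 0)) m')" unfolding s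
    proof (rule runs_Seq[OF T])
     fix s assume A: "\<exists>m' :: memory. s = (m', g) &
      m' 38 = a + UU + (2 * h) div 2 + length R' &
      (length L \<le> (2 * h) div 2 --> (\<forall>t<length L. m' (a + UU + t) = L ! t) & (\<forall>t<length R'. m' (a + UU + (2 * h) div 2 + t) = R' ! t)) &
      (\<forall>b::nat. b \<notin> {36, 37, 38, 39, 40} --> ~ (a + UU \<le> b & b < a + UU + 2 * h + (2 * h) div 2) --> m' b = ?m1 b)"
     then obtain m' :: memory where s: "s = (m', g)" and c: "m' 38 = a + UU + h + length R' &
      (length L \<le> h --> (\<forall>t<length L. m' (a + UU + t) = L ! t) & (\<forall>t<length R'. m' (a + UU + h + t) = R' ! t)) &
      (\<forall>b::nat. b \<notin> {36, 37, 38, 39, 40} --> ~ (a + UU \<le> b & b < a + UU + 2 * h + h) --> m' b = ?m1 b)"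
      unfolding h2 by (elim exE conjE) (rule that, assumption, (rule conjI)?, (assumption | rule conjI)+)
     show "runs w H ks verdict_prog s 80 (%s. \<exists>m' :: memory. s = (m', g) & SIM y g (mstep ?W (shf d y) (incf d y) ?ts (v, win, 0, fu, 0)) m')"
      unfolding s by (rule V[OF c[THEN conjunct1] c[THEN conjunct2, THEN conjunct1, rule_format] c[THEN conjunct2, THEN conjunct2, rule_format]])
    qed (simp add: mm)
   qed simp
  qed (use m False in simp_all)
 qed
qed

definition body_prog :: com where
 "body_prog = Cond (vr 11) adv_prog test_prog"

definition main_prog :: com where
 "main_prog = While (less (plus (vr 10) (times (vr 12) (vr 0))) (vr 0)) body_prog"

text \<open>A test takes time proportional to the number of keys at its node, which is its weight in
  \<open>A\<close>, and any other step takes constant time. The loop guard compares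
  \<open>v + st * n\<close> with \<open>n\<close> and so checks both reasons for stopping at
  once.\<close>

lemma main_runs:
 assumes "ms (2 ^ d) (64 * (d + 1)) (shf d y) (incf d y) (tst (tau g) ks) (%v. 2 ^ (d - floor_log v)) sm A a k sm'"
  and "final (2 ^ d) sm'" and "SIM y g sm m" and n: "length ks = 2 ^ d"
 shows "runs w H ks main_prog (m, g) (300 * (A + k) + 20) (%s. \<exists>m' :: memory. s = (m', g) & SIM y g sm' m')"
 using assms(1-3)
proof (induction arbitrary: m rule: ms.induct)
 case (stop sm)
 obtain v win md fu st where sm: "sm = (v, win, md, fu, st)" by (cases sm) auto
 have c: "m 10 = v" "m 12 = st" "m 0 = 2 ^ d" "v \<le> 2 ^ d" "st \<le> 1" using stop.prems(2) by (auto simp: sm SIM_def PRE_def P0_def)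
 have uv: "ub c v" if "1 \<le> c" for c by (rule ub_le[OF ub_mono[OF ub_pow that, of d]]) (use c in auto)
 have us: "ub c st" for c by (rule ub_le[of c 1]) (use c in auto)
 have "~ v + st * 2 ^ d < 2 ^ d" using stop.prems(1) c(5) by (cases st) (auto simp: final_def sm)
 hence "aval w m (less (plus (vr 10) (times (vr 12) (vr 0))) (vr 0)) = 0" using c by (simp add: uv us)
 thus ?case unfolding main_prog_def using stop.prems(2) by (intro runs_While_done) auto
next
 case (go sm A a k sm')
 obtain v win md fu st where sm: "sm = (v, win, md, fu, st)" by (cases sm) auto
 have nf: "v < 2 ^ d" "st = 0" using go.hyps(1) by (auto simp: final_def sm)
 have c: "m 10 = v" "m 12 = 0" "m 0 = 2 ^ d" "m 11 = md" "md \<le> 1" using go.prems(2) nf by (auto simp: sm SIM_def PRE_def P0_def)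
 have uv: "ub c v" if "1 \<le> c" for c by (rule ub_le[OF ub_mono[OF ub_pow that, of d]]) (use nf in auto)
 let ?mw = "2 ^ (d - floor_log v) :: nat"
 let ?st = "mstep (64 * (d + 1)) (shf d y) (incf d y) (tst (tau g) ks) sm"
 let ?T = "if md = 1 then 90 else if fu = 0 then 40 else 60 * ?mw + 210"
 have body: "runs w H ks body_prog (m, g) ?T (%s. \<exists>m' :: memory. s = (m', g) & SIM y g ?st m')"
 proof (cases "md = 1")
  case True
  have S: "SIM y g (v, win, 1, fu, 0) m" using go.prems(2) True nf by (simp add: sm)
  show ?thesis unfolding body_prog_def
   by (rule runs_Cond[where ?T1.0 = 80]) (use sim_adv[OF S nf(1)] c True nf in \<open>simp_all add: sm\<close>)
 next
  case False
  hence md: "md = 0" using c by simp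
  have S: "SIM y g (v, win, 0, fu, 0) m" using go.prems(2) md nf by (simp add: sm)
  show ?thesis unfolding body_prog_def
   by (rule runs_Cond[where ?T1.0 = "if fu = 0 then 30 else 60 * ?mw + 200"]) (use sim_test[OF S nf(1) n] c md nf in \<open>simp_all add: sm\<close>)
 qed
 show ?case unfolding main_prog_def
 proof (rule runs_While_step[OF _ body])
  show "aval w (fst (m, g)) (less (plus (vr 10) (times (vr 12) (vr 0))) (vr 0)) ~= 0" using c nf by (simp add: uv)
  fix s assume "\<exists>m' :: memory. s = (m', g) & SIM y g ?st m'"
  then obtain m' where s: "s = (m', g)" "SIM y g ?st m'" by blast
  show "runs w H ks (While (less (plus (vr 10) (times (vr 12) (vr 0))) (vr 0)) body_prog) s (300 * (A + k) + 20)
   (%s. \<exists>m' :: memory. s = (m', g) & SIM y g sm' m')"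
   using go.IH[OF go.prems(1) s(2)] unfolding main_prog_def s(1) .
 next
  have "1 \<le> ?mw" by simp
  show "1 + acost (less (plus (vr 10) (times (vr 12) (vr 0))) (vr 0)) + ?T + (300 * (A + k) + 20) \<le>
   300 * (A + (if is_test sm then 2 ^ (d - floor_log (fst sm)) else 0) + (k + (if is_test sm then 0 else 1))) + 20"
  proof (cases "is_test sm")
   case True
   moreover have "37 \<le> 40 * ?mw" using \<open>1 \<le> ?mw\<close> by linarith
   ultimately show ?thesis by (simp add: sm is_test_def)
  next
   case False
   show ?thesis
   proof (cases "md = 1")
    case True
    thus ?thesis using False by simp
   next
    case nmd: False
    hence fu: "fu = 0" "md = 0" using False c by (auto simp: is_test_def sm)
    show ?thesis using False fu by simp
   qed
  qed
 qed
qed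

end

section \<open>The machine performs the depth-first search\<close>

fun chain :: "nat => nat => nat list => bool" where
 "chain W i [] = False"
| "chain W i [c] = (c < 2 ^ W & 2 ^ W \<le> c + i)"
| "chain W i (c # c' # cs) = (c' = c + i & chain W i (c' # cs))"

lemma chain_less: "chain W i cs ==> \<forall>c\<in>set cs. c < 2 ^ W"
proof (induction W i cs rule: chain.induct)
 case (3 W i c c' cs)
 hence "c' < 2 ^ W" "c \<le> c'" by auto
 thus ?case using 3 by auto
qed auto

lemma chain_map:
 assumes "m < F" "c0 + (F - 1) * i < 2 ^ W" "2 ^ W \<le> c0 + F * i"
 shows "chain W i (map (%f. c0 + f * i) [m..<F])"
 using assms(1)
proof (induction "F - m" arbitrary: m)
 case (Suc x)
 show ?case
 proof (cases "Suc m = F")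
  case True
  thus ?thesis using assms(2,3) by (auto simp: add.commute add.left_commute)
 next
  case False
  hence m: "Suc m < F" using Suc by simp
  have "chain W i (map (%f. c0 + f * i) [Suc m..<F])" using Suc m by auto
  moreover have "[m..<F] = m # Suc m # [Suc (Suc m)..<F]" "[Suc m..<F] = Suc m # [Suc (Suc m)..<F]"
   using m by (simp_all add: upt_conv_Cons)
  ultimately show ?thesis by simp
 qed
qed simp

text \<open>In the order of their fresh bits the children of a window form an arithmetic progression
  whose continuation leaves the range. So the machine, which only adds the increment and compares
  with \<open>2 ^ W\<close>, runs through exactly this list.\<close>

lemma chain_kids:
 assumes "b \<le> W" "c < 2 ^ W"
 shows "chain W (2 ^ (W - b)) (kids W b c)"
 unfolding kids_def
proof (rule chain_map)
 have "c div 2 ^ b + (2 ^ b - 1) * 2 ^ (W - b) \<in> set (kids W b c)" unfolding kids_def by (auto simp: image_iff)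
 thus "c div 2 ^ b + (2 ^ b - 1) * 2 ^ (W - b) < 2 ^ W" by (rule kids_less[OF assms])
 have "(2::nat) ^ b * 2 ^ (W - b) = 2 ^ W" using assms(1) by (simp flip: power_add)
 thus "2 ^ W \<le> c div 2 ^ b + 2 ^ b * 2 ^ (W - b)" by simp
qed simp

lemma hd_kids: "hd (kids W b c) = c div 2 ^ b"
 by (simp add: kids_def hd_map)

lemma srch_path:
 assumes "srch W ls cs = (Some p, t)"
 shows "length p = length ls & (\<forall>i<length ls. fst (ls ! i) (p ! i)) & (ls ~= [] --> hd p \<in> set cs) &
  (\<forall>i. Suc i < length ls --> p ! Suc i \<in> set (kids W (snd (ls ! i)) (p ! i)))"
 using assms
proof (induction W ls cs arbitrary: p t rule: srch.induct)
 case (1 W L)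
 thus ?case by (auto split: if_splits)
next
 case (3 W l ls c cs)
 show ?case
 proof (cases "fst l c & fst (srch W ls (kids W (snd l) c)) ~= None")
  case True
  then obtain q u where q: "srch W ls (kids W (snd l) c) = (Some q, u)" by (metis not_None_eq prod.collapse)
  have p: "p = c # q" using "3.prems" True q by simp
  note IH = "3.IH"(1)[OF conjunct1[OF True] q]
  have "p ! Suc i \<in> set (kids W (snd ((l # ls) ! i)) (p ! i))" if "Suc i < length (l # ls)" for i
  proof (cases i)
   case 0
   thus ?thesis using IH that by (cases q) (auto simp: p)
  next
   case (Suc i')
   thus ?thesis using IH that by (simp add: p)
  qed
  moreover have "fst ((l # ls) ! i) (p ! i)" if "i < length (l # ls)" for i
   using IH True that by (cases i) (auto simp: p)
  ultimately show ?thesis using IH by (auto simp: p)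
 next
  case False
  hence e: "srch W (l # ls) cs = (Some p, snd (srch W (l # ls) cs))"
   using "3.prems" by (auto split: if_splits prod.splits option.splits intro!: prod_eqI)
  show ?thesis
  proof (cases "fst l c")
   case True
   obtain u where u: "srch W ls (kids W (snd l) c) = (None, u)" using False True by (metis prod.collapse)
   have "length p = length (l # ls) & (\<forall>i<length (l # ls). fst ((l # ls) ! i) (p ! i)) & (l # ls ~= [] --> hd p \<in> set cs) &
    (\<forall>i. Suc i < length (l # ls) --> p ! Suc i \<in> set (kids W (snd ((l # ls) ! i)) (p ! i)))"
    by (rule "3.IH"(2)[OF True u[symmetric] refl e])
   thus ?thesis by (meson list.set_intros(2))
  next
   case F: False
   have "length p = length (l # ls) & (\<forall>i<length (l # ls). fst ((l # ls) ! i) (p ! i)) & (l # ls ~= [] --> hd p \<in> set cs) &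
    (\<forall>i. Suc i < length (l # ls) --> p ! Suc i \<in> set (kids W (snd ((l # ls) ! i)) (p ! i)))"
    by (rule "3.IH"(4)[OF F e])
   thus ?thesis by (meson list.set_intros(2))
  qed
 qed
qed simp

lemma srch_path_less:
 assumes "srch W ls cs = (Some p, t)" "\<forall>c\<in>set cs. c < 2 ^ W" "\<forall>l\<in>set ls. snd l \<le> W" "i < length ls"
 shows "p ! i < 2 ^ W"
 using assms(4)
proof (induction i)
 case 0
 thus ?case using srch_path[OF assms(1)] assms(2) by (cases p) auto
next
 case (Suc i)
 have "p ! Suc i \<in> set (kids W (snd (ls ! i)) (p ! i))" using srch_path[OF assms(1)] Suc.prems by blast
 moreover have "snd (ls ! i) \<le> W" using assms(3) Suc.prems by simp
 moreover have "p ! i < 2 ^ W" using Suc by simp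
 ultimately show ?case by (blast intro: kids_less)
qed

lemma ms_one:
 assumes "~ final n sm" "mstep W sh ic ts sm = sm'"
 shows "is_test sm ==> ms n W sh ic ts wt sm (wt (fst sm)) 1 0 sm'" "~ is_test sm ==> ms n W sh ic ts wt sm 0 0 1 sm'"
 using ms.go[OF assms(1) ms.stop, of W sh ic ts wt] assms(2) by simp_all

text \<open>If the budget covers the tests of \<open>srch\<close>, the machine agrees with it: on
  success it stands behind the segment with the next window prepared, on failure it stands at
  \<open>v\<close> in mode 1 with no candidate left. If the budget is too small it stops with the
  flag set, at no greater cost than the unlimited search.\<close>

definition outcome :: "nat => (nat => nat) => (nat => nat) => nat => nat => (nat => nat) => nat => nat => nat list option \<times> nat => nat => mstate => bool" where
 "outcome W sh ic v v1 win fu w0 rt A sm \<longleftrightarrow> (if snd rt \<le> fu then A = snd rt * w0 & (case fst rt of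
   Some p => (\<exists>win'. sm = (v1, win', 0, fu - snd rt, 0) & (\<forall>x<v. win' x = win x) & (\<forall>i<length p. win' (v + i) = p ! i) &
    win' v1 = last p div 2 ^ sh v1)
  | None => (\<exists>win'. sm = (v, win', 1, fu - snd rt, 0) & (\<forall>x<v. win' x = win x) & 2 ^ W \<le> win' v + ic v))
  else A \<le> snd rt * w0 & snd (snd (snd (snd sm))) = 1)"

text \<open>Two nested inductions, over the distance to the end of the segment and over the
  candidates at \<open>v\<close>. The test at \<open>u\<close> may be replaced by the fixed
  predicate \<open>ok u\<close>, since its outcome depends on the windows before the segment and on
  the window of \<open>u\<close> alone.\<close>

lemma run_srch:
 fixes v0 v1 n W w0 :: nat and ok :: "nat => nat => bool" and sh ic :: "nat => nat"
 defines "ls \<equiv> %v. map (%u. (ok u, if Suc u < v1 then sh (Suc u) else 0)) [v..<v1]"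
 assumes v1: "v1 \<le> n"
  and sh: "!!u. v0 < u ==> u < v1 ==> sh u < W & ic u = 2 ^ (W - sh u)"
  and ts: "!!win' u. (\<forall>x<v0. win' x = win0 x) ==> v0 \<le> u ==> u < v1 ==> win' u < 2 ^ W ==> ts win' u = ok u (win' u)"
  and wt: "!!u. v0 \<le> u ==> u < v1 ==> wt u = w0"
  and "v0 \<le> v" "v < v1" "chain W (ic v) cs" "win v = hd cs" "\<forall>x<v0. win x = win0 x"
 shows "\<exists>A a k sm. ms n W sh ic ts wt (v, win, 0, fu, 0) A a k sm & outcome W sh ic v v1 win fu w0 (srch W (ls v) cs) A sm"
 using assms(6-)
proof (induction "v1 - v" arbitrary: v cs win fu)
 case 0
 thus ?case by simp
next
 case (Suc X)
 note OUT = Suc.hyps(1)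
 have X: "X = v1 - Suc v" and vv: "v0 \<le> v" "v < v1" using Suc.hyps(2) Suc.prems by auto
 have lsv: "ls v = (ok v, if Suc v < v1 then sh (Suc v) else 0) # ls (Suc v)"
  using vv by (simp add: ls_def upt_conv_Cons)
 have nf: "~ final n (v, win', md, fu', 0)" for win' md fu' using vv v1 by (simp add: final_def)
 have nf': "Suc v < v1 ==> ~ final n (Suc v, win', md, fu', 0)" for win' md fu' using v1 by (simp add: final_def)
 have "\<exists>A a k sm. ms n W sh ic ts wt (v, win, 0, fu, 0) A a k sm & outcome W sh ic v v1 win fu w0 (srch W (ls v) cs) A sm"
  if "chain W (ic v) cs" "win v = hd cs" "\<forall>x<v0. win x = win0 x" for win cs fu
  using that
 proof (induction cs arbitrary: win fu)
  case Nil
  thus ?case by simp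
 next
  case (Cons c cs)
  have wc: "win v = c" and cW: "c < 2 ^ W" using Cons.prems chain_less[OF Cons.prems(1)] by auto
  let ?S = "srch W (ls v) (c # cs)" and ?S' = "srch W (ls v) cs"
  have t1: "1 \<le> snd ?S" unfolding lsv by (auto split: prod.splits option.splits)
  have tsv: "ts win v = ok v c" using ts[of win v] Cons.prems(3) vv wc cW by simp
  show ?case
  proof (cases "fu = 0")
   case True
   have "ms n W sh ic ts wt (v, win, 0, fu, 0) 0 0 1 (v, win, 0, fu, 1)"
    by (rule ms_one(2)[OF nf]) (use True in \<open>simp_all add: mstep_def is_test_def\<close>)
   moreover have "outcome W sh ic v v1 win fu w0 ?S 0 (v, win, 0, fu, 1)" using t1 True by (simp add: outcome_def)
   ultimately show ?thesis by blast
  next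
   case False
   \<comment> \<open>The common continuation once \<open>c\<close> is refuted, by its own test
     (\<open>t1 = 0\<close>) or by the search below it, which took \<open>t1\<close> tests: the
     machine moves on to the remaining candidates \<open>cs\<close>.\<close>
   have ADV: "\<exists>A a k sm. ms n W sh ic ts wt (v, win, 0, fu, 0) A a k sm & outcome W sh ic v v1 win fu w0 (fst ?S', Suc (t1 + snd ?S')) A sm"
    if M: "ms n W sh ic ts wt (v, win, 0, fu, 0) (Suc t1 * w0) a k (v, win', 1, fu - Suc t1, 0)" and le: "Suc t1 \<le> fu"
     and w': "\<forall>x<v. win' x = win x" "win' v = c" for win' t1 a k
   proof (cases cs)
    case Nil
    have "outcome W sh ic v v1 win fu w0 (fst ?S', Suc (t1 + snd ?S')) (Suc t1 * w0) (v, win', 1, fu - Suc t1, 0)"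
     using Nil le w' Cons.prems(1) by (simp add: lsv outcome_def)
    thus ?thesis using M by blast
   next
    case (Cons c' cs')
    have c': "c' = c + ic v" "chain W (ic v) cs" "c' < 2 ^ W" using Cons.prems(1) chain_less[OF Cons.prems(1)] Cons by auto
    let ?w = "win'(v := c')"
    have M2: "ms n W sh ic ts wt (v, win', 1, fu - Suc t1, 0) 0 0 1 (v, ?w, 0, fu - Suc t1, 0)"
     by (rule ms_one(2)[OF nf]) (use c' w' in \<open>simp_all add: mstep_def is_test_def\<close>)
    have "\<exists>A a k sm. ms n W sh ic ts wt (v, ?w, 0, fu - Suc t1, 0) A a k sm & outcome W sh ic v v1 ?w (fu - Suc t1) w0 ?S' A sm"
     by (rule Cons.IH) (use c' Cons w' Cons.prems(3) vv in auto)
    then obtain A a' k' sm where M3: "ms n W sh ic ts wt (v, ?w, 0, fu - Suc t1, 0) A a' k' sm"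
     and o: "outcome W sh ic v v1 ?w (fu - Suc t1) w0 ?S' A sm" by blast
    have "outcome W sh ic v v1 win fu w0 (fst ?S', Suc (t1 + snd ?S')) (Suc t1 * w0 + (0 + A)) sm"
     using o le w' unfolding outcome_def
     by (auto simp: algebra_simps split: option.splits if_splits)
    thus ?thesis using ms_trans[OF M ms_trans[OF M2 M3]] by blast
   qed
   let ?st = "if ok v c then (Suc v, win(Suc v := win v div 2 ^ sh (Suc v)), 0, fu - 1, 0) else (v, win, 1, fu - 1, 0)"
   have "ms n W sh ic ts wt (v, win, 0, fu, 0) (wt (fst (v, win, 0 :: nat, fu, 0 :: nat))) 1 0 ?st"
    by (rule ms_one(1)[OF nf]) (use False tsv in \<open>simp_all add: mstep_def is_test_def\<close>)
   hence M1: "ms n W sh ic ts wt (v, win, 0, fu, 0) w0 1 0 ?st" using wt[OF vv] by simp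
   show ?thesis
   proof (cases "ok v c")
    case nok: False
    have "?S = (fst ?S', Suc (0 + snd ?S'))" unfolding lsv using nok by simp
    thus ?thesis using ADV[of 0 1 0 win] M1 nok False wc by simp
   next
    case ok: True
    let ?w = "win(Suc v := c div 2 ^ sh (Suc v))"
    have M1': "ms n W sh ic ts wt (v, win, 0, fu, 0) w0 1 0 (Suc v, ?w, 0, fu - 1, 0)" using M1 ok wc by simp
    show ?thesis
    proof (cases "Suc v < v1")
     case False
     hence e: "Suc v = v1" using vv by simp
     have "?S = (Some [c], 1)" unfolding lsv using ok e by (simp add: ls_def)
     hence "outcome W sh ic v v1 win fu w0 ?S w0 (Suc v, ?w, 0, fu - 1, 0)"
      using \<open>fu ~= 0\<close> e wc by (simp add: outcome_def)
     thus ?thesis using M1' by blast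
    next
     case True
     let ?b = "sh (Suc v)"
     have b: "?b < W" "ic (Suc v) = 2 ^ (W - ?b)" using sh[of "Suc v"] vv True by auto
     let ?K = "srch W (ls (Suc v)) (kids W ?b c)"
     have "\<exists>A a k sm. ms n W sh ic ts wt (Suc v, ?w, 0, fu - 1, 0) A a k sm & outcome W sh ic (Suc v) v1 ?w (fu - 1) w0 ?K A sm"
      by (rule OUT[OF X]) (use vv True b cW Cons.prems(3) in \<open>auto simp: hd_kids intro!: chain_kids\<close>)
     then obtain A a k sm where M2: "ms n W sh ic ts wt (Suc v, ?w, 0, fu - 1, 0) A a k sm"
      and o: "outcome W sh ic (Suc v) v1 ?w (fu - 1) w0 ?K A sm" by blast
     note M12 = ms_trans[OF M1' M2]
     show ?thesis
     proof (cases "snd ?K \<le> fu - 1")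
      case nle: False
      have "snd ?K < snd ?S" unfolding lsv using ok True by (auto split: prod.splits option.splits)
      moreover have "A \<le> snd ?K * w0" "snd (snd (snd (snd sm))) = 1" using o nle by (auto simp: outcome_def)
      ultimately have "outcome W sh ic v v1 win fu w0 ?S (w0 + A) sm"
       using nle False mult_le_mono1[of "Suc (snd ?K)" "snd ?S" w0] by (auto simp: outcome_def)
      thus ?thesis using M12 by blast
     next
      case le: True
      show ?thesis
      proof (cases "fst ?K")
       case (Some p)
       have S: "?S = (Some (c # p), Suc (snd ?K))" unfolding lsv using ok True Some by (cases ?K) auto
       obtain win' where w': "sm = (v1, win', 0, fu - 1 - snd ?K, 0)" "\<forall>x<Suc v. win' x = ?w x" "\<forall>i<length p. win' (Suc v + i) = p ! i"
         "win' v1 = last p div 2 ^ sh v1"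
        and A: "A = snd ?K * w0" using o le Some by (auto simp: outcome_def)
       have "srch W (ls (Suc v)) (kids W ?b c) = (Some p, snd ?K)" using Some by (metis prod.collapse)
       hence "length p = length (ls (Suc v))" by (rule srch_path[THEN conjunct1])
       hence ne: "p ~= []" using True by (auto simp: ls_def)
       have "win' (v + i) = (c # p) ! i" if "i < length (c # p)" for i
        using w'(2,3) wc that by (cases i) auto
       hence "outcome W sh ic v v1 win fu w0 ?S (w0 + A) sm"
        unfolding S outcome_def using w' le False A ne by auto
       thus ?thesis using M12 by blast
      next
       case None
       have S: "?S = (fst ?S', Suc (snd ?K + snd ?S'))" unfolding lsv using ok True None by (cases ?K) auto
       obtain win' where w': "sm = (Suc v, win', 1, fu - 1 - snd ?K, 0)" "\<forall>x<Suc v. win' x = ?w x" "2 ^ W \<le> win' (Suc v) + ic (Suc v)"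
        and A: "A = snd ?K * w0" using o le None by (auto simp: outcome_def)
       have "ms n W sh ic ts wt sm 0 0 1 (v, win', 1, fu - 1 - snd ?K, 0)"
        unfolding w'(1) by (rule ms_one(2)[OF nf'[OF True]]) (use w' b in \<open>simp_all add: mstep_def is_test_def\<close>)
       from ms_trans[OF M12 this] have "ms n W sh ic ts wt (v, win, 0, fu, 0) (Suc (snd ?K) * w0) (1 + a + 0) (0 + k + 1) (v, win', 1, fu - Suc (snd ?K), 0)"
        by (simp add: A)
       from ADV[OF this] show ?thesis unfolding S using le False w'(2) wc by auto
      qed
     qed
    qed
   qed
  qed
 qed
 from this[OF Suc.prems(3-5)] show ?case .
qed

lemma ms_fuel:
 assumes "ms n W sh ic ts wt sm A a k sm'"
 shows "a + fst (snd (snd (snd sm'))) \<le> fst (snd (snd (snd sm)))"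
 using assms
proof (induction rule: ms.induct)
 case (go sm A a k sm')
 obtain v win md fu st where sm: "sm = (v, win, md, fu, st)" by (cases sm) auto
 show ?case using go.IH by (auto simp: sm mstep_def is_test_def split: if_splits)
qed simp

lemma ms_weight:
 assumes "ms n W sh ic ts wt sm A a k sm'" "!!v. 1 \<le> wt v" "!!v. wt v \<le> B"
 shows "a \<le> A & A \<le> a * B"
 using assms(1)
proof (induction rule: ms.induct)
 case (go sm A a k sm')
 thus ?case using assms(2,3)[of "fst sm"] by auto
qed simp

section \<open>The segments of one attempt\<close>

definition ok :: "nat set => (nat => bool) => bool" where
 "ok X f \<longleftrightarrow> 2 * card {i \<in> X. f i} = card X"

text \<open>The key sets \<open>Xs\<close> are fixed for the whole segment. The condition on
  \<open>c\<close> makes each layer false outside the finite range of windows, which matches the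
  default value in \<open>rl\<close>.\<close>

definition lay :: "nat => nat => (nat => nat => nat => bool) => nat => (nat => nat set) => layer list" where
 "lay d y T v Xs = map (%r. (%c. c < 2 ^ (64 * (d + 1)) & ok (Xs (v + r)) (T (v + r) c), bl d y (d - floor_log v) ! r))
  [0..<2 ^ kap d y (d - floor_log v)]"

text \<open>\<open>2 ^ (8 * (d + 1))\<close> equally spaced windows. Since one start succeeds with
  probability at least \<open>2^(-6(d+1))\<close>, exhausting them all is improbable.\<close>

definition roots :: "nat => nat list" where
 "roots d = kids (64 * (d + 1)) (8 * (d + 1)) 0"

definition nextX :: "(nat => nat => nat => bool) => nat => nat list => (nat => nat set) => nat => nat set" where
 "nextX T v p Xs u = (if v \<le> u div 2 & u div 2 < v + length p
  then {i \<in> Xs (u div 2). T (u div 2) (p ! (u div 2 - v)) i \<longleftrightarrow> u mod 2 = 1} else Xs u)"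

lemma roots_less: "\<forall>c\<in>set (roots d). c < 2 ^ (64 * (d + 1))"
proof
 fix c assume "c \<in> set (roots d)"
 thus "c < 2 ^ (64 * (d + 1))" unfolding roots_def by (rule kids_less[rotated 2]) simp_all
qed

abbreviation sr :: "nat => layer list => nat list option \<times> nat" where
 "sr d ls \<equiv> srch (64 * (d + 1)) ls (roots d)"

text \<open>An idealised attempt without budget, as a function of a table \<open>T\<close> of hash
  values: the segments searched in order, up to the first one without a path. The analysis concerns
  this list; \<open>run_visit\<close> relates the machine to it.\<close>

function visit :: "nat => nat => (nat => nat => nat => bool) => nat => (nat => nat set) => (nat \<times> layer list) list" where
 "visit d y T v Xs = (if v < 2 ^ d then
  (d - floor_log v, lay d y T v Xs) # (case fst (sr d (lay d y T v Xs)) of None => []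
   | Some p => visit d y T (v + 2 ^ kap d y (d - floor_log v)) (nextX T v p Xs)) else [])"
 by pat_completeness auto
termination by (relation "Wellfounded.measure (%(d, y, T, v, Xs). 2 ^ d - v)") (auto intro!: diff_less_mono2)

declare visit.simps [simp del]

definition vtests :: "nat => (nat \<times> layer list) list => nat" where
 "vtests d vs = (\<Sum>(k, ls)\<leftarrow>vs. snd (sr d ls))"

definition vcost :: "nat => (nat \<times> layer list) list => nat" where
 "vcost d vs = (\<Sum>(k, ls)\<leftarrow>vs. 2 ^ k * snd (sr d ls))"

definition vfound :: "nat => (nat \<times> layer list) list => bool" where
 "vfound d vs \<longleftrightarrow> (\<forall>(k, ls)\<in>set vs. ~ fails (64 * (d + 1)) ls (roots d))"

definition aligned :: "nat => nat => nat => bool" where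
 "aligned d y v \<longleftrightarrow> 1 \<le> v & v \<le> 2 ^ d & (v < 2 ^ d --> 2 ^ kap d y (d - floor_log v) dvd v - 2 ^ floor_log v)"

text \<open>At depth \<open>j\<close> the exponent \<open>kap\<close> is at most \<open>j\<close>,
  so the length of a segment divides \<open>2 ^ j\<close>; the segments tile the level and none
  crosses its end.\<close>

lemma aligned_seg:
 assumes a: "aligned d y v" "v < 2 ^ d"
 defines "j \<equiv> floor_log v" and "K \<equiv> 2 ^ kap d y (d - floor_log v)"
 shows "j < d" "v + K \<le> 2 * 2 ^ j" "2 ^ j \<le> v" "aligned d y (v + K)"
  "r < K ==> floor_log (v + r) = j" "r < K ==> (v + r - 2 ^ j) mod K = r"
proof -
 have v1: "1 \<le> v" using a by (simp add: aligned_def)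
 show jd: "j < d" unfolding j_def by (rule floor_log_less[OF v1 a(2)])
 show jv: "2 ^ j \<le> v" unfolding j_def by (rule floor_log_bounds(1)[OF v1])
 have vj: "v < 2 * 2 ^ j" unfolding j_def by (rule floor_log_bounds(2))
 have kj: "kap d y (d - floor_log v) \<le> j" using jd by (auto simp: kap_def j_def)
 obtain q where q: "v - 2 ^ j = K * q" using a by (auto simp: aligned_def K_def j_def dvd_def)
 have JK: "2 ^ j = K * 2 ^ (j - kap d y (d - floor_log v))" unfolding K_def using kj by (simp flip: power_add)
 have K0: "0 < K" by (simp add: K_def)
 have "K * q < K * 2 ^ (j - kap d y (d - floor_log v))" using q vj jv JK by linarith
 hence "Suc q \<le> 2 ^ (j - kap d y (d - floor_log v))" using K0 by simp
 hence "K * Suc q \<le> 2 ^ j" unfolding JK by (rule mult_le_mono2)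
 thus vK: "v + K \<le> 2 * 2 ^ j" using q jv by simp
 show fl: "floor_log (v + r) = j" if "r < K" for r using that vK jv by (intro floor_log_eqI) auto
 show "(v + r - 2 ^ j) mod K = r" if "r < K" for r
 proof -
  have "v + r - 2 ^ j = K * q + r" using q jv by simp
  thus ?thesis using that by simp
 qed
 have le: "v + K \<le> 2 ^ d"
 proof -
  have "(2::nat) * 2 ^ j \<le> 2 ^ d" using jd power_increasing[of "Suc j" d "2::nat"] by simp
  thus ?thesis using vK by simp
 qed
 have "2 ^ kap d y (d - floor_log (v + K)) dvd v + K - 2 ^ floor_log (v + K)" 
 proof (cases "v + K = 2 * 2 ^ j")
  case True
  have "floor_log (v + K) = Suc j" unfolding True using floor_log_power[of "Suc j"] by simp
  thus ?thesis using True by simp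
 next
  case False
  hence "floor_log (v + K) = j" using vK jv by (intro floor_log_eqI) auto
  moreover have "v + K - 2 ^ j = K * Suc q" using q jv by simp
  ultimately show ?thesis by (simp add: K_def j_def)
 qed
 thus "aligned d y (v + K)" using le v1 by (simp add: aligned_def)
qed

lemma bl_nth: "r < 2 ^ kap d y k ==> bl d y k ! r = (if Suc r < 2 ^ kap d y k then po d y k (Suc r) - po d y k r else 0)"
 by (auto simp: bl_def nth_append)

lemma seg_shifts:
 assumes a: "aligned d y v" "v < 2 ^ d" "y \<le> d"
 defines "k \<equiv> d - floor_log v" 
 shows "shf d y v = 64 * (d + 1)" "incf d y v = 2 ^ (56 * (d + 1))"
  "Suc r < 2 ^ kap d y k ==> shf d y (v + Suc r) = bl d y k ! r"
  "0 < r ==> r < 2 ^ kap d y k ==> shf d y (v + r) < 64 * (d + 1) & incf d y (v + r) = 2 ^ (64 * (d + 1) - shf d y (v + r))"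
proof -
 note s = aligned_seg[OF a(1,2)]
 note m = s(6)[folded k_def] and f = s(5)[folded k_def]
 show "shf d y v = 64 * (d + 1)" "incf d y v = 2 ^ (56 * (d + 1))"
  using m[of 0] by (simp_all add: shf_def incf_def shq_def incq_def k_def[symmetric])
 show e: "shf d y (v + Suc r) = bl d y k ! r" if r: "Suc r < 2 ^ kap d y k" for r
  using m[OF r] f[OF r] r by (simp add: shf_def shq_def Let_def bl_nth flip: k_def)
 have k: "1 \<le> k" "k \<le> d" using s(1) by (auto simp: k_def)
 interpret seg_params d y k by unfold_locales (use k a in auto)
 assume r: "0 < r" "r < 2 ^ kap d y k"
 then obtain r' where r': "r = Suc r'" by (cases r) auto
 have "bl d y k ! r' \<in> set (bl d y k)" using r r' by simp
 hence "bl d y k ! r' < 64 * (d + 1)" using bl_le by fastforce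
 hence "shf d y (v + r) < 64 * (d + 1)" using e[of r'] r r' by simp
 thus "shf d y (v + r) < 64 * (d + 1) & incf d y (v + r) = 2 ^ (64 * (d + 1) - shf d y (v + r))"
  using m[OF r(2)] f[OF r(2)] r by (simp add: shf_def incf_def incq_def flip: k_def)
qed

lemma tst_cong:
 assumes "!!x. 1 \<le> x ==> x \<le> u ==> win x = win' x" "1 \<le> u"
 shows "tst tu keys win u = tst tu keys win' u"
proof -
 have "Xset tu keys win u = Xset tu keys win' u" by (rule Xset_cong) (use assms in auto)
 thus ?thesis using assms by (simp add: tst_def)
qed

text \<open>The last condition says that the old bits of the window are those of its predecessor,
  shifted by the number of fresh bits. It is what allows the windows to share storage.\<close>

definition goodw :: "nat => nat => (nat => nat => 'k => bool) => 'k list => (nat => nat) => nat => bool" where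
 "goodw d y tu keys win u \<longleftrightarrow> tst tu keys win u & win u < 2 ^ (64 * (d + 1)) &
  (shf d y u ~= 64 * (d + 1) --> win u mod 2 ^ (64 * (d + 1) - shf d y u) = win (u - 1) div 2 ^ shf d y u)"

lemma kids_mod:
 assumes "b \<le> W" "c < 2 ^ W" "u \<in> set (kids W b c)"
 shows "u mod 2 ^ (W - b) = c div 2 ^ b"
proof -
 have "(2::nat) ^ W = 2 ^ (W - b) * 2 ^ b" using assms(1) by (simp flip: power_add)
 hence "c div 2 ^ b < 2 ^ (W - b)" using assms(2) by (simp add: less_mult_imp_div_less)
 thus ?thesis using assms(3) by (auto simp: kids_def)
qed

text \<open>Induction over the segments. A segment lies within one level, so by \<open>par\<close>
  the parents of its nodes come before \<open>v\<close>: the key sets \<open>Xs\<close> stay valid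
  during the search, and \<open>nextX\<close> adds those of the children once a path is found. The
  remaining budget is passed on.\<close>

lemma run_visit:
 fixes tu :: "nat => nat => 'k => bool" and keys :: "'k list"
 defines "T \<equiv> %u c i. tu u c (keys ! i)"
 assumes y: "y \<le> d"
  and "aligned d y v" "v < 2 ^ d ==> win v = 0"
  and "!!u. 1 \<le> u ==> u div 2 < v ==> Xset tu keys win u = Xs u"
 shows "\<exists>A a k sm. ms (2 ^ d) (64 * (d + 1)) (shf d y) (incf d y) (tst tu keys) (%v. 2 ^ (d - floor_log v)) (v, win, 0, fu, 0) A a k sm &
  final (2 ^ d) sm & A \<le> vcost d (visit d y T v Xs) &
  (if vfound d (visit d y T v Xs) & vtests d (visit d y T v Xs) \<le> fu
  then \<exists>win' fu'. sm = (2 ^ d, win', 0, fu', 0) & (\<forall>x<v. win' x = win x) & (\<forall>u\<in>{v..<2 ^ d}. goodw d y tu keys win' u)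
  else snd (snd (snd (snd sm))) = 1)"
 using assms(3-)
proof (induction "2 ^ d - v" arbitrary: v win Xs fu rule: less_induct)
 case less
 let ?W = "64 * (d + 1)" and ?n = "2 ^ d :: nat" and ?V = "visit d y T v Xs"
 let ?ms = "ms ?n ?W (shf d y) (incf d y) (tst tu keys) (%v. 2 ^ (d - floor_log v))"
 show ?case
 proof (cases "v < ?n")
  case False
  hence v: "v = ?n" using less.prems(1) by (simp add: aligned_def)
  have V: "?V = []" using False by (simp add: visit.simps)
  have "?ms (v, win, 0, fu, 0) 0 0 0 (v, win, 0, fu, 0)" by (rule ms.stop)
  thus ?thesis unfolding V using v by (intro exI[of _ 0] exI[of _ "(v, win, 0, fu, 0)"]) (simp add: final_def vfound_def vtests_def)
 next
  case vn: True
  note al = less.prems(1)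
  let ?k = "d - floor_log v" let ?K = "2 ^ kap d y ?k :: nat" let ?v1 = "v + ?K"
  let ?ls = "lay d y T v Xs"
  note s = aligned_seg[OF al vn] and sh = seg_shifts[OF al vn y]
  have v1: "1 \<le> v" using al by (simp add: aligned_def)
  have le: "?v1 \<le> ?n" using s(4) by (simp add: aligned_def)
  have par: "u div 2 < v" if "u < ?v1" for u
  proof -
   have "u < 2 * 2 ^ floor_log v" using that s(2) by linarith
   thus ?thesis using s(3) by linarith
  qed
  have ls: "map (%u. (%c. c < 2 ^ ?W & ok (Xs u) (T u c), if Suc u < ?v1 then shf d y (Suc u) else 0)) [v..<?v1] = ?ls"
  proof (rule nth_equalityI)
   fix i assume "i < length (map (%u. (%c. c < 2 ^ ?W & ok (Xs u) (T u c), if Suc u < ?v1 then shf d y (Suc u) else 0)) [v..<?v1])"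
   hence i: "i < ?K" by simp
   show "map (%u. (%c. c < 2 ^ ?W & ok (Xs u) (T u c), if Suc u < ?v1 then shf d y (Suc u) else 0)) [v..<?v1] ! i = ?ls ! i"
    using i sh(3)[of i] by (simp add: lay_def bl_nth)
  qed (simp add: lay_def)
  have "\<exists>A a k sm. ?ms (v, win, 0, fu, 0) A a k sm & outcome ?W (shf d y) (incf d y) v ?v1 win fu (2 ^ ?k)
   (srch ?W (map (%u. (%c. c < 2 ^ ?W & ok (Xs u) (T u c), if Suc u < ?v1 then shf d y (Suc u) else 0)) [v..<?v1]) (roots d)) A sm"
  proof (rule run_srch[where ?v0.0 = v and ?win0.0 = win])
   fix u assume u: "v < u" "u < ?v1"
   show "shf d y u < ?W & incf d y u = 2 ^ (?W - shf d y u)" using sh(4)[of "u - v"] u by simp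
  next
   fix win' u assume w': "\<forall>x<v. win' x = win x" and u: "v \<le> u" "u < ?v1" and wW: "win' u < 2 ^ ?W"
   have "Xset tu keys win' u = Xset tu keys win u" by (rule Xset_cong) (use par[OF u(2)] w' in auto)
   also have "... = Xs u" using less.prems(3)[of u] par[OF u(2)] u v1 by simp
   finally show "tst tu keys win' u = (win' u < 2 ^ ?W & ok (Xs u) (T u (win' u)))" using wW by (simp add: tst_def ok_def T_def)
  next
   fix u assume "v \<le> u" "u < ?v1"
   thus "2 ^ (d - floor_log u) = 2 ^ ?k" using s(5)[of "u - v"] by simp
  next
   have "chain ?W (2 ^ (?W - 8 * (d + 1))) (roots d)" unfolding roots_def by (rule chain_kids) auto
   moreover have "?W - 8 * (d + 1) = 56 * (d + 1)" by simp
   ultimately show "chain ?W (incf d y v) (roots d)" unfolding sh(2) by (simp only:)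
   show "win v = hd (roots d)" using less.prems(2)[OF vn] by (simp add: roots_def hd_kids)
  qed (use le in simp_all)
  then obtain A a k sm where M: "?ms (v, win, 0, fu, 0) A a k sm" and
   o: "outcome ?W (shf d y) (incf d y) v ?v1 win fu (2 ^ ?k) (sr d ?ls) A sm" unfolding ls by blast
  have V: "?V = (?k, ?ls) # (case fst (sr d ?ls) of None => [] | Some p => visit d y T ?v1 (nextX T v p Xs))"
   using vn by (subst visit.simps) simp
  have c1: "2 ^ ?k * snd (sr d ?ls) \<le> vcost d ?V" "snd (sr d ?ls) \<le> vtests d ?V"
   unfolding V by (simp_all add: vcost_def vtests_def)
  show ?thesis
  proof (cases "snd (sr d ?ls) \<le> fu")
   case False
   hence "A \<le> snd (sr d ?ls) * 2 ^ ?k" "snd (snd (snd (snd sm))) = 1" using o by (simp_all add: outcome_def)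
   moreover from this have "final ?n sm" by (cases sm) (simp add: final_def)
   ultimately show ?thesis using M c1 False by (intro exI[of _ A] exI[of _ a] exI[of _ k] exI[of _ sm]) (simp add: mult.commute)
  next
   case t1: True
   show ?thesis
   proof (cases "fst (sr d ?ls)")
    case None
    hence fl: "fails ?W ?ls (roots d)" by (simp add: srch_None_iff)
    obtain win' where w': "sm = (v, win', 1, fu - snd (sr d ?ls), 0)" "2 ^ ?W \<le> win' v + incf d y v" and A: "A = snd (sr d ?ls) * 2 ^ ?k"
     using o t1 None by (auto simp: outcome_def)
    have "?ms sm 0 0 1 (v, win', 1, fu - snd (sr d ?ls), 1)"
     by (rule ms_one(2)) (use w' vn sh(1) in \<open>simp_all add: mstep_def is_test_def final_def\<close>)
    from ms_trans[OF M this] show ?thesis using c1 A fl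
     by (intro exI[of _ "A + 0"] exI[of _ "a + 0"] exI[of _ "k + 1"] exI[of _ "(v, win', 1, fu - snd (sr d ?ls), 1)"])
      (simp add: V vfound_def mult.commute final_def)
   next
    case (Some p)
    let ?Xs = "nextX T v p Xs" let ?V' = "visit d y T ?v1 ?Xs"
    have V': "?V = (?k, ?ls) # ?V'" unfolding V Some by simp
    have nfl: "~ fails ?W ?ls (roots d)" using srch_None_iff[of ?W ?ls "roots d"] Some by simp
    obtain win' where w': "sm = (?v1, win', 0, fu - snd (sr d ?ls), 0)" "\<forall>x<v. win' x = win x" "\<forall>i<length p. win' (v + i) = p ! i"
      "win' ?v1 = last p div 2 ^ shf d y ?v1" and A: "A = snd (sr d ?ls) * 2 ^ ?k"
     using o t1 Some by (auto simp: outcome_def)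
    have S: "sr d ?ls = (Some p, snd (sr d ?ls))" using Some by (metis prod.collapse)
    note sp = srch_path[OF S]
    have lls: "length ?ls = ?K" by (simp add: lay_def)
    have lp: "length p = ?K" using sp lls by simp
    have k: "1 \<le> ?k" "?k \<le> d" using s(1) by auto
    interpret seg_params d y ?k by unfold_locales (use k y in auto)
    have bW: "snd l \<le> ?W" if "l \<in> set ?ls" for l
    proof -
     have "snd l \<in> set (bl d y ?k)" using that by (auto simp: lay_def)
     thus ?thesis using bl_le by fastforce
    qed
    note rW = roots_less[of d]
    have pW: "p ! i < 2 ^ ?W" if "i < ?K" for i
    proof (rule srch_path_less[OF S rW])
     show "\<forall>l\<in>set ?ls. snd l \<le> ?W" using bW by blast
     show "i < length ?ls" using that unfolding lls .
    qed
    have X: "Xset tu keys win' u = Xs u" if "1 \<le> u" "u div 2 < v" for u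
    proof -
     have "Xset tu keys win' u = Xset tu keys win u" by (rule Xset_cong) (use that w'(2) in auto)
     thus ?thesis using less.prems(3)[OF that] by simp
    qed
    have wp: "win' x = p ! (x - v)" if "v \<le> x" "x < ?v1" for x
     using w'(3)[rule_format, of "x - v"] that lp by simp
    have G: "goodw d y tu keys win' u" if u: "v \<le> u" "u < ?v1" for u
    proof -
     define r where "r = u - v"
     have r: "r < ?K" "u = v + r" using u by (auto simp: r_def)
     have "fst (?ls ! r) (p ! r)" using sp r lls by simp
     hence "ok (Xs u) (T u (win' u))" using r wp[OF u] by (simp add: lay_def)
     hence 1: "tst tu keys win' u" using X[of u] par[OF u(2)] u v1 by (simp add: tst_def ok_def T_def)
     have 2: "win' u < 2 ^ ?W" using pW[OF r(1)] wp[OF u] r by simp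
     have 3: "win' u mod 2 ^ (?W - shf d y u) = win' (u - 1) div 2 ^ shf d y u" if "shf d y u ~= ?W"
     proof -
      have "r ~= 0" using that sh(1) r by (intro notI) simp
      then obtain r' where r': "r = Suc r'" by (cases r) auto
      have "p ! Suc r' \<in> set (kids ?W (snd (?ls ! r')) (p ! r'))" using sp r r' lls by auto
      moreover have "snd (?ls ! r') = shf d y u" using sh(3)[of r'] r r' by (simp add: lay_def)
      moreover have "shf d y u \<le> ?W" using sh(4)[of r] r r' by simp
      ultimately have "p ! r mod 2 ^ (?W - shf d y u) = p ! r' div 2 ^ shf d y u"
       using pW[of r'] r r' by (intro kids_mod) auto
      moreover have "win' (u - 1) = p ! r'" using wp[of "u - 1"] r r' u by simp
      ultimately show ?thesis using wp[OF u] r by simp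
     qed
     show ?thesis unfolding goodw_def using 1 2 3 by blast
    qed
    have K0: "0 < ?K" by simp
    have "\<exists>A a k sm'. ?ms (?v1, win', 0, fu - snd (sr d ?ls), 0) A a k sm' &
     final ?n sm' & A \<le> vcost d ?V' & (if vfound d ?V' & vtests d ?V' \<le> fu - snd (sr d ?ls)
      then \<exists>win'' fu'. sm' = (?n, win'', 0, fu', 0) & (\<forall>x<?v1. win'' x = win' x) & (\<forall>u\<in>{?v1..<?n}. goodw d y tu keys win'' u)
      else snd (snd (snd (snd sm'))) = 1)"
    proof (rule less.hyps)
     show "?n - ?v1 < ?n - v" using vn K0 by linarith
     show "aligned d y ?v1" by (rule s(4))
     show "win' ?v1 = 0" if "?v1 < ?n"
     proof -
      have "last p = p ! (?K - 1)" using lp K0 by (metis last_conv_nth length_greater_0_conv)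
      hence "last p < 2 ^ ?W" using pW[of "?K - 1"] by simp
      moreover have "shf d y ?v1 = ?W" by (rule seg_shifts(1)[OF s(4) that y])
      ultimately show ?thesis using w'(4) by simp
     qed
     fix u assume u: "1 \<le> u" "u div 2 < ?v1"
     show "Xset tu keys win' u = ?Xs u"
     proof (cases "u div 2 < v")
      case True
      thus ?thesis using X[OF u(1) True] by (simp add: nextX_def)
     next
      case False
      let ?x = "u div 2"
      have x: "v \<le> ?x" "?x < ?v1" using False u by auto
      have "Xset tu keys win' (2 * ?x + u mod 2) = {i \<in> Xset tu keys win' ?x. tu ?x (win' ?x) (keys ! i) \<longleftrightarrow> u mod 2 = 1}"
       by (rule Xset_child) (use x v1 in auto)
      moreover have "Xset tu keys win' ?x = Xs ?x" by (rule X) (use x v1 par[OF x(2)] in auto)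
      ultimately show ?thesis using x lp wp[OF x] by (simp add: nextX_def T_def)
     qed
    qed
    then obtain A2 a2 k2 sm' where M2: "?ms (?v1, win', 0, fu - snd (sr d ?ls), 0) A2 a2 k2 sm'"
     and f2: "final ?n sm'" "A2 \<le> vcost d ?V'" and
     r2: "if vfound d ?V' & vtests d ?V' \<le> fu - snd (sr d ?ls)
      then \<exists>win'' fu'. sm' = (?n, win'', 0, fu', 0) & (\<forall>x<?v1. win'' x = win' x) & (\<forall>u\<in>{?v1..<?n}. goodw d y tu keys win'' u)
      else snd (snd (snd (snd sm'))) = 1" by blast
    have M12: "?ms (v, win, 0, fu, 0) (A + A2) (a + a2) (k + k2) sm'"
     by (rule ms_trans[OF M]) (use M2 w'(1) in simp)
    have iff: "vfound d ?V & vtests d ?V \<le> fu \<longleftrightarrow> vfound d ?V' & vtests d ?V' \<le> fu - snd (sr d ?ls)"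
     unfolding V' using nfl t1 by (auto simp: vfound_def vtests_def)
    have cA: "A + A2 \<le> vcost d ?V" using f2(2) unfolding V' by (simp add: vcost_def A mult.commute)
    have R: "if vfound d ?V & vtests d ?V \<le> fu
      then \<exists>win'' fu'. sm' = (?n, win'', 0, fu', 0) & (\<forall>x<v. win'' x = win x) & (\<forall>u\<in>{v..<?n}. goodw d y tu keys win'' u)
      else snd (snd (snd (snd sm'))) = 1"
    proof (cases "vfound d ?V & vtests d ?V \<le> fu")
     case True
     then obtain win'' fu' where w2: "sm' = (?n, win'', 0, fu', 0)" "\<forall>x<?v1. win'' x = win' x" "\<forall>u\<in>{?v1..<?n}. goodw d y tu keys win'' u"
      using r2 unfolding iff by (simp only: if_True simp_thms) blast
     have "goodw d y tu keys win'' u" if u: "v \<le> u" "u < ?v1" for u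
     proof -
      have "tst tu keys win'' u = tst tu keys win' u" by (rule tst_cong) (use w2(2) u v1 in auto)
      thus ?thesis using G[OF u] w2(2) u by (simp add: goodw_def)
     qed
     hence "\<forall>u\<in>{v..<?n}. goodw d y tu keys win'' u" using w2(3) by (meson atLeastLessThan_iff not_le)
     thus ?thesis using True w2 w'(2) by auto
    next
     case False
     thus ?thesis using r2 unfolding iff by (simp only: if_False simp_thms)
    qed
    show ?thesis using M12 f2(1) cA R by blast
   qed
  qed
 qed
qed

section \<open>Writing the bit string\<close>

lemma bit_less_pow: "(x::nat) < 2 ^ w ==> bit x n ==> n < w"
 by (metis bit_take_bit_iff take_bit_nat_eq_self)

text \<open>A window fits into a word and thus meets at most two neighbouring cells; the disjunction
  preserves what other windows have put there.\<close>

lemma pay_or: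
 fixes m :: memory and w s Q B x i p :: nat
 assumes "s < w" "x < 2 ^ w"
 defines "m' \<equiv> m(B + Q := Bit_Operations.or (m (B + Q)) (take_bit w (push_bit s x)),
  Suc (B + Q) := Bit_Operations.or (m (Suc (B + Q))) (drop_bit (w - s) x))"
 shows "bit (m' (B + i div w)) (i mod w) \<longleftrightarrow> bit (m (B + i div w)) (i mod w) \<or> (Q * w + s \<le> i & bit x (i - (Q * w + s)))"
proof -
 define q t where "q = i div w" and "t = i mod w"
 have t: "t < w" and i: "i = q * w + t" using assms by (auto simp: q_def t_def)
 consider "q < Q" | "q = Q" | "q = Suc Q" | "Q + 2 \<le> q" by linarith
 hence "bit (m' (B + q)) t \<longleftrightarrow> bit (m (B + q)) t \<or> (Q * w + s \<le> i & bit x (i - (Q * w + s)))"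
 proof cases
  case 1
  hence "Suc q * w \<le> Q * w" by (intro mult_le_mono1) simp
  hence "~ Q * w + s \<le> i" using i t by simp
  thus ?thesis using 1 by (simp add: m'_def)
 next
  case 2
  thus ?thesis using t i by (auto simp: m'_def bit_or_iff bit_take_bit_iff bit_push_bit_iff)
 next
  case 3
  have "i - (Q * w + s) = w - s + t" "Q * w + s \<le> i" using i 3 assms(1) by auto
  thus ?thesis using 3 by (simp add: m'_def bit_or_iff bit_drop_bit_eq)
 next
  case 4
  hence "(Q + 2) * w \<le> q * w" by (rule mult_le_mono1)
  hence "w \<le> i - (Q * w + s)" using i assms(1) by (simp add: algebra_simps)
  hence "~ bit x (i - (Q * w + s))" using bit_less_pow[OF assms(2)] by (meson not_le)
  thus ?thesis using 4 by (simp add: m'_def)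
 qed
 thus ?thesis by (simp add: q_def t_def)
qed

lemma read_window:
 fixes c0 c1 s w W t :: nat
 assumes "s < w" "c0 < 2 ^ w" "W \<le> w"
 shows "bit (take_bit W (Bit_Operations.or (drop_bit s c0) (take_bit w (push_bit (w - s) c1)))) t \<longleftrightarrow>
  t < W & bit (if t + s < w then c0 else c1) ((t + s) mod w)"
proof (cases "t < W")
 case True
 show ?thesis
 proof (cases "t + s < w")
  case False
  have "(t + s) mod w = t - (w - s)" using False True assms by (simp add: mod_if)
  moreover have "~ bit c0 (s + t)" using bit_less_pow[OF assms(2), of "s + t"] False by auto
  ultimately show ?thesis using True False assms
   by (auto simp: bit_take_bit_iff bit_or_iff bit_drop_bit_eq bit_push_bit_iff)
 qed (use True assms in \<open>auto simp: bit_take_bit_iff bit_or_iff bit_drop_bit_eq bit_push_bit_iff add.commute\<close>)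
qed (simp only: bit_take_bit_iff simp_thms)

text \<open>Every node writes its whole window instead of only its fresh bits. Overlapping windows
  agree by \<open>goodw\<close>, so the disjunction is harmless and the writing needs no case
  distinction.\<close>

definition payl :: "nat => nat => (nat => nat) => nat => nat => bool" where
 "payl d y win N i \<longleftrightarrow> (\<exists>u\<in>{1..<N}. posf d y u \<le> i & bit (win u) (i - posf d y u))"

lemma OFF_mono: "k \<le> k' ==> OFF d y k \<le> OFF d y k'"
 unfolding OFF_def by (rule sum_mono2) auto

lemma OFF_Suc: "1 \<le> k ==> OFF d y (Suc k) = OFF d y k + 2 ^ (d - k) div 2 ^ kap d y k * SL d y k"
 by (simp add: OFF_def)

lemma node_coords:
 fixes d y v :: nat
 assumes v: "1 \<le> v" "v < 2 ^ d"
 defines "k \<equiv> d - floor_log v"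
 defines "s \<equiv> (v - 2 ^ floor_log v) div 2 ^ kap d y k" and "r \<equiv> (v - 2 ^ floor_log v) mod 2 ^ kap d y k"
 shows "k \<in> {1..d}" "floor_log v = d - k" "v = 2 ^ (d - k) + s * 2 ^ kap d y k + r" "r < 2 ^ kap d y k"
  "posf d y v = OFF d y k + s * SL d y k + po d y k r" "posf d y v + 64 * (d + 1) \<le> OFF d y k + Suc s * SL d y k"
  "OFF d y k + Suc s * SL d y k \<le> OFF d y (Suc k)"
proof -
 have j: "floor_log v < d" by (rule floor_log_less[OF v])
 show k: "k \<in> {1..d}" "floor_log v = d - k" using j by (auto simp: k_def)
 have q: "v - 2 ^ floor_log v < 2 ^ floor_log v" "2 ^ floor_log v \<le> v" using floor_log_bounds[of v] v by auto
 have kj: "kap d y k \<le> d - k" by (rule kap_le)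
 show "v = 2 ^ (d - k) + s * 2 ^ kap d y k + r" using q(2) unfolding s_def r_def k(2)[symmetric] by (metis add.assoc div_mult_mod_eq le_add_diff_inverse)
 show r: "r < 2 ^ kap d y k" by (simp add: r_def)
 show p: "posf d y v = OFF d y k + s * SL d y k + po d y k r"
  by (simp add: posf_def posq_def s_def r_def k_def)
 have "po d y k r \<le> po d y k (2 ^ kap d y k - 1)" by (rule po_mono) (use r in simp)
 thus "posf d y v + 64 * (d + 1) \<le> OFF d y k + Suc s * SL d y k" unfolding p by (simp add: SL_def)
 have e: "2 ^ (d - k) = 2 ^ (d - k - kap d y k) * (2 ^ kap d y k :: nat)" using kj by (simp flip: power_add)
 have "s < 2 ^ (d - k - kap d y k)" unfolding s_def using q(1) unfolding k(2) e by (rule less_mult_imp_div_less)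
 hence "Suc s * SL d y k \<le> 2 ^ (d - k) div 2 ^ kap d y k * SL d y k" unfolding e by (intro mult_le_mono1) simp
 thus "OFF d y k + Suc s * SL d y k \<le> OFF d y (Suc k)" using k(1) by (simp add: OFF_Suc)
qed

text \<open>The overlap condition of \<open>goodw\<close>, iterated along a segment. Together with
  the positions \<open>po\<close> it says that all windows of a segment are cut out of one bit
  string.\<close>

lemma window_shift:
 fixes v0 d y :: nat and win :: "nat => nat"
 assumes a: "aligned d y v0" "v0 < 2 ^ d" "y \<le> d" and g: "!!u. u \<in> {1..<2 ^ d} ==> goodw d y tu keys win u"
 defines "k \<equiv> d - floor_log v0"
 assumes "r \<le> r'" "r' < 2 ^ kap d y k" "t + (po d y k r' - po d y k r) < 64 * (d + 1)"
 shows "bit (win (v0 + r')) t \<longleftrightarrow> bit (win (v0 + r)) (t + (po d y k r' - po d y k r))"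
 using assms(6-)
proof (induction r' arbitrary: t rule: dec_induct)
 case (step n)
 let ?W = "64 * (d + 1)" let ?u = "v0 + Suc n" let ?b = "po d y k (Suc n) - po d y k n"
 have sn: "shf d y ?u = ?b" using seg_shifts(3)[OF a, of n] step.prems by (simp add: bl_nth k_def)
 have m: "po d y k n \<le> po d y k (Suc n)" "po d y k r \<le> po d y k n" using step by (auto intro: po_mono)
 have lt: "t + ?b < ?W" using step.prems m by linarith
 have "v0 + 2 ^ kap d y k \<le> 2 ^ d" using aligned_seg(4)[OF a(1,2)] by (simp add: aligned_def k_def)
 hence "goodw d y tu keys win ?u" using step.prems a by (intro g) (auto simp: aligned_def)
 moreover have "shf d y ?u ~= ?W" unfolding sn using lt by simp
 ultimately have "win ?u mod 2 ^ (?W - ?b) = win (v0 + n) div 2 ^ ?b" unfolding sn goodw_def by simp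
 hence "bit (take_bit (?W - ?b) (win ?u)) t \<longleftrightarrow> bit (drop_bit ?b (win (v0 + n))) t"
  by (simp add: take_bit_eq_mod drop_bit_eq_div)
 hence "bit (win ?u) t \<longleftrightarrow> bit (win (v0 + n)) (t + ?b)" using lt less_diff_conv[of t ?W ?b] by (simp only: bit_take_bit_iff bit_drop_bit_eq o_apply add.commute simp_thms)
 also have "... \<longleftrightarrow> bit (win (v0 + r)) (t + ?b + (po d y k n - po d y k r))"
  by (rule step.IH) (use step.prems m in auto)
 also have "t + ?b + (po d y k n - po d y k r) = t + (po d y k (Suc n) - po d y k r)" using m by simp
 finally show ?case .
qed simp

text \<open>A set bit inside the window of \<open>v\<close> can only stem from a window of the same
  segment, because the blocks \<open>SL\<close> include the full width of their last window and so
  keep segments and levels apart. Within the segment \<open>window_shift\<close> identifies the two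
  bits, whichever node comes first.\<close>

lemma payl_window:
 assumes y: "y \<le> d" and g: "!!u. u \<in> {1..<2 ^ d} ==> goodw d y tu keys win u"
  and v: "v \<in> {1..<2 ^ d}" and t: "t < 64 * (d + 1)"
 shows "payl d y win (2 ^ d) (posf d y v + t) \<longleftrightarrow> bit (win v) t"
proof
 assume "bit (win v) t"
 thus "payl d y win (2 ^ d) (posf d y v + t)" unfolding payl_def using v by (intro bexI[of _ v]) auto
next
 let ?W = "64 * (d + 1)"
 assume "payl d y win (2 ^ d) (posf d y v + t)"
 then obtain u where u: "u \<in> {1..<2 ^ d}" "posf d y u \<le> posf d y v + t" and b: "bit (win u) (posf d y v + t - posf d y u)"
  by (auto simp: payl_def)
 have uW: "posf d y v + t - posf d y u < ?W" by (rule bit_less_pow[OF _ b]) (use g[OF u(1)] in \<open>simp add: goodw_def\<close>)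
 define k s r where "k = d - floor_log u" and "s = (u - 2 ^ floor_log u) div 2 ^ kap d y (d - floor_log u)" and "r = (u - 2 ^ floor_log u) mod 2 ^ kap d y (d - floor_log u)"
 define k' s' r' where "k' = d - floor_log v" and "s' = (v - 2 ^ floor_log v) div 2 ^ kap d y (d - floor_log v)" and "r' = (v - 2 ^ floor_log v) mod 2 ^ kap d y (d - floor_log v)"
 have u1: "1 \<le> u" "u < 2 ^ d" and v1: "1 \<le> v" "v < 2 ^ d" using u v by auto
 note cu = node_coords(1,2)[OF u1, folded k_def] node_coords(3-7)[OF u1, of y, folded s_def r_def, folded k_def]
 note cv = node_coords(1,2)[OF v1, folded k'_def] node_coords(3-7)[OF v1, of y, folded s'_def r'_def, folded k'_def]
 have kk: "k = k'"
 proof (rule ccontr)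
  assume "k ~= k'"
  hence "Suc k \<le> k' \<or> Suc k' \<le> k" by linarith
  thus False
  proof
   assume "Suc k \<le> k'"
   hence "OFF d y (Suc k) \<le> OFF d y k'" by (rule OFF_mono)
   thus False using cu(6,7) cv(5) uW u(2) by linarith
  next
   assume "Suc k' \<le> k"
   hence "OFF d y (Suc k') \<le> OFF d y k" by (rule OFF_mono)
   thus False using cv(6,7) cu(5) u(2) t by linarith
  qed
 qed
 have ss: "s = s'"
 proof (rule ccontr)
  assume "s ~= s'"
  hence "Suc s \<le> s' \<or> Suc s' \<le> s" by linarith
  thus False
  proof
   assume "Suc s \<le> s'"
   hence "Suc s * SL d y k \<le> s' * SL d y k" by (rule mult_le_mono1)
   thus False using cu(6) cv(5) uW u(2) unfolding kk by linarith
  next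
   assume "Suc s' \<le> s"
   hence "Suc s' * SL d y k \<le> s * SL d y k" by (rule mult_le_mono1)
   thus False using cv(6) cu(5) u(2) t unfolding kk by linarith
  qed
 qed
 define v0 where "v0 = 2 ^ (d - k) + s * 2 ^ kap d y k"
 have uv: "u = v0 + r" "v = v0 + r'" using cu(3) cv(3) unfolding v0_def kk ss by auto
 have rr: "r < 2 ^ kap d y k" "r' < 2 ^ kap d y k" using cu(4) cv(4) kk by auto
 have v0n: "1 \<le> v0" unfolding v0_def by (rule trans_le_add1) simp
 have v0n: "1 \<le> v0" "v0 < 2 ^ d" using v0n u1 uv by auto
 have fl: "floor_log v0 = d - k"
 proof (rule floor_log_eqI)
  show "0 < v0" "2 ^ (d - k) \<le> v0" by (auto simp: v0_def)
  show "v0 < 2 * 2 ^ (d - k)" using floor_log_bounds(2)[of u] uv(1) unfolding cu(2) by linarith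
 qed
 have dk: "d - (d - k) = k" using cu(1) by auto
 have al: "aligned d y v0" unfolding aligned_def fl dk using v0n by (auto simp: v0_def)
 have pp: "posf d y v + t - posf d y u = t + po d y k r' - po d y k r" unfolding cu(5) cv(5) kk ss by simp
 note ws = window_shift[OF al v0n(2) y g, unfolded fl dk]
 show "bit (win v) t"
 proof (cases "r \<le> r'")
  case True
  have m: "po d y k r \<le> po d y k r'" using True by (rule po_mono)
  have "bit (win (v0 + r')) t \<longleftrightarrow> bit (win (v0 + r)) (t + (po d y k r' - po d y k r))"
   by (rule ws[OF _ True rr(2)]) (use uW pp m in auto)
  thus ?thesis using b unfolding pp uv(1)[symmetric] uv(2)[symmetric] using m by simp
 next
  case False
  hence le: "r' \<le> r" by simp
  have m: "po d y k r' \<le> po d y k r" using le by (rule po_mono)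
  have le2: "po d y k r - po d y k r' \<le> t" using u(2) unfolding cu(5) cv(5) kk ss by simp
  let ?t = "t + po d y k r' - po d y k r"
  have e: "?t + (po d y k r - po d y k r') = t" using le2 m by simp
  have "bit (win (v0 + r)) ?t \<longleftrightarrow> bit (win (v0 + r')) (?t + (po d y k r - po d y k r'))"
   by (rule ws[OF _ le rr(1)]) (use e t in auto)
  thus ?thesis using b unfolding pp e uv(1)[symmetric] uv(2)[symmetric] by simp
 qed
qed

context ram
begin

definition Tg :: "nat => nat => nat => nat => bool" where
 "Tg g = (%u c i. tau g u c (ks ! i))"

definition vis :: "nat => nat => (nat \<times> layer list) list" where
 "vis y g = visit d y (Tg g) 1 (%_. {..<2 ^ d})"

definition succ :: "nat => nat => bool" where
 "succ y g \<longleftrightarrow> vfound d (vis y g) & vtests d (vis y g) \<le> 2 ^ (8 * (d + 1))"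

text \<open>The budget allows \<open>2 ^ (8 * (d + 1))\<close> tests, each of weight at most
  \<open>2 ^ d\<close>. This cap keeps attempts with repeated windows from spoiling the
  expectation.\<close>

definition cst :: "nat => nat => nat" where
 "cst y g = min (vcost d (vis y g)) (2 ^ (8 * (d + 1)) * 2 ^ d)"

definition try_prog :: com where
 "try_prog = Seq (asg 9 (pow2 (times (Const 8) (plus (vr 2) (Const 1))))) (Seq (asg 10 (Const 1)) (Seq (asg 11 (Const 0))
  (Seq (asg 12 (Const 0)) (Store (arr 6 (vr 10)) (Const 0)))))"

definition att_body :: com where
 "att_body = Seq try_prog (Seq main_prog (Cond (vr 12) (Seq Rehash (asg 13 (Const 0))) (asg 13 (Const 1))))"

definition att_prog :: com where
 "att_prog = Seq (asg 13 (Const 0)) (While (Op Equal (vr 13) (Const 0)) att_body)"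

definition FND :: "nat => nat => (nat => nat) => memory => bool" where
 "FND y g win m \<longleftrightarrow> PRE y m & (\<forall>u\<in>{1..<2 ^ d}. m (6 * UU + u) = win u & goodw d y (tau g) ks win u)"

lemma body_runs:
 assumes P: "PRE y m" and n: "length ks = 2 ^ d" and y: "y \<le> d"
 shows "runs w H ks att_body (m, g) (900 * cst y g + 750) (%s. \<exists>m' :: memory. PRE y m' &
  (if succ y g then s = (m', g) & m' 13 = 1 & (\<exists>win. FND y g win m') else s = (m', Suc g) & m' 13 = 0))"
proof -
 let ?F = "2 ^ (8 * (d + 1)) :: nat"
 let ?m1 = "m(9 := ?F, 10 := 1, 11 := 0, 12 := 0, 6 * UU + 1 := 0)"
 let ?Q = "%s. \<exists>m' :: memory. PRE y m' &
  (if succ y g then s = (m', g) & m' 13 = 1 & (\<exists>win. FND y g win m') else s = (m', Suc g) & m' 13 = 0)"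
 have U: "64 < UU" using d4_UU by simp
 have m: "m 2 = d" "m 6 = UU" using P by (auto simp: PRE_def P0_def)
 have d1: "den w H ks try_prog (m, g) = (?m1, g)" using m U by (simp add: try_prog_def ev)
 have P1: "PRE y ?m1" by (rule PRE_cong[OF _ P]) (use U in auto)
 have X1: "Xset (tau g) ks win 1 = {..<2 ^ d}" for win using n by (auto simp: Xset_def)
 have R1: "REG ?m1 g (%_. 0) 1"
  unfolding REG_def
 proof (intro allI impI)
  fix u :: nat assume u: "1 \<le> u" "u < 2 * 2 ^ d" "u div 2 < 1"
  hence u1: "u = 1" by linarith
  have a: "addr 1 = 8 * UU" by (simp add: addr_def)
  have "?m1 (8 * UU + t) = t" if "t < 2 ^ d" for t using P1 that unfolding PRE_def by blast
  hence "bij_betw (%t. ?m1 (8 * UU + t)) {..<2 ^ d} {..<2 ^ d} = bij_betw (%t. t) {..<2 ^ d} ({..<2 ^ d} :: nat set)"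
   by (intro bij_betw_cong) auto
  hence "bij_betw (%t. ?m1 (8 * UU + t)) {..<2 ^ d} {..<2 ^ d}" using bij_betw_id unfolding id_def by blast
  thus "bij_betw (%t. ?m1 (addr u + t)) {..<2 ^ (d - floor_log u)} (Xset (tau g) ks (%_. 0) u)"
   unfolding u1 a X1 by simp
 qed
 have S1: "SIM y g (1, %_. 0, 0, ?F, 0) ?m1"
  unfolding SIM_def prod.case
 proof (intro conjI allI impI)
  show "PRE y ?m1" by (rule P1)
  show "REG ?m1 g (%_. 0) 1" by (rule R1)
  fix u :: nat assume "1 \<le> u" "u \<le> 1" "u < 2 ^ d"
  hence "u = 1" by simp
  thus "?m1 (6 * UU + u) = 0" by simp
 qed (use U in auto)
 have al: "aligned d y 1" by (simp add: aligned_def)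
 have "\<exists>A a k sm. ms (2 ^ d) (64 * (d + 1)) (shf d y) (incf d y) (tst (tau g) ks) (%v. 2 ^ (d - floor_log v)) (1, %_. 0, 0, ?F, 0) A a k sm &
  final (2 ^ d) sm & A \<le> vcost d (vis y g) &
  (if vfound d (vis y g) & vtests d (vis y g) \<le> ?F
  then \<exists>win' fu'. sm = (2 ^ d, win', 0, fu', 0) & (\<forall>x<1. win' x = 0) & (\<forall>u\<in>{1..<2 ^ d}. goodw d y (tau g) ks win' u)
  else snd (snd (snd (snd sm))) = 1)"
  unfolding vis_def Tg_def
 proof (rule run_visit[OF y al])
  fix u :: nat assume "1 \<le> u" "u div 2 < 1"
  hence "u = 1" by linarith
  thus "Xset (tau g) ks (%_. 0) u = {..<2 ^ d}" using X1 by simp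
 qed simp
 then obtain A a k sm where M: "ms (2 ^ d) (64 * (d + 1)) (shf d y) (incf d y) (tst (tau g) ks) (%v. 2 ^ (d - floor_log v)) (1, %_. 0, 0, ?F, 0) A a k sm"
  and fin: "final (2 ^ d) sm" and A: "A \<le> vcost d (vis y g)" and
  r: "if succ y g then \<exists>win' fu'. sm = (2 ^ d, win', 0, fu', 0) & (\<forall>x<1. win' x = 0) & (\<forall>u\<in>{1..<2 ^ d}. goodw d y (tau g) ks win' u)
  else snd (snd (snd (snd sm))) = 1"
  unfolding succ_def by blast
 have "(2::nat) ^ (d - floor_log v) \<le> 2 ^ d" for v by (rule power_increasing) auto
 hence aA: "a \<le> A" "A \<le> a * 2 ^ d" using ms_weight[OF M, of "2 ^ d"] by auto
 have "a \<le> ?F" using ms_fuel[OF M] by simp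
 hence "a * 2 ^ d \<le> ?F * 2 ^ d" by (rule mult_le_mono1)
 with aA(2) have "A \<le> ?F * 2 ^ d" by (rule order_trans)
 hence Ac: "A \<le> cst y g" using A by (simp only: cst_def min.bounded_iff simp_thms)
 have main: "runs w H ks main_prog (?m1, g) (300 * (A + k) + 20) (%s. \<exists>m' :: memory. s = (m', g) & SIM y g sm m')"
  by (rule main_runs[OF M fin S1 n])
 have st: "snd (snd (snd (snd sm))) \<le> 1" if "SIM y g sm m'" for m' using that by (cases sm) (auto simp: SIM_def)
 have "\<exists>m'. SIM y g sm m'" using main unfolding runs_def by blast
 hence "snd (snd (snd (snd sm))) \<le> 1" using st by blast
 moreover have "shf d y 0 = 64 * (d + 1)" by (simp add: shf_def shq_def)
 note ms_potential[OF M this]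
 ultimately have k: "k \<le> 2 + 2 * a" by simp
 have T: "300 * (A + k) + 20 \<le> 900 * cst y g + 620"
 proof -
  have "A + k \<le> 3 * cst y g + 2" using k aA(1) Ac by linarith
  thus ?thesis by simp
 qed
 have main': "runs w H ks main_prog (?m1, g) (900 * cst y g + 620) (%s. \<exists>m' :: memory. s = (m', g) & SIM y g sm m')"
  by (rule runs_mono[OF main T], assumption)
 show ?thesis unfolding att_body_def
 proof (rule runs_Seq[where R = "%s. s = (?m1, g)" and ?T1.0 = 80, OF runs_den])
  show "loop_free try_prog" "tb try_prog \<le> 80" by (simp_all add: try_prog_def)
  show "den w H ks try_prog (m, g) = (?m1, g)" by (rule d1)
  fix s assume s: "s = (?m1, g)"
  show "runs w H ks (Seq main_prog (Cond (vr 12) (Seq Rehash (asg 13 (Const 0))) (asg 13 (Const 1)))) s (900 * cst y g + 650) ?Q"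
   unfolding s
  proof (rule runs_Seq[OF main', where ?T2.0 = 20])
   fix s assume "\<exists>m' :: memory. s = (m', g) & SIM y g sm m'"
   then obtain m' where s: "s = (m', g)" and S: "SIM y g sm m'" by blast
   have P': "PRE y m'" and m12: "m' 12 = snd (snd (snd (snd sm)))" using S by (cases sm, auto simp: SIM_def)+
   have PP: "PRE y (m'(13 := x))" for x by (rule PRE_cong[OF _ P']) auto
   show "runs w H ks (Cond (vr 12) (Seq Rehash (asg 13 (Const 0))) (asg 13 (Const 1))) s 20 ?Q"
   proof (rule runs_den)
    show "?Q (den w H ks (Cond (vr 12) (Seq Rehash (asg 13 (Const 0))) (asg 13 (Const 1))) s)"
    proof (cases "succ y g")
     case True
     then obtain win' fu' where sm: "sm = (2 ^ d, win', 0, fu', 0)" and gw: "\<forall>u\<in>{1..<2 ^ d}. goodw d y (tau g) ks win' u"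
      using r by auto
     have "m' (6 * UU + u) = win' u" if "u \<in> {1..<2 ^ d}" for u using S that by (simp add: sm SIM_def)
     hence "FND y g win' (m'(13 := 1))" using gw PP U by (simp add: FND_def)
     moreover have "den w H ks (Cond (vr 12) (Seq Rehash (asg 13 (Const 0))) (asg 13 (Const 1))) s = (m'(13 := 1), g)"
      using m12 by (simp add: s sm)
     ultimately show ?thesis using True PP[of 1] by (intro exI[of _ "m'(13 := 1)"]) auto
    next
     case False
     hence "m' 12 = 1" using r m12 by simp
     hence "den w H ks (Cond (vr 12) (Seq Rehash (asg 13 (Const 0))) (asg 13 (Const 1))) s = (m'(13 := 0), Suc g)"
      by (simp add: s)
     thus ?thesis using False PP[of 0] by (intro exI[of _ "m'(13 := 0)"]) auto
    qed
   qed simp_all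
  qed simp
 qed simp
qed

lemma att_runs:
 assumes n: "length ks = 2 ^ d" and y: "y \<le> d" and "PRE y m" "m 13 = 0"
  and "!!i. i < N ==> ~ succ y (g + i)" "succ y (g + N)"
 shows "runs w H ks (While (Op Equal (vr 13) (Const 0)) att_body) (m, g) ((\<Sum>i\<le>N. 900 * cst y (g + i) + 770) + 10)
  (%s. \<exists>(m' :: memory) win. s = (m', g + N) & FND y (g + N) win m')"
 using assms(3-)
proof (induction N arbitrary: m g)
 case 0
 have S: "succ y g" using 0 by simp
 show ?case
 proof (rule runs_While_step[OF _ body_runs[OF 0(1) n y]])
  show "aval w (fst (m, g)) (Op Equal (vr 13) (Const 0)) ~= 0" using 0 by simp
  fix s assume "\<exists>m' :: memory. PRE y m' & (if succ y g then s = (m', g) & m' 13 = 1 & (\<exists>win. FND y g win m') else s = (m', Suc g) & m' 13 = 0)"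
  then obtain m' win where s: "s = (m', g)" "m' 13 = 1" "FND y g win m'" using S by auto
  show "runs w H ks (While (Op Equal (vr 13) (Const 0)) att_body) s 10 (%s. \<exists>(m' :: memory) win. s = (m', g + 0) & FND y (g + 0) win m')"
   by (rule runs_While_done) (use s in auto)
 qed simp
next
 case (Suc N)
 have S: "~ succ y g" using Suc.prems(3)[of 0] by simp
 have e: "(\<Sum>i\<le>Suc N. 900 * cst y (g + i) + 770) = 900 * cst y g + 770 + (\<Sum>i\<le>N. 900 * cst y (Suc g + i) + 770)"
  by (subst sum.atMost_Suc_shift) simp
 show ?case
 proof (rule runs_While_step[OF _ body_runs[OF Suc.prems(1) n y]])
  show "aval w (fst (m, g)) (Op Equal (vr 13) (Const 0)) ~= 0" using Suc.prems by simp
  fix s assume "\<exists>m' :: memory. PRE y m' & (if succ y g then s = (m', g) & m' 13 = 1 & (\<exists>win. FND y g win m') else s = (m', Suc g) & m' 13 = 0)"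
  then obtain m' where s: "s = (m', Suc g)" "m' 13 = 0" "PRE y m'" using S by auto
  have "runs w H ks (While (Op Equal (vr 13) (Const 0)) att_body) (m', Suc g) ((\<Sum>i\<le>N. 900 * cst y (Suc g + i) + 770) + 10)
   (%s. \<exists>(m' :: memory) win. s = (m', Suc g + N) & FND y (Suc g + N) win m')"
   by (rule Suc.IH) (use s Suc.prems(3)[of "Suc _"] Suc.prems(4) in auto)
  thus "runs w H ks (While (Op Equal (vr 13) (Const 0)) att_body) s ((\<Sum>i\<le>N. 900 * cst y (Suc g + i) + 770) + 10)
   (%s. \<exists>(m' :: memory) win. s = (m', g + Suc N) & FND y (g + Suc N) win m')" unfolding s by simp
 qed (unfold e, simp)
qed

definition out_body :: com where
 "out_body = Seq (Seq (asg 41 (Load (arr 5 (vr 10)))) (Seq (asg 42 (plus (plus (Const 64) (times (Const 4) (vr 2))) (Op Div (vr 41) (vr 44))))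
  (Seq (asg 41 (Op Mod (vr 41) (vr 44))) (asg 43 (Load (arr 6 (vr 10)))))))
  (Seq (Store (vr 42) (Op BOr (Load (vr 42)) (Op Shl (vr 43) (vr 41)))) (Seq (inc 42)
  (Seq (Store (vr 42) (Op BOr (Load (vr 42)) (Op Shr (vr 43) (minus (vr 44) (vr 41))))) (inc 10))))"

definition out_prog :: com where
 "out_prog = Seq (asg 10 (Const 1)) (Seq (While (less (vr 10) (vr 0)) out_body)
  (asg 0 (times (vr 44) (plus (plus (Const 65) (times (Const 4) (vr 2))) (Op Div (vr 27) (vr 44))))))"

text \<open>The bit string begins at cell 1, so it contains the registers 1 to 63, at a cost of
  O(log n) bits; in return the query finds \<open>d\<close> in a fixed place. The headers start at
  cell 64 and the windows at cell \<open>64 + 4 * d\<close>. The length includes a spare cell, as a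
  window may straddle two cells.\<close>

definition OUTP :: "nat => (nat => nat) => memory => bool" where
 "OUTP y win m \<longleftrightarrow> m 0 = w * (65 + 4 * d + OFF d y (Suc d) div w) & m 2 = d & (\<forall>k\<in>{1..d}. hdr_ok y k m) &
  (\<forall>i. 64 + 4 * d + i div w < UU --> bit (m (64 + 4 * d + i div w)) (i mod w) = payl d y win (2 ^ d) i)"

lemma out_runs:
 assumes F: "FND y g win m"
 shows "runs w H ks out_prog (m, g) (150 * 2 ^ d + 100) (%s. \<exists>m' :: memory. s = (m', g) & OUTP y win m')"
proof -
 let ?B = "64 + 4 * d" and ?W = "64 * (d + 1)"
 have P: "PRE y m" and wn: "!!u. u \<in> {1..<2 ^ d} ==> m (6 * UU + u) = win u & win u < 2 ^ ?W"
  using F by (auto simp: FND_def goodw_def)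
 have c: "m 0 = 2 ^ d" "m 2 = d" "m 6 = UU" "m 44 = w" "m 27 = OFF d y (Suc d)" using P by (auto simp: PRE_def P0_def w)
 have U: "64 < UU" "4 * 2 ^ d < UU" "?B < UU" using d4_UU pow_d_UU by auto
 have z: "m b = 0" if "?B \<le> b" "b < UU" for b using P that by (auto simp: PRE_def)
 have uO: "ub c (OFF d y k)" if "12 \<le> c" "k \<le> Suc d" for c k
  by (rule ub_mono[OF _ that(1)]) (use OFF_le[of k d] that in \<open>simp add: ub_def\<close>)
 have uw: "ub c w" if "9 \<le> c" for c
 proof (rule ub_mono[OF _ that])
  have "(2::nat) ^ 8 * (d + 1) \<le> 2 ^ (8 * (d + 1)) * 2 ^ (d + 1)" using d_le(2) by (intro mult_mono power_increasing) auto
  also have "... = 2 ^ (9 * (d + 1))" unfolding power_add[symmetric] by simp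
  finally have "ub 9 (256 * (d + 1))" by (simp add: ub_def)
  thus "ub 9 w" by (simp only: w)
 qed
 define J where "J i m' \<longleftrightarrow> m' 10 = Suc i & (\<forall>b. b \<notin> {10, 41, 42, 43} --> ~ (?B \<le> b & b < UU) --> m' b = m b) &
  (\<forall>b. ?B \<le> b --> b < UU --> m' b < 2 ^ w) &
  (\<forall>x. ?B + x div w < UU --> bit (m' (?B + x div w)) (x mod w) = payl d y win (Suc i) x)" for i and m' :: memory
 let ?I = "%i s. \<exists>m' :: memory. s = (m', g) & J i m'"
 have d1: "den w H ks (asg 10 (Const 1)) (m, g) = (m(10 := 1), g)" by simp
 have J0: "J 0 (m(10 := 1))" unfolding J_def by (auto simp: z payl_def)
 have body: "runs w H ks out_body (m', g) 90 (?I (Suc i)) & m' 0 = 2 ^ d" if i: "i < 2 ^ d - 1" and J: "J i m'" for i m'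
 proof -
  let ?v = "Suc i"
  note jc = J[unfolded J_def]
  have m10: "m' 10 = ?v" by (rule jc[THEN conjunct1])
  have fr: "m' b = m b" if "b \<notin> {10, 41, 42, 43}" "~ (?B \<le> b & b < UU)" for b
   by (rule jc[THEN conjunct2, THEN conjunct1, rule_format, OF that])
  have lt: "m' b < 2 ^ w" if "?B \<le> b" "b < UU" for b
   by (rule jc[THEN conjunct2, THEN conjunct2, THEN conjunct1, rule_format, OF that])
  have py: "bit (m' (?B + x div w)) (x mod w) = payl d y win (Suc i) x" if "?B + x div w < UU" for x
   by (rule jc[THEN conjunct2, THEN conjunct2, THEN conjunct2, rule_format, OF that])
  have v: "1 \<le> ?v" "?v < 2 ^ d" using i by auto
  have vU: "?v < UU" using v U by linarith
  have e: "m' 0 = 2 ^ d" "m' 2 = d" "m' 6 = UU" "m' 44 = w" using fr[of 0] fr[of 2] fr[of 6] fr[of 44] c by auto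
  define p where "p = posf d y ?v"
  have nv: "m' (5 * UU + ?v) = p" using fr[of "5 * UU + ?v"] node_vals(5)[OF P v] U vU by (simp add: p_def)
  define x where "x = win ?v"
  have xv: "m' (6 * UU + ?v) = x" and xW: "x < 2 ^ ?W" using fr[of "6 * UU + ?v"] wn[of ?v] v U vU by (simp_all add: x_def)
  have xw: "x < 2 ^ w" by (rule less_le_trans[OF xW power_increasing]) (simp_all add: w)
  have pO: "p + ?W \<le> OFF d y (Suc d)"
  proof -
   note nc = node_coords(6,7)[OF v, of y]
   have "OFF d y (Suc (d - floor_log ?v)) \<le> OFF d y (Suc d)" by (rule OFF_mono) simp
   thus ?thesis using nc unfolding p_def by linarith
  qed
  have up: "ub c p" if "12 \<le> c" for c by (rule ub_le[OF uO[OF that, of "Suc d"]]) (use pO in simp_all)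
  define Q s where "Q = p div w" and "s = p mod w"
  have s: "s < w" and pQ: "p = Q * w + s" by (auto simp: Q_def s_def)
  have uQ: "ub c Q" if "12 \<le> c" for c unfolding Q_def using up[OF that] by simp
  have BQ: "Suc (?B + Q) < UU" by (rule less_UU[where a = 19]) (use uQ in simp_all)
  have uv: "ub c ?v" if "1 \<le> c" for c by (rule ub_le[OF ub_mono[OF ub_pow that, of d]]) (use v in auto)
  have uvi: "ub c i" if "1 \<le> c" for c by (rule ub_le[OF uv[OF that]]) simp
  have ux: "ub c x" if "64 \<le> c" for c by (rule ub_mono[OF _ that]) (use xW in \<open>simp add: ub_def\<close>)
  have us: "ub c s" if "9 \<le> c" for c by (rule ub_le[OF uw[OF that]]) (use s in simp)
  let ?m1 = "m'(42 := ?B + Q, 41 := s, 43 := x)"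
  have d1: "den w H ks (Seq (asg 41 (Load (arr 5 (vr 10)))) (Seq (asg 42 (plus (plus (Const 64) (times (Const 4) (vr 2))) (Op Div (vr 41) (vr 44))))
  (Seq (asg 41 (Op Mod (vr 41) (vr 44))) (asg 43 (Load (arr 6 (vr 10))))))) (m', g) = (?m1, g)"
   using m10 e nv xv U by (simp add: uv uvi up uQ us fun_eq_iff flip: Q_def s_def)
  define A where "A = Bit_Operations.or (m' (?B + Q)) (take_bit w (push_bit s x))"
  define A' where "A' = Bit_Operations.or (m' (Suc (?B + Q))) (drop_bit (w - s) x)"
  have t1: "take_bit w (m' (?B + Q)) = m' (?B + Q)" "take_bit w (m' (Suc (?B + Q))) = m' (Suc (?B + Q))"
   using lt[of "?B + Q"] lt[of "Suc (?B + Q)"] BQ by (auto intro!: take_bit_nat_eq_self)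
  have t2: "take_bit w (drop_bit (w - s) x) = drop_bit (w - s) x"
   unfolding drop_bit_eq_div by (rule take_bit_nat_eq_self, rule le_less_trans[OF div_le_dividend xw])
  have tA: "take_bit w A = A" "take_bit w A' = A'" unfolding A_def A'_def take_bit_or t1 t2 by simp_all
  let ?m2 = "?m1(?B + Q := A)" let ?m3 = "?m2(42 := Suc (?B + Q))" let ?m4 = "?m3(Suc (?B + Q) := A')" let ?m5 = "?m4(10 := Suc ?v)"
  have s1: "den w H ks (Store (vr 42) (Op BOr (Load (vr 42)) (Op Shl (vr 43) (vr 41)))) (?m1, g) = (?m2, g)"
   using tA(1) by (simp add: A_def[symmetric])
  have s2: "den w H ks (inc 42) (?m2, g) = (?m3, g)" by (simp add: uQ)
  have s3: "den w H ks (Store (vr 42) (Op BOr (Load (vr 42)) (Op Shr (vr 43) (minus (vr 44) (vr 41))))) (?m3, g) = (?m4, g)"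
  proof -
   have w1: "take_bit w (w - s) = w - s" using uw[of 255] by simp
   show ?thesis using e t1(2) t2 by (simp add: w1 A'_def)
  qed
  have s4: "den w H ks (inc 10) (?m4, g) = (?m5, g)" using m10 by (simp add: uv uvi)
  have den: "den w H ks out_body (m', g) = (?m5, g)" using d1 s1 s2 s3 s4 by (simp only: out_body_def den.simps(4))
  have "J (Suc i) ?m5"
   unfolding J_def
  proof (intro conjI allI impI)
   fix b :: nat assume "b \<notin> {10, 41, 42, 43}" "~ (?B \<le> b & b < UU)"
   thus "?m5 b = m b" using fr[of b] BQ by auto
  next
   fix b :: nat assume b: "?B \<le> b" "b < UU"
   have "A < 2 ^ w" "A' < 2 ^ w" using tA by (metis take_bit_nat_less_exp)+
   thus "?m5 b < 2 ^ w" using lt[OF b] b by auto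
  next
   fix z :: nat assume zU: "?B + z div w < UU"
   have "bit (?m5 (?B + z div w)) (z mod w) = bit ((m'(?B + Q := A, Suc (?B + Q) := A')) (?B + z div w)) (z mod w)" by simp
   also have "... \<longleftrightarrow> bit (m' (?B + z div w)) (z mod w) \<or> (Q * w + s \<le> z & bit x (z - (Q * w + s)))"
    unfolding A_def A'_def by (rule pay_or[OF s xw])
   also have "... \<longleftrightarrow> payl d y win (Suc (Suc i)) z"
    unfolding py[OF zU] pQ[symmetric] unfolding p_def x_def payl_def by (auto simp: atLeastLessThanSuc)
   finally show "bit (?m5 (?B + z div w)) (z mod w) = payl d y win (Suc (Suc i)) z" .
  qed simp
  moreover have "loop_free out_body" "tb out_body \<le> 90" by (simp_all add: out_body_def)
  ultimately show ?thesis using e(1) den by (auto intro!: runs_den)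
 qed
 have n1: "Suc (2 ^ d - 1) = (2 ^ d :: nat)" by simp
 show ?thesis unfolding out_prog_def
 proof (rule runs_Seq[where R = "%s. s = (m(10 := 1), g)" and ?T1.0 = 10, OF runs_den])
  show "den w H ks (asg 10 (Const 1)) (m, g) = (m(10 := 1), g)" by (rule d1)
  fix s assume s: "s = (m(10 := 1), g)"
  show "runs w H ks (Seq (While (less (vr 10) (vr 0)) out_body)
  (asg 0 (times (vr 44) (plus (plus (Const 65) (times (Const 4) (vr 2))) (Op Div (vr 27) (vr 44)))))) s (150 * 2 ^ d + 90)
  (%s. \<exists>m' :: memory. s = (m', g) & OUTP y win m')" unfolding s
  proof (rule runs_Seq[where R = "?I (2 ^ d - 1)" and ?T1.0 = "150 * 2 ^ d + 10"])
   show "runs w H ks (While (less (vr 10) (vr 0)) out_body) (m(10 := 1), g) (150 * 2 ^ d + 10) (?I (2 ^ d - 1))"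
   proof (rule runs_for[where I = ?I and N = "2 ^ d - 1" and T = "%_. 90"])
    show "?I 0 (m(10 := 1), g)" using J0 by blast
    fix i s assume i: "i < 2 ^ d - 1" and "?I i s"
    then obtain m' where s: "s = (m', g)" and J: "J i m'" by blast
    have "m' 10 = Suc i" using J unfolding J_def by blast
    thus "aval w (fst s) (less (vr 10) (vr 0)) ~= 0 & runs w H ks out_body s 90 (?I (Suc i))"
     using body[OF i J] i by (simp add: s)
   next
    fix s assume "?I (2 ^ d - 1) s"
    then obtain m' where s: "s = (m', g)" and J: "J (2 ^ d - 1) m'" by blast
    have "m' 10 = 2 ^ d" using J unfolding J_def n1 by blast
    moreover have "m' 0 = m 0" using J[unfolded J_def, THEN conjunct2, THEN conjunct1, rule_format, of 0] U by simp
    ultimately show "aval w (fst s) (less (vr 10) (vr 0)) = 0" using c by (simp add: s)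
   next
    have "(\<Sum>i<N. 90 + (1 + 5)) + (1 + 5) \<le> 150 * M + 10" if "N \<le> M" for N M :: nat using that by simp
    from this[of "2 ^ d - 1" "2 ^ d"] have "(\<Sum>i<(2::nat) ^ d - 1. 90 + (1 + 5)) + (1 + 5) \<le> 150 * (2::nat) ^ d + 10" by simp
    moreover have "acost (less (vr 10) (vr 0)) = 5" by simp
    ultimately show "(\<Sum>i<(2::nat) ^ d - 1. 90 + (1 + acost (less (vr 10) (vr 0)))) + (1 + acost (less (vr 10) (vr 0))) \<le> 150 * 2 ^ d + 10" by (simp only:)
   qed
   fix s assume "?I (2 ^ d - 1) s"
   then obtain m' where s: "s = (m', g)" and J: "J (2 ^ d - 1) m'" by blast
   note jc = J[unfolded J_def n1]
   have fr: "m' b = m b" if "b \<notin> {10, 41, 42, 43}" "~ (?B \<le> b & b < UU)" for b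
    by (rule jc[THEN conjunct2, THEN conjunct1, rule_format, OF that])
   have e: "m' 0 = 2 ^ d" "m' 2 = d" "m' 44 = w" "m' 27 = OFF d y (Suc d)" using fr[of 0] fr[of 2] fr[of 27] fr[of 44] c by auto
   let ?L = "w * (65 + 4 * d + OFF d y (Suc d) div w)"
   have den: "den w H ks (asg 0 (times (vr 44) (plus (plus (Const 65) (times (Const 4) (vr 2))) (Op Div (vr 27) (vr 44))))) s = (m'(0 := ?L), g)"
    using e by (simp add: s uw uO)
   have O: "OUTP y win (m'(0 := ?L))"
    unfolding OUTP_def
   proof (intro conjI ballI allI impI)
    fix k assume k: "k \<in> {1..d}"
    have "hdr_ok y k m" using P k by (simp add: PRE_def)
    moreover have "m' (64 + 4 * (d - k) + i) = m (64 + 4 * (d - k) + i)" if "i < 4" for i using k that by (intro fr) auto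
    note this[of 0] this[of 1] this[of 2] this[of 3]
    ultimately show "hdr_ok y k (m'(0 := ?L))" by (simp add: hdr_ok_def Let_def)
   next
    fix i assume "?B + i div w < UU"
    thus "bit ((m'(0 := ?L)) (?B + i div w)) (i mod w) = payl d y win (2 ^ d) i"
     using jc[THEN conjunct2, THEN conjunct2, THEN conjunct2, rule_format, of i] by simp
   qed (use e in simp_all)
   show "runs w H ks (asg 0 (times (vr 44) (plus (plus (Const 65) (times (Const 4) (vr 2))) (Op Div (vr 27) (vr 44))))) s 80
    (%s. \<exists>m' :: memory. s = (m', g) & OUTP y win m')"
    by (rule runs_den) (use den O in auto)
  qed simp
 qed simp_all
qed

end

section \<open>Expected cost of one attempt\<close>

definition row_pmf :: "nat => (nat => bool) pmf" where
 "row_pmf n = Pi_pmf {..<n} False (%_. bernoulli_pmf (1 / 2))"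

definition node_pmf :: "nat => (nat => nat => bool) pmf" where
 "node_pmf d = Pi_pmf {..<2 ^ (64 * (d + 1))} (%_. False) (%_. row_pmf (2 ^ d))"

definition table_pmf :: "nat => nat set => (nat => nat => nat => bool) pmf" where
 "table_pmf d A = Pi_pmf A (%_ _. False) (%_. node_pmf d)"

lemma ok_prob:
 assumes X: "X \<subseteq> {..<n}" "card X = 2 ^ k" and k: "1 \<le> k"
 shows "map_pmf (ok X) (row_pmf n) = bernoulli_pmf (pr k)"
proof -
 define t where "t = (2::nat) ^ (k - 1)"
 have c: "card X = 2 * t" using X k by (cases k) (auto simp: t_def)
 have fX: "finite X" using X(1) by (rule finite_subset) simp
 have "binomial_pmf (2 * t) (1 / 2) = map_pmf (%f. card {x \<in> X. f x}) (Pi_pmf X False (%_. bernoulli_pmf (1 / 2)))"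
  using fX c by (intro binomial_pmf_altdef') auto
 also have "Pi_pmf X False (%_. bernoulli_pmf (1 / 2)) = map_pmf (%f x. if x \<in> X then f x else False) (row_pmf n)"
  unfolding row_pmf_def by (rule Pi_pmf_subset) (use X in auto)
 also have "map_pmf (%f. card {x \<in> X. f x}) (map_pmf (%f x. if x \<in> X then f x else False) (row_pmf n)) = map_pmf (%f. card {x \<in> X. f x}) (row_pmf n)"
  unfolding pmf.map_comp by (intro map_pmf_cong refl) (auto intro!: arg_cong[where f = card])
 finally have b: "map_pmf (%f. card {x \<in> X. f x}) (row_pmf n) = binomial_pmf (2 * t) (1 / 2)" ..
 have "map_pmf (ok X) (row_pmf n) = map_pmf (%c. c = t) (map_pmf (%f. card {x \<in> X. f x}) (row_pmf n))"
  unfolding pmf.map_comp by (intro map_pmf_cong refl) (auto simp: ok_def c)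
 also have "... = map_pmf (%c. c = t) (binomial_pmf (2 * t) (1 / 2))" unfolding b ..
 also have "... = bernoulli_pmf (pr k)"
 proof (rule pmf_eqI)
  have "pmf (map_pmf (%c. c = t) (binomial_pmf (2 * t) (1 / 2))) True = measure (binomial_pmf (2 * t) (1 / 2)) ((%c. c = t) -` {True})"
   by (rule pmf_map)
  also have "(%c. c = t) -` {True} = {t}" by auto
  also have "measure (binomial_pmf (2 * t) (1 / 2)) {t} = pmf (binomial_pmf (2 * t) (1 / 2)) t" by (rule measure_pmf_single)
  also have "... = real ((2 * t) choose t) * (1 / 2) ^ t * (1 / 2) ^ t" by (subst pmf_binomial) simp_all
  also have "... = pr k" by (simp add: pr_def cb_def t_def power_divide flip: power_mult_distrib power_add)
  finally have T: "pmf (map_pmf (%c. c = t) (binomial_pmf (2 * t) (1 / 2))) True = pr k" .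
  have p: "0 \<le> pr k" "pr k \<le> 1" using pr_pos[of k] pr_le[of k] by auto
  fix i show "pmf (map_pmf (%c. c = t) (binomial_pmf (2 * t) (1 / 2))) i = pmf (bernoulli_pmf (pr k)) i"
   using T p by (cases i) (simp_all add: pmf_False_conv_True)
 qed
 finally show ?thesis .
qed

lemma layer_pmf:
 assumes X: "X \<subseteq> {..<2 ^ d}" "card X = 2 ^ k" and k: "1 \<le> k"
 shows "map_pmf (%N c. c < 2 ^ (64 * (d + 1)) & ok X (N c)) (node_pmf d) = Pi_pmf {..<2 ^ (64 * (d + 1))} False (%_. bernoulli_pmf (pr k))"
proof -
 have f: "ok X (%_. False) = False" using X by (simp add: ok_def)
 have "Pi_pmf {..<2 ^ (64 * (d + 1))} False (%_. bernoulli_pmf (pr k)) = Pi_pmf {..<2 ^ (64 * (d + 1))} False (%_. map_pmf (ok X) (row_pmf (2 ^ d)))"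
  unfolding ok_prob[OF X k] ..
 also have "... = map_pmf (%h. ok X \<circ> h) (node_pmf d)" unfolding node_pmf_def by (rule Pi_pmf_map) (use f in simp_all)
 also have "... = map_pmf (%N c. c < 2 ^ (64 * (d + 1)) & ok X (N c)) (node_pmf d)"
 proof (rule map_pmf_cong[OF refl])
  fix N assume "N \<in> set_pmf (node_pmf d)"
  hence "\<forall>c. c \<notin> {..<2 ^ (64 * (d + 1))} --> N c = (%_. False)" unfolding node_pmf_def using set_Pi_pmf_subset by fastforce
  hence e: "ok X (N c) = (c < 2 ^ (64 * (d + 1)) & ok X (N c))" for c using f by (cases "c < 2 ^ (64 * (d + 1))") simp_all
  show "ok X \<circ> N = (%c. c < 2 ^ (64 * (d + 1)) & ok X (N c))" unfolding o_def by (rule ext) (rule e)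
 qed
 finally show ?thesis ..
qed

text \<open>For fixed key sets the layers of a segment read the table at different nodes and are
  therefore independent; each is a family of Bernoulli variables by
  \<open>layer_pmf\<close>.\<close>

lemma layers_pmf:
 assumes X: "!!r. r < length bs ==> Xs (v + r) \<subseteq> {..<2 ^ d} & card (Xs (v + r)) = 2 ^ k" and k: "1 \<le> k"
 shows "map_pmf (%T. map (%r. (%c. c < 2 ^ (64 * (d + 1)) & ok (Xs (v + r)) (T (v + r) c), bs ! r)) [0..<length bs])
  (table_pmf d {v..<v + length bs}) = rl (64 * (d + 1)) (pr k) bs"
 using X
proof (induction bs arbitrary: v)
 case (Cons b bs)
 let ?W = "64 * (d + 1)"
 let ?L = "%v bs T. map (%r. (%c. c < 2 ^ ?W & ok (Xs (v + r)) (T (v + r) c), bs ! r)) [0..<length bs]"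
 have i: "{v..<v + length (b # bs)} = insert v {Suc v..<Suc v + length bs}" by auto
 have t: "table_pmf d {v..<v + length (b # bs)} = bind_pmf (node_pmf d) (%N. map_pmf (%T. T(v := N)) (table_pmf d {Suc v..<Suc v + length bs}))"
  unfolding i table_pmf_def by (subst Pi_pmf_insert') (simp_all add: map_pmf_def)
 have s: "?L v (b # bs) (T(v := N)) = (%c. c < 2 ^ ?W & ok (Xs v) (N c), b) # ?L (Suc v) bs T" for T N
 proof -
  have u: "[0..<length (b # bs)] = 0 # map Suc [0..<length bs]" by (simp add: map_Suc_upt upt_conv_Cons del: upt_Suc)
  show ?thesis unfolding u by simp
 qed
 have IH: "map_pmf (?L (Suc v) bs) (table_pmf d {Suc v..<Suc v + length bs}) = rl ?W (pr k) bs"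
  by (rule Cons.IH) (use Cons.prems[of "Suc _"] in auto)
 have X0: "Xs v \<subseteq> {..<2 ^ d}" "card (Xs v) = 2 ^ k" using Cons.prems[of 0] by auto
 have "map_pmf (?L v (b # bs)) (table_pmf d {v..<v + length (b # bs)}) =
  bind_pmf (node_pmf d) (%N. map_pmf (%ls. (%c. c < 2 ^ ?W & ok (Xs v) (N c), b) # ls) (map_pmf (?L (Suc v) bs) (table_pmf d {Suc v..<Suc v + length bs})))"
  unfolding t map_bind_pmf pmf.map_comp o_def s ..
 also have "... = bind_pmf (map_pmf (%N c. c < 2 ^ ?W & ok (Xs v) (N c)) (node_pmf d)) (%o'. map_pmf (%ls. (o', b) # ls) (rl ?W (pr k) bs))"
  unfolding IH bind_map_pmf ..
 also have "... = rl ?W (pr k) (b # bs)" unfolding layer_pmf[OF X0 k] by simp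
 finally show ?case .
qed (simp add: table_pmf_def)

lemma nextX_subset: "(!!u. Xs u \<subseteq> A) ==> nextX T v p Xs u \<subseteq> A"
 by (auto simp: nextX_def)

lemma lay_cong:
 assumes "!!u c i. v \<le> u ==> u < v + 2 ^ kap d y (d - floor_log v) ==> c < 2 ^ (64 * (d + 1)) ==> i < 2 ^ d ==> T u c i = T' u c i"
  and X: "!!u. Xs u \<subseteq> {..<2 ^ d}"
 shows "lay d y T v Xs = lay d y T' v Xs"
proof -
 have "(c < 2 ^ (64 * (d + 1)) & ok (Xs (v + r)) (T (v + r) c)) = (c < 2 ^ (64 * (d + 1)) & ok (Xs (v + r)) (T' (v + r) c))"
  if r: "r < 2 ^ kap d y (d - floor_log v)" for r c
 proof (cases "c < 2 ^ (64 * (d + 1))")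
  case True
  have "{i \<in> Xs (v + r). T (v + r) c i} = {i \<in> Xs (v + r). T' (v + r) c i}" using assms(1)[of "v + r" c] r True X by auto
  thus ?thesis by (simp add: ok_def)
 qed simp
 thus ?thesis unfolding lay_def by simp
qed

lemma lay_b: "l \<in> set (lay d y T v Xs) ==> snd l \<in> set (bl d y (d - floor_log v))"
 by (auto simp: lay_def)

lemma sr_path:
 assumes S: "fst (sr d (lay d y T v Xs)) = Some p" and al: "aligned d y v" "v < 2 ^ d" and y: "y \<le> d"
 shows "length p = 2 ^ kap d y (d - floor_log v)" "r < length p ==> p ! r < 2 ^ (64 * (d + 1)) & ok (Xs (v + r)) (T (v + r) (p ! r))"
proof -
 have S': "sr d (lay d y T v Xs) = (Some p, snd (sr d (lay d y T v Xs)))" using S by (metis prod.collapse)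
 note sp = srch_path[OF S']
 have l: "length (lay d y T v Xs) = 2 ^ kap d y (d - floor_log v)" by (simp add: lay_def)
 show lp: "length p = 2 ^ kap d y (d - floor_log v)" using sp l by simp
 assume r: "r < length p"
 have "fst (lay d y T v Xs ! r) (p ! r)" using sp r l lp by simp
 thus "p ! r < 2 ^ (64 * (d + 1)) & ok (Xs (v + r)) (T (v + r) (p ! r))" using r lp by (simp add: lay_def)
qed

text \<open>From \<open>v\<close> on, an attempt reads the table only at later nodes, at windows of
  proper size and at existing keys. So earlier segments act on later ones through the key sets
  alone.\<close>

lemma visit_cong:
 assumes "!!u c i. v \<le> u ==> u < 2 ^ d ==> c < 2 ^ (64 * (d + 1)) ==> i < 2 ^ d ==> T u c i = T' u c i"
  and "!!u. Xs u \<subseteq> {..<2 ^ d}" and "aligned d y v" and y: "y \<le> d"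
 shows "visit d y T v Xs = visit d y T' v Xs"
 using assms(1-3)
proof (induction "2 ^ d - v" arbitrary: v Xs rule: less_induct)
 case less
 show ?case
 proof (cases "v < 2 ^ d")
  case True
  let ?K = "2 ^ kap d y (d - floor_log v) :: nat"
  note s = aligned_seg[OF less.prems(3) True]
  have le: "v + ?K \<le> 2 ^ d" using s(4) by (simp add: aligned_def)
  have L: "lay d y T v Xs = lay d y T' v Xs" by (rule lay_cong) (use less.prems le in auto)
  have R: "visit d y T (v + ?K) (nextX T v p Xs) = visit d y T' (v + ?K) (nextX T' v p Xs)" if p: "fst (sr d (lay d y T v Xs)) = Some p" for p
  proof -
   note pp = sr_path[OF p less.prems(3) True y]
   have N: "nextX T v p Xs = nextX T' v p Xs"
   proof
    fix u
    have "T (u div 2) (p ! (u div 2 - v)) i = T' (u div 2) (p ! (u div 2 - v)) i" if "v \<le> u div 2" "u div 2 < v + length p" "i \<in> Xs (u div 2)" for i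
    proof (rule less.prems(1))
     show "p ! (u div 2 - v) < 2 ^ (64 * (d + 1))" using pp(2)[of "u div 2 - v"] that by auto
    qed (use that le pp(1) less.prems(2) in auto)
    thus "nextX T v p Xs u = nextX T' v p Xs u" unfolding nextX_def by auto
   qed
   have "visit d y T (v + ?K) (nextX T v p Xs) = visit d y T' (v + ?K) (nextX T v p Xs)"
   proof (rule less.hyps)
    show "2 ^ d - (v + ?K) < 2 ^ d - v" using True by (intro diff_less_mono2) auto
    show "nextX T v p Xs u \<subseteq> {..<2 ^ d}" for u by (rule nextX_subset) (rule less.prems(2))
    show "aligned d y (v + ?K)" by (rule s(4))
   qed (use less.prems(1) in auto)
   thus ?thesis unfolding N .
  qed
  show ?thesis
   by (subst (1 2) visit.simps) (use True R in \<open>auto simp: L split: option.splits\<close>)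
 qed (simp add: visit.simps)
qed

text \<open>Fubini for the table of the present segment and that of the later nodes. Given the
  former, the next key sets are fixed and again halved perfectly, so the induction hypothesis
  applies to the latter whatever path was found. The bound for a segment is shared equally by its
  nodes, which hides the segmentation from the final sum.\<close>

lemma visit_expect:
 fixes g :: "nat => layer list => ennreal" and ga :: "nat => ennreal"
 assumes g: "!!k. k \<in> {1..d} ==> (\<integral>\<^sup>+ls. g k ls \<partial>rl (64 * (d + 1)) (pr k) (bl d y k)) \<le> of_nat (2 ^ kap d y k) * ga k"
  and y: "y \<le> d" and "aligned d y v" and "!!u. Xs u \<subseteq> {..<2 ^ d}"
  and "!!u. 1 \<le> u ==> u div 2 < v ==> u < 2 * 2 ^ d ==> card (Xs u) = 2 ^ (d - floor_log u)"
 shows "(\<integral>\<^sup>+T. (\<Sum>(k, ls)\<leftarrow>visit d y T v Xs. g k ls) \<partial>table_pmf d {v..<2 ^ d}) \<le> (\<Sum>u=v..<2 ^ d. ga (d - floor_log u))"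
 using assms(3-)
proof (induction "2 ^ d - v" arbitrary: v Xs rule: less_induct)
 case less
 show ?case
 proof (cases "v < 2 ^ d")
  case False
  thus ?thesis by (simp add: visit.simps)
 next
  case True
  let ?W = "64 * (d + 1)" let ?k = "d - floor_log v"
  let ?K = "2 ^ kap d y ?k :: nat" let ?v1 = "v + ?K"
  note s = aligned_seg[OF less.prems(1) True]
  have v1: "1 \<le> v" using less.prems(1) by (simp add: aligned_def)
  have le: "?v1 \<le> 2 ^ d" using s(4) by (simp add: aligned_def)
  have k: "?k \<in> {1..d}" using s(1) by auto
  have par: "u div 2 < v" if "u < ?v1" for u
  proof -
   have "u < 2 * 2 ^ floor_log v" using that s(2) by linarith
   thus ?thesis using s(3) by linarith
  qed
  define mg where "mg = (%(T1 :: nat => nat => nat => bool, T2) u. if u \<in> {v..<?v1} then T1 u else T2 u)"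
  have "{v..<2 ^ d} = {v..<?v1} \<union> {?v1..<2 ^ d}" using le by auto
  hence tp: "table_pmf d {v..<2 ^ d} = map_pmf mg (pair_pmf (table_pmf d {v..<?v1}) (table_pmf d {?v1..<2 ^ d}))"
   unfolding table_pmf_def mg_def by (simp only:) (rule Pi_pmf_union, auto)
  let ?R = "\<Sum>u=?v1..<2 ^ d. ga (d - floor_log u)"
  have inner: "(\<integral>\<^sup>+T2. (\<Sum>(k, ls)\<leftarrow>visit d y (mg (T1, T2)) v Xs. g k ls) \<partial>table_pmf d {?v1..<2 ^ d}) \<le> g ?k (lay d y T1 v Xs) + ?R" for T1
  proof -
   have L: "lay d y (mg (T1, T2)) v Xs = lay d y T1 v Xs" for T2 by (rule lay_cong) (use less.prems in \<open>auto simp: mg_def\<close>)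
   have V: "visit d y (mg (T1, T2)) v Xs = (?k, lay d y T1 v Xs) # (case fst (sr d (lay d y T1 v Xs)) of None => []
    | Some p => visit d y (mg (T1, T2)) ?v1 (nextX (mg (T1, T2)) v p Xs))" for T2
    by (subst visit.simps) (use True in \<open>simp add: L\<close>)
   show ?thesis
   proof (cases "fst (sr d (lay d y T1 v Xs))")
    case None
    thus ?thesis unfolding V by (simp add: measure_pmf.emeasure_space_1 add_increasing2)
   next
    case (Some p)
    note pp = sr_path[OF Some less.prems(1) True y]
    have N: "nextX (mg (T1, T2)) v p Xs = nextX T1 v p Xs" for T2
     using pp(1) by (auto simp: nextX_def mg_def fun_eq_iff)
    have X': "nextX T1 v p Xs u \<subseteq> {..<2 ^ d}" for u by (rule nextX_subset) (rule less.prems(2))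
    have C: "visit d y (mg (T1, T2)) ?v1 (nextX T1 v p Xs) = visit d y T2 ?v1 (nextX T1 v p Xs)" for T2
     by (rule visit_cong) (use X' s(4) y in \<open>auto simp: mg_def\<close>)
    have "(\<integral>\<^sup>+T2. (\<Sum>(k, ls)\<leftarrow>visit d y (mg (T1, T2)) v Xs. g k ls) \<partial>table_pmf d {?v1..<2 ^ d}) =
     (\<integral>\<^sup>+T2. g ?k (lay d y T1 v Xs) + (\<Sum>(k, ls)\<leftarrow>visit d y T2 ?v1 (nextX T1 v p Xs). g k ls) \<partial>table_pmf d {?v1..<2 ^ d})"
     unfolding V Some option.case N C by simp
    also have "... = g ?k (lay d y T1 v Xs) + (\<integral>\<^sup>+T2. (\<Sum>(k, ls)\<leftarrow>visit d y T2 ?v1 (nextX T1 v p Xs). g k ls) \<partial>table_pmf d {?v1..<2 ^ d})"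
     by (subst nn_integral_add) (simp_all add: measure_pmf.emeasure_space_1)
    also have "... \<le> g ?k (lay d y T1 v Xs) + ?R"
    proof (rule add_left_mono, rule less.hyps)
     show "2 ^ d - ?v1 < 2 ^ d - v" using True by (intro diff_less_mono2) auto
     show "aligned d y ?v1" by (rule s(4))
     show "nextX T1 v p Xs u \<subseteq> {..<2 ^ d}" for u by (rule X')
     fix u :: nat assume u: "1 \<le> u" "u div 2 < ?v1" "u < 2 * 2 ^ d"
     show "card (nextX T1 v p Xs u) = 2 ^ (d - floor_log u)"
     proof (cases "u div 2 < v")
      case True
      thus ?thesis using less.prems(3)[of u] u by (simp add: nextX_def)
     next
      case False
      let ?x = "u div 2"
      have x: "v \<le> ?x" "?x < ?v1" using False u by auto
      define r where "r = ?x - v"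
      have r: "r < ?K" "?x = v + r" using x by (auto simp: r_def)
      let ?X = "Xs ?x" let ?P = "T1 ?x (p ! r)"
      have fX: "finite ?X" by (rule finite_subset[OF less.prems(2)]) simp
      have cX: "card ?X = 2 ^ (d - floor_log ?x)" using less.prems(3)[of ?x] par[OF x(2)] x v1 u by simp
      have ok: "2 * card {i \<in> ?X. ?P i} = card ?X" using pp(2)[of r] r pp(1) by (simp add: ok_def)
      have "card {i \<in> ?X. ?P i} + card {i \<in> ?X. ~ ?P i} = card ({i \<in> ?X. ?P i} \<union> {i \<in> ?X. ~ ?P i})"
       using fX by (intro card_Un_disjoint[symmetric]) auto
      also have "{i \<in> ?X. ?P i} \<union> {i \<in> ?X. ~ ?P i} = ?X" by auto
      finally have cc: "2 * card {i \<in> ?X. ~ ?P i} = card ?X" using ok by linarith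
      have u2: "2 \<le> u" using x v1 by auto
      have fl: "floor_log u = Suc (floor_log ?x)" using floor_log_rec[of u] u2 by simp
      have "floor_log ?x < d" using floor_log_less[of ?x d] x v1 u by auto
      hence e: "(2::nat) ^ (d - floor_log ?x) = 2 * 2 ^ (d - floor_log u)" unfolding fl by (simp flip: power_Suc add: Suc_diff_Suc)
      have "nextX T1 v p Xs u = {i \<in> ?X. ?P i \<longleftrightarrow> u mod 2 = 1}" using x pp(1) by (simp add: nextX_def r_def)
      thus ?thesis using ok cc cX e by (cases "u mod 2 = 1") simp_all
     qed
    qed
    finally show ?thesis .
   qed
  qed
  have lp: "map_pmf (%T. lay d y T v Xs) (table_pmf d {v..<?v1}) = rl ?W (pr ?k) (bl d y ?k)"
  proof -
   have "map_pmf (%T. map (%r. (%c. c < 2 ^ ?W & ok (Xs (v + r)) (T (v + r) c), bl d y ?k ! r)) [0..<length (bl d y ?k)])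
    (table_pmf d {v..<v + length (bl d y ?k)}) = rl ?W (pr ?k) (bl d y ?k)"
   proof (rule layers_pmf)
    fix r assume "r < length (bl d y ?k)"
    hence r: "r < ?K" by simp
    have "card (Xs (v + r)) = 2 ^ (d - floor_log (v + r))" using less.prems(3)[of "v + r"] par[of "v + r"] r le v1 by simp
    thus "Xs (v + r) \<subseteq> {..<2 ^ d} & card (Xs (v + r)) = 2 ^ ?k" using less.prems(2) s(5)[OF r] by simp
   qed (use k in simp)
   thus ?thesis by (simp add: lay_def)
  qed
  have "(\<integral>\<^sup>+T. (\<Sum>(k, ls)\<leftarrow>visit d y T v Xs. g k ls) \<partial>table_pmf d {v..<2 ^ d}) =
   (\<integral>\<^sup>+T1. \<integral>\<^sup>+T2. (\<Sum>(k, ls)\<leftarrow>visit d y (mg (T1, T2)) v Xs. g k ls) \<partial>table_pmf d {?v1..<2 ^ d} \<partial>table_pmf d {v..<?v1})"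
   unfolding tp nn_integral_map_pmf nn_integral_pair_pmf' ..
  also have "... \<le> (\<integral>\<^sup>+T1. g ?k (lay d y T1 v Xs) + ?R \<partial>table_pmf d {v..<?v1})"
   by (intro nn_integral_mono inner)
  also have "... = (\<integral>\<^sup>+T1. g ?k (lay d y T1 v Xs) \<partial>table_pmf d {v..<?v1}) + ?R"
   by (subst nn_integral_add) (simp_all add: measure_pmf.emeasure_space_1)
  also have "(\<integral>\<^sup>+T1. g ?k (lay d y T1 v Xs) \<partial>table_pmf d {v..<?v1}) = (\<integral>\<^sup>+ls. g ?k ls \<partial>rl ?W (pr ?k) (bl d y ?k))"
   unfolding lp[symmetric] nn_integral_map_pmf ..
  also have "... + ?R \<le> of_nat ?K * ga ?k + ?R" by (intro add_right_mono g k)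
  also have "of_nat ?K * ga ?k = (\<Sum>u=v..<?v1. ga (d - floor_log u))"
  proof -
   have "(\<Sum>u=v..<?v1. ga (d - floor_log u)) = (\<Sum>u=v..<?v1. ga ?k)"
   proof (intro sum.cong refl)
    fix u assume "u \<in> {v..<?v1}"
    hence "u - v < ?K" "v + (u - v) = u" by auto
    thus "ga (d - floor_log u) = ga ?k" using s(5)[of "u - v"] by simp
   qed
   thus ?thesis by simp
  qed
  also have "(\<Sum>u=v..<?v1. ga (d - floor_log u)) + ?R = (\<Sum>u=v..<2 ^ d. ga (d - floor_log u))"
   by (rule sum.atLeastLessThan_concat) (use le in auto)
  finally show ?thesis .
 qed
qed

lemma sum_nodes:
 "(\<Sum>u=1..<2 ^ d. ga (d - floor_log u)) = (\<Sum>k=1..d. of_nat (2 ^ (d - k)) * ga k)" for ga :: "nat => ennreal"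
proof -
 have "(\<Sum>u=1..<2 ^ e. ga (d - floor_log u)) = (\<Sum>j<e. of_nat (2 ^ j) * ga (d - j))" for e
 proof (induction e)
  case (Suc e)
  have "(\<Sum>u=1..<2 ^ Suc e. ga (d - floor_log u)) = (\<Sum>u=1..<2 ^ e. ga (d - floor_log u)) + (\<Sum>u=2 ^ e..<2 ^ Suc e. ga (d - floor_log u))"
   by (rule sum.atLeastLessThan_concat[symmetric]) auto
  also have "(\<Sum>u=2 ^ e..<2 ^ Suc e. ga (d - floor_log u)) = (\<Sum>u=(2::nat) ^ e..<2 ^ Suc e. ga (d - e))"
  proof (intro sum.cong refl)
   fix u :: nat assume u: "u \<in> {2 ^ e..<2 ^ Suc e}"
   have "floor_log u = e" using u by (intro floor_log_eqI) (auto intro: less_le_trans[of 0 "2 ^ e"])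
   thus "ga (d - floor_log u) = ga (d - e)" by simp
  qed
  also have "... = of_nat (2 ^ e) * ga (d - e)" by simp
  finally show ?case using Suc by simp
 qed simp
 from this[of d] show ?thesis
  by (simp, intro sum.reindex_bij_witness[of _ "%k. d - k" "%j. d - j"]) auto
qed

section \<open>Failure probability and expected cost of an attempt\<close>

definition badv :: "nat => (nat \<times> layer list) list => bool" where
 "badv d vs \<longleftrightarrow> (\<exists>(k, ls)\<in>set vs. bad (64 * (d + 1)) ls (roots d))"

text \<open>An attempt without repetitions has none in any of its segments, so the joint restriction
  may be relaxed to one per segment; only then is the right-hand side a sum to which
  \<open>visit_expect\<close> applies.\<close>

lemma vcost_le: "of_nat (vcost d vs) * of_bool (~ badv d vs) \<le>
  (\<Sum>(k, ls)\<leftarrow>vs. of_nat (2 ^ k * snd (sr d ls)) * of_bool (~ bad (64 * (d + 1)) ls (roots d)) :: ennreal)"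
proof (cases "badv d vs")
 case False
 hence "of_nat (vcost d vs) = (\<Sum>(k, ls)\<leftarrow>vs. of_nat (2 ^ k * snd (sr d ls)) * of_bool (~ bad (64 * (d + 1)) ls (roots d)) :: ennreal)"
  by (induction vs) (auto simp: vcost_def badv_def)
 thus ?thesis using False by simp
qed simp

lemma badv_le: "of_bool (badv d vs) \<le> (\<Sum>(k, ls)\<leftarrow>vs. of_bool (bad (64 * (d + 1)) ls (roots d)) :: ennreal)"
proof (induction vs)
 case (Cons a vs)
 obtain k ls where a: "a = (k, ls)" by (cases a)
 have "of_bool (badv d (a # vs)) \<le> (of_bool (bad (64 * (d + 1)) (snd a) (roots d)) + of_bool (badv d vs) :: ennreal)"
  by (auto simp: badv_def split: prod.splits)
 also have "... \<le> (\<Sum>(k, ls)\<leftarrow>a # vs. of_bool (bad (64 * (d + 1)) ls (roots d)))"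
  unfolding a list.map sum_list.Cons prod.case snd_conv by (rule add_left_mono[OF Cons])
 finally show ?case .
qed (simp add: badv_def)

lemma vfound_le: "of_bool (~ vfound d vs & ~ badv d vs) \<le>
  (\<Sum>(k, ls)\<leftarrow>vs. of_bool (fails (64 * (d + 1)) ls (roots d) & ~ bad (64 * (d + 1)) ls (roots d)) :: ennreal)"
proof (induction vs)
 case (Cons a vs)
 obtain k ls where a: "a = (k, ls)" by (cases a)
 have "of_bool (~ vfound d (a # vs) & ~ badv d (a # vs)) \<le>
   (of_bool (fails (64 * (d + 1)) (snd a) (roots d) & ~ bad (64 * (d + 1)) (snd a) (roots d)) + of_bool (~ vfound d vs & ~ badv d vs) :: ennreal)"
  by (auto simp: badv_def vfound_def split: prod.splits)
 also have "... \<le> (\<Sum>(k, ls)\<leftarrow>a # vs. of_bool (fails (64 * (d + 1)) ls (roots d) & ~ bad (64 * (d + 1)) ls (roots d)))"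
  unfolding a list.map sum_list.Cons prod.case snd_conv by (rule add_left_mono[OF Cons])
 finally show ?case .
qed (simp add: vfound_def)

lemma vtests_le_vcost: "vtests d vs \<le> vcost d vs"
 unfolding vtests_def vcost_def by (intro sum_list_mono) auto

definition VT :: "nat => nat => (nat => nat => nat => bool) => (nat \<times> layer list) list" where
 "VT d y T = visit d y T 1 (%_. {..<2 ^ d})"

definition failT :: "nat => nat => (nat => nat => nat => bool) => bool" where
 "failT d y T \<longleftrightarrow> ~ (vfound d (VT d y T) & vtests d (VT d y T) \<le> 2 ^ (8 * (d + 1)))"

definition costT :: "nat => nat => (nat => nat => nat => bool) => nat" where
 "costT d y T = min (vcost d (VT d y T)) (2 ^ (8 * (d + 1)) * 2 ^ d)"

definition CB :: "nat => nat => real" where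
 "CB d y = 48 * 2 powr (3 * real d / 2) + 144 * (2 ^ d * 2 ^ y)"

lemma VT_expect:
 assumes "!!k. k \<in> {1..d} ==> (\<integral>\<^sup>+ls. g k ls \<partial>rl (64 * (d + 1)) (pr k) (bl d y k)) \<le> of_nat (2 ^ kap d y k) * ga k" "y \<le> d"
 shows "(\<integral>\<^sup>+T. (\<Sum>(k, ls)\<leftarrow>VT d y T. g k ls) \<partial>table_pmf d {1..<2 ^ d}) \<le> (\<Sum>u=1..<2 ^ d. ga (d - floor_log u))"
 unfolding VT_def
proof (rule visit_expect[OF assms])
 show "aligned d y 1" by (simp add: aligned_def)
 fix u :: nat assume "1 \<le> u" "u div 2 < 1"
 hence "u = 1" by linarith
 thus "card {..<(2::nat) ^ d} = 2 ^ (d - floor_log u)" by simp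
qed auto

lemma VT_expect_const:
 assumes "!!k. k \<in> {1..d} ==> (\<integral>\<^sup>+ls. g k ls \<partial>rl (64 * (d + 1)) (pr k) (bl d y k)) \<le> of_nat (2 ^ kap d y k) * ennreal c" "y \<le> d" "0 \<le> c"
 shows "(\<integral>\<^sup>+T. (\<Sum>(k, ls)\<leftarrow>VT d y T. g k ls) \<partial>table_pmf d {1..<2 ^ d}) \<le> ennreal (2 ^ d * c)"
proof -
 have "(\<Sum>u=1..<(2::nat) ^ d. ennreal c) \<le> (\<Sum>u<(2::nat) ^ d. ennreal c)" by (rule sum_mono2) auto
 also have "... = ennreal (2 ^ d * c)" using assms(3) by (simp add: ennreal_mult ennreal_of_nat_eq_real_of_nat flip: ennreal_power ennreal_numeral)
 finally show ?thesis using VT_expect[where ga = "%_. ennreal c", OF assms(1,2)] by (rule order_trans[rotated])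
qed

context
 fixes d y :: nat
 assumes y: "y \<le> d"
begin

lemma bl_W: assumes "k \<in> {1..d}" shows "\<forall>b\<in>set (bl d y k). b \<le> 64 * (d + 1)"
proof -
 interpret seg_params d y k by unfold_locales (use assms y in auto)
 show ?thesis using bl_le by fastforce
qed

lemma cost_expect_good:
 "(\<integral>\<^sup>+T. of_nat (vcost d (VT d y T)) * of_bool (~ badv d (VT d y T)) \<partial>table_pmf d {1..<2 ^ d}) \<le> ennreal (CB d y)"
proof -
 let ?g = "%k ls. of_nat (2 ^ k * snd (sr d ls)) * of_bool (~ bad (64 * (d + 1)) ls (roots d)) :: ennreal"
 let ?ga = "%k. ennreal (2 ^ k * (6 * 2 ^ xx y k / pr k))"
 have "(\<integral>\<^sup>+T. of_nat (vcost d (VT d y T)) * of_bool (~ badv d (VT d y T)) \<partial>table_pmf d {1..<2 ^ d}) \<le>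
   (\<integral>\<^sup>+T. (\<Sum>(k, ls)\<leftarrow>VT d y T. ?g k ls) \<partial>table_pmf d {1..<2 ^ d})"
  by (intro nn_integral_mono vcost_le)
 also have "... \<le> (\<Sum>u=1..<2 ^ d. ?ga (d - floor_log u))"
 proof (rule VT_expect[OF _ y])
  fix k assume k: "k \<in> {1..d}"
  interpret seg_params d y k by unfold_locales (use k y in auto)
  have p: "0 < pr k" "pr k \<le> 1" using pr_pos[of k] pr_le[of k] by auto
  have "(\<integral>\<^sup>+ls. ?g k ls \<partial>rl (64 * (d + 1)) (pr k) (bl d y k)) =
    ennreal (2 ^ k) * (\<integral>\<^sup>+ls. of_nat (snd (sr d ls)) * of_bool (~ bad (64 * (d + 1)) ls (roots d)) \<partial>rl (64 * (d + 1)) (pr k) (bl d y k))"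
   by (subst nn_integral_cmult[symmetric]) (auto simp: ac_simps simp flip: ennreal_power ennreal_numeral)
  also have "... \<le> ennreal (2 ^ k) * ennreal (tsum (pr k) (bl d y k))"
   by (intro mult_left_mono expect_srch p bl_W[OF k] roots_less) simp
  also have "... \<le> ennreal (2 ^ k) * ennreal (real (2 ^ kap d y k) * (6 * 2 ^ xx y k / pr k))"
   by (intro mult_left_mono ennreal_leI tsum_bl) simp
  also have "... = of_nat (2 ^ kap d y k) * ?ga k"
   using p unfolding ennreal_of_nat_eq_real_of_nat by (subst (1 2) ennreal_mult[symmetric]) (auto simp: ac_simps)
  finally show "(\<integral>\<^sup>+ls. ?g k ls \<partial>rl (64 * (d + 1)) (pr k) (bl d y k)) \<le> of_nat (2 ^ kap d y k) * ?ga k" .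
 qed
 also have "... = (\<Sum>k=1..d. of_nat (2 ^ (d - k)) * ?ga k)" by (rule sum_nodes)
 also have "... = ennreal (\<Sum>k=1..d. 2 ^ (d - k) * (2 ^ k * (6 * 2 ^ xx y k / pr k)))"
 proof -
  have n: "0 \<le> 2 ^ k * (6 * 2 ^ xx y k / pr k)" for k using pr_pos[of k] by simp
  have m: "ennreal (real (2 ^ (d - k))) * ?ga k = ennreal (2 ^ (d - k) * (2 ^ k * (6 * 2 ^ xx y k / pr k)))" for k
   by (subst ennreal_mult[symmetric]) (use n[of k] in auto)
  show ?thesis unfolding ennreal_of_nat_eq_real_of_nat m
   by (rule sum_ennreal) (intro mult_nonneg_nonneg n, simp)
 qed
 also have "... \<le> ennreal (CB d y)" unfolding CB_def by (intro ennreal_leI sum_time)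
 finally show ?thesis .
qed

text \<open>With growth \<open>2 ^ (5 * (d + 1))\<close>, \<open>2 ^ (8 * (d + 1))\<close> starting
  windows and at most \<open>4 * (d + 1)\<close> fresh bits per node, the sum in the numerator of
  \<open>prob_bad\<close> stays below \<open>2 ^ (33 * (d + 1))\<close>; the window width
  \<open>64 * (d + 1)\<close> outweighs it.\<close>

lemma bad_expect: "(\<integral>\<^sup>+T. of_bool (badv d (VT d y T)) \<partial>table_pmf d {1..<2 ^ d}) \<le> ennreal (2 ^ d * (1 / 2 ^ (31 * (d + 1))))"
proof -
 let ?W = "64 * (d + 1)"
 let ?g = "%(k::nat) ls. of_bool (bad ?W ls (roots d)) :: ennreal"
 have "(\<integral>\<^sup>+T. of_bool (badv d (VT d y T)) \<partial>table_pmf d {1..<2 ^ d}) \<le> (\<integral>\<^sup>+T. (\<Sum>(k, ls)\<leftarrow>VT d y T. ?g k ls) \<partial>table_pmf d {1..<2 ^ d})"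
  by (intro nn_integral_mono badv_le)
 also have "... \<le> ennreal (2 ^ d * (1 / 2 ^ (31 * (d + 1))))"
 proof (rule VT_expect_const[OF _ y])
  fix k assume k: "k \<in> {1..d}"
  interpret seg_params d y k by unfold_locales (use k y in auto)
  let ?G = "2 ^ (5 * (d + 1)) :: real" and ?D = "d + 1"
  have "(\<integral>\<^sup>+ls. ?g k ls \<partial>rl ?W (pr k) (bl d y k)) \<le>
   ennreal (real (length (bl d y k)) * (?G\<^sup>2 * 4 ^ (8 * ?D) + real (length (bl d y k)) * (?G ^ 3 * 4 ^ (4 * ?D)) * 2 ^ (8 * ?D)) / 2 ^ ?W)"
   unfolding roots_def
   by (rule prob_bad) (use pr_pos[of k] pr_le[of k] bl_W[OF k] bl_le Gm_bl in auto)
  also have "... \<le> ennreal (real (2 ^ kap d y k) * (1 / 2 ^ (31 * ?D)))"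
  proof (rule ennreal_leI)
   have K: "real (2 ^ kap d y k) \<le> 2 ^ ?D"
   proof -
    have "(2::real) ^ kap d y k \<le> 2 ^ ?D" using kap_le[of d y k] by (intro power_increasing) auto
    thus ?thesis by simp
   qed
   have e1: "?G\<^sup>2 * 4 ^ (8 * ?D) = 2 ^ (26 * ?D)"
   proof -
    have "(4::real) ^ (8 * ?D) = 2 ^ (16 * ?D)" using power_mult[of "2::real" 2 "8 * ?D"] by (simp add: mult.assoc[symmetric] del: mult_Suc_right)
    moreover have "?G\<^sup>2 = 2 ^ (10 * ?D)" unfolding power_mult[symmetric] by (rule arg_cong[where f = "power 2"]) simp
    ultimately show ?thesis unfolding power_add[symmetric] by (simp only: power_add[symmetric]) (rule arg_cong[where f = "power 2"], simp)
   qed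
   have e2: "?G ^ 3 * 4 ^ (4 * ?D) * 2 ^ (8 * ?D) = 2 ^ (31 * ?D)"
   proof -
    have "(4::real) ^ (4 * ?D) = 2 ^ (8 * ?D)" using power_mult[of "2::real" 2 "4 * ?D"] by (simp add: mult.assoc[symmetric] del: mult_Suc_right)
    moreover have "?G ^ 3 = 2 ^ (15 * ?D)" unfolding power_mult[symmetric] by (rule arg_cong[where f = "power 2"]) simp
    ultimately show ?thesis by (simp only: power_add[symmetric]) (rule arg_cong[where f = "power 2"], simp)
   qed
   have "?G\<^sup>2 * 4 ^ (8 * ?D) + real (2 ^ kap d y k) * (?G ^ 3 * 4 ^ (4 * ?D)) * 2 ^ (8 * ?D) \<le> 2 ^ (26 * ?D) + 2 ^ ?D * 2 ^ (31 * ?D)"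
    unfolding e1 mult.assoc[of "real (2 ^ kap d y k)"] e2 by (intro add_left_mono mult_right_mono K) simp
   also have "... \<le> 2 ^ (32 * ?D) + 2 ^ (32 * ?D)"
   proof (intro add_mono)
    show "(2::real) ^ (26 * ?D) \<le> 2 ^ (32 * ?D)" by (rule power_increasing) auto
    show "(2::real) ^ ?D * 2 ^ (31 * ?D) \<le> 2 ^ (32 * ?D)" unfolding power_add[symmetric] by (rule power_increasing) auto
   qed
   also have "... = 2 ^ Suc (32 * ?D)" unfolding power_Suc mult_2 ..
   also have "... \<le> 2 ^ (33 * ?D)" by (rule power_increasing) auto
   finally have A: "?G\<^sup>2 * 4 ^ (8 * ?D) + real (2 ^ kap d y k) * (?G ^ 3 * 4 ^ (4 * ?D)) * 2 ^ (8 * ?D) \<le> 2 ^ (33 * ?D)" .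
   have "(?G\<^sup>2 * 4 ^ (8 * ?D) + real (2 ^ kap d y k) * (?G ^ 3 * 4 ^ (4 * ?D)) * 2 ^ (8 * ?D)) / 2 ^ ?W \<le> 2 ^ (33 * ?D) / 2 ^ ?W"
    by (rule divide_right_mono[OF A]) simp
   also have "2 ^ (33 * ?D) / 2 ^ ?W = (1 / 2 ^ (31 * ?D) :: real)"
   proof -
    have "(2::real) ^ ?W = 2 ^ (33 * ?D) * 2 ^ (31 * ?D)" unfolding power_add[symmetric] by (rule arg_cong[where f = "power 2"]) simp
    thus ?thesis by simp
   qed
   finally have B: "(?G\<^sup>2 * 4 ^ (8 * ?D) + real (2 ^ kap d y k) * (?G ^ 3 * 4 ^ (4 * ?D)) * 2 ^ (8 * ?D)) / 2 ^ ?W \<le> 1 / 2 ^ (31 * ?D)" .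
   show "real (length (bl d y k)) * (?G\<^sup>2 * 4 ^ (8 * ?D) + real (length (bl d y k)) * (?G ^ 3 * 4 ^ (4 * ?D)) * 2 ^ (8 * ?D)) / 2 ^ ?W
    \<le> real (2 ^ kap d y k) * (1 / 2 ^ (31 * ?D))"
    unfolding length_bl times_divide_eq_right[symmetric] using B by (intro mult_left_mono) simp_all
  qed
  also have "... = of_nat (2 ^ kap d y k) * ennreal (1 / 2 ^ (31 * ?D))"
   unfolding ennreal_of_nat_eq_real_of_nat by (rule ennreal_mult) simp_all
  finally show "(\<integral>\<^sup>+ls. ?g k ls \<partial>rl ?W (pr k) (bl d y k)) \<le> of_nat (2 ^ kap d y k) * ennreal (1 / 2 ^ (31 * ?D))" .
 qed simp
 finally show ?thesis .
qed

text \<open>For \<open>N\<close> starting windows with success probability \<open>t\<close>,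
  Bernoulli's inequality gives \<open>(1 - t)^N \<le> 1 / (N * t)\<close>; here
  \<open>N = 2 ^ (8 * (d + 1))\<close> and \<open>1 / t \<le> 2 ^ (6 * (d + 1))\<close>.\<close>

lemma miss_expect: "(\<integral>\<^sup>+T. of_bool (~ vfound d (VT d y T) & ~ badv d (VT d y T)) \<partial>table_pmf d {1..<2 ^ d}) \<le> ennreal (2 ^ d * (1 / 2 ^ (2 * (d + 1))))"
proof -
 let ?W = "64 * (d + 1)"
 let ?g = "%(k::nat) ls. of_bool (fails ?W ls (roots d) & ~ bad ?W ls (roots d)) :: ennreal"
 have "(\<integral>\<^sup>+T. of_bool (~ vfound d (VT d y T) & ~ badv d (VT d y T)) \<partial>table_pmf d {1..<2 ^ d}) \<le> (\<integral>\<^sup>+T. (\<Sum>(k, ls)\<leftarrow>VT d y T. ?g k ls) \<partial>table_pmf d {1..<2 ^ d})"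
  by (intro nn_integral_mono vfound_le)
 also have "... \<le> ennreal (2 ^ d * (1 / 2 ^ (2 * (d + 1))))"
 proof (rule VT_expect_const[OF _ y])
  fix k assume k: "k \<in> {1..d}"
  interpret seg_params d y k by unfold_locales (use k y in auto)
  let ?D = "d + 1" let ?t = "th (pr k) (bl d y k)"
  have p: "0 < pr k" "pr k \<le> 1" using pr_pos[of k] pr_le[of k] by auto
  have t: "0 < ?t" "?t \<le> 1" using th_pos_le[OF p] by auto
  have "(\<integral>\<^sup>+ls. ?g k ls \<partial>rl ?W (pr k) (bl d y k)) \<le> ennreal ((1 - ?t) ^ length (roots d))"
   by (intro prob_fails p bl_W[OF k] roots_less)
  also have "... \<le> ennreal (1 / 2 ^ (2 * ?D))"
  proof (rule ennreal_leI)
   let ?N = "length (roots d)"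
   have N: "real ?N = 2 ^ (8 * ?D)" by (simp add: roots_def)
   have b: "real ?N * ?t * (1 - ?t) ^ ?N \<le> 1"
   proof -
    have "1 + real ?N * ?t \<le> (1 + ?t) ^ ?N" using t by (intro Bernoulli_inequality) auto
    hence "(1 + real ?N * ?t) * (1 - ?t) ^ ?N \<le> (1 + ?t) ^ ?N * (1 - ?t) ^ ?N" using t by (intro mult_right_mono) auto
    also have "... = ((1 + ?t) * (1 - ?t)) ^ ?N" by (rule power_mult_distrib[symmetric])
    also have "... \<le> 1" using t by (intro power_le_one) (auto simp: algebra_simps mult_le_one)
    finally show ?thesis using t by (simp add: algebra_simps) (smt (verit) zero_le_power)
   qed
   have "(1 - ?t) ^ ?N \<le> (1 / ?t) / real ?N" using b t N by (simp add: field_simps)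
   also have "... \<le> 2 ^ (6 * ?D) / real ?N" using th_bl_ge by (intro divide_right_mono) auto
   also have "... = 1 / 2 ^ (2 * ?D)"
   proof -
    have "(2::real) ^ (8 * ?D) = 2 ^ (6 * ?D) * 2 ^ (2 * ?D)" unfolding power_add[symmetric] by (rule arg_cong[where f = "power 2"]) simp
    thus ?thesis unfolding N by simp
   qed
   finally show "(1 - ?t) ^ ?N \<le> 1 / 2 ^ (2 * ?D)" .
  qed
  also have "... \<le> of_nat (2 ^ kap d y k) * ennreal (1 / 2 ^ (2 * ?D))"
  proof -
   have "(1 :: ennreal) \<le> of_nat (2 ^ kap d y k)" by (metis of_nat_1 of_nat_mono one_le_numeral one_le_power)
   from mult_right_mono[OF this, of "ennreal (1 / 2 ^ (2 * ?D))"] show ?thesis by simp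
  qed
  finally show "(\<integral>\<^sup>+ls. ?g k ls \<partial>rl ?W (pr k) (bl d y k)) \<le> of_nat (2 ^ kap d y k) * ennreal (1 / 2 ^ (2 * ?D))" .
 qed simp
 finally show ?thesis .
qed

lemma CB_le: "CB d y \<le> 192 * 4 ^ d" "0 \<le> CB d y"
proof -
 have "(2::real) powr (3 * real d / 2) \<le> 2 powr (2 * real d)" by (rule powr_mono) auto
 also have "... = 4 ^ d" using powr_realpow[of "2::real" "2 * d"] by (simp add: power_mult)
 finally have 1: "(2::real) powr (3 * real d / 2) \<le> 4 ^ d" .
 have "(2::real) ^ d * 2 ^ y \<le> 2 ^ d * 2 ^ d" using y by (intro mult_left_mono power_increasing) auto
 also have "... = 4 ^ d" by (simp flip: power_mult_distrib)
 finally show "CB d y \<le> 192 * 4 ^ d" using 1 unfolding CB_def by linarith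
qed (simp add: CB_def)

text \<open>An attempt fails through a repetition, through exhausted candidates or through an
  exceeded budget. The last is bounded by Markov's inequality, as the expected cost is only of order
  \<open>4 ^ d\<close>. For \<open>d = 0\<close> that estimate is too weak, but then there is no
  node to search.\<close>

lemma fail_expect: "(\<integral>\<^sup>+T. of_bool (failT d y T) \<partial>table_pmf d {1..<2 ^ d}) \<le> ennreal (1 / 2)"
proof (cases "d = 0")
 case True
 have "~ failT d y T" for T using True by (simp add: failT_def VT_def visit.simps vfound_def vtests_def)
 thus ?thesis by simp
next
 case False
 let ?V = "VT d y" and ?F = "2 ^ (8 * (d + 1)) :: nat"
 have "(\<integral>\<^sup>+T. of_bool (failT d y T) \<partial>table_pmf d {1..<2 ^ d}) \<le>
  (\<integral>\<^sup>+T. of_bool (badv d (?V T)) + (of_bool (~ vfound d (?V T) & ~ badv d (?V T)) +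
   ennreal (1 / real ?F) * (of_nat (vcost d (?V T)) * of_bool (~ badv d (?V T)))) \<partial>table_pmf d {1..<2 ^ d})"
 proof (rule nn_integral_mono)
  fix T
  show "of_bool (failT d y T) \<le> of_bool (badv d (?V T)) + (of_bool (~ vfound d (?V T) & ~ badv d (?V T)) +
   ennreal (1 / real ?F) * (of_nat (vcost d (?V T)) * of_bool (~ badv d (?V T))))"
  proof (cases "failT d y T & ~ badv d (?V T) & vfound d (?V T)")
   case True
   hence "?F \<le> vtests d (?V T)" by (auto simp: failT_def)
   hence "?F \<le> vcost d (?V T)" using vtests_le_vcost[of d "?V T"] by linarith
   hence "real ?F \<le> real (vcost d (?V T))" by (rule of_nat_mono)
   hence "1 \<le> 1 / real ?F * real (vcost d (?V T))" by (simp add: field_simps)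
   hence "ennreal 1 \<le> ennreal (1 / real ?F) * of_nat (vcost d (?V T))"
    unfolding ennreal_of_nat_eq_real_of_nat by (subst ennreal_mult[symmetric]) (auto intro: ennreal_leI simp del: ennreal_1)
   thus ?thesis using True by simp
  qed (auto simp: failT_def)
 qed
 also have "... = (\<integral>\<^sup>+T. of_bool (badv d (?V T)) \<partial>table_pmf d {1..<2 ^ d}) + ((\<integral>\<^sup>+T. of_bool (~ vfound d (?V T) & ~ badv d (?V T)) \<partial>table_pmf d {1..<2 ^ d}) +
  ennreal (1 / real ?F) * (\<integral>\<^sup>+T. of_nat (vcost d (?V T)) * of_bool (~ badv d (?V T)) \<partial>table_pmf d {1..<2 ^ d}))"
  by (subst nn_integral_add; (subst nn_integral_add)?; (subst nn_integral_cmult)?) simp_all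
 also have "... \<le> ennreal (2 ^ d * (1 / 2 ^ (31 * (d + 1)))) + (ennreal (2 ^ d * (1 / 2 ^ (2 * (d + 1)))) + ennreal (1 / real ?F) * ennreal (CB d y))"
  by (intro add_mono mult_left_mono bad_expect miss_expect cost_expect_good) simp
 also have "... = ennreal (2 ^ d * (1 / 2 ^ (31 * (d + 1))) + (2 ^ d * (1 / 2 ^ (2 * (d + 1))) + 1 / real ?F * CB d y))"
 proof -
  have m: "ennreal (1 / real ?F) * ennreal (CB d y) = ennreal (1 / real ?F * CB d y)"
   by (rule ennreal_mult[symmetric]) (use CB_le(2) in simp_all)
  have n: "0 \<le> 2 ^ d * (1 / 2 ^ (31 * (d + 1)) :: real)" "0 \<le> 2 ^ d * (1 / 2 ^ (2 * (d + 1)) :: real)" "0 \<le> 1 / real ?F * CB d y"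
   using CB_le(2) by simp_all
  show ?thesis unfolding m ennreal_plus[OF n(1) add_nonneg_nonneg[OF n(2,3)]] ennreal_plus[OF n(2,3)] ..
 qed
 also have "... \<le> ennreal (1 / 2)"
 proof (rule ennreal_leI)
  have d1: "1 \<le> d" using False by simp
  have a: "2 ^ d * (1 / 2 ^ (2 * (d + 1))) \<le> (1 / 8 :: real)"
  proof -
   have "(2::real) ^ (2 * (d + 1)) = 2 ^ d * 2 ^ (d + 2)" unfolding power_add[symmetric] by (rule arg_cong[where f = "power 2"]) simp
   hence "2 ^ d * (1 / 2 ^ (2 * (d + 1))) = (1 / 2 ^ (d + 2) :: real)" by simp
   also have "... \<le> 1 / 2 ^ 3" using d1 by (intro divide_left_mono power_increasing) auto
   finally show ?thesis by simp
  qed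
  have b: "2 ^ d * (1 / 2 ^ (31 * (d + 1))) \<le> (1 / 8 :: real)"
  proof -
   have "1 / (2::real) ^ (31 * (d + 1)) \<le> 1 / 2 ^ (2 * (d + 1))" by (intro divide_left_mono power_increasing) auto
   hence "2 ^ d * (1 / 2 ^ (31 * (d + 1))) \<le> 2 ^ d * (1 / (2::real) ^ (2 * (d + 1)))" by (rule mult_left_mono) simp
   thus ?thesis using a by linarith
  qed
  have c: "1 / real ?F * CB d y \<le> 1 / 64"
  proof -
   have F: "real ?F = 256 * 256 ^ d" by (simp add: power_mult power_add)
   have "CB d y \<le> 256 * 4 ^ d" using CB_le(1) by (smt (verit) zero_le_power)
   hence "1 / real ?F * CB d y \<le> (256 * 4 ^ d) / (256 * 256 ^ d)" unfolding F by (simp add: field_simps)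
   also have "... = (4 / 256) ^ d" unfolding power_divide by simp
   also have "... \<le> (4 / 256) ^ 1" using d1 by (intro power_decreasing) auto
   finally show ?thesis by simp
  qed
  show "2 ^ d * (1 / 2 ^ (31 * (d + 1))) + (2 ^ d * (1 / 2 ^ (2 * (d + 1))) + 1 / real ?F * CB d y) \<le> 1 / 2"
   using a b c by linarith
 qed
 finally show ?thesis .
qed

text \<open>In the presence of repetitions only the cap is known. It is \<open>2^(9d+8)\<close>, and
  multiplied by the probability of a repetition it contributes at most 1.\<close>

lemma cost_expect: "(\<integral>\<^sup>+T. of_nat (costT d y T) \<partial>table_pmf d {1..<2 ^ d}) \<le> ennreal (CB d y + 1)"
proof -
 let ?V = "VT d y" and ?F = "2 ^ (8 * (d + 1)) * 2 ^ d :: nat"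
 have "(\<integral>\<^sup>+T. of_nat (costT d y T) \<partial>table_pmf d {1..<2 ^ d}) \<le>
  (\<integral>\<^sup>+T. of_nat (vcost d (?V T)) * of_bool (~ badv d (?V T)) + of_nat ?F * of_bool (badv d (?V T)) \<partial>table_pmf d {1..<2 ^ d})"
 proof (rule nn_integral_mono)
  fix T
  have "costT d y T \<le> vcost d (?V T)" "costT d y T \<le> ?F" unfolding costT_def by (rule min.cobounded1, rule min.cobounded2)
  from this[THEN of_nat_mono] have "(of_nat (costT d y T) :: ennreal) \<le> of_nat (vcost d (?V T))" "(of_nat (costT d y T) :: ennreal) \<le> of_nat ?F" by blast+
  thus "of_nat (costT d y T) \<le> of_nat (vcost d (?V T)) * of_bool (~ badv d (?V T)) + of_nat ?F * (of_bool (badv d (?V T)) :: ennreal)"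
   by (cases "badv d (?V T)") (simp_all del: of_nat_mult of_nat_power)
 qed
 also have "... = (\<integral>\<^sup>+T. of_nat (vcost d (?V T)) * of_bool (~ badv d (?V T)) \<partial>table_pmf d {1..<2 ^ d}) + of_nat ?F * (\<integral>\<^sup>+T. of_bool (badv d (?V T)) \<partial>table_pmf d {1..<2 ^ d})"
  by (subst nn_integral_add; (subst nn_integral_cmult)?) simp_all
 also have "... \<le> ennreal (CB d y) + of_nat ?F * ennreal (2 ^ d * (1 / 2 ^ (31 * (d + 1))))"
  by (intro add_mono mult_left_mono bad_expect cost_expect_good) simp
 also have "... = ennreal (CB d y + real ?F * (2 ^ d * (1 / 2 ^ (31 * (d + 1)))))"
  unfolding ennreal_of_nat_eq_real_of_nat using CB_le(2) by (subst ennreal_mult[symmetric]) (auto simp: ennreal_plus)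
 also have "... \<le> ennreal (CB d y + 1)"
 proof (intro ennreal_leI add_left_mono)
  have "real ?F * 2 ^ d = 2 ^ (8 * (d + 1) + d + d)" by (simp only: of_nat_mult of_nat_power of_nat_numeral power_add[of _ _ d])
  also have "... \<le> 2 ^ (31 * (d + 1))" by (rule power_increasing) auto
  finally show "real ?F * (2 ^ d * (1 / 2 ^ (31 * (d + 1)))) \<le> 1" by (simp add: field_simps)
 qed
 finally show ?thesis .
qed

end

section \<open>Queries\<close>

lemma pack_output:
 assumes m0: "m 0 = w * N" and a: "a < N" and lt: "m (1 + a) < 2 ^ w" and w: "0 < w"
 shows "pack w (output_bits w m) a = m (1 + a)"
proof -
 have l: "a * w + i < w * N" if "i < w" for i
 proof -
  have "a * w + i < Suc a * w" using that by simp
  also have "... \<le> N * w" using a by (intro mult_le_mono1) simp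
  finally show ?thesis by (simp add: mult.commute)
 qed
 have "take w (drop (a * w) (output_bits w m)) = map (bit (m (1 + a))) [0..<w]"
 proof (rule nth_equalityI)
  have "a * w + w \<le> w * N" using l[of "w - 1"] w by simp
  thus "length (take w (drop (a * w) (output_bits w m))) = length (map (bit (m (1 + a))) [0..<w])"
   by (simp add: output_bits_def m0)
  fix i assume "i < length (take w (drop (a * w) (output_bits w m)))"
  hence i: "i < w" by simp
  show "take w (drop (a * w) (output_bits w m)) ! i = map (bit (m (1 + a))) [0..<w] ! i"
  proof -
   have "a * w \<le> w * N" using l[OF i] by linarith
   thus ?thesis using i l[OF i] by (simp add: output_bits_def m0 nth_drop)
  qed
 qed
 thus ?thesis unfolding pack_def using lt by (simp add: horner_sum_bit_eq_take_bit take_bit_nat_eq_self)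
qed

text \<open>The query recomputes positions from the headers instead of storing them for each node.
  Its cells are numbered one lower than during the construction, where the string began at cell 1;
  hence 63.\<close>

definition qpos :: "nat => memory => nat => nat" where
 "qpos d m v = (let j = floor_log v; q = v - 2 ^ j; a = 63 + 4 * j in
  m a + (q div 2 ^ m (a + 2)) * m (a + 3) + (q mod 2 ^ m (a + 2)) * m (a + 1) div 2 ^ (d + 2))"

definition qwin :: "nat => memory => nat => nat" where
 "qwin d m v = (let w = 256 * (d + 1); p = qpos d m v; a = 63 + 4 * d + p div w; s = p mod w in
  take_bit (64 * (d + 1)) (Bit_Operations.or (drop_bit s (m a)) (take_bit w (push_bit (w - s) (m (a + 1))))))"

definition seed :: "nat => bool list => nat => nat" where
 "seed d bits v = v * 2 ^ (64 * (d + 1)) + qwin d (pack (256 * (d + 1)) bits) v"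

context ram
begin

definition PK :: "nat => (nat => nat) => memory => bool" where
 "PK y win m \<longleftrightarrow> y \<le> d & m 1 = d & (\<forall>j<d. m (63 + 4 * j) = OFF d y (d - j) & m (64 + 4 * j) = ee d y (d - j) &
   m (65 + 4 * j) = kap d y (d - j) & m (66 + 4 * j) = SL d y (d - j)) &
  (\<forall>i. i div w \<le> Suc (OFF d y (Suc d) div w) --> bit (m (63 + 4 * d + i div w)) (i mod w) = payl d y win (2 ^ d) i) &
  (\<forall>a. a \<le> 64 + 4 * d + OFF d y (Suc d) div w --> m a < 2 ^ w)"

lemma uw: "9 \<le> c ==> ub c w"
proof (erule ub_mono[rotated])
 have "(2::nat) ^ 8 * (d + 1) \<le> 2 ^ (8 * (d + 1)) * 2 ^ (d + 1)" using d_le(2) by (intro mult_mono power_increasing) auto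
 also have "... = 2 ^ (9 * (d + 1))" unfolding power_add[symmetric] by simp
 finally have "ub 9 (256 * (d + 1))" by (simp add: ub_def)
 thus "ub 9 w" by (simp only: w)
qed

lemma OFF_UU: "64 + 4 * d + OFF d y (Suc d) div w + 2 < UU"
proof (rule less_UU[where a = 19])
 have "ub 12 (OFF d y (Suc d))" using OFF_le[of "Suc d" d] by (simp add: ub_def)
 hence "ub c (OFF d y (Suc d) div w)" if "12 \<le> c" for c using ub_mono[OF _ that] by simp
 thus "ub 19 (64 + 4 * d + OFF d y (Suc d) div w + 2)" by simp
qed simp

lemma PK_output:
 assumes O: "OUTP y win m" and lt: "\<forall>a. m a < 2 ^ w" and y: "y \<le> d"
 shows "PK y win (pack w (output_bits w m))"
proof -
 let ?N = "65 + 4 * d + OFF d y (Suc d) div w"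
 have m0: "m 0 = w * ?N" using O by (simp add: OUTP_def)
 have pk: "pack w (output_bits w m) a = m (Suc a)" if "a < ?N" for a
  using pack_output[of m w ?N a, OF m0 that] lt by simp
 have UUN: "?N + 1 < UU" using OFF_UU[of y] by simp
 show ?thesis unfolding PK_def
 proof (intro conjI allI impI)
  show "pack w (output_bits w m) 1 = d" using O pk[of 1] by (simp add: OUTP_def numeral_2_eq_2)
  fix j assume j: "j < d"
  have h: "hdr_ok y (d - j) m" using O j by (simp add: OUTP_def)
  have dj: "d - (d - j) = j" using j by simp
  show "pack w (output_bits w m) (63 + 4 * j) = OFF d y (d - j)" "pack w (output_bits w m) (64 + 4 * j) = ee d y (d - j)"
   "pack w (output_bits w m) (65 + 4 * j) = kap d y (d - j)" "pack w (output_bits w m) (66 + 4 * j) = SL d y (d - j)"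
   using h j unfolding hdr_ok_def dj Let_def by (simp_all add: pk)
 next
  fix a assume "a \<le> 64 + 4 * d + OFF d y (Suc d) div w"
  thus "pack w (output_bits w m) a < 2 ^ w" using lt by (simp add: pk)
 next
  fix i assume i: "i div w \<le> Suc (OFF d y (Suc d) div w)"
  have "bit (m (64 + 4 * d + i div w)) (i mod w) = payl d y win (2 ^ d) i"
   using O i UUN by (auto simp: OUTP_def)
  thus "bit (pack w (output_bits w m) (63 + 4 * d + i div w)) (i mod w) = payl d y win (2 ^ d) i"
   using i pk[of "63 + 4 * d + i div w"] by (simp add: add.assoc)
 qed (rule y)
qed

lemma qpos_eq:
 assumes P: "PK y win m" and v: "1 \<le> v" "v < 2 ^ d"
 shows "qpos d m v = posf d y v"
proof -
 have "floor_log v < d" by (rule floor_log_less[OF v])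
 thus ?thesis using P by (simp add: qpos_def posf_def posq_def po_def PK_def Let_def add.commute mult.commute)
qed

text \<open>A window is shorter than a word and is read from at most two neighbouring words; by
  \<open>payl_window\<close> the bits found there are its own and not those of other
  segments.\<close>

lemma qwin_eq:
 assumes P: "PK y win m" and v: "1 \<le> v" "v < 2 ^ d" and g: "!!u. u \<in> {1..<2 ^ d} ==> goodw d y tu keys win u"
 shows "qwin d m v = win v"
proof (rule bit_eqI)
 fix t
 let ?W = "64 * (d + 1)" let ?p = "posf d y v" let ?a = "63 + 4 * d + ?p div w" let ?s = "?p mod w"
 have y: "y \<le> d" using P by (simp add: PK_def)
 have pO: "?p + ?W \<le> OFF d y (Suc d)"
 proof -
  have "OFF d y (Suc (d - floor_log v)) \<le> OFF d y (Suc d)" by (rule OFF_mono) simp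
  thus ?thesis using node_coords(6,7)[OF v, of y] by linarith
 qed
 hence pw: "?p div w \<le> OFF d y (Suc d) div w" by (intro div_le_mono) simp
 have c0: "m ?a < 2 ^ w" using P pw by (simp add: PK_def)
 have "bit (qwin d m v) t \<longleftrightarrow> t < ?W & bit (if t + ?s < w then m ?a else m (?a + 1)) ((t + ?s) mod w)"
  unfolding qwin_def qpos_eq[OF P v] Let_def w[symmetric]
  by (rule read_window) (use c0 in \<open>simp_all add: w\<close>)
 also have "... \<longleftrightarrow> t < ?W & bit (win v) t"
 proof (cases "t < ?W")
  case True
  have d: "(?p + t) div w = (if t + ?s < w then ?p div w else Suc (?p div w))" "(?p + t) mod w = (t + ?s) mod w"
  proof -
   have e: "?p + t = ?p div w * w + (t + ?s)" using div_mult_mod_eq[of ?p w] by linarith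
   have "t < w" using True unfolding w by linarith
   have "?s < w" by simp
   with \<open>t < w\<close> have l: "t + ?s < 2 * w" by linarith
   show "(?p + t) mod w = (t + ?s) mod w" by (metis add.commute mod_add_left_eq)
   have "(t + ?s) div w = (if t + ?s < w then 0 else 1)"
   proof (cases "t + ?s < w")
    case False
    hence "t + ?s - w < w" using l by linarith
    thus ?thesis using False by (simp add: le_div_geq)
   qed simp
   moreover have "(?p + t) div w = ?p div w + (t + ?s) div w" using \<open>t < w\<close> div_add1_eq[of ?p t w] by (simp add: add.commute)
   ultimately show "(?p + t) div w = (if t + ?s < w then ?p div w else Suc (?p div w))" by simp
  qed
  have "(?p + t) div w \<le> Suc (OFF d y (Suc d) div w)" using pw by (simp add: d(1))
  hence "bit (m (63 + 4 * d + (?p + t) div w)) ((?p + t) mod w) = payl d y win (2 ^ d) (?p + t)"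
   using P unfolding PK_def by blast
  moreover have "payl d y win (2 ^ d) (?p + t) = bit (win v) t" by (rule payl_window[OF y g]) (use v True in auto)
  ultimately show ?thesis unfolding d by (cases "t + ?s < w") simp_all
 qed simp
 also have "... \<longleftrightarrow> bit (win v) t" using bit_less_pow[of "win v" ?W t] g[of v] v by (auto simp: goodw_def)
 finally show "bit (qwin d m v) t = bit (win v) t" .
qed

definition qry_body :: com where
 "qry_body = Seq (asg 14 (plus (Const 63) (times (Const 4) (vr 11)))) (Seq (asg 15 (minus (vr 10) (pow2 (vr 11))))
  (Seq (asg 16 (Load (plus (vr 14) (Const 2))))
  (Seq (asg 17 (plus (plus (Load (vr 14)) (times (Op Div (vr 15) (pow2 (vr 16))) (Load (plus (vr 14) (Const 3)))))
    (Op Div (times (Op Mod (vr 15) (pow2 (vr 16))) (Load (plus (vr 14) (Const 1)))) (pow2 (plus (vr 1) (Const 2))))))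
  (Seq (asg 18 (plus (plus (Const 63) (times (Const 4) (vr 1))) (Op Div (vr 17) (vr 13))))
  (Seq (asg 19 (Op Mod (vr 17) (vr 13)))
  (Seq (asg 20 (Op Mod (Op BOr (Op Shr (Load (vr 18)) (vr 19)) (Op Shl (Load (plus (vr 18) (Const 1))) (minus (vr 13) (vr 19)))) (pow2 (vr 12))))
  (Seq (Hash (Const 21) (plus (times (vr 10) (pow2 (vr 12))) (vr 20)) (Const 0))
  (Seq (asg 10 (plus (times (Const 2) (vr 10)) (vr 21))) (inc 11)))))))))"

definition qry_prog :: com where
 "qry_prog = Seq (Seq (asg 10 (Const 1)) (Seq (asg 11 (Const 0)) (Seq (asg 12 (times (Const 64) (plus (vr 1) (Const 1))))
  (asg 13 (times (Const 256) (plus (vr 1) (Const 1)))))))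
  (Seq (While (less (vr 11) (vr 1)) qry_body) (asg 0 (minus (plus (vr 10) (Const 1)) (pow2 (vr 1)))))"

lemma node_at_bounds: "2 ^ j \<le> node_at f j x & node_at f j x < 2 * 2 ^ j"
 by (induction j) auto

lemma qry_runs:
 fixes x :: 'k and g :: nat and m :: memory
 assumes P: "PK y win m" and ks: "ks = [x]"
 defines "f \<equiv> %v. H (prod_encode (g, v * 2 ^ (64 * (d + 1)) + qwin d m v))"
 shows "runs w H ks qry_prog (m, g) (200 * d + 100) (%s. \<exists>m'. s = (m', g) & m' 0 = node_at f d x + 1 - 2 ^ d)"
proof -
 let ?W = "64 * (d + 1)"
 have m1: "m 1 = d" and y: "y \<le> d" using P by (auto simp: PK_def)
 define J where "J j m' \<longleftrightarrow> m' 10 = node_at f j x & m' 11 = j & m' 12 = ?W & m' 13 = w & m' 1 = d & (\<forall>b\<ge>60. m' b = m b)" for j and m' :: memory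
 let ?I = "%j s. \<exists>m' :: memory. s = (m', g) & J j m'"
 let ?init = "Seq (asg 10 (Const 1)) (Seq (asg 11 (Const 0)) (Seq (asg 12 (times (Const 64) (plus (vr 1) (Const 1))))
  (asg 13 (times (Const 256) (plus (vr 1) (Const 1))))))"
 have w': "256 + 256 * d = w" by (simp add: w)
 have i1: "?I 0 (den w H ks ?init (m, g))" using m1 ub_fit[OF uw[of 255]] by (simp add: J_def w')
 have body: "runs w H ks qry_body (m', g) 150 (?I (Suc j))" if j: "j < d" and J: "J j m'" for j m'
 proof -
  define v where "v = node_at f j x"
  have v: "2 ^ j \<le> v" "v < 2 * 2 ^ j" using node_at_bounds[of j f x] by (auto simp: v_def)
  have fl: "floor_log v = j" using v by (intro floor_log_eqI) (auto intro: less_le_trans[of 0 "2 ^ j"])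
  have vd: "1 \<le> v" "v < 2 ^ d"
  proof -
   have "(2::nat) * 2 ^ j \<le> 2 ^ d" using j power_increasing[of "Suc j" d "2::nat"] by simp
   thus "v < 2 ^ d" using v by simp
   show "1 \<le> v" using v(1) by (meson one_le_numeral one_le_power order_trans)
  qed
  have e: "m' 10 = v" "m' 11 = j" "m' 12 = ?W" "m' 13 = w" "m' 1 = d" and hi: "!!b. 60 \<le> b ==> m' b = m b" using J by (auto simp: J_def v_def)
  let ?k = "d - j"
  have k: "1 \<le> ?k" "?k \<le> d" using j by auto
  have h: "m (63 + 4 * j) = OFF d y ?k" "m (64 + 4 * j) = ee d y ?k" "m (65 + 4 * j) = kap d y ?k" "m (66 + 4 * j) = SL d y ?k"
   using P j by (auto simp: PK_def)
  define p where "p = posf d y v"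
  have pO: "p + ?W \<le> OFF d y (Suc d)"
  proof -
   have "OFF d y (Suc (d - floor_log v)) \<le> OFF d y (Suc d)" by (rule OFF_mono) simp
   thus ?thesis using node_coords(6,7)[OF vd, of y] unfolding p_def by linarith
  qed
  hence pw: "p div w \<le> OFF d y (Suc d) div w" by (intro div_le_mono) simp
  let ?q = "v - 2 ^ j"
  have pe: "p = OFF d y ?k + ?q div 2 ^ kap d y ?k * SL d y ?k + ?q mod 2 ^ kap d y ?k * ee d y ?k div 2 ^ (d + 2)"
   by (simp add: p_def posf_def posq_def fl po_def)
  have uO: "ub c (OFF d y k')" if "12 \<le> c" "k' \<le> Suc d" for c k'
   by (rule ub_mono[OF _ that(1)]) (use OFF_le[of k' d] that in \<open>simp add: ub_def\<close>)
  have up: "ub c p" if "12 \<le> c" for c by (rule ub_le[OF uO[OF that, of "Suc d"]]) (use pO in simp_all)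
  have uk: "ub c ((2::nat) ^ kap d y ?k)" if "1 \<le> c" for c using kap_le[of d y ?k] by (auto intro!: ub_mono[OF ub_pow that])
  have uS: "ub c (SL d y ?k)" if "10 \<le> c" for c by (rule ub_mono[OF _ that]) (use SL_le[OF k(2)] in \<open>simp add: ub_def\<close>)
  have ue: "ub c (ee d y ?k)" if "10 \<le> c" for c by (rule ub_mono[of 8]) (use ee_le(1)[OF k(2), of y] that in \<open>simp_all add: ub_def\<close>)
  have uj: "ub c j" if "1 \<le> c" for c using ub_le[OF ub_d[OF that]] j by simp
  have uv: "ub c v" if "1 \<le> c" for c by (rule ub_le[OF ub_mono[OF ub_pow that, of d]]) (use vd in auto)
  have u2j: "ub c ((2::nat) ^ j)" if "1 \<le> c" for c by (rule ub_mono[OF ub_pow that]) (use j in simp)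
  have uW: "ub c ((2::nat) ^ (64 + 64 * d))" if "64 \<le> c" for c by (rule ub_mono[OF ub_pow that]) simp
  have u2d: "ub c ((2::nat) ^ (d + 2))" if "2 \<le> c" for c by (rule ub_mono[OF ub_pow that]) simp
  have u2d': "ub c (4 * (2::nat) ^ d)" if "2 \<le> c" for c using u2d[OF that] by (simp add: power_add)
  define a s where "a = 63 + 4 * d + p div w" and "s = p mod w"
  have ua: "ub c a" if "13 \<le> c" for c unfolding a_def using up by (intro ub_mono[OF _ that]) simp
  let ?m2 = "m'(14 := 63 + 4 * j, 15 := ?q, 16 := kap d y ?k)"
  let ?c1 = "Seq (asg 14 (plus (Const 63) (times (Const 4) (vr 11)))) (Seq (asg 15 (minus (vr 10) (pow2 (vr 11)))) (asg 16 (Load (plus (vr 14) (Const 2)))))"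
  have d1: "den w H ks ?c1 (m', g) = (?m2, g)" using e hi[of "65 + 4 * j"] h by (simp add: uj uv u2j ev)
  let ?e17 = "plus (plus (Load (vr 14)) (times (Op Div (vr 15) (pow2 (vr 16))) (Load (plus (vr 14) (Const 3)))))
    (Op Div (times (Op Mod (vr 15) (pow2 (vr 16))) (Load (plus (vr 14) (Const 1)))) (pow2 (plus (vr 1) (Const 2))))"
  let ?m3 = "?m2(17 := p)"
  have d2: "den w H ks (asg 17 ?e17) (?m2, g) = (?m3, g)"
   unfolding pe using e hi[of "63 + 4 * j"] hi[of "64 + 4 * j"] hi[of "66 + 4 * j"] h by (simp add: uj uv u2j uk uS ue uO u2d u2d' ev)
  let ?m4 = "?m3(18 := a, 19 := s)"
  have d3: "den w H ks (Seq (asg 18 (plus (plus (Const 63) (times (Const 4) (vr 1))) (Op Div (vr 17) (vr 13)))) (asg 19 (Op Mod (vr 17) (vr 13)))) (?m3, g) = (?m4, g)"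
   using e by (simp add: up a_def s_def)
  let ?o = "Bit_Operations.or (drop_bit s (m a)) (take_bit w (push_bit (w - s) (m (Suc a))))"
  have ma: "m a < 2 ^ w" using P pw by (simp add: PK_def a_def)
  have to: "take_bit w (drop_bit s (m a)) = drop_bit s (m a)"
   unfolding drop_bit_eq_div by (rule take_bit_nat_eq_self, rule le_less_trans[OF div_le_dividend ma])
  have qw: "take_bit ?W ?o = qwin d m v"
   unfolding qwin_def qpos_eq[OF P vd] Let_def w[symmetric] p_def[symmetric] a_def[symmetric] s_def[symmetric] by simp
  have qW: "qwin d m v < 2 ^ ?W" unfolding qw[symmetric] by (rule take_bit_nat_less_exp)
  let ?m5 = "?m4(20 := qwin d m v)"
  let ?e20 = "Op Mod (Op BOr (Op Shr (Load (vr 18)) (vr 19)) (Op Shl (Load (plus (vr 18) (Const 1))) (minus (vr 13) (vr 19)))) (pow2 (vr 12))"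
  have d4: "den w H ks (asg 20 ?e20) (?m4, g) = (?m5, g)"
  proof -
   have a60: "60 \<le> a" by (simp add: a_def)
   have "aval w ?m4 (Op BOr (Op Shr (Load (vr 18)) (vr 19)) (Op Shl (Load (plus (vr 18) (Const 1))) (minus (vr 13) (vr 19)))) = ?o"
   proof -
    have w1: "take_bit w (w - s) = w - s" using uw[of 255] by simp
    have "aval w ?m4 (Op Shr (Load (vr 18)) (vr 19)) = drop_bit s (m a)" using hi[of a] a60 to by simp
    moreover have "aval w ?m4 (Op Shl (Load (plus (vr 18) (Const 1))) (minus (vr 13) (vr 19))) = take_bit w (push_bit (w - s) (m (Suc a)))"
     using hi[of "Suc a"] a60 e by (simp add: w1 ua)
    ultimately have "aval w ?m4 (Op BOr (Op Shr (Load (vr 18)) (vr 19)) (Op Shl (Load (plus (vr 18) (Const 1))) (minus (vr 13) (vr 19)))) = take_bit w ?o"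
     by (simp only: aval.simps(3) binop_val.simps)
    also have "... = ?o" unfolding take_bit_or to by simp
    finally show ?thesis .
   qed
   moreover have "aval w ?m4 (pow2 (vr 12)) = 2 ^ ?W" using e by (simp add: ev uW)
   ultimately have "aval w ?m4 ?e20 = take_bit w (?o mod 2 ^ ?W)" by (simp only: aval.simps(3) binop_val.simps)
   also have "?o mod 2 ^ ?W = qwin d m v" using qw by (simp only: take_bit_eq_mod)
   also have "take_bit w (qwin d m v) = qwin d m v"
    by (rule take_bit_nat_eq_self, rule less_le_trans[OF qW power_increasing]) (simp_all add: w)
   finally have av: "aval w ?m4 ?e20 = qwin d m v" .
   have a20: "aval w ?m4 (Const 20) = 20" by simp
   show ?thesis by (simp only: den.simps(1) fst_conv snd_conv av a20)
  qed
  have u64: "ub 64 (qwin d m v)" unfolding ub_def by (rule less_imp_le[OF qW])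
  have uq: "ub c (qwin d m v)" if "64 \<le> c" for c by (rule ub_mono[OF u64 that])
  let ?m6 = "?m5(21 := of_bool (f v x), 10 := 2 * v + of_bool (f v x), 11 := Suc j)"
  let ?m7 = "?m5(21 := of_bool (f v x))"
  have s1: "den w H ks (Hash (Const 21) (plus (times (vr 10) (pow2 (vr 12))) (vr 20)) (Const 0)) (?m5, g) = (?m7, g)"
  proof -
   have a1: "aval w ?m5 (plus (times (vr 10) (pow2 (vr 12))) (vr 20)) = v * 2 ^ ?W + qwin d m v"
    using e by (simp add: ev uW uv uq)
   have a2: "aval w ?m5 (Const 21) = 21" "aval w ?m5 (Const 0) = 0" by simp_all
   have hv: "hash_val H ks g (v * 2 ^ ?W + qwin d m v) 0 = of_bool (f v x)" by (simp add: hash_val_def ks f_def)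
   have tb: "take_bit w (of_bool b) = (of_bool b :: nat)" for b by (cases b) simp_all
   show ?thesis by (simp only: den.simps(2) fst_conv snd_conv a1 a2 hv tb)
  qed
  have s2: "den w H ks (Seq (asg 10 (plus (times (Const 2) (vr 10)) (vr 21))) (inc 11)) (?m7, g) = (?m6, g)"
   using e by (simp add: uv uj)
  note d5 = s1 s2
  have den: "den w H ks qry_body (m', g) = (?m6, g)" using d1 d2 d3 d4 d5 by (simp only: qry_body_def den.simps(4))
  have "J (Suc j) ?m6" unfolding J_def using e hi by (simp add: v_def)
  moreover have "loop_free qry_body" "tb qry_body \<le> 150" by (simp_all add: qry_body_def)
  ultimately show ?thesis using den by (auto intro!: runs_den)
 qed
 show ?thesis unfolding qry_prog_def
 proof (rule runs_Seq[where R = "?I 0" and ?T1.0 = 60, OF runs_den])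
  show "?I 0 (den w H ks ?init (m, g))" by (rule i1)
  fix s assume s: "?I 0 s"
  show "runs w H ks (Seq (While (less (vr 11) (vr 1)) qry_body) (asg 0 (minus (plus (vr 10) (Const 1)) (pow2 (vr 1))))) s (200 * d + 40)
   (%s. \<exists>m'. s = (m', g) & m' 0 = node_at f d x + 1 - 2 ^ d)"
  proof (rule runs_Seq[where R = "?I d" and ?T1.0 = "200 * d + 10"])
   show "runs w H ks (While (less (vr 11) (vr 1)) qry_body) s (200 * d + 10) (?I d)"
   proof (rule runs_for[where I = ?I and N = d and T = "%_. 150"])
    show "?I 0 s" by (rule s)
    fix i s assume i: "i < d" and "?I i s"
    then obtain m' where s: "s = (m', g)" and J: "J i m'" by blast
    show "aval w (fst s) (less (vr 11) (vr 1)) ~= 0 & runs w H ks qry_body s 150 (?I (Suc i))"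
     using body[OF i J] J i unfolding s by (simp add: J_def)
   next
    fix s assume "?I d s"
    then obtain m' where s: "s = (m', g)" and J: "J d m'" by blast
    show "aval w (fst s) (less (vr 11) (vr 1)) = 0" using J unfolding s by (simp add: J_def)
   qed simp
   fix s assume "?I d s"
   then obtain m' where s: "s = (m', g)" and J: "J d m'" by blast
   define v where "v = node_at f d x"
   have lt: "v < 2 * 2 ^ d" unfolding v_def by (rule conjunct2[OF node_at_bounds])
   have v2: "ub 2 v"
   proof (rule ub_le[of 2 "2 * 2 ^ d"])
    show "v \<le> 2 * 2 ^ d" using lt by (rule less_imp_le)
   qed simp
   have uv: "ub c v" if "2 \<le> c" for c by (rule ub_mono[OF v2 that])
   have e: "m' 10 = v" "m' 1 = d" unfolding v_def by (rule J[unfolded J_def, THEN conjunct1],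
    rule J[unfolded J_def, THEN conjunct2, THEN conjunct2, THEN conjunct2, THEN conjunct2, THEN conjunct1])
   have den: "den w H ks (asg 0 (minus (plus (vr 10) (Const 1)) (pow2 (vr 1)))) (m', g) = (m'(0 := v + 1 - 2 ^ d), g)"
    using e by (simp add: ev uv)
   show "runs w H ks (asg 0 (minus (plus (vr 10) (Const 1)) (pow2 (vr 1)))) s 30 (%s. \<exists>m'. s = (m', g) & m' 0 = node_at f d x + 1 - 2 ^ d)"
    unfolding s v_def[symmetric]
   proof (rule runs_den)
    show "\<exists>m''. den w H ks (asg 0 (minus (plus (vr 10) (Const 1)) (pow2 (vr 1)))) (m', g) = (m'', g) & m'' 0 = v + 1 - 2 ^ d"
     unfolding den by (intro exI conjI) (rule refl, rule fun_upd_same)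
   qed simp_all
  qed simp
 qed simp_all
qed

end

lemma pow_diff_double: "j < d ==> (2::nat) ^ (d - j) = 2 * 2 ^ (d - Suc j)"
 by (simp flip: power_Suc add: Suc_diff_Suc)

lemma Xset_card:
 assumes k: "length keys = 2 ^ d" and t: "!!u. u \<in> {1..<2 ^ d} ==> tst tu keys win u"
  and v: "1 \<le> v" "v < 2 * 2 ^ d"
 shows "card (Xset tu keys win v) = 2 ^ (d - floor_log v)"
 using v
proof (induction v rule: less_induct)
 case (less v)
 show ?case
 proof (cases "v = 1")
  case True
  have "Xset tu keys win 1 = {..<2 ^ d}" using k by (auto simp: Xset_def)
  thus ?thesis using True by simp
 next
  case False
  let ?u = "v div 2"
  have u: "1 \<le> ?u" "?u < v" "?u < 2 ^ d" using less.prems False by auto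
  have IH: "card (Xset tu keys win ?u) = 2 ^ (d - floor_log ?u)" using less.IH[OF u(2,1)] u by simp
  have lt: "floor_log ?u < d" by (rule floor_log_less[OF u(1,3)])
  have fl: "floor_log v = Suc (floor_log ?u)"
   by (rule floor_log_rec) (use u(1) in linarith)
  have e: "(2::nat) ^ (d - floor_log ?u) = 2 * 2 ^ (d - floor_log v)" unfolding fl by (rule pow_diff_double[OF lt])
  let ?X = "Xset tu keys win ?u" let ?P = "%i. tu ?u (win ?u) (keys ! i)"
  have "tst tu keys win ?u" by (rule t) (simp only: atLeastLessThan_iff u(1,3) simp_thms)
  hence t: "2 * card {i \<in> ?X. ?P i} = card ?X" unfolding tst_def .
  have "card {i \<in> ?X. ?P i} + card {i \<in> ?X. ~ ?P i} = card ({i \<in> ?X. ?P i} \<union> {i \<in> ?X. ~ ?P i})"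
   by (rule card_Un_disjoint[symmetric]) auto
  also have "{i \<in> ?X. ?P i} \<union> {i \<in> ?X. ~ ?P i} = ?X" by auto
  finally have h: "card {i \<in> ?X. ?P i} = 2 ^ (d - floor_log v)" "card {i \<in> ?X. ~ ?P i} = 2 ^ (d - floor_log v)"
   using t IH e by linarith+
  have "Xset tu keys win (2 * ?u + v mod 2) = {i \<in> ?X. ?P i \<longleftrightarrow> v mod 2 = 1}" by (rule Xset_child) (use u in auto)
  hence X: "Xset tu keys win v = {i \<in> ?X. ?P i \<longleftrightarrow> v mod 2 = 1}" unfolding mult_div_mod_eq .
  show ?thesis unfolding X using h by (cases "v mod 2 = 1") simp_all
 qed
qed

text \<open>Each perfect test halves the key set, so at depth \<open>d\<close> every node holds
  exactly one key. Hence the rank is injective, and counting makes it onto.\<close>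

lemma splits_and_bij:
 fixes keys :: "'k list"
 assumes k: "length keys = 2 ^ d" "distinct keys" and t: "!!u. u \<in> {1..<2 ^ d} ==> tst tu keys win u"
  and f: "!!u. u \<in> {1..<2 ^ d} ==> f u = tu u (win u)"
 shows "splits_perfectly d f (set keys)" "bij_betw (leaf_rank d f) (set keys) {1..2 ^ d}"
proof -
 let ?f = "%u. tu u (win u)"
 have nb: "2 ^ j \<le> node_at h j x & node_at h j x < 2 * 2 ^ j" for h j and x :: 'k
  by (induction j) auto
 have nf: "node_at f j x = node_at ?f j x" if "j \<le> d" for j x
  using that
 proof (induction j)
  case (Suc j)
  have "(2::nat) * 2 ^ j \<le> 2 ^ d" using Suc.prems power_increasing[of "Suc j" d "2::nat"] by simp
  moreover have "(1::nat) \<le> 2 ^ j" by simp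
  ultimately have "node_at ?f j x \<in> {1..<2 ^ d}" using nb[of j ?f x] by auto
  thus ?case using Suc f by simp
 qed simp
 have cS: "card {x \<in> set keys. Q x} = card {i. i < length keys & Q (keys ! i)}" for Q
 proof -
  have "{x \<in> set keys. Q x} = (!) keys ` {i. i < length keys & Q (keys ! i)}" by (auto simp: in_set_conv_nth)
  moreover have "inj_on ((!) keys) {i. i < length keys & Q (keys ! i)}"
   using k(2) by (auto simp: inj_on_def nth_eq_iff_index_eq)
  ultimately show ?thesis by (simp add: card_image)
 qed
 show "splits_perfectly d f (set keys)"
  unfolding splits_perfectly_def
 proof (intro allI impI ballI)
  fix j v :: nat assume j: "j < d" and v: "v \<in> {2 ^ j..<2 ^ Suc j}"
  have fl: "floor_log v = j" using v by (intro floor_log_eqI) (auto intro: less_le_trans[of 0 "2 ^ j"])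
  have "(2::nat) ^ Suc j \<le> 2 ^ d" using j by (intro power_increasing) auto
  moreover have "(1::nat) \<le> 2 ^ j" by simp
  ultimately have vd: "v \<in> {1..<2 ^ d}" using v by auto
  let ?X = "Xset tu keys win v" let ?P = "%i. tu v (win v) (keys ! i)"
  have X: "?X = {i. i < length keys & node_at f j (keys ! i) = v}" unfolding Xset_def fl using nf[of j] j by simp
  have t: "2 * card {i \<in> ?X. ?P i} = card ?X" using t[OF vd] by (simp add: tst_def)
  have "card {i \<in> ?X. ?P i} + card {i \<in> ?X. ~ ?P i} = card ({i \<in> ?X. ?P i} \<union> {i \<in> ?X. ~ ?P i})"
   by (rule card_Un_disjoint[symmetric]) auto
  also have "{i \<in> ?X. ?P i} \<union> {i \<in> ?X. ~ ?P i} = ?X" by auto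
  finally have h: "card {i \<in> ?X. ?P i} = card {i \<in> ?X. ~ ?P i}" using t by linarith
  show "card {x \<in> set keys. node_at f j x = v & f v x} = card {x \<in> set keys. node_at f j x = v & ~ f v x}"
   unfolding cS f[OF vd] using h unfolding X by (simp add: conj_ac)
 qed
 show "bij_betw (leaf_rank d f) (set keys) {1..2 ^ d}"
 proof -
  have inj: "inj_on (node_at f d) (set keys)"
  proof (rule inj_onI)
   fix x x' assume x: "x \<in> set keys" "x' \<in> set keys" "node_at f d x = node_at f d x'"
   let ?v = "node_at f d x"
   have fl: "floor_log ?v = d" using nb[of d f x] by (intro floor_log_eqI) (auto intro: less_le_trans[of 0 "2 ^ d"])
   have "1 \<le> ?v" using nb[of d f x] by (meson one_le_numeral one_le_power order_trans)
   hence "card (Xset tu keys win ?v) = 2 ^ (d - floor_log ?v)" using nb[of d f x] by (intro Xset_card[OF k(1) t]) auto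
   hence c1: "card (Xset tu keys win ?v) = 1" unfolding fl by simp
   obtain i i' where i: "i < length keys" "keys ! i = x" "i' < length keys" "keys ! i' = x'" using x by (auto simp: in_set_conv_nth)
   have "i \<in> Xset tu keys win ?v" "i' \<in> Xset tu keys win ?v" unfolding Xset_def fl using i x(3) nf[of d] by auto
   hence "i = i'" using c1 by (metis card_1_singletonE singletonD)
   thus "x = x'" using i by simp
  qed
  have inj2: "inj_on (leaf_rank d f) (set keys)"
  proof (rule inj_onI)
   fix x x' assume x: "x \<in> set keys" "x' \<in> set keys" "leaf_rank d f x = leaf_rank d f x'"
   hence "node_at f d x = node_at f d x'" using nb[of d f x] nb[of d f x'] unfolding leaf_rank_def by linarith
   thus "x = x'" using inj x by (auto dest: inj_onD)
  qed
  have sub: "leaf_rank d f ` set keys \<subseteq> {1..2 ^ d}"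
  proof
   fix z assume "z \<in> leaf_rank d f ` set keys"
   then obtain x where "z = leaf_rank d f x" by blast
   thus "z \<in> {1..2 ^ d}" using nb[of d f x] unfolding leaf_rank_def by auto
  qed
  have "card (leaf_rank d f ` set keys) = 2 ^ d" using card_image[OF inj2] distinct_card[OF k(2)] k(1) by simp
  hence "leaf_rank d f ` set keys = {1..2 ^ d}" using sub by (intro card_subset_eq) auto
  thus ?thesis using inj2 by (simp add: bij_betw_def)
 qed
qed

section \<open>Independent attempts\<close>

lemma ball_image: "(\<forall>p\<in>f ` A. P p) \<longleftrightarrow> (\<forall>z\<in>A. P (f z))"
 by blast

lemma Int_vimage_image:
 "J ~= {} ==> {om \<in> S. \<forall>p\<in>f ` J. X p om = t p} = (\<Inter>p\<in>f ` J. X p -` {t p} \<inter> S)"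
 by blast

locale hashing =
 fixes M :: "'w measure" and h :: "nat => 'k => 'w => bool" and d :: nat and keys :: "'k list" and y :: nat
 assumes uh: "simple_uniform_hashing M h" and dk: "distinct keys" and lk: "length keys = 2 ^ d" and y: "y \<le> d"
begin

sublocale prob_space M
 using uh by (simp add: simple_uniform_hashing_def)

lemma indep: "indep_vars (%_. count_space UNIV) (%(s, x). h s x) UNIV"
 using uh by (simp add: simple_uniform_hashing_def)

lemma hm: "h s x \<in> measurable M (count_space UNIV)"
proof -
 have "\<forall>i\<in>UNIV. random_variable (count_space UNIV) ((%(s, x). h s x) i)" using indep unfolding indep_vars_def by (rule conjunct1)
 from this[rule_format, of "(s, x)"] show ?thesis by simp
qed

lemma hprob: "prob (h s x -` {b} \<inter> space M) = 1 / 2"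
proof -
 have "prob (h s x -` {b} \<inter> space M) = measure (distr M (count_space UNIV) (h s x)) {b}"
  by (rule measure_distr[symmetric]) (simp_all add: hm)
 also have "... = measure (measure_pmf (pmf_of_set (UNIV :: bool set))) {b}"
  using uh by (simp add: simple_uniform_hashing_def)
 also have "... = 1 / 2" unfolding measure_pmf_single by (subst pmf_of_set) (simp_all add: UNIV_bool)
 finally show ?thesis .
qed

definition J :: "(nat \<times> nat \<times> nat) set" where
 "J = {1..<2 ^ d} \<times> {..<2 ^ (64 * (d + 1))} \<times> {..<2 ^ d}"

definition hx :: "nat => nat \<times> nat \<times> nat => nat \<times> 'k" where
 "hx g z = (case z of (u, c, i) => (prod_encode (g, u * 2 ^ (64 * (d + 1)) + c), keys ! i))"

text \<open>The hash values that batch \<open>g\<close> can contribute, as a table indexed by node,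
  window and key position. Entries outside \<open>J\<close> are False, as in
  \<open>table_pmf\<close>, so the tables form the finite set \<open>TT\<close>.\<close>

definition tabf :: "nat => (nat \<times> 'k => bool) => nat => nat => nat => bool" where
 "tabf g \<rho> = (%u c i. (u, c, i) \<in> J & \<rho> (hx g (u, c, i)))"

definition tab :: "nat => 'w => nat => nat => nat => bool" where
 "tab g om = tabf g (%(s, x). h s x om)"

definition TT :: "(nat => nat => nat => bool) set" where
 "TT = {T. \<forall>u c i. T u c i --> (u, c, i) \<in> J}"

lemma finite_J [simp]: "finite J"
 by (simp add: J_def)

text \<open>Batch and seed are recovered by injectivity of \<open>prod_encode\<close>, node and
  window by division of the seed, and the position from the distinctness of the keys. Within a batch
  this gives the uniform table, across batches independence.\<close>

lemma hx_eq:
 assumes "hx g z = hx g' z'" "z \<in> J" "z' \<in> J"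
 shows "g = g' & z = z'"
proof -
 obtain u c i u' c' i' where z: "z = (u, c, i)" "z' = (u', c', i')" by (metis prod_cases3)
 let ?W = "2 ^ (64 * (d + 1)) :: nat"
 have c: "c < ?W" "c' < ?W" "i < 2 ^ d" "i' < 2 ^ d" using assms(2,3) by (auto simp: J_def z)
 have e: "prod_encode (g, u * ?W + c) = prod_encode (g', u' * ?W + c')" "keys ! i = keys ! i'" using assms(1) by (auto simp: hx_def z)
 have ge: "g = g'" and a: "u * ?W + c = u' * ?W + c'" using e(1) by (auto simp: inj_eq)
 have "u = (u * ?W + c) div ?W" "c = (u * ?W + c) mod ?W" using c by simp_all
 moreover have "u' = (u' * ?W + c') div ?W" "c' = (u' * ?W + c') mod ?W" using c by simp_all
 ultimately have "u = u'" "c = c'" using a by metis+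
 moreover have "i = i'" using e(2) c dk lk by (simp add: nth_eq_iff_index_eq)
 ultimately show ?thesis using ge z by simp
qed

lemma hx_inj: "inj_on (hx g) J"
 by (rule inj_onI) (blast dest: hx_eq)

lemma finite_TT: "finite TT"
proof (rule finite_subset)
 show "TT \<subseteq> (%S u c i. (u, c, i) \<in> S) ` Pow J"
 proof
  fix T assume T: "T \<in> TT"
  have "T = (%S u c i. (u, c, i) \<in> S) {(u, c, i). T u c i}" by simp
  moreover have "{(u, c, i). T u c i} \<in> Pow J" using T by (auto simp: TT_def)
  ultimately show "T \<in> (%S u c i. (u, c, i) \<in> S) ` Pow J" by (rule image_eqI)
 qed
qed simp

lemma tab_TT: "tab g om \<in> TT"
 by (simp add: tab_def tabf_def TT_def)

text \<open>A table is a conjunction of \<open>card J\<close> independent events of probability 1/2.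
  Independence is stated for nonempty index sets only, which makes the case \<open>J = {}\<close>,
  that is \<open>d = 0\<close>, separate.\<close>

lemma tab_prob:
 assumes T: "T \<in> TT"
 shows "{om \<in> space M. tab g om = T} \<in> sets M" "prob {om \<in> space M. tab g om = T} = (1 / 2) ^ card J"
proof -
 define T' where "T' p = (case inv_into J (hx g) p of (u, c, i) => T u c i)" for p
 let ?X = "%(s, x). h s x"
 have iff: "tab g om = T \<longleftrightarrow> (\<forall>p\<in>hx g ` J. ?X p om = T' p)" for om
 proof -
  have T'z: "T' (hx g (u, c, i)) = T u c i" if "(u, c, i) \<in> J" for u c i
   using that hx_inj by (simp add: T'_def inv_into_f_f)
  have tabv: "tab g om u c i \<longleftrightarrow> (u, c, i) \<in> J & ?X (hx g (u, c, i)) om" for u c i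
   by (simp add: tab_def tabf_def case_prod_beta)
  have Tv: "T u c i ==> (u, c, i) \<in> J" for u c i using T unfolding TT_def by blast
  have "tab g om = T \<longleftrightarrow> (\<forall>u c i. tab g om u c i = T u c i)" unfolding fun_eq_iff ..
  also have "... \<longleftrightarrow> (\<forall>u c i. (u, c, i) \<in> J --> ?X (hx g (u, c, i)) om = T' (hx g (u, c, i)))"
   unfolding tabv using Tv T'z by metis
  also have "... \<longleftrightarrow> (\<forall>z\<in>J. ?X (hx g z) om = T' (hx g z))" by (metis prod_cases3)
  also have "... \<longleftrightarrow> (\<forall>p\<in>hx g ` J. ?X p om = T' p)" 
   by (rule ball_image[symmetric, where P = "%p. ?X p om = T' p" and f = "hx g"])
  finally show ?thesis .
 qed
 have ne_case: "prob (\<Inter>p\<in>hx g ` J. ?X p -` {T' p} \<inter> space M) = (1 / 2) ^ card J & {om \<in> space M. tab g om = T} \<in> sets M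
  & {om \<in> space M. tab g om = T} = (\<Inter>p\<in>hx g ` J. ?X p -` {T' p} \<inter> space M)" if ne: "J ~= {}"
 proof (intro conjI)
  have "prob (\<Inter>p\<in>hx g ` J. ?X p -` {T' p} \<inter> space M) = (\<Prod>p\<in>hx g ` J. prob (?X p -` {T' p} \<inter> space M))"
   by (rule indep_varsD[OF indep]) (use ne in auto)
  also have "... = (\<Prod>p\<in>hx g ` J. 1 / 2)" by (intro prod.cong refl) (auto simp: hprob split: prod.splits)
  also have "... = (1 / 2) ^ card J" using card_image[OF hx_inj, of g] by simp
  finally show "prob (\<Inter>p\<in>hx g ` J. ?X p -` {T' p} \<inter> space M) = (1 / 2) ^ card J" .
  show eq: "{om \<in> space M. tab g om = T} = (\<Inter>p\<in>hx g ` J. ?X p -` {T' p} \<inter> space M)"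
   unfolding iff by (rule Int_vimage_image[OF ne])
  have meas: "?X p -` {T' p} \<inter> space M \<in> sets M" for p
  proof (rule measurable_sets)
   show "?X p \<in> measurable M (count_space UNIV)" by (cases p) (simp only: prod.case hm)
  qed simp
  show "{om \<in> space M. tab g om = T} \<in> sets M" unfolding eq
  proof (rule sets.finite_INT)
   show "finite (hx g ` J)" by simp
   show "hx g ` J ~= {}" using ne by (simp only: image_is_empty not_False_eq_True simp_thms)
  qed (rule meas)
 qed
 have e_case: "{om \<in> space M. tab g om = T} = space M" if "J = {}" unfolding iff that by blast
 show "{om \<in> space M. tab g om = T} \<in> sets M"
 proof (cases "J = {}")
  case True
  show ?thesis unfolding e_case[OF True] by (rule sets.top)
 qed (use ne_case in blast)
 show "prob {om \<in> space M. tab g om = T} = (1 / 2) ^ card J"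
 proof (cases "J = {}")
  case True
  show ?thesis unfolding e_case[OF True] by (simp add: prob_space True)
 next
  case False
  show ?thesis by (simp only: ne_case[OF False, THEN conjunct2, THEN conjunct2] ne_case[OF False, THEN conjunct1])
 qed
qed

lemma pmf_TT:
 assumes T: "T \<in> TT"
 shows "pmf (table_pmf d {1..<2 ^ d}) T = (1 / 2) ^ card J"
proof -
 let ?W = "2 ^ (64 * (d + 1)) :: nat"
 have row: "pmf (row_pmf (2 ^ d)) (T u c) = (1 / 2) ^ 2 ^ d" for u c
 proof -
  have "pmf (row_pmf (2 ^ d)) (T u c) = (\<Prod>i<2 ^ d. pmf (bernoulli_pmf (1 / 2)) (T u c i))"
   unfolding row_pmf_def using T by (intro pmf_Pi') (auto simp: TT_def J_def)
  also have "... = (\<Prod>i<(2::nat) ^ d. 1 / 2)" by (intro prod.cong refl) (metis (full_types) pmf_bernoulli_half)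
  finally show ?thesis by simp
 qed
 have nd: "pmf (node_pmf d) (T u) = ((1 / 2) ^ 2 ^ d) ^ ?W" for u
 proof -
  have "pmf (node_pmf d) (T u) = (\<Prod>c<?W. pmf (row_pmf (2 ^ d)) (T u c))"
   unfolding node_pmf_def using T by (intro pmf_Pi') (auto simp: TT_def J_def fun_eq_iff)
  thus ?thesis unfolding row by simp
 qed
 have "pmf (table_pmf d {1..<2 ^ d}) T = (\<Prod>u=1..<2 ^ d. pmf (node_pmf d) (T u))"
  unfolding table_pmf_def using T by (intro pmf_Pi') (auto simp: TT_def J_def fun_eq_iff)
 also have "... = (1 / 2) ^ card J" unfolding nd by (simp add: J_def card_cartesian_product ac_simps flip: power_mult)
 finally show ?thesis .
qed

lemma table_nn:
 fixes F :: "(nat => nat => nat => bool) => ennreal"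
 shows "(\<integral>\<^sup>+om. F (tab g om) \<partial>M) = (\<integral>\<^sup>+T. F T \<partial>table_pmf d {1..<2 ^ d})"
proof -
 have "(\<integral>\<^sup>+om. F (tab g om) \<partial>M) = (\<integral>\<^sup>+om. (\<Sum>T\<in>TT. F T * indicator {om \<in> space M. tab g om = T} om) \<partial>M)"
 proof (rule nn_integral_cong)
  fix om assume om: "om \<in> space M"
  have "(\<Sum>T\<in>TT. F T * indicator {om \<in> space M. tab g om = T} om) = (\<Sum>T\<in>{tab g om}. F T * indicator {om \<in> space M. tab g om = T} om)"
   by (rule sum.mono_neutral_right) (use finite_TT tab_TT om in auto)
  thus "F (tab g om) = (\<Sum>T\<in>TT. F T * indicator {om \<in> space M. tab g om = T} om)" using om by simp
 qed
 also have "... = (\<Sum>T\<in>TT. F T * emeasure M {om \<in> space M. tab g om = T})"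
  by (subst nn_integral_sum) (auto simp: tab_prob(1) nn_integral_cmult_indicator intro!: borel_measurable_times_ennreal borel_measurable_indicator)
 also have "... = (\<Sum>T\<in>TT. F T * ennreal (pmf (table_pmf d {1..<2 ^ d}) T))"
  by (intro sum.cong refl) (simp only: emeasure_eq_measure tab_prob(2) pmf_TT)
 also have "... = (\<integral>\<^sup>+T. F T \<partial>table_pmf d {1..<2 ^ d})"
 proof -
  have sub: "T \<in> TT" if "T \<in> set_pmf (table_pmf d {1..<2 ^ d})" for T
  proof -
   have T1: "T \<in> PiE_dflt {1..<2 ^ d} (%_ _. False) (set_pmf \<circ> (%_. node_pmf d))" using that unfolding table_pmf_def by (simp add: set_Pi_pmf)
   show ?thesis unfolding TT_def
   proof (intro CollectI allI impI)
    fix u c i assume t: "T u c i"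
    have u: "u \<in> {1..<2 ^ d}"
    proof (rule ccontr)
     assume "u \<notin> {1..<2 ^ d}"
     hence "T u = (%_ _. False)" using T1 unfolding PiE_dflt_def by blast
     thus False using t by simp
    qed
    hence "T u \<in> set_pmf (node_pmf d)" using T1 unfolding PiE_dflt_def o_def by blast
    hence T2: "T u \<in> PiE_dflt {..<2 ^ (64 * (d + 1))} (%_. False) (set_pmf \<circ> (%_. row_pmf (2 ^ d)))" unfolding node_pmf_def by (simp add: set_Pi_pmf)
    have c: "c \<in> {..<2 ^ (64 * (d + 1))}"
    proof (rule ccontr)
     assume "c \<notin> {..<2 ^ (64 * (d + 1))}"
     hence "T u c = (%_. False)" using T2 unfolding PiE_dflt_def by blast
     thus False using t by simp
    qed
    hence "T u c \<in> set_pmf (row_pmf (2 ^ d))" using T2 unfolding PiE_dflt_def o_def by blast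
    hence T3: "T u c \<in> PiE_dflt {..<2 ^ d} False (set_pmf \<circ> (%_. bernoulli_pmf (1 / 2)))" unfolding row_pmf_def by (simp add: set_Pi_pmf)
    have "i \<in> {..<2 ^ d}"
    proof (rule ccontr)
     assume "i \<notin> {..<2 ^ d}"
     hence "T u c i = False" using T3 unfolding PiE_dflt_def by blast
     thus False using t by simp
    qed
    thus "(u, c, i) \<in> J" using u c by (simp add: J_def)
   qed
  qed
  show ?thesis by (rule nn_integral_measure_pmf_support[symmetric]) (use finite_TT sub in auto)
 qed
 finally show ?thesis .
qed

text \<open>By \<open>hx_eq\<close> different batches read disjoint families of hash values, and
  functions of disjoint subfamilies are independent.\<close>

lemma tab_indep:
 fixes F :: "nat => (nat => nat => nat => bool) => ennreal"
 shows "indep_vars (%_. borel) (%g om. F g (tab g om)) UNIV"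
proof -
 let ?X = "%(s, x). h s x"
 have "disjoint_family_on (%g. hx g ` J) UNIV" unfolding disjoint_family_on_def using hx_eq by blast
 from indep_vars_restrict[OF indep _ this]
 have 1: "indep_vars (%g. PiM (hx g ` J) (%_. count_space UNIV)) (%g om. restrict (%i. ?X i om) (hx g ` J)) UNIV" by simp
 have "indep_vars (%_. borel) (%g om. F g (tabf g (restrict (%i. ?X i om) (hx g ` J)))) UNIV"
 proof (rule indep_vars_compose2[OF 1, where Y = "%g \<rho>. F g (tabf g \<rho>)"])
  fix g :: nat
  have "PiM (hx g ` J) (%_. count_space (UNIV :: bool set)) = count_space (PiE (hx g ` J) (%_. UNIV))"
   by (rule count_space_PiM_finite) simp_all
  thus "(%\<rho>. F g (tabf g \<rho>)) \<in> measurable (PiM (hx g ` J) (%_. count_space UNIV)) borel" by simp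
 qed
 moreover have "tabf g (restrict (%i. ?X i om) (hx g ` J)) = tab g om" for g om
  unfolding tab_def tabf_def by (intro ext) (auto simp: case_prod_beta)
 ultimately show ?thesis by simp
qed

lemma tab_measurable: "(%om. F (tab g om)) \<in> borel_measurable M" for F :: "_ => ennreal"
 using tab_indep[of "%_. F"] unfolding indep_vars_def by blast

abbreviation fl :: "nat => 'w => bool" where
 "fl i om \<equiv> failT d y (tab i om)"

lemma fl_measurable: "{om \<in> space M. fl i om} \<in> sets M"
proof -
 have "{om \<in> space M. fl i om} = (%om. of_bool (fl i om) :: ennreal) -` {1} \<inter> space M" by auto
 thus ?thesis using measurable_sets[OF tab_measurable[of "%T. of_bool (failT d y T)" i], of "{1}"] by simp
qed

text \<open>The earlier attempts and attempt \<open>G\<close> are independent, so the integral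
  factors: each earlier failure contributes at most 1/2, and \<open>F\<close> is integrated against
  the law of a single table.\<close>

lemma geo:
 fixes F :: "(nat => nat => nat => bool) => ennreal"
 shows "(\<integral>\<^sup>+om. of_bool (\<forall>i<G. fl i om) * F (tab G om) \<partial>M) \<le> ennreal ((1 / 2) ^ G) * (\<integral>\<^sup>+T. F T \<partial>table_pmf d {1..<2 ^ d})"
proof -
 let ?F = "%i T. if i < G then of_bool (failT d y T) else F T"
 have "of_bool (\<forall>i<G. fl i om) * F (tab G om) = (\<Prod>i\<le>G. ?F i (tab i om))" for om
 proof -
  have "(\<Prod>i\<le>G. ?F i (tab i om)) = (\<Prod>i<G. ?F i (tab i om)) * F (tab G om)" by (simp flip: lessThan_Suc_atMost)
  also have "(\<Prod>i<G. ?F i (tab i om)) = (\<Prod>i<G. of_bool (fl i om))" by (intro prod.cong) auto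
  also have "... = of_bool (\<forall>i<G. fl i om)" by (induction G) (auto simp: less_Suc_eq)
  finally show ?thesis ..
 qed
 hence "(\<integral>\<^sup>+om. of_bool (\<forall>i<G. fl i om) * F (tab G om) \<partial>M) = (\<integral>\<^sup>+om. (\<Prod>i\<le>G. ?F i (tab i om)) \<partial>M)" by simp
 also have "... = (\<Prod>i\<le>G. \<integral>\<^sup>+om. ?F i (tab i om) \<partial>M)"
  by (rule indep_vars_nn_integral) (auto intro: indep_vars_subset[OF tab_indep])
 also have "... = (\<Prod>i<G. \<integral>\<^sup>+om. ?F i (tab i om) \<partial>M) * (\<integral>\<^sup>+om. F (tab G om) \<partial>M)"
  by (simp flip: lessThan_Suc_atMost)
 also have "... \<le> (\<Prod>i<G. ennreal (1 / 2)) * (\<integral>\<^sup>+T. F T \<partial>table_pmf d {1..<2 ^ d})"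
 proof (rule mult_mono)
  show "(\<Prod>i<G. \<integral>\<^sup>+om. ?F i (tab i om) \<partial>M) \<le> (\<Prod>i<G. ennreal (1 / 2))"
  proof (rule prod_mono_ennreal)
   fix i assume "i \<in> {..<G}"
   hence "(\<integral>\<^sup>+om. ?F i (tab i om) \<partial>M) = (\<integral>\<^sup>+om. of_bool (fl i om) \<partial>M)" by simp
   also have "... = (\<integral>\<^sup>+T. of_bool (failT d y T) \<partial>table_pmf d {1..<2 ^ d})" by (rule table_nn)
   also have "... \<le> ennreal (1 / 2)" by (rule fail_expect[OF y])
   finally show "(\<integral>\<^sup>+om. ?F i (tab i om) \<partial>M) \<le> ennreal (1 / 2)" .
  qed
  show "(\<integral>\<^sup>+om. F (tab G om) \<partial>M) \<le> (\<integral>\<^sup>+T. F T \<partial>table_pmf d {1..<2 ^ d})" unfolding table_nn ..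
 qed simp_all
 also have "(\<Prod>i<G. ennreal (1 / 2)) = ennreal ((1 / 2) ^ G)" unfolding prod_constant card_lessThan by (rule ennreal_power) simp
 finally show ?thesis .
qed

lemma all_fl_sets: "{om \<in> space M. \<forall>i<G. fl i om} \<in> sets M"
proof (induction G)
 case (Suc G)
 have "{om \<in> space M. \<forall>i<Suc G. fl i om} = {om \<in> space M. \<forall>i<G. fl i om} \<inter> {om \<in> space M. fl G om}"
  by (auto simp: less_Suc_eq)
 thus ?case using Suc fl_measurable[of G] by (simp only: sets.Int)
qed simp

lemma of_bool_measurable: "(%om. of_bool (\<forall>i<G. fl i om) :: ennreal) \<in> borel_measurable M"
proof -
 note s = all_fl_sets[of G]
 have "(%om. indicator {om \<in> space M. \<forall>i<G. fl i om} om :: ennreal) \<in> borel_measurable M" by (rule borel_measurable_indicator[OF s])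
 moreover have "(%om. of_bool (\<forall>i<G. fl i om) :: ennreal) \<in> borel_measurable M \<longleftrightarrow> (%om. indicator {om \<in> space M. \<forall>i<G. fl i om} om :: ennreal) \<in> borel_measurable M"
  by (rule measurable_cong) (simp only: indicator_def mem_Collect_eq simp_thms)
 ultimately show ?thesis by blast
qed

text \<open>Attempt \<open>G\<close> takes place exactly if all earlier ones failed, an event
  independent of its own table. So its expected cost carries the weight \<open>(1/2)^G\<close> at
  most, and the series sums to twice the cost of one attempt.\<close>

lemma total_expect:
 fixes F :: "(nat => nat => nat => bool) => ennreal" and c :: real
 assumes F: "(\<integral>\<^sup>+T. F T \<partial>table_pmf d {1..<2 ^ d}) \<le> ennreal c" and c: "0 \<le> c"
 shows "(\<integral>\<^sup>+om. (\<Sum>G. of_bool (\<forall>i<G. fl i om) * F (tab G om)) \<partial>M) \<le> ennreal (2 * c)"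
proof -
 have "(\<integral>\<^sup>+om. (\<Sum>G. of_bool (\<forall>i<G. fl i om) * F (tab G om)) \<partial>M) = (\<Sum>G. \<integral>\<^sup>+om. of_bool (\<forall>i<G. fl i om) * F (tab G om) \<partial>M)"
  by (rule nn_integral_suminf) (intro borel_measurable_times_ennreal of_bool_measurable tab_measurable)
 also have "... \<le> (\<Sum>G. ennreal ((1 / 2) ^ G * c))"
 proof (intro suminf_le)
  fix G
  have "(\<integral>\<^sup>+om. of_bool (\<forall>i<G. fl i om) * F (tab G om) \<partial>M) \<le> ennreal ((1 / 2) ^ G) * (\<integral>\<^sup>+T. F T \<partial>table_pmf d {1..<2 ^ d})" by (rule geo)
  also have "... \<le> ennreal ((1 / 2) ^ G) * ennreal c" by (intro mult_left_mono F) simp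
  also have "... = ennreal ((1 / 2) ^ G * c)" using c by (simp add: ennreal_mult)
  finally show "(\<integral>\<^sup>+om. of_bool (\<forall>i<G. fl i om) * F (tab G om) \<partial>M) \<le> ennreal ((1 / 2) ^ G * c)" .
 qed simp_all
 also have "... = ennreal (2 * c)"
 proof (rule suminf_ennreal_eq)
  have "(%G. (1 / 2 :: real) ^ G) sums (1 / (1 - 1 / 2))" by (rule geometric_sums) simp
  from sums_mult2[OF this, of c] show "(%G. (1 / 2) ^ G * c) sums (2 * c)" by simp
 qed (use c in simp)
 finally show ?thesis .
qed

text \<open>With unit cost the sum in \<open>total_expect\<close> counts the attempts. Its
  expectation is finite, so it is finite almost everywhere.\<close>

lemma AE_success: "AE om in M. \<exists>i. ~ fl i om"
proof -
 have m: "(%om. \<Sum>G. of_bool (\<forall>i<G. fl i om) * (1 :: ennreal)) \<in> borel_measurable M"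
  by (intro borel_measurable_suminf_order borel_measurable_times_ennreal of_bool_measurable) simp
 have "(\<integral>\<^sup>+om. (\<Sum>G. of_bool (\<forall>i<G. fl i om) * (1 :: ennreal)) \<partial>M) \<le> ennreal (2 * 1)"
  by (rule total_expect) (simp_all add: measure_pmf.emeasure_space_1)
 hence "(\<integral>\<^sup>+om. (\<Sum>G. of_bool (\<forall>i<G. fl i om) * (1 :: ennreal)) \<partial>M) ~= \<infinity>" by (auto simp: top_unique)
 from nn_integral_PInf_AE[OF m this] show ?thesis
 proof eventually_elim
  fix om assume f: "(\<Sum>G. of_bool (\<forall>i<G. fl i om) * (1 :: ennreal)) ~= \<infinity>"
  show "\<exists>i. ~ fl i om"
  proof (rule ccontr)
   assume "\<nexists>i. ~ fl i om"
   hence e: "(\<Sum>G. of_bool (\<forall>i<G. fl i om) * (1 :: ennreal)) = (\<Sum>G. 1)" by simp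
   have "(\<Sum>G. (1 :: ennreal)) = \<infinity>"
   proof (rule ccontr)
    assume "(\<Sum>G. (1 :: ennreal)) ~= \<infinity>"
    then obtain r where r: "(\<Sum>G. (1 :: ennreal)) = ennreal r" "0 \<le> r" by (cases "(\<Sum>G. (1 :: ennreal))") auto
    obtain n where n: "r < real n" using reals_Archimedean2 by blast
    have "(\<Sum>G<n. (1 :: ennreal)) \<le> (\<Sum>G. 1)" by (rule sum_le_suminf) auto
    hence "ennreal (real n) \<le> ennreal r" using r by (simp add: ennreal_of_nat_eq_real_of_nat)
    thus False using n r by simp
   qed
   thus False using e f by simp
  qed
 qed
qed

lemma prob_many_failures: "prob {om \<in> space M. \<forall>i<G. fl i om} \<le> (1 / 2) ^ G"
proof -
 let ?A = "{om \<in> space M. \<forall>i<G. fl i om}"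
 have "emeasure M ?A = (\<integral>\<^sup>+om. indicator ?A om \<partial>M)" by (rule nn_integral_indicator[OF all_fl_sets, symmetric])
 also have "... = (\<integral>\<^sup>+om. of_bool (\<forall>i<G. fl i om) * 1 \<partial>M)" by (intro nn_integral_cong) (simp only: indicator_def mem_Collect_eq simp_thms mult_1_right)
 also have "... \<le> ennreal ((1 / 2) ^ G) * (\<integral>\<^sup>+T. 1 \<partial>table_pmf d {1..<2 ^ d})" by (rule geo)
 also have "... = ennreal ((1 / 2) ^ G)" by (simp add: measure_pmf.emeasure_space_1)
 finally have "ennreal (prob ?A) \<le> ennreal ((1 / 2) ^ G)" unfolding emeasure_eq_measure .
 thus ?thesis by (rule ennreal_le_iff[THEN iffD1, rotated]) (rule zero_le_power, simp)
qed

end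

section \<open>The whole construction\<close>

context ram
begin

definition build_prog :: com where
 "build_prog = Seq prep_prog (Seq att_prog out_prog)"

lemma build_runs:
 assumes n: "length ks = 2 ^ d" and E: "E \<le> 2 ^ d" and y: "clg E \<le> d"
  and f: "!!i. i < N ==> ~ succ (clg E) i" "succ (clg E) N"
 shows "runs w H ks build_prog ((%_. 0)(0 := 2 ^ d, 1 := E), 0) (600 * 2 ^ d + 100 * (d * d) + 1100 * d + 700 + (\<Sum>i\<le>N. 900 * cst (clg E) i + 770))
  (%s. \<exists>(m :: memory) win. s = (m, N) & OUTP (clg E) win m & (\<forall>u\<in>{1..<2 ^ d}. goodw d (clg E) (tau N) ks win u))"
 unfolding build_prog_def
proof (rule runs_Seq[OF prep_runs[OF E]])
 fix s :: state assume "\<exists>m'. s = (m', 0) & PRE (clg E) m'"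
 then obtain m where s: "s = (m, 0)" and P: "PRE (clg E) m" by (elim exE conjE) (rule that)
 let ?m = "m(13 := 0)"
 have P1: "PRE (clg E) ?m" by (rule PRE_cong[OF _ P]) auto
 show "runs w H ks (Seq att_prog out_prog) s ((10 + ((\<Sum>i\<le>N. 900 * cst (clg E) i + 770) + 10)) + (150 * 2 ^ d + 100))
  (%s. \<exists>(m :: memory) win. s = (m, N) & OUTP (clg E) win m & (\<forall>u\<in>{1..<2 ^ d}. goodw d (clg E) (tau N) ks win u))"
  unfolding s
 proof (rule runs_Seq[where R = "%s. \<exists>(m' :: memory) win. s = (m', N) & FND (clg E) N win m'"])
  show "runs w H ks att_prog (m, 0) (10 + ((\<Sum>i\<le>N. 900 * cst (clg E) i + 770) + 10)) (%s. \<exists>(m' :: memory) win. s = (m', N) & FND (clg E) N win m')"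
   unfolding att_prog_def
  proof (rule runs_Seq[where R = "%s. s = (?m, 0)" and ?T1.0 = 10, OF runs_den])
   fix s :: state assume s: "s = (?m, 0)"
   have "runs w H ks (While (Op Equal (vr 13) (Const 0)) att_body) (?m, 0) ((\<Sum>i\<le>N. 900 * cst (clg E) (0 + i) + 770) + 10)
    (%s. \<exists>(m' :: memory) win. s = (m', 0 + N) & FND (clg E) (0 + N) win m')"
    by (rule att_runs[OF n y P1]) (use f in auto)
   thus "runs w H ks (While (Op Equal (vr 13) (Const 0)) att_body) s ((\<Sum>i\<le>N. 900 * cst (clg E) i + 770) + 10)
    (%s. \<exists>(m' :: memory) win. s = (m', N) & FND (clg E) N win m')" unfolding s by simp
  qed simp_all
  fix s assume "\<exists>(m' :: memory) win. s = (m', N) & FND (clg E) N win m'"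
  then obtain m' win where s: "s = (m', N)" and F: "FND (clg E) N win m'" by blast
  have g: "\<forall>u\<in>{1..<2 ^ d}. goodw d (clg E) (tau N) ks win u" using F by (simp add: FND_def)
  show "runs w H ks out_prog s (150 * 2 ^ d + 100)
   (%s. \<exists>(m :: memory) win. s = (m, N) & OUTP (clg E) win m & (\<forall>u\<in>{1..<2 ^ d}. goodw d (clg E) (tau N) ks win u))"
   unfolding s by (rule runs_mono[OF out_runs[OF F] order_refl]) (use g in blast)
 qed simp
qed simp

end

lemma run_build_exec:
 assumes "exec w H ks c (build_input (length ks) \<epsilon>, 0) t (m, g)"
 shows "run_build w H ks \<epsilon> c = Some (t, output_bits w m, g)"
proof -
 have "(THE r. (%(t, s). exec w H ks c (build_input (length ks) \<epsilon>, 0) t s) r) = (t, m, g)"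
  by (rule the_equality) (use assms exec_deterministic in \<open>fastforce+\<close>)
 thus ?thesis using assms unfolding run_build_def Let_def by auto
qed

lemma run_build_SomeD:
 assumes "run_build w H ks \<epsilon> c = Some (t, bits, g)"
 shows "\<exists>m. exec w H ks c (build_input (length ks) \<epsilon>, 0) t (m, g) & bits = output_bits w m"
proof -
 have "\<exists>r. (%(t, s). exec w H ks c (build_input (length ks) \<epsilon>, 0) t s) r"
  using assms unfolding run_build_def Let_def by (metis option.distinct(1))
 then obtain t' m' g' where e: "exec w H ks c (build_input (length ks) \<epsilon>, 0) t' (m', g')" by auto
 from run_build_exec[OF e] assms e show ?thesis by auto
qed

lemma option_None_set: "{x \<in> S. f x = None} = S - (\<Union>r. {x \<in> S. f x = Some r})"
proof (rule set_eqI)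
 fix x show "x \<in> {x \<in> S. f x = None} \<longleftrightarrow> x \<in> S - (\<Union>r. {x \<in> S. f x = Some r})" by (cases "f x") auto
qed

lemma vimage_singleton_Int: "f -` {a} \<inter> S = {x \<in> S. f x = a}"
 by blast

lemma clg_le_d: "E \<le> 2 ^ d ==> clg E \<le> d"
 unfolding clg_def by (rule Least_le)

lemma square_le_pow: "d * d \<le> 4 * 2 ^ d" for d :: nat
proof (induction d)
 case (Suc d)
 have 1: "d < 2 ^ d" by (rule less_exp)
 have 2: "Suc d * Suc d = d * d + 2 * d + 1" by simp
 show ?case unfolding 2 power_Suc using Suc 1 by linarith
qed simp

definition LB :: "nat => nat => nat" where
 "LB d y = 256 * (d + 1) * (65 + 4 * d + OFF d y (Suc d) div (256 * (d + 1)))"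

text \<open>The \<open>65 + 4 * d\<close> words of registers, headers and rounding have
  \<open>256 * (d + 1)\<close> bits each and account for the rest of the squared logarithm.\<close>

lemma LB_le:
 assumes "y \<le> d"
 shows "real (LB d y) \<le> 2 ^ d * log 2 (exp 1) + 396 * (2 ^ d / 2 ^ y) + 1088 * (real d * real d) + 17728 * real d + 16640"
proof -
 let ?w = "256 * (d + 1)"
 have "LB d y = ?w * (65 + 4 * d) + ?w * (OFF d y (Suc d) div ?w)" unfolding LB_def by (simp add: distrib_left)
 also have "... \<le> ?w * (65 + 4 * d) + OFF d y (Suc d)" by (intro add_left_mono) (rule times_div_less_eq_dividend)
 finally have "real (LB d y) \<le> real (?w * (65 + 4 * d) + OFF d y (Suc d))" by (rule of_nat_mono)
 also have "... = 1024 * (real d * real d) + 17664 * real d + 16640 + real (OFF d y (Suc d))" by (simp add: algebra_simps)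
 also have "... \<le> 1024 * (real d * real d) + 17664 * real d + 16640 + (2 ^ d * log 2 (exp 1) + 64 * real d * (real d + 1) + 396 * (2 ^ d / 2 ^ y))"
  by (intro add_left_mono OFF_bound assms)
 finally show ?thesis by (simp add: algebra_simps)
qed

context hashing
begin

abbreviation "w \<equiv> 256 * (d + 1)"
abbreviation "HH om \<equiv> (%s x. h s x om)"

lemma link:
 shows "ram.succ d (HH om) keys y g \<longleftrightarrow> ~ fl g om" "ram.cst d (HH om) keys y g = costT d y (tab g om)"
proof -
 interpret R: ram d w "HH om" keys by unfold_locales simp
 have "R.vis y g = VT d y (tab g om)"
  unfolding R.vis_def VT_def
 proof (rule visit_cong)
  fix u c i :: nat assume "1 \<le> u" "u < 2 ^ d" "c < 2 ^ (64 * (d + 1))" "i < 2 ^ d"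
  thus "R.Tg g u c i = tab g om u c i" by (simp add: R.Tg_def R.tau_def tab_def tabf_def J_def hx_def)
 qed (use y in \<open>auto simp: aligned_def\<close>)
 thus "R.succ y g \<longleftrightarrow> ~ fl g om" "R.cst y g = costT d y (tab g om)"
  by (simp_all add: R.succ_def R.cst_def failT_def costT_def)
qed

abbreviation "TB \<equiv> 600 * 2 ^ d + 100 * (d * d) + 1100 * d + 700 :: nat"

lemma run_result:
 assumes E: "nat \<lceil>1 / \<epsilon>\<rceil> \<le> 2 ^ d" "y = clg (nat \<lceil>1 / \<epsilon>\<rceil>)"
  and N: "!!i. i < N ==> fl i om" "~ fl N om"
 shows "\<exists>t bits. run_build w (HH om) keys \<epsilon> ram.build_prog = Some (t, bits, N) &
  t \<le> TB + (\<Sum>i\<le>N. 900 * costT d y (tab i om) + 770) & length bits = LB d y &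
  (let f = (%v. HH om (prod_encode (N, seed d bits v))) in
   splits_perfectly d f (set keys) & bij_betw (leaf_rank d f) (set keys) {1..2 ^ d} &
   (\<forall>x. \<exists>tq m g'. exec w (HH om) [x] ram.qry_prog (pack w bits, N) tq (m, g') & m 0 = leaf_rank d f x & tq \<le> 200 * d + 100))"
proof -
 let ?E = "nat \<lceil>1 / \<epsilon>\<rceil>"
 interpret R: ram d w "HH om" keys by unfold_locales simp
 have "runs w (HH om) keys R.build_prog ((%_. 0)(0 := 2 ^ d, 1 := ?E), 0) (TB + (\<Sum>i\<le>N. 900 * R.cst (clg ?E) i + 770))
  (%s. \<exists>(m :: memory) win. s = (m, N) & R.OUTP (clg ?E) win m & (\<forall>u\<in>{1..<2 ^ d}. goodw d (clg ?E) (R.tau N) keys win u))"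
  by (rule R.build_runs[OF lk E(1)]) (use N E link[of om] y in auto)
 then obtain t m win where ex: "exec w (HH om) keys R.build_prog ((%_. 0)(0 := 2 ^ d, 1 := ?E), 0) t (m, N)"
  and t: "t \<le> TB + (\<Sum>i\<le>N. 900 * R.cst (clg ?E) i + 770)" and O: "R.OUTP y win m" and g: "!!u. u \<in> {1..<2 ^ d} ==> goodw d y (R.tau N) keys win u"
  unfolding runs_def E(2)[symmetric] by blast
 let ?bits = "output_bits w m"
 have B: "run_build w (HH om) keys \<epsilon> ram.build_prog = Some (t, ?bits, N)"
  by (rule run_build_exec) (use ex lk in \<open>simp add: build_input_def\<close>)
 have dw: "(2::nat) ^ d < 2 ^ w" by (rule power_strict_increasing) auto
 have lt: "\<forall>a. m a < 2 ^ w"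
  using exec_bounded[OF ex] dw E(1) by (auto simp: le_less_trans)
 have "m 0 = w * (65 + 4 * d + OFF d y (Suc d) div w)" using O unfolding R.OUTP_def by blast
 hence L: "length ?bits = LB d y" unfolding LB_def output_bits_def length_map length_upt minus_nat.diff_0 .
 have P: "R.PK y win (pack w ?bits)" by (rule R.PK_output[OF O lt y])
 let ?f = "%v. HH om (prod_encode (N, seed d ?bits v))"
 have fe: "?f v = R.tau N v (win v)" if "v \<in> {1..<2 ^ d}" for v
 proof -
  have "qwin d (pack w ?bits) v = win v" by (rule R.qwin_eq[OF P _ _ g]) (use that in auto)
  thus ?thesis by (simp add: seed_def R.tau_def)
 qed
 have tst: "tst (R.tau N) keys win u" if "u \<in> {1..<2 ^ d}" for u using g[OF that] by (simp add: goodw_def)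
 note sb = splits_and_bij[OF lk dk tst fe]
 have q: "\<exists>tq m g'. exec w (HH om) [x] ram.qry_prog (pack w ?bits, N) tq (m, g') & m 0 = leaf_rank d ?f x & tq \<le> 200 * d + 100" for x
 proof -
  interpret Q: ram d w "HH om" "[x]" by unfold_locales simp
  obtain tq s' where q: "exec w (HH om) [x] ram.qry_prog (pack w ?bits, N) tq s'" "tq \<le> 200 * d + 100"
   and "\<exists>m'. s' = (m', N) & m' 0 = node_at (%v. HH om (prod_encode (N, v * 2 ^ (64 * (d + 1)) + qwin d (pack w ?bits) v))) d x + 1 - 2 ^ d"
   using Q.qry_runs[OF P refl, of N] unfolding runs_def by blast
  then obtain m' where m': "s' = (m', N)" "m' 0 = node_at (%v. HH om (prod_encode (N, v * 2 ^ (64 * (d + 1)) + qwin d (pack w ?bits) v))) d x + 1 - 2 ^ d" by blast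
  have "m' 0 = leaf_rank d ?f x" unfolding leaf_rank_def seed_def by (rule m'(2))
  thus ?thesis using q unfolding m'(1) by blast
 qed
 have c: "R.cst (clg ?E) i = costT d y (tab i om)" for i using link(2)[of om i] E(2) by simp
 show ?thesis unfolding Let_def
  by (intro exI[of _ t] exI[of _ ?bits] conjI allI B L sb q) (use t in \<open>simp add: c\<close>)
qed

text \<open>The result lies in a countable set, so its fibres suffice. A terminating result depends
  on finitely many hash values, and non-termination is the complement of the countably many other
  fibres.\<close>

lemma B_measurable: "(%om. run_build v (HH om) keys \<epsilon> c) \<in> measurable M (count_space UNIV)"
proof -
 have S: "{om \<in> space M. run_build v (HH om) keys \<epsilon> c = Some r} \<in> sets M" for r
 proof (rule measurable_finite_use[where K = "set keys" and P = "%H. run_build v H keys \<epsilon> c = Some r"])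
  fix H :: "nat => 'k => bool" assume r: "run_build v H keys \<epsilon> c = Some r"
  obtain t bits g where rr: "r = (t, bits, g)" by (cases r)
  obtain m where m: "exec v H keys c (build_input (length keys) \<epsilon>, 0) t (m, g)" "bits = output_bits v m"
   using run_build_SomeD[of v H keys \<epsilon> c t bits g] r rr by auto
  from exec_finite_use[OF m(1)] obtain N where N: "\<forall>H'. (\<forall>i<N. \<forall>x\<in>set keys. H' i x = H i x) --> exec v H' keys c (build_input (length keys) \<epsilon>, 0) t (m, g)" by blast
  show "\<exists>N. \<forall>H'. (\<forall>i<N. \<forall>x\<in>set keys. H' i x = H i x) --> run_build v H' keys \<epsilon> c = Some r"
  proof (intro exI[of _ N] allI impI)
   fix H' assume a: "\<forall>i<N. \<forall>x\<in>set keys. H' i x = H i x"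
   have "exec v H' keys c (build_input (length keys) \<epsilon>, 0) t (m, g)" by (rule N[THEN spec, THEN mp, OF a])
   from run_build_exec[OF this] show "run_build v H' keys \<epsilon> c = Some r" unfolding rr m(2) .
  qed
 qed (rule hm, rule finite_set)
 have Nn: "{om \<in> space M. run_build v (HH om) keys \<epsilon> c = None} = space M - (\<Union>r. {om \<in> space M. run_build v (HH om) keys \<epsilon> c = Some r})"
  by (rule option_None_set)
 have N: "{om \<in> space M. run_build v (HH om) keys \<epsilon> c = None} \<in> sets M" unfolding Nn
  by (rule sets.Diff[OF sets.top sets.countable_UN], rule image_subsetI, rule S)
 show ?thesis
 proof (subst measurable_count_space_eq_countable)
  show "countable (UNIV :: (nat \<times> bool list \<times> nat) option set)" by simp
  show "(%om. run_build v (HH om) keys \<epsilon> c) \<in> space M \<rightarrow> UNIV & (\<forall>a\<in>UNIV. (%om. run_build v (HH om) keys \<epsilon> c) -` {a} \<inter> space M \<in> sets M)"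
  proof (intro conjI ballI)
   fix a
   show "(%om. run_build v (HH om) keys \<epsilon> c) -` {a} \<inter> space M \<in> sets M"
   proof (cases a)
    case None
    show ?thesis unfolding vimage_singleton_Int None by (rule N)
   next
    case (Some r)
    show ?thesis unfolding vimage_singleton_Int Some by (rule S)
   qed
  qed simp
 qed
qed

lemma first_success: "~ fl i om ==> \<exists>N\<le>i. (\<forall>i<N. fl i om) & ~ fl N om"
 using exists_least_iff[of "%i. ~ fl i om"] by (metis linorder_not_less)

lemma sum_le_total:
 assumes "!!i. i < N ==> fl i om"
 shows "(\<Sum>i\<le>N. F (tab i om)) \<le> (\<Sum>G. of_bool (\<forall>i<G. fl i om) * F (tab G om) :: ennreal)"
proof -
 have "(\<Sum>i\<le>N. F (tab i om)) = (\<Sum>i\<le>N. of_bool (\<forall>j<i. fl j om) * F (tab i om))"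
  using assms by (intro sum.cong refl) auto
 also have "... \<le> (\<Sum>G. of_bool (\<forall>i<G. fl i om) * F (tab G om))" by (rule sum_le_suminf) auto
 finally show ?thesis .
qed

lemma suminf_measurable: "(%om. \<Sum>G. of_bool (\<forall>i<G. fl i om) * F (tab G om) :: ennreal) \<in> borel_measurable M"
 by (intro borel_measurable_suminf_order borel_measurable_times_ennreal of_bool_measurable tab_measurable)

lemma nn_const_add: "f \<in> borel_measurable M ==> (\<integral>\<^sup>+om. c + f om \<partial>M) = c + (\<integral>\<^sup>+om. f om \<partial>M)" for f :: "'w => ennreal"
 by (subst nn_integral_add) (simp_all add: emeasure_space_1)

lemma conclusions:
 assumes E: "nat \<lceil>1 / \<epsilon>\<rceil> \<le> 2 ^ d" "y = clg (nat \<lceil>1 / \<epsilon>\<rceil>)"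
  and S: "real (LB d y) + real d + 2 \<le> S" and Tt: "real TB + 2 * (900 * CB d y + 1670) \<le> Tt" and q: "200 * real d + 100 \<le> Qt"
 defines "B \<equiv> %om. run_build w (HH om) keys \<epsilon> ram.build_prog"
 shows "(AE om in M. \<exists>t bits g. B om = Some (t, bits, g) & real (length bits) \<le> S &
   (let f = (%v. HH om (prod_encode (g, seed d bits v))) in
    splits_perfectly d f (set keys) & bij_betw (leaf_rank d f) (set keys) {1..2 ^ d} &
    (\<forall>x. \<exists>tq m g'. exec w (HH om) [x] ram.qry_prog (pack w bits, g) tq (m, g') & m 0 = leaf_rank d f x & real tq \<le> Qt)))"
  and "(%om. space_bits (B om)) \<in> borel_measurable M" and "(\<integral>\<^sup>+om. space_bits (B om) \<partial>M) \<le> ennreal S"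
  and "measure M {om \<in> space M. space_bits (B om) \<le> ennreal S} \<ge> 1 - 1 / 2 ^ d"
  and "(%om. build_time (B om)) \<in> borel_measurable M" and "(\<integral>\<^sup>+om. build_time (B om) \<partial>M) \<le> ennreal Tt"
proof -
 note rr = run_result[OF E, folded B_def]
 show "AE om in M. \<exists>t bits g. B om = Some (t, bits, g) & real (length bits) \<le> S &
   (let f = (%v. HH om (prod_encode (g, seed d bits v))) in
    splits_perfectly d f (set keys) & bij_betw (leaf_rank d f) (set keys) {1..2 ^ d} &
    (\<forall>x. \<exists>tq m g'. exec w (HH om) [x] ram.qry_prog (pack w bits, g) tq (m, g') & m 0 = leaf_rank d f x & real tq \<le> Qt))"
  using AE_success
 proof eventually_elim
  fix om assume "\<exists>i. ~ fl i om"
  then obtain N where N: "!!i. i < N ==> fl i om" "~ fl N om" using first_success by metis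
  obtain t bits where r: "B om = Some (t, bits, N)" "length bits = LB d y"
   and f: "let f = (%v. HH om (prod_encode (N, seed d bits v))) in
   splits_perfectly d f (set keys) & bij_betw (leaf_rank d f) (set keys) {1..2 ^ d} &
   (\<forall>x. \<exists>tq m g'. exec w (HH om) [x] ram.qry_prog (pack w bits, N) tq (m, g') & m 0 = leaf_rank d f x & tq \<le> 200 * d + 100)"
   using rr[OF N] unfolding B_def by blast
  have Q: "real tq \<le> Qt" if "tq \<le> 200 * d + 100" for tq
  proof -
   have "real tq \<le> real (200 * d + 100)" using that by (rule of_nat_mono)
   thus ?thesis using q by simp
  qed
  have l: "real (length bits) \<le> S" unfolding r(2) using S by linarith
  show "\<exists>t bits g. B om = Some (t, bits, g) & real (length bits) \<le> S &
   (let f = (%v. HH om (prod_encode (g, seed d bits v))) in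
    splits_perfectly d f (set keys) & bij_betw (leaf_rank d f) (set keys) {1..2 ^ d} &
    (\<forall>x. \<exists>tq m g'. exec w (HH om) [x] ram.qry_prog (pack w bits, g) tq (m, g') & m 0 = leaf_rank d f x & real tq \<le> Qt))"
  proof (rule exI[of _ t], rule exI[of _ bits], rule exI[of _ N], intro conjI r(1) l)
   show "let f = (%v. HH om (prod_encode (N, seed d bits v))) in
    splits_perfectly d f (set keys) & bij_betw (leaf_rank d f) (set keys) {1..2 ^ d} &
    (\<forall>x. \<exists>tq m g'. exec w (HH om) [x] ram.qry_prog (pack w bits, N) tq (m, g') & m 0 = leaf_rank d f x & real tq \<le> Qt)"
    using f Q unfolding Let_def by meson
  qed
 qed
 have Bm: "B \<in> measurable M (count_space UNIV)" unfolding B_def by (rule B_measurable)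
 show m1: "(%om. space_bits (B om)) \<in> borel_measurable M" by (rule measurable_compose[OF Bm]) simp
 show "(%om. build_time (B om)) \<in> borel_measurable M" by (rule measurable_compose[OF Bm]) simp
 have sp: "space_bits (B om) = of_nat (LB d y + (N + 1))" if N: "!!i. i < N ==> fl i om" "~ fl N om" for om N
  using rr[OF N] by (auto simp: space_bits_def B_def)
 show "(\<integral>\<^sup>+om. space_bits (B om) \<partial>M) \<le> ennreal S"
 proof -
  have "(\<integral>\<^sup>+om. space_bits (B om) \<partial>M) \<le> (\<integral>\<^sup>+om. of_nat (LB d y) + (\<Sum>G. of_bool (\<forall>i<G. fl i om) * (%_. 1) (tab G om)) \<partial>M)"
  proof (rule nn_integral_mono_AE)
   show "AE om in M. space_bits (B om) \<le> of_nat (LB d y) + (\<Sum>G. of_bool (\<forall>i<G. fl i om) * (%_. 1) (tab G om))"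
    using AE_success
   proof eventually_elim
    fix om assume "\<exists>i. ~ fl i om"
    then obtain N where N: "!!i. i < N ==> fl i om" "~ fl N om" using first_success by metis
    have "space_bits (B om) = of_nat (LB d y + (N + 1))" by (rule sp[OF N])
    \<comment> \<open>The unary batch number takes one bit for each attempt made, so
      \<open>total_expect\<close> with unit cost bounds its expected length by 2.\<close>
    also have "... = of_nat (LB d y) + (\<Sum>i\<le>N. (%_. 1) (tab i om))" by simp
    also have "... \<le> of_nat (LB d y) + (\<Sum>G. of_bool (\<forall>i<G. fl i om) * (%_. 1) (tab G om))"
     by (intro add_left_mono sum_le_total N(1))
    finally show "space_bits (B om) \<le> of_nat (LB d y) + (\<Sum>G. of_bool (\<forall>i<G. fl i om) * (%_. 1) (tab G om))" .
   qed
  qed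
  also have "... = of_nat (LB d y) + (\<integral>\<^sup>+om. (\<Sum>G. of_bool (\<forall>i<G. fl i om) * (%_. 1) (tab G om)) \<partial>M)"
   by (rule nn_const_add[OF suminf_measurable])
  also have "... \<le> of_nat (LB d y) + ennreal (2 * 1)"
   by (intro add_left_mono total_expect) (simp_all add: measure_pmf.emeasure_space_1)
  also have "... = ennreal (real (LB d y) + 2)" unfolding ennreal_of_nat_eq_real_of_nat by (subst ennreal_plus) simp_all
  also have "... \<le> ennreal S" using S by (intro ennreal_leI) simp
  finally show ?thesis .
 qed
 show "measure M {om \<in> space M. space_bits (B om) \<le> ennreal S} \<ge> 1 - 1 / 2 ^ d"
 proof -
  \<comment> \<open>Outside this event the batch number is at most \<open>d\<close>, and its unary
    code fits into the \<open>d + 2\<close> bits by which \<open>S\<close> exceeds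
    \<open>LB d y\<close>.\<close>
  let ?A = "{om \<in> space M. \<forall>i<Suc d. fl i om}"
  have A: "?A \<in> sets M" by (rule all_fl_sets)
  have "1 - 1 / 2 ^ d \<le> 1 - (1 / 2 :: real) ^ Suc d" by (simp add: power_divide field_simps)
  also have "... \<le> 1 - prob ?A" using prob_many_failures[of "Suc d"] by linarith
  also have "... = prob (space M - ?A)" using prob_compl[OF A] by simp
  also have "... \<le> prob {om \<in> space M. space_bits (B om) \<le> ennreal S}"
  proof (rule finite_measure_mono)
   show "space M - ?A \<subseteq> {om \<in> space M. space_bits (B om) \<le> ennreal S}"
   proof
    fix om assume "om \<in> space M - ?A"
    then obtain i where i: "om \<in> space M" "i < Suc d" "~ fl i om" by auto
    then obtain N where N: "N \<le> i" "!!i. i < N ==> fl i om" "~ fl N om" using first_success by metis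
    have "real (LB d y + (N + 1)) \<le> S" using S N(1) i(2) by simp
    hence "of_nat (LB d y + (N + 1)) \<le> ennreal S" unfolding ennreal_of_nat_eq_real_of_nat by (rule ennreal_leI)
    moreover have "space_bits (B om) = of_nat (LB d y + (N + 1))" by (rule sp[OF N(2,3)])
    ultimately have "space_bits (B om) \<le> ennreal S" by (simp only:)
    thus "om \<in> {om \<in> space M. space_bits (B om) \<le> ennreal S}" using i by simp
   qed
   show "{om \<in> space M. space_bits (B om) \<le> ennreal S} \<in> sets M" by (rule borel_measurable_le[OF m1 borel_measurable_const])
  qed
  finally show ?thesis by simp
 qed
 let ?F = "%T. of_nat (900 * costT d y T + 770) :: ennreal"
 have F: "(\<integral>\<^sup>+T. ?F T \<partial>table_pmf d {1..<2 ^ d}) \<le> ennreal (900 * CB d y + 1670)"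
 proof -
  have "(\<integral>\<^sup>+T. ?F T \<partial>table_pmf d {1..<2 ^ d}) = 900 * (\<integral>\<^sup>+T. of_nat (costT d y T) \<partial>table_pmf d {1..<2 ^ d}) + 770"
   by (simp add: nn_integral_add nn_integral_cmult measure_pmf.emeasure_space_1)
  also have "... \<le> 900 * ennreal (CB d y + 1) + 770" by (intro add_right_mono mult_left_mono cost_expect[OF y]) simp
  also have "... = ennreal (900 * (CB d y + 1) + 770)"
   using CB_le(2)[OF y] by (simp add: ennreal_plus ennreal_mult del: ennreal_plus) (simp flip: ennreal_numeral ennreal_mult ennreal_plus)
  finally show ?thesis by (simp add: algebra_simps)
 qed
 show "(\<integral>\<^sup>+om. build_time (B om) \<partial>M) \<le> ennreal Tt"
 proof -
  have "(\<integral>\<^sup>+om. build_time (B om) \<partial>M) \<le> (\<integral>\<^sup>+om. of_nat TB + (\<Sum>G. of_bool (\<forall>i<G. fl i om) * ?F (tab G om)) \<partial>M)"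
  proof (rule nn_integral_mono_AE)
   show "AE om in M. build_time (B om) \<le> of_nat TB + (\<Sum>G. of_bool (\<forall>i<G. fl i om) * ?F (tab G om))"
    using AE_success
   proof eventually_elim
    fix om assume "\<exists>i. ~ fl i om"
    then obtain N where N: "!!i. i < N ==> fl i om" "~ fl N om" using first_success by metis
    obtain t bits where r: "B om = Some (t, bits, N)" and t: "t \<le> TB + (\<Sum>i\<le>N. 900 * costT d y (tab i om) + 770)"
     using rr[OF N] unfolding B_def by blast
    have "build_time (B om) = of_nat t" by (simp add: r build_time_def)
    also have "... \<le> of_nat (TB + (\<Sum>i\<le>N. 900 * costT d y (tab i om) + 770))" using t by (rule of_nat_mono)
    also have "... = of_nat TB + (\<Sum>i\<le>N. ?F (tab i om))" by (simp only: of_nat_add of_nat_sum)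
    also have "... \<le> of_nat TB + (\<Sum>G. of_bool (\<forall>i<G. fl i om) * ?F (tab G om))"
     by (intro add_left_mono sum_le_total N(1))
    finally show "build_time (B om) \<le> of_nat TB + (\<Sum>G. of_bool (\<forall>i<G. fl i om) * ?F (tab G om))" .
   qed
  qed
  also have "... = of_nat TB + (\<integral>\<^sup>+om. (\<Sum>G. of_bool (\<forall>i<G. fl i om) * ?F (tab G om)) \<partial>M)"
   by (rule nn_const_add[OF suminf_measurable])
  also have "... \<le> of_nat TB + ennreal (2 * (900 * CB d y + 1670))"
   using CB_le(2)[OF y] by (intro add_left_mono total_expect F) simp
  also have "... = ennreal (real TB + 2 * (900 * CB d y + 1670))"
   unfolding ennreal_of_nat_eq_real_of_nat using CB_le(2)[OF y] by (subst ennreal_plus) simp_all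
  also have "... \<le> ennreal Tt" using Tt by (rule ennreal_leI)
  finally show ?thesis .
 qed
qed

end

theorem theorem12:
 fixes OPT :: "nat \<Rightarrow> real"
 assumes OPT: "(\<lambda>n. real n * log 2 (exp 1) - OPT n) \<in> O(\<lambda>n. log 2 (real n))"
 shows "\<exists>(build :: com) (query :: com) (seed :: nat \<Rightarrow> bool list \<Rightarrow> nat \<Rightarrow> nat) (c :: nat) (C :: real).
  \<forall>(d :: nat) (n :: nat) (w :: nat) (\<epsilon> :: real) (M :: 'w measure)
   (h :: nat \<Rightarrow> 'k \<Rightarrow> 'w \<Rightarrow> bool) (keys :: 'k list).
   n = 2 ^ d \<longrightarrow> w = c * (d + 1) \<longrightarrow> \<epsilon> \<in> {1 / real n..1} \<longrightarrow>
   simple_uniform_hashing M h \<longrightarrow> distinct keys \<longrightarrow> length keys = n \<longrightarrow>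
   (let H = (\<lambda>\<omega> s x. h s x \<omega>);
     B = (\<lambda>\<omega>. run_build w (H \<omega>) keys \<epsilon> build);
     space_bound = OPT n + C * (\<epsilon> * real n + (log 2 (real n))\<^sup>2)
   in
    (AE \<omega> in M. \<exists>t bits g. B \<omega> = Some (t, bits, g) \<and>
      real (length bits) \<le> space_bound \<and>
      (let f = (\<lambda>v. H \<omega> (prod_encode (g, seed d bits v))) in
       splits_perfectly d f (set keys) \<and>
       bij_betw (leaf_rank d f) (set keys) {1..n} \<and>
       (\<forall>x. \<exists>tq m g'. exec w (H \<omega>) [x] query (pack w bits, g) tq (m, g') \<and>
         m 0 = leaf_rank d f x \<and>
         real tq \<le> C * max 1 (log 2 (real n))))) \<and>
    (\<lambda>\<omega>. space_bits (B \<omega>)) \<in> borel_measurable M \<and>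
    (\<integral>\<^sup>+\<omega>. space_bits (B \<omega>) \<partial>M) \<le> ennreal space_bound \<and>
    measure M {\<omega> \<in> space M. space_bits (B \<omega>) \<le> ennreal space_bound} \<ge> 1 - 1 / real n \<and>
    (\<lambda>\<omega>. build_time (B \<omega>)) \<in> borel_measurable M \<and>
    (\<integral>\<^sup>+\<omega>. build_time (B \<omega>) \<partial>M) \<le> ennreal (C * max (real n powr (3/2)) (real n / \<epsilon>)))"
proof -
 let ?\<delta> = "%n. real n * log 2 (exp 1) - OPT n"
 obtain K1 where K1: "K1 > 0" "eventually (%n. norm (?\<delta> n) \<le> K1 * norm (log 2 (real n))) sequentially"
  using landau_o.bigE[OF OPT] by blast
 then obtain n0 where n0: "!!n. n \<ge> n0 ==> norm (?\<delta> n) \<le> K1 * norm (log 2 (real n))" by (auto simp: eventually_sequentially)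
 \<comment> \<open>The asymptotic assumption is silent about the finitely many
   \<open>n < n0\<close>; this constant covers them and is absorbed later because
   \<open>\<epsilon> * real n \<ge> 1\<close>.\<close>
 define K2 where "K2 = (\<Sum>n<n0. norm (?\<delta> n))"
 have K2: "0 \<le> K2" unfolding K2_def by (rule sum_nonneg) simp
 have opt: "real n * log 2 (exp 1) \<le> OPT n + K1 * norm (log 2 (real n)) + K2" for n
 proof (cases "n < n0")
  case True
  have "norm (?\<delta> n) \<le> K2" unfolding K2_def using True by (intro member_le_sum) auto
  moreover have "0 \<le> K1 * norm (log 2 (real n))" using K1(1) by simp
  ultimately show ?thesis unfolding real_norm_def by linarith
 next
  case False
  hence "norm (?\<delta> n) \<le> K1 * norm (log 2 (real n))" using n0 by simp
  thus ?thesis using K2 unfolding real_norm_def by linarith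
 qed
 \<comment> \<open>\<open>K1\<close> and \<open>K2\<close> pass from
   \<open>n * log 2 (exp 1)\<close> to \<open>OPT n\<close>. The number covers the numerical
   constants; the largest is the one of the construction time,
   \<open>6100 + 1800 * 624 + 3340\<close>.\<close>
 define C where "C = K1 + K2 + 2000000"
 have C: "2000000 \<le> C" using K1(1) K2 by (simp add: C_def)
 show ?thesis
 proof (rule exI[of _ ram.build_prog], rule exI[of _ ram.qry_prog], rule exI[of _ "Submission.seed"], rule exI[of _ 256], rule exI[of _ C], intro allI impI)
  fix d n w :: nat and \<epsilon> :: real and M :: "'w measure" and h :: "nat => 'k => 'w => bool" and keys :: "'k list"
  assume n: "n = 2 ^ d" and w: "w = 256 * (d + 1)" and \<epsilon>: "\<epsilon> \<in> {1 / real n..1}" and uh: "simple_uniform_hashing M h"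
   and dk: "distinct keys" and lk: "length keys = n"
  let ?E = "nat \<lceil>1 / \<epsilon>\<rceil>"
  define y where "y = clg ?E"
  have n0: "0 < real n" and n1: "1 \<le> real n" by (simp_all add: n)
  have e0: "0 < \<epsilon>" "\<epsilon> \<le> 1" using \<epsilon> n0 by (auto intro: less_le_trans[of 0 "1 / real n"])
  have en: "1 \<le> \<epsilon> * real n" using \<epsilon> n0 by (simp add: field_simps)
  have ie: "1 / \<epsilon> \<le> real n" "1 \<le> 1 / \<epsilon>" using en e0 by (simp_all add: field_simps)
  have "\<lceil>1 / \<epsilon>\<rceil> \<le> int n" using ie by (simp add: ceiling_le_iff)
  hence E: "?E \<le> 2 ^ d" using n by simp
  have Ege: "1 / \<epsilon> \<le> real ?E" using ie by (simp add: le_of_int_ceiling of_nat_nat ceiling_mono)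
  have Ele: "real ?E \<le> 2 / \<epsilon>"
  proof -
   have "real ?E = of_int \<lceil>1 / \<epsilon>\<rceil>" using ie(2) by (intro of_nat_nat) (smt (verit) zero_le_ceiling)
   also have "... \<le> 1 / \<epsilon> + 1" by linarith
   also have "... \<le> 1 / \<epsilon> + 1 / \<epsilon>" using ie(2) by linarith
   also have "... = 2 / \<epsilon>" by (simp flip: add_divide_distrib)
   finally show ?thesis .
  qed
  have yd: "y \<le> d" unfolding y_def by (rule clg_le_d[OF E])
  \<comment> \<open>\<open>2 ^ y\<close> lies between \<open>1 / \<epsilon>\<close> and
    \<open>4 / \<epsilon>\<close>: a factor 2 is lost in rounding up to an integer and another in
    rounding up to a power of two. The lower bound serves the space, the upper bound
    \<open>y2\<close> the time.\<close>
  have y1: "2 ^ d / 2 ^ y \<le> \<epsilon> * real n"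
  proof -
   have "real ?E \<le> 2 ^ y" using clg_le[of ?E] unfolding y_def by (metis of_nat_le_iff of_nat_numeral of_nat_power)
   hence "1 / \<epsilon> \<le> 2 ^ y" using Ege by linarith
   hence "1 / 2 ^ y \<le> \<epsilon>" using e0 by (simp add: field_simps)
   from mult_left_mono[OF this, of "2 ^ d"] show ?thesis by (simp add: n mult.commute)
  qed
  have y2: "2 ^ y \<le> 4 / \<epsilon>"
  proof (cases y)
   case 0
   have "1 \<le> 4 * (1 / \<epsilon>)" using ie(2) by linarith
   thus ?thesis using 0 by simp
  next
   case (Suc y')
   have "2 ^ y' < ?E" by (rule clg_gt) (use Suc in \<open>simp add: y_def\<close>)
   hence "real (2 ^ y') \<le> real ?E" by (intro of_nat_mono less_imp_le)
   hence "2 ^ y' \<le> real ?E" by (simp only: of_nat_power of_nat_numeral)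
   moreover have "(2::real) ^ y = 2 * 2 ^ y'" using Suc by simp
   moreover have "2 * (2 / \<epsilon>) = 4 / \<epsilon>" by simp
   ultimately show ?thesis using Ele by linarith
  qed
  interpret hashing M h d keys y by unfold_locales (use uh dk lk n yd in auto)
  have ln: "log 2 (real n) = real d" using n by (simp add: log_nat_power)
  have dd: "real d \<le> real d * real d" by (cases d) simp_all
  let ?S = "OPT n + C * (\<epsilon> * real n + (log 2 (real n))\<^sup>2)"
  let ?m = "max (real n powr (3/2)) (real n / \<epsilon>)"
  have S: "real (LB d y) + real d + 2 \<le> ?S"
  proof -
   have o: "2 ^ d * log 2 (exp 1) \<le> OPT n + K1 * real d + K2" using opt[of n] unfolding ln by (simp add: n)
   have k1: "K1 * real d \<le> K1 * (real d * real d)" using dd K1(1) by (intro mult_left_mono) auto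
   have k2: "K2 \<le> K2 * (\<epsilon> * real n)" using mult_left_mono[OF en K2] by simp
   have k3: "0 \<le> K1 * (\<epsilon> * real n)" "0 \<le> K2 * (real d * real d)" using K1(1) K2 en by auto
   have "?S = OPT n + (K1 * (\<epsilon> * real n) + K2 * (\<epsilon> * real n) + 2000000 * (\<epsilon> * real n) + K1 * (real d * real d) + K2 * (real d * real d) + 2000000 * (real d * real d))"
    unfolding ln C_def power2_eq_square by (simp add: algebra_simps)
   moreover have "0 \<le> real d * real d" by simp
   ultimately show ?thesis using LB_le[OF yd] o k1 k2 k3 y1 en dd by linarith
  qed
  have T: "real TB + 2 * (900 * CB d y + 1670) \<le> C * ?m"
  proof -
   have p: "2 powr (3 * real d / 2) \<le> ?m"
   proof -
    have "real n powr (3 / 2) = 2 powr (3 * real d / 2)" by (simp add: n powr_powr mult.commute flip: powr_realpow)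
    thus ?thesis by simp
   qed
   have nm: "real n \<le> ?m" "real n / \<epsilon> \<le> ?m"
   proof -
    have "real n * 1 \<le> real n * (1 / \<epsilon>)" using ie(2) by (intro mult_left_mono) auto
    thus "real n \<le> ?m" by simp
   qed simp
   have "(2 :: real) ^ d * 2 ^ y \<le> real n * (4 / \<epsilon>)"
    unfolding n of_nat_power of_nat_numeral by (rule mult_left_mono[OF y2]) simp
   moreover have "real n * (4 / \<epsilon>) = 4 * (real n / \<epsilon>)" by simp
   ultimately have "2 ^ d * 2 ^ y \<le> 4 * ?m" using nm(2) by linarith
   hence cb: "CB d y \<le> 624 * ?m" unfolding CB_def using p by linarith
   have "real (d * d) \<le> real (4 * 2 ^ d)" by (rule of_nat_mono[OF square_le_pow])
   hence d2: "real d * real d \<le> 4 * real n" by (simp add: n)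
   have "real TB = 600 * real n + 100 * (real d * real d) + 1100 * real d + 700" by (simp add: n)
   also have "... \<le> 600 * real n + 100 * (4 * real n) + 1100 * (4 * real n) + 700 * real n" using d2 dd n1 by linarith
   finally have tb: "real TB \<le> 6100 * real n" by simp
   have "real TB + 2 * (900 * CB d y + 1670) \<le> 6100 * ?m + 1123200 * ?m + 3340 * ?m"
   proof -
    have "a + 2 * (900 * b + 1670) \<le> 6100 * c + 1123200 * c + 3340 * c"
     if h: "a \<le> 6100 * e" "b \<le> 624 * c" "e \<le> c" "1 \<le> e" for a b c e :: real
    proof -
     have 1: "a \<le> 6100 * c" using h(1,3) by linarith
     have 2: "1800 * b \<le> 1123200 * c" using h(2) by simp
     have 3: "3340 \<le> 3340 * c" using order_trans[OF h(4,3)] by simp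
     have "a + 2 * (900 * b + 1670) = a + 1800 * b + 3340" by simp
     also have "... \<le> 6100 * c + 1123200 * c + 3340 * c" by (intro add_mono 1 2 3)
     finally show ?thesis .
    qed
    from this[OF tb cb nm(1) n1] show ?thesis .
   qed
   also have "... \<le> 2000000 * ?m"
   proof -
    have "6100 * c + 1123200 * c + 3340 * c \<le> 2000000 * c" if "1 \<le> c" for c :: real using that by simp
    from this[OF order_trans[OF n1 nm(1)]] show ?thesis .
   qed
   also have "... \<le> C * ?m" by (rule mult_right_mono[OF C order_trans[OF _ nm(1)]]) simp
   finally show ?thesis .
  qed
  have q: "200 * real d + 100 \<le> C * max 1 (log 2 (real n))"
  proof -
   have "200 * real d + 100 \<le> 2000000 * max 1 (real d)" by (simp add: max_def)
   also have "... \<le> C * max 1 (real d)" using C by (intro mult_right_mono) auto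
   finally show ?thesis unfolding ln .
  qed
  have rn: "(2::real) ^ d = real n" by (simp add: n)
  note con = conclusions[OF E y_def S T q, unfolded rn, folded n w]
  show "let H = (%om s x. h s x om);
     B = (%om. run_build w (H om) keys \<epsilon> ram.build_prog);
     space_bound = OPT n + C * (\<epsilon> * real n + (log 2 (real n))\<^sup>2)
   in
    (AE om in M. \<exists>t bits g. B om = Some (t, bits, g) &
      real (length bits) \<le> space_bound &
      (let f = (%v. H om (prod_encode (g, Submission.seed d bits v))) in
       splits_perfectly d f (set keys) &
       bij_betw (leaf_rank d f) (set keys) {1..n} &
       (\<forall>x. \<exists>tq m g'. exec w (H om) [x] ram.qry_prog (pack w bits, g) tq (m, g') &
         m 0 = leaf_rank d f x &
         real tq \<le> C * max 1 (log 2 (real n))))) &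
    (%om. space_bits (B om)) \<in> borel_measurable M &
    (\<integral>\<^sup>+om. space_bits (B om) \<partial>M) \<le> ennreal space_bound &
    measure M {om \<in> space M. space_bits (B om) \<le> ennreal space_bound} \<ge> 1 - 1 / real n &
    (%om. build_time (B om)) \<in> borel_measurable M &
    (\<integral>\<^sup>+om. build_time (B om) \<partial>M) \<le> ennreal (C * max (real n powr (3/2)) (real n / \<epsilon>))"
   unfolding Let_def using con[unfolded Let_def] by (intro conjI) assumption+
 qed
qed

end
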